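(* Let $\Lambda$ be a stationary point process in $\mathbb C$ having a finite second moment, with spectral measure $\rho_\Lambda$ and conditional intensity $\mathfrak c_\Lambda$. For $a\in\mathbb C$ consider the stationary generalized random processes ${\sf\Delta}_a\zeta_\Lambda(\varphi)=\int_{\mathbb C}(\zeta_\Lambda(z+a)-\zeta_\Lambda(z))\varphi(z)\,{\rm d}m(z)$ and $\wp_\Lambda(\varphi)=\int_{\mathbb C}\zeta_\Lambda\,\partial_z\varphi\,{\rm d}m$ (i.e. $\wp_\Lambda=-\partial_z\zeta_\Lambda$) on compactly supported smooth $\varphi$. Then \[ {\rm d}\rho_{{\sf\Delta}_a\zeta_\Lambda}(\xi)=\mathbf 1_{\mathbb C\setminus\{0\}}(\xi)\frac{|1-e^{2\pi{\rm i}\,a\cdot\xi}|^2}{|\xi|^2}{\rm d}\rho_\Lambda(\xi)+\pi^2|a|^2\rho_\Lambda(\{0\})\,\delta_0(\xi), \] and consequently the spectral measure of ${\sf\Delta}_a\zeta_\Lambda-\pi\mathfrak c_\Lambda\bar a$ is $\mathbf 1_{\mathbb C\setminus\{0\}}(\xi)\,|1-e^{2\pi{\rm i}\,a\cdot\xi}|^2|\xi|^{-2}{\rm d}\rho_\Lambda(\xi)$. Moreover, ${\rm d}\rho_{\wp_\Lambda}(\xi)=\pi^2\mathbf 1_{\mathbb C\setminus\{0\}}(\xi)\,{\rm d}\rho_\Lambda(\xi)$.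
   Context: A point process $\Lambda$ in $\mathbb C$ is stationary if its distribution is translation invariant; finite second moment means $\mathbb E[n_\Lambda(B)^2]<\infty$ for bounded Borel $B$, $n_\Lambda=\sum_{\lambda\in\Lambda}\delta_\lambda$. The spectral measure of a stationary generalized random process $X$ (with $X(\varphi)\in L^2$ for test functions $\varphi$) is the non-negative locally finite measure $\rho_X$ with ${\sf Cov}[X(\varphi),X(\psi)]=\int\widehat\varphi\,\overline{\widehat\psi}\,{\rm d}\rho_X$ for all compactly supported smooth $\varphi,\psi$, where $\widehat\varphi(\xi)=\int e^{-2\pi{\rm i}\,\xi\cdot x}\varphi(x)\,{\rm d}m(x)$; $\rho_\Lambda$ is that of $X(\varphi)=\sum_{\lambda\in\Lambda}\varphi(\lambda)$. $\mathfrak c_\Lambda=\pi^{-1}\mathbb E[n_\Lambda(\mathbb D)\mid\mathcal F_{\sf inv}]$ with $\mathcal F_{\sf inv}$ the translation-invariant events. $\zeta_\Lambda(z)=\sum_{|\lambda|<1}\frac1{z-\lambda}+\sum_{|\lambda|\ge1}\big(\frac1{z-\lambda}+\frac1\lambda+\frac z{\lambda^2}\big)-\Psi_2(\infty)z$, where $\Psi_2(\infty)$ is the $L^2$-limit of $\sum_{1\le|\lambda|\le R}\lambda^{-2}$ as $R\to\infty$. $\partial_z=\frac12(\partial_x-{\rm i}\partial_y)$. *)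

theory Defs
  imports "HOL-Probability.Probability"
begin

type_synonym config = "complex \<Rightarrow> nat"   \<comment> \<open>multiplicity of each point\<close>

definition supp_conf :: "config \<Rightarrow> complex set" where
  "supp_conf c = {z. c z > 0}"

definition locfin :: "config \<Rightarrow> bool" where
  "locfin c \<longleftrightarrow> (\<forall>r::real. finite {z \<in> supp_conf c. cmod z \<le> r})"

definition cnt :: "config \<Rightarrow> complex set \<Rightarrow> nat" where
  "cnt c B = (\<Sum>z\<in>supp_conf c \<inter> B. c z)"

definition linstat :: "config \<Rightarrow> (complex \<Rightarrow> complex) \<Rightarrow> complex" where
  "linstat c \<phi> = (\<Sum>z\<in>{z \<in> supp_conf c. \<phi> z \<noteq> 0}. of_nat (c z) * \<phi> z)"

definition shift_conf :: "complex \<Rightarrow> config \<Rightarrow> config" where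
  "shift_conf w c = (\<lambda>z. c (z - w))"

definition conf_space :: "config measure" where
  "conf_space = sigma {c. locfin c}
     {{c. locfin c \<and> cnt c B = k} | B k. B \<in> sets borel \<and> bounded B}"

definition shift_invariant :: "config set \<Rightarrow> bool" where
  "shift_invariant E \<longleftrightarrow> (\<forall>w c. locfin c \<longrightarrow> (c \<in> E \<longleftrightarrow> shift_conf w c \<in> E))"

definition point_process :: "'a measure \<Rightarrow> ('a \<Rightarrow> config) \<Rightarrow> bool" where
  "point_process M N \<longleftrightarrow> prob_space M \<and> (\<forall>\<omega>\<in>space M. locfin (N \<omega>)) \<and>
     (\<forall>B. B \<in> sets borel \<and> bounded B \<longrightarrow> (\<lambda>\<omega>. real (cnt (N \<omega>) B)) \<in> borel_measurable M)"

definition stationary_pp :: "'a measure \<Rightarrow> ('a \<Rightarrow> config) \<Rightarrow> bool" where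
  "stationary_pp M N \<longleftrightarrow> (\<forall>w Bs. (\<forall>B\<in>set Bs. B \<in> sets borel \<and> bounded B) \<longrightarrow>
     distr M (count_space UNIV) (\<lambda>\<omega>. map (\<lambda>B. cnt (N \<omega>) B) Bs) =
     distr M (count_space UNIV) (\<lambda>\<omega>. map (\<lambda>B. cnt (N \<omega>) ((+) w ` B)) Bs))"

definition finite_second_moment :: "'a measure \<Rightarrow> ('a \<Rightarrow> config) \<Rightarrow> bool" where
  "finite_second_moment M N \<longleftrightarrow> (\<forall>B. B \<in> sets borel \<and> bounded B \<longrightarrow>
     integrable M (\<lambda>\<omega>. (real (cnt (N \<omega>) B))\<^sup>2))"

definition F_inv :: "'a measure \<Rightarrow> ('a \<Rightarrow> config) \<Rightarrow> 'a measure" where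
  "F_inv M N = sigma (space M)
     {N -` E \<inter> space M | E. E \<in> sets conf_space \<and> shift_invariant E}"

definition cond_intensity :: "'a measure \<Rightarrow> ('a \<Rightarrow> config) \<Rightarrow> 'a \<Rightarrow> real" where
  "cond_intensity M N \<omega> =
     real_cond_exp M (F_inv M N) (\<lambda>\<omega>. real (cnt (N \<omega>) (ball 0 1))) \<omega> / pi"

definition pderiv_dir :: "complex \<Rightarrow> (complex \<Rightarrow> complex) \<Rightarrow> complex \<Rightarrow> complex" where
  "pderiv_dir v f = (\<lambda>z. frechet_derivative f (at z) v)"

definition smooth_fun :: "(complex \<Rightarrow> complex) \<Rightarrow> bool" where
  "smooth_fun f \<longleftrightarrow> (\<forall>vs z. foldr pderiv_dir vs f differentiable (at z))"

definition test_fun :: "(complex \<Rightarrow> complex) \<Rightarrow> bool" where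
  "test_fun f \<longleftrightarrow> smooth_fun f \<and> compact (closure {z. f z \<noteq> 0})"

definition dz :: "(complex \<Rightarrow> complex) \<Rightarrow> complex \<Rightarrow> complex" where
  "dz f z = (frechet_derivative f (at z) 1 - \<i> * frechet_derivative f (at z) \<i>) / 2"

definition fourier :: "(complex \<Rightarrow> complex) \<Rightarrow> complex \<Rightarrow> complex" where
  "fourier f \<xi> = (\<integral>x. exp (- (2 * of_real pi * \<i>) * of_real (\<xi> \<bullet> x)) * f x \<partial>lborel)"

definition expect :: "'a measure \<Rightarrow> ('a \<Rightarrow> complex) \<Rightarrow> complex" where
  "expect M X = (\<integral>\<omega>. X \<omega> \<partial>M)"

definition covar :: "'a measure \<Rightarrow> ('a \<Rightarrow> complex) \<Rightarrow> ('a \<Rightarrow> complex) \<Rightarrow> complex" where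
  "covar M X Y = (\<integral>\<omega>. (X \<omega> - expect M X) * cnj (Y \<omega> - expect M Y) \<partial>M)"

definition spectral_measure ::
  "'a measure \<Rightarrow> ((complex \<Rightarrow> complex) \<Rightarrow> 'a \<Rightarrow> complex) \<Rightarrow> complex measure \<Rightarrow> bool" where
  "spectral_measure M X \<rho> \<longleftrightarrow>
     sets \<rho> = sets borel \<and> (\<forall>K. compact K \<longrightarrow> emeasure \<rho> K < \<infinity>) \<and>
     (\<forall>\<phi>. test_fun \<phi> \<longrightarrow> X \<phi> \<in> borel_measurable M \<and> integrable M (\<lambda>\<omega>. (cmod (X \<phi> \<omega>))\<^sup>2)) \<and>
     (\<forall>\<phi> \<psi>. test_fun \<phi> \<and> test_fun \<psi> \<longrightarrow>
        integrable \<rho> (\<lambda>\<xi>. fourier \<phi> \<xi> * cnj (fourier \<psi> \<xi>)) \<and>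
        covar M (X \<phi>) (X \<psi>) = (\<integral>\<xi>. fourier \<phi> \<xi> * cnj (fourier \<psi> \<xi>) \<partial>\<rho>))"

definition lin_process :: "('a \<Rightarrow> config) \<Rightarrow> (complex \<Rightarrow> complex) \<Rightarrow> 'a \<Rightarrow> complex" where
  "lin_process N \<phi> \<omega> = linstat (N \<omega>) \<phi>"

definition add_measure :: "'b measure \<Rightarrow> 'b measure \<Rightarrow> 'b measure" where
  "add_measure \<mu> \<nu> = measure_of (space \<mu>) (sets \<mu>) (\<lambda>A. emeasure \<mu> A + emeasure \<nu> A)"

definition Psi_partial :: "config \<Rightarrow> real \<Rightarrow> complex" where
  "Psi_partial c R = (\<Sum>z\<in>{z \<in> supp_conf c. 1 \<le> cmod z \<and> cmod z \<le> R}. of_nat (c z) / z\<^sup>2)"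

definition Psi2_inf :: "'a measure \<Rightarrow> ('a \<Rightarrow> config) \<Rightarrow> 'a \<Rightarrow> complex" where
  "Psi2_inf M N = (SOME \<Psi>. \<Psi> \<in> borel_measurable M \<and>
     ((\<lambda>R. \<integral>\<^sup>+\<omega>. ennreal ((cmod (Psi_partial (N \<omega>) R - \<Psi> \<omega>))\<^sup>2) \<partial>M) \<longlongrightarrow> 0) at_top)"

definition zeta_conf :: "config \<Rightarrow> complex \<Rightarrow> complex \<Rightarrow> complex" where
  "zeta_conf c psi z =
     (\<Sum>l\<in>{l \<in> supp_conf c. cmod l < 1}. of_nat (c l) / (z - l)) +
     infsum (\<lambda>l. of_nat (c l) * (1 / (z - l) + 1 / l + z / l\<^sup>2)) {l \<in> supp_conf c. 1 \<le> cmod l}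
     - psi * z"

definition zeta_pp :: "'a measure \<Rightarrow> ('a \<Rightarrow> config) \<Rightarrow> 'a \<Rightarrow> complex \<Rightarrow> complex" where
  "zeta_pp M N \<omega> z = zeta_conf (N \<omega>) (Psi2_inf M N \<omega>) z"

definition Delta_zeta :: "'a measure \<Rightarrow> ('a \<Rightarrow> config) \<Rightarrow> complex \<Rightarrow> (complex \<Rightarrow> complex) \<Rightarrow> 'a \<Rightarrow> complex" where
  "Delta_zeta M N a \<phi> \<omega> = (\<integral>z. (zeta_pp M N \<omega> (z + a) - zeta_pp M N \<omega> z) * \<phi> z \<partial>lborel)"

definition wp_pp :: "'a measure \<Rightarrow> ('a \<Rightarrow> config) \<Rightarrow> (complex \<Rightarrow> complex) \<Rightarrow> 'a \<Rightarrow> complex" where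
  "wp_pp M N \<phi> \<omega> = (\<integral>z. zeta_pp M N \<omega> z * dz \<phi> z \<partial>lborel)"

end

theory Submission
  imports Defs "HOL-Real_Asymp.Real_Asymp"
begin

text \<open>
  Both processes are pairings \<open>\<integral> \<zeta> \<theta>\<close> with a test function \<open>\<theta>\<close> of mean zero: \<open>\<theta> = \<phi>(\<cdot> - a) - \<phi>\<close>
  for the increments and \<open>\<theta> = \<partial>\<^sub>z \<phi>\<close> for the derivative. By Fubini, such a pairing is a linear statistic
  of the Cauchy transform of \<open>\<theta>\<close>. Cutting off the Cauchy kernel at radius \<open>R\<close> turns this
  transform into a test function, whose linear statistic is governed by \<open>\<rho>\<close>. As \<open>R \<rightarrow> \<infinity>\<close> its Fourier transform
  tends to \<open>\<i> \<theta>^(\<xi>) / \<xi>\<close> off the origin, boundedly by a multiple of \<open>|\<theta>^(\<xi>) / \<xi>|\<close>, hence in \<open>L\<^sup>2(\<rho>)\<close>,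
  and to \<open>0\<close> at the origin. The cut-off introduces two further linear statistics: the partial
  sum of \<open>\<lambda>\<^sup>-\<^sup>2\<close>, whose limit enters the definition of \<open>\<zeta>\<close>, and an ergodic average over the disk of radius \<open>R\<close>,
  which tends to \<open>\<pi> c\<close> times the integral of \<open>cnj z * \<theta> z\<close>. This last term carries the atom at the origin.
\<close>

subsection \<open>Lebesgue measure on the plane\<close>

text \<open>The profile (1 - |u|^2)^2 of the cut-off meets two demands. The dbar derivative of the
  cut kernel is \<pi> times a point mass minus the explicit bounded function
  \<open>paraboloid\<close>, which gives the Fourier bound and the limit; and the removed part of
  the kernel is continuously differentiable, so a first-order expansion at scale R has error
  o(R^-2), uniformly for points within 2R. Such a disk holds of order R^2 points in mean square, so
  this error vanishes. The main obstacle is circular: \<zeta> contains the limit of the truncated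
  sums of \<lambda>^-2, encoded by a choice operator, and the expansion controls these sums only in
  combination with the truncated transform. The way out is one function, the derivative
  \<open>dz\<close> of a normalized test function: its transform converges by the spectral isometry
  alone, and its moment against z is -1, so the sums converge as well. Linear statistics with jumps
  or infinite support lie outside the spectral definition; they are compared with test functions
  through a second-moment bound that uses only the counts in unit squares.\<close>

lemma nn_integral_complex_affine:
  fixes f :: "complex \<Rightarrow> ennreal"
  assumes [measurable]: "f \<in> borel_measurable borel" and "c \<noteq> 0"
  shows "(\<integral>\<^sup>+x. f x \<partial>lborel) = ennreal (c\<^sup>2) * (\<integral>\<^sup>+x. f (t + c *\<^sub>R x) \<partial>lborel)"
  by (subst lborel_affine[OF assms(2), of t])
     (simp add: nn_integral_density nn_integral_distr nn_integral_cmult)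

lemma integrable_scaleR_right_iff':
  fixes f :: "'a \<Rightarrow> 'b::{banach, second_countable_topology}"
  assumes "c \<noteq> 0"
  shows "integrable M (\<lambda>x. c *\<^sub>R f x) \<longleftrightarrow> integrable M f"
  using integrable_scaleR_right[of "inverse c" M "\<lambda>x. c *\<^sub>R f x"] integrable_scaleR_right[of c M f] assms
  by auto

lemma integrable_complex_affine_iff:
  fixes f :: "complex \<Rightarrow> 'b::{banach, second_countable_topology}"
  assumes [measurable]: "f \<in> borel_measurable borel" and "c \<noteq> 0"
  shows "integrable lborel (\<lambda>x. f (t + c *\<^sub>R x)) \<longleftrightarrow> integrable lborel f"
proof -
  have "integrable lborel f \<longleftrightarrow> integrable (density (distr lborel borel (\<lambda>x. t + c *\<^sub>R x)) (\<lambda>_. \<bar>c\<bar>^DIM(complex))) f"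
    using lborel_affine[OF assms(2), of t] by simp
  also have "\<dots> \<longleftrightarrow> integrable lborel (\<lambda>x. f (t + c *\<^sub>R x))"
    using assms(2) by (subst integrable_density) (auto simp: integrable_distr_eq integrable_scaleR_right_iff')
  finally show ?thesis ..
qed

lemma integral_complex_affine:
  fixes f :: "complex \<Rightarrow> 'b::{banach, second_countable_topology}"
  assumes [measurable]: "f \<in> borel_measurable borel" and "c \<noteq> 0"
  shows "(\<integral>x. f x \<partial>lborel) = c\<^sup>2 *\<^sub>R (\<integral>x. f (t + c *\<^sub>R x) \<partial>lborel)"
  by (subst lborel_affine[OF assms(2), of t])
     (simp add: integral_density integral_distr)

lemma
  fixes f :: "complex \<Rightarrow> 'b::{banach, second_countable_topology}"
  assumes [measurable]: "f \<in> borel_measurable borel"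
  shows integral_complex_shift: "(\<integral>x. f (x + a) \<partial>lborel) = (\<integral>x. f x \<partial>lborel)"
    and integral_complex_shift': "(\<integral>x. f (x - a) \<partial>lborel) = (\<integral>x. f x \<partial>lborel)"
    and integral_complex_reflect: "(\<integral>x. f (a - x) \<partial>lborel) = (\<integral>x. f x \<partial>lborel)"
    and integrable_complex_shift: "integrable lborel (\<lambda>x. f (x + a)) \<longleftrightarrow> integrable lborel f"
    and integrable_complex_shift': "integrable lborel (\<lambda>x. f (x - a)) \<longleftrightarrow> integrable lborel f"
  using integral_complex_affine[OF assms, of 1 a] integral_complex_affine[OF assms, of 1 "-a"]
    integral_complex_affine[OF assms, of "-1" a] integrable_complex_affine_iff[OF assms, of 1 a]
    integrable_complex_affine_iff[OF assms, of 1 "-a"] integrable_complex_affine_iff[OF assms, of "-1" a]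
  by (simp_all add: add.commute)

lemma
  fixes f :: "complex \<Rightarrow> ennreal"
  assumes [measurable]: "f \<in> borel_measurable borel"
  shows nn_integral_complex_shift: "(\<integral>\<^sup>+x. f (x + a) \<partial>lborel) = (\<integral>\<^sup>+x. f x \<partial>lborel)"
    and nn_integral_complex_shift': "(\<integral>\<^sup>+x. f (x - a) \<partial>lborel) = (\<integral>\<^sup>+x. f x \<partial>lborel)"
  using nn_integral_complex_affine[OF assms, of 1 a] nn_integral_complex_affine[OF assms, of 1 "-a"]
    nn_integral_complex_affine[OF assms, of "-1" a]
  by (simp_all add: add.commute)

lemma
  fixes f :: "complex \<Rightarrow> complex"
  assumes [measurable]: "f \<in> borel_measurable borel" and "R > 0"
  shows integral_complex_scale: "(\<integral>x. f (x / of_real R) \<partial>lborel) = R\<^sup>2 * (\<integral>x. f x \<partial>lborel)"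
    and integrable_complex_scale: "integrable lborel (\<lambda>x. f (x / of_real R)) \<longleftrightarrow> integrable lborel f"
  using integral_complex_affine[OF assms(1), of "1/R" 0] integrable_complex_affine_iff[OF assms(1), of "1/R" 0] assms(2)
  by (auto simp: scaleR_conv_of_real field_simps)

lemma nn_integral_complex_scale:
  fixes f :: "complex \<Rightarrow> ennreal"
  assumes [measurable]: "f \<in> borel_measurable borel" and "R > 0"
  shows "(\<integral>\<^sup>+x. f (x / of_real R) \<partial>lborel) = ennreal (R\<^sup>2) * (\<integral>\<^sup>+x. f x \<partial>lborel)"
proof -
  have "ennreal (R\<^sup>2) * (\<integral>\<^sup>+x. f x \<partial>lborel) = (ennreal (R\<^sup>2) * ennreal ((1/R)\<^sup>2)) * (\<integral>\<^sup>+x. f (0 + (1/R) *\<^sub>R x) \<partial>lborel)"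
    using assms(2) by (subst nn_integral_complex_affine[OF assms(1), of "1/R" 0]) (simp_all add: mult.assoc)
  also have "ennreal (R\<^sup>2) * ennreal ((1/R)\<^sup>2) = 1"
    using assms(2) by (simp add: ennreal_mult[symmetric] power_divide)
  finally show ?thesis
    by (simp add: scaleR_conv_of_real field_simps)
qed

text \<open>A quarter turn maps boxes to boxes, so it is enough to compare volumes of boxes. This
  one rotation already reverses the sign of \<open>(cnj u)^2\<close>, which is what
  \<open>integral_cut_dz\<close> uses.\<close>

lemma lborel_distr_times_ii: "distr lborel borel ((*) \<i>) = lborel"
proof (rule lborel_eqI[symmetric])
  fix l u :: complex assume le: "\<And>b. b \<in> Basis \<Longrightarrow> l \<bullet> b \<le> u \<bullet> b"
  have "(*) \<i> -` box l u = box (Complex (Im l) (- Re u)) (Complex (Im u) (- Re l))"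
    by (auto simp: box_def Basis_complex_def)
  then have "emeasure (distr lborel borel ((*) \<i>)) (box l u) =
      emeasure lborel (box (Complex (Im l) (- Re u)) (Complex (Im u) (- Re l)))"
    by (subst emeasure_distr) auto
  also have "\<dots> = (\<Prod>b\<in>Basis. (u - l) \<bullet> b)"
    using le[of 1] le[of \<i>] by (subst emeasure_lborel_box) (auto simp: Basis_complex_def mult.commute)
  finally show "emeasure (distr lborel borel ((*) \<i>)) (box l u) = (\<Prod>b\<in>Basis. (u - l) \<bullet> b)" .
qed auto

lemma integral_complex_times_ii:
  fixes f :: "complex \<Rightarrow> 'b::{banach, second_countable_topology}"
  assumes [measurable]: "f \<in> borel_measurable borel"
  shows "(\<integral>x. f (\<i> * x) \<partial>lborel) = (\<integral>x. f x \<partial>lborel)"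
  by (subst (2) lborel_distr_times_ii[symmetric]) (simp add: integral_distr)

lemma emeasure_cball_complex: "r \<ge> 0 \<Longrightarrow> emeasure lborel (cball c r :: complex set) = ennreal (pi * r\<^sup>2)"
  by (simp add: emeasure_cball unit_ball_vol_2)

lemma emeasure_ball_complex: "r \<ge> 0 \<Longrightarrow> emeasure lborel (ball c r :: complex set) = ennreal (pi * r\<^sup>2)"
  by (simp add: emeasure_ball unit_ball_vol_2)

text \<open>The disk |u|^2 \<le> s has area \<pi> s, linear in s, so |u|^2 is distributed as \<pi>
  times Lebesgue measure on the half-line. Taking s = |u|^2 as radial variable takes the place of
  polar coordinates.\<close>

lemma distr_cmod_square:
  "distr lborel borel (\<lambda>u::complex. (cmod u)\<^sup>2) = density lborel (\<lambda>s. ennreal pi * indicator {0..} s)"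
proof -
  have B: "sets (borel :: real measure) = sigma_sets UNIV (range atMost)"
    by (subst borel_eq_atMost) (rule sets_measure_of, simp)
  show ?thesis
proof (rule measure_eqI_generator_eq[where \<Omega>=UNIV and E="range atMost" and A="\<lambda>i. {..real i}"])
  show "Int_stable (range (atMost :: real \<Rightarrow> _))" by (auto simp: Int_stable_def)
  fix X :: "real set" assume "X \<in> range atMost"
  then obtain a where X: "X = {..a}" by auto
  have *: "(\<lambda>u::complex. (cmod u)\<^sup>2) -` {..a} = (if a \<ge> 0 then cball 0 (sqrt a) else {})"
  proof (cases "a \<ge> 0")
    case True
    have "(cmod u)\<^sup>2 \<le> a \<longleftrightarrow> cmod u \<le> sqrt a" for u
      by (metis norm_ge_zero real_sqrt_abs2 real_sqrt_le_iff abs_of_nonneg power2_eq_square)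
    then show ?thesis using True by auto
  next
    case False
    then show ?thesis by (auto simp: not_le) (meson le_less_trans zero_le_power2 not_le)
  qed
  have "emeasure (distr lborel borel (\<lambda>u::complex. (cmod u)\<^sup>2)) X = (if a \<ge> 0 then ennreal (pi * a) else 0)"
    unfolding X by (subst emeasure_distr) (auto simp: * emeasure_cball_complex)
  moreover have "emeasure (density lborel (\<lambda>s. ennreal pi * indicator {0..} s)) X = (if a \<ge> 0 then ennreal (pi * a) else 0)"
  proof -
    have "emeasure (density lborel (\<lambda>s. ennreal pi * indicator {0..} s)) X = (\<integral>\<^sup>+s. ennreal pi * indicator {0..a} s \<partial>lborel)"
      unfolding X by (subst emeasure_density) (auto intro!: nn_integral_cong simp: indicator_def)
    also have "\<dots> = ennreal pi * emeasure lborel {0..a}"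
      by (subst nn_integral_cmult) auto
    finally show ?thesis by (auto simp: ennreal_mult)
  qed
  ultimately show "emeasure (distr lborel borel (\<lambda>u::complex. (cmod u)\<^sup>2)) X = emeasure (density lborel (\<lambda>s. ennreal pi * indicator {0..} s)) X"
    by simp
next
  fix i :: nat
  have "emeasure (distr lborel borel (\<lambda>u::complex. (cmod u)\<^sup>2)) {..real i} = emeasure lborel (cball 0 (sqrt i) :: complex set)"
    by (subst emeasure_distr)
       (auto intro!: arg_cong[where f="emeasure lborel"] simp: real_le_rsqrt, metis norm_ge_zero of_nat_0_le_iff power_mono real_sqrt_pow2)
  then show "emeasure (distr lborel borel (\<lambda>u::complex. (cmod u)\<^sup>2)) {..real i} \<noteq> \<infinity>"
    by (simp add: emeasure_cball_complex)
next
  show "sets (distr lborel borel (\<lambda>u::complex. (cmod u)\<^sup>2)) = sigma_sets UNIV (range atMost)"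
    by (simp add: B)
  show "sets (density lborel (\<lambda>s::real. ennreal pi * indicator {0..} s)) = sigma_sets UNIV (range atMost)"
    by (simp add: B)
  show "(\<Union>i. {..real i}) = UNIV" using real_arch_simple by auto
qed auto
qed

lemma nn_integral_radial:
  fixes f :: "real \<Rightarrow> ennreal"
  assumes [measurable]: "f \<in> borel_measurable borel"
  shows "(\<integral>\<^sup>+u. f ((cmod u)\<^sup>2) \<partial>lborel) = ennreal pi * (\<integral>\<^sup>+s. f s * indicator {0..} s \<partial>lborel)"
proof -
  have "(\<integral>\<^sup>+u. f ((cmod u)\<^sup>2) \<partial>lborel) = (\<integral>\<^sup>+s. f s \<partial>distr lborel borel (\<lambda>u::complex. (cmod u)\<^sup>2))"
    by (simp add: nn_integral_distr)
  also have "\<dots> = (\<integral>\<^sup>+s. ennreal pi * (f s * indicator {0..} s) \<partial>lborel)"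
    unfolding distr_cmod_square
    by (subst nn_integral_density) (auto intro!: nn_integral_cong simp: mult_ac)
  finally show ?thesis by (simp add: nn_integral_cmult)
qed

lemma AE_complex_not_in_sphere: "AE x in lborel. cmod x \<noteq> r"
proof (rule AE_I')
  have "sphere 0 r \<in> null_sets (lborel :: complex measure)"
    using negligible_sphere[of 0 r]
    by (auto simp: null_sets_completion_iff negligible_iff_null_sets)
  then show "sphere (0::complex) r \<in> null_sets lborel" .
qed auto

lemma nn_integral_cmod_inverse_ball:
  assumes "r \<ge> 0"
  shows "(\<integral>\<^sup>+u. ennreal (1 / cmod u) * indicator (cball 0 r) u \<partial>lborel) = ennreal (2 * pi * r)"
proof (cases "r = 0")
  case True
  have "AE u::complex in lborel. ennreal (1 / cmod u) * indicator (cball 0 r) u = 0"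
    using True by (auto simp: indicator_def)
  then show ?thesis using True by (simp add: nn_integral_0_iff_AE)
next
  case False
  have eq: "ennreal (1 / cmod u) * indicator (cball 0 r) u = ennreal (1 / sqrt ((cmod u)\<^sup>2)) * indicator {..r\<^sup>2} ((cmod u)\<^sup>2)" for u
    using assms by (auto simp: indicator_def real_le_rsqrt abs_le_square_iff[symmetric])
  have "(\<integral>\<^sup>+u. ennreal (1 / cmod u) * indicator (cball 0 r) u \<partial>lborel) =
     ennreal pi * (\<integral>\<^sup>+s. ennreal (1 / sqrt s) * indicator {..r\<^sup>2} s * indicator {0..} s \<partial>lborel)"
    unfolding eq by (rule nn_integral_radial) measurable
  also have "(\<integral>\<^sup>+s. ennreal (1 / sqrt s) * indicator {..r\<^sup>2} s * indicator {0..} s \<partial>lborel) =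
      (\<integral>\<^sup>+s. ennreal (1 / sqrt s) * indicator {0..r\<^sup>2} s \<partial>lborel)"
    by (intro nn_integral_cong) (auto simp: indicator_def)
  also have "\<dots> = ennreal (2 * sqrt (r\<^sup>2) - 2 * sqrt 0)"
  proof (rule nn_integral_has_integral_lebesgue')
    show "((\<lambda>s. 1 / sqrt s) has_integral 2 * sqrt (r\<^sup>2) - 2 * sqrt 0) {0..r\<^sup>2}"
    \<comment> \<open>The primitive \<open>2 * sqrt s\<close> has no derivative at 0, hence the
      version that asks for derivatives only in the interior.\<close>
    proof (rule fundamental_theorem_of_calculus_interior)
      fix x :: real assume "x \<in> {0<..<r\<^sup>2}"
      then show "((\<lambda>s. 2 * sqrt s) has_vector_derivative 1 / sqrt x) (at x)"
        by (auto intro!: derivative_eq_intros simp: has_real_derivative_iff_has_vector_derivative[symmetric] field_simps)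
    qed (auto intro!: continuous_intros)
  qed auto
  also have "\<dots> = ennreal (2 * r)"
    using assms by simp
  finally show ?thesis by (simp add: ennreal_mult[symmetric] assms mult_ac)
qed

text \<open>The mass \<pi> found here becomes the constant in \<open>fourier_cauchy_cut\<close>, by
  way of \<open>fourier_approximate_identity\<close>.\<close>

lemma nn_integral_inverse_one_plus_square:
  "(\<integral>\<^sup>+u. ennreal (1 / (1 + (cmod u)\<^sup>2)\<^sup>2) \<partial>lborel) = ennreal pi"
proof -
  have "(\<integral>\<^sup>+u. ennreal (1 / (1 + (cmod u)\<^sup>2)\<^sup>2) \<partial>lborel) =
      ennreal pi * (\<integral>\<^sup>+s. ennreal (1 / (1 + s)\<^sup>2) * indicator {0..} s \<partial>lborel)"
    by (rule nn_integral_radial) measurable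
  also have "(\<integral>\<^sup>+s. ennreal (1 / (1 + s)\<^sup>2) * indicator {0..} s \<partial>lborel) = ennreal (0 - (- 1 / (1 + 0)))"
  proof (rule nn_integral_FTC_atLeast)
    fix x :: real assume "0 \<le> x"
    then show "((\<lambda>x. - 1 / (1 + x)) has_real_derivative 1 / (1 + x)\<^sup>2) (at x)"
      by (auto intro!: derivative_eq_intros simp: power2_eq_square)
  qed (auto, real_asymp)
  finally show ?thesis by simp
qed

text \<open>Two uses: with R = 1 it yields the almost sure convergence of the sum of |l|^-3, and for
  large R the value of order 1/R bounds what the points beyond radius 2R contribute to
  \<open>link_error\<close>.\<close>

lemma nn_integral_cubic_decay:
  assumes "R > 0"
  shows "(\<integral>\<^sup>+u. ennreal (1 / sqrt (R\<^sup>2 + (cmod u)\<^sup>2) ^ 3) \<partial>lborel) = ennreal (2 * pi / R)"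
proof -
  have "(\<integral>\<^sup>+u. ennreal (1 / sqrt (R\<^sup>2 + (cmod u)\<^sup>2) ^ 3) \<partial>lborel) =
      ennreal pi * (\<integral>\<^sup>+s. ennreal (1 / sqrt (R\<^sup>2 + s) ^ 3) * indicator {0..} s \<partial>lborel)"
    by (rule nn_integral_radial) measurable
  also have "(\<integral>\<^sup>+s. ennreal (1 / sqrt (R\<^sup>2 + s) ^ 3) * indicator {0..} s \<partial>lborel) = ennreal (0 - (- 2 / sqrt (R\<^sup>2 + 0)))"
  proof (rule nn_integral_FTC_atLeast)
    fix x :: real assume "0 \<le> x"
    then have "R\<^sup>2 + x > 0" using assms by (simp add: add_pos_nonneg)
    then show "((\<lambda>x. - 2 / sqrt (R\<^sup>2 + x)) has_real_derivative 1 / sqrt (R\<^sup>2 + x) ^ 3) (at x)"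
      by (auto intro!: derivative_eq_intros simp: field_simps power3_eq_cube)
  next
    show "((\<lambda>x. - 2 / sqrt (R\<^sup>2 + x)) \<longlongrightarrow> 0) at_top"
      using assms by real_asymp
  qed auto
  finally show ?thesis using assms by (simp add: ennreal_mult[symmetric] mult_ac)
qed

lemma nn_integral_paraboloid:
  "(\<integral>\<^sup>+u. ennreal (2 * max 0 (1 - (cmod u)\<^sup>2)) \<partial>lborel) = ennreal pi"
proof -
  have "(\<integral>\<^sup>+u. ennreal (2 * max 0 (1 - (cmod u)\<^sup>2)) \<partial>lborel) =
      ennreal pi * (\<integral>\<^sup>+s. ennreal (2 * max 0 (1 - s)) * indicator {0..} s \<partial>lborel)"
    by (rule nn_integral_radial) measurable
  also have "(\<integral>\<^sup>+s. ennreal (2 * max 0 (1 - s)) * indicator {0..} s \<partial>lborel) =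
      (\<integral>\<^sup>+s. ennreal (2 * (1 - s)) * indicator {0..1::real} s \<partial>lborel)"
    by (intro nn_integral_cong) (auto simp: indicator_def max_def)
  also have "\<dots> = ennreal ((2 * 1 - 1\<^sup>2) - (2 * 0 - 0\<^sup>2))"
  proof (rule nn_integral_FTC_Icc)
    fix x :: real
    show "((\<lambda>x. 2 * x - x\<^sup>2) has_real_derivative 2 * (1 - x)) (at x)"
      by (auto intro!: derivative_eq_intros)
  qed auto
  finally show ?thesis by simp
qed

subsection \<open>Test functions\<close>

text \<open>Smoothness means that all iterated directional derivatives are differentiable, so a
  class of differentiable functions that is stable under \<open>pderiv_dir\<close> consists of
  smooth functions. The order of differentiation never has to be tracked.\<close>

lemma smooth_fun_coinduct:
  assumes "S f"
    and diff: "\<And>f z. S f \<Longrightarrow> f differentiable (at z)"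
    and step: "\<And>f v. S f \<Longrightarrow> S (pderiv_dir v f)"
  shows "smooth_fun f"
proof -
  have "S (foldr pderiv_dir vs f)" for vs
    using \<open>S f\<close> by (induction vs) (auto intro: step)
  then show ?thesis unfolding smooth_fun_def by (blast intro: diff)
qed

lemma smooth_fun_differentiable: "smooth_fun f \<Longrightarrow> f differentiable (at z)"
  unfolding smooth_fun_def by (metis foldr.simps(1) id_apply)

lemma smooth_fun_pderiv_dir: "smooth_fun f \<Longrightarrow> smooth_fun (pderiv_dir v f)"
  unfolding smooth_fun_def
proof (intro allI)
  fix vs z assume *: "\<forall>vs z. foldr pderiv_dir vs f differentiable at z"
  show "foldr pderiv_dir vs (pderiv_dir v f) differentiable at z"
    using *[rule_format, of "vs @ [v]" z] by simp
qed

lemma pderiv_dir_eq: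
  assumes "\<And>z. (f has_derivative D z) (at z)"
  shows "pderiv_dir v f = (\<lambda>z. D z v)"
  unfolding pderiv_dir_def by (simp add: frechet_derivative_at[OF assms, symmetric])

lemma has_derivative_pderiv_dir:
  assumes "f differentiable (at z)"
  shows "(f has_derivative (\<lambda>v. pderiv_dir v f z)) (at z)"
  unfolding pderiv_dir_def using assms by (simp add: frechet_derivative_works)

lemma bounded_linear_pderiv_dir:
  "f differentiable (at z) \<Longrightarrow> bounded_linear (\<lambda>v. pderiv_dir v f z)"
  using has_derivative_pderiv_dir has_derivative_bounded_linear by blast

lemma pderiv_dir_components:
  assumes "f differentiable (at z)"
  shows "pderiv_dir v f z = of_real (Re v) * pderiv_dir 1 f z + of_real (Im v) * pderiv_dir \<i> f z"
proof -
  interpret bounded_linear "\<lambda>v. pderiv_dir v f z"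
    by (rule bounded_linear_pderiv_dir[OF assms])
  have "v = Re v *\<^sub>R 1 + Im v *\<^sub>R \<i>"
    by (simp add: complex_eq_iff)
  then have "pderiv_dir v f z = pderiv_dir (Re v *\<^sub>R 1 + Im v *\<^sub>R \<i>) f z"
    by simp
  also have "\<dots> = Re v *\<^sub>R pderiv_dir 1 f z + Im v *\<^sub>R pderiv_dir \<i> f z"
    by (simp only: add scaleR)
  finally show ?thesis by (simp add: scaleR_conv_of_real)
qed

text \<open>Differentiating a product produces a sum of products, so the products of smooth
  functions alone are not stable under \<open>pderiv_dir\<close>. Collecting all operations in one
  class makes the coinduction work.\<close>

inductive smooth_closure :: "(complex \<Rightarrow> complex) \<Rightarrow> bool" where
  base: "smooth_fun f \<Longrightarrow> smooth_closure f"
| add: "smooth_closure f \<Longrightarrow> smooth_closure g \<Longrightarrow> smooth_closure (\<lambda>z. f z + g z)"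
| mult: "smooth_closure f \<Longrightarrow> smooth_closure g \<Longrightarrow> smooth_closure (\<lambda>z. f z * g z)"
| cmult: "smooth_closure f \<Longrightarrow> smooth_closure (\<lambda>z. c * f z)"
| cnj: "smooth_closure f \<Longrightarrow> smooth_closure (\<lambda>z. cnj (f z))"
| shift: "smooth_closure f \<Longrightarrow> smooth_closure (\<lambda>z. f (z - a))"

lemma smooth_closure_differentiable: "smooth_closure f \<Longrightarrow> f differentiable (at z)"
proof (induction arbitrary: z rule: smooth_closure.induct)
  case (cnj f)
  then show ?case
    unfolding differentiable_def by (blast intro: bounded_linear.has_derivative[OF bounded_linear_cnj])
next
  case (shift f a)
  have "(\<lambda>z. z - a) differentiable (at z)" by simp
  with shift show ?case
    using differentiable_chain_at[of "\<lambda>z. z - a" z f] by (simp add: o_def)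
next
  case (base f) then show ?case by (rule smooth_fun_differentiable)
qed simp_all

lemma smooth_closure_pderiv_dir: "smooth_closure f \<Longrightarrow> smooth_closure (pderiv_dir v f)"
proof (induction rule: smooth_closure.induct)
  case (base f)
  then show ?case by (intro smooth_closure.base smooth_fun_pderiv_dir)
next
  case (add f g)
  have eq: "pderiv_dir v (\<lambda>z. f z + g z) = (\<lambda>z. pderiv_dir v f z + pderiv_dir v g z)"
    by (rule pderiv_dir_eq)
       (intro has_derivative_add has_derivative_pderiv_dir smooth_closure_differentiable add)
  show ?case unfolding eq by (intro smooth_closure.add add)
next
  case (mult f g)
  have eq: "pderiv_dir v (\<lambda>z. f z * g z) = (\<lambda>z. f z * pderiv_dir v g z + pderiv_dir v f z * g z)"
    by (rule pderiv_dir_eq)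
       (intro has_derivative_mult has_derivative_pderiv_dir smooth_closure_differentiable mult)
  show ?case unfolding eq by (rule smooth_closure.add[OF smooth_closure.mult smooth_closure.mult]) (rule mult)+
next
  case (cmult f c)
  have eq: "pderiv_dir v (\<lambda>z. c * f z) = (\<lambda>z. c * pderiv_dir v f z)"
    by (rule pderiv_dir_eq)
       (intro has_derivative_mult_right has_derivative_pderiv_dir smooth_closure_differentiable cmult)
  show ?case unfolding eq by (rule smooth_closure.cmult[OF cmult(2)])
next
  case (cnj f)
  have eq: "pderiv_dir v (\<lambda>z. cnj (f z)) = (\<lambda>z. cnj (pderiv_dir v f z))"
    by (rule pderiv_dir_eq)
       (intro bounded_linear.has_derivative[OF bounded_linear_cnj] has_derivative_pderiv_dir smooth_closure_differentiable cnj)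
  show ?case unfolding eq by (rule smooth_closure.cnj[OF cnj(2)])
next
  case (shift f a)
  have "((\<lambda>z. f (z - a)) has_derivative (\<lambda>v. pderiv_dir v f (z - a))) (at z)" for z
  proof -
    have "((\<lambda>z. z - a) has_derivative (\<lambda>v. v)) (at z)"
      by (auto intro!: derivative_eq_intros)
    from diff_chain_at[OF this has_derivative_pderiv_dir[OF smooth_closure_differentiable[OF shift(1)]]]
    show ?thesis by (simp add: o_def)
  qed
  from pderiv_dir_eq[OF this] show ?case by (simp only:) (rule smooth_closure.shift[OF shift(2)])
qed

lemma smooth_closure_imp_smooth_fun: "smooth_closure f \<Longrightarrow> smooth_fun f"
  by (rule smooth_fun_coinduct[of smooth_closure])
     (auto intro: smooth_closure_differentiable smooth_closure_pderiv_dir)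

text \<open>In the plane a closure is compact exactly when the set is bounded, so the support
  condition becomes vanishing outside some disk.\<close>

lemma test_fun_iff:
  "test_fun f \<longleftrightarrow> smooth_fun f \<and> (\<exists>r. \<forall>x. r < cmod x \<longrightarrow> f x = 0)"
proof -
  have "(\<forall>x\<in>{z. f z \<noteq> 0}. cmod x \<le> r) \<longleftrightarrow> (\<forall>x. r < cmod x \<longrightarrow> f x = 0)" for r
    by (auto simp: not_less)
  then show ?thesis unfolding test_fun_def compact_closure bounded_iff by simp
qed

lemma test_fun_smooth: "test_fun f \<Longrightarrow> smooth_fun f"
  by (simp add: test_fun_iff)

lemma test_fun_support:
  assumes "test_fun f" obtains r where "r > 0" "\<And>x. r < cmod x \<Longrightarrow> f x = 0"
proof -
  from assms obtain r where r: "\<And>x. r < cmod x \<Longrightarrow> f x = 0" by (auto simp: test_fun_iff)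
  show thesis by (rule that[of "max r 1"]) (auto intro: r)
qed

lemma test_fun_differentiable: "test_fun f \<Longrightarrow> f differentiable (at z)"
  by (simp add: test_fun_iff smooth_fun_differentiable)

lemma test_fun_add:
  assumes "test_fun f" "test_fun g"
  shows "test_fun (\<lambda>z. f z + g z)"
proof -
  obtain r where r: "\<And>x. r < cmod x \<Longrightarrow> f x = 0" using test_fun_support[OF assms(1)] by blast
  obtain s where s: "\<And>x. s < cmod x \<Longrightarrow> g x = 0" using test_fun_support[OF assms(2)] by blast
  have "\<forall>x. max r s < cmod x \<longrightarrow> f x + g x = 0" using r s by auto
  moreover have "smooth_fun (\<lambda>z. f z + g z)"
    using assms[THEN test_fun_smooth, THEN smooth_closure.base]
    by (intro smooth_closure_imp_smooth_fun smooth_closure.add)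
  ultimately show ?thesis unfolding test_fun_iff by blast
qed

lemma test_fun_mult:
  assumes "test_fun f" "test_fun g"
  shows "test_fun (\<lambda>z. f z * g z)"
proof -
  obtain r where r: "\<And>x. r < cmod x \<Longrightarrow> f x = 0" using test_fun_support[OF assms(1)] by blast
  have "\<forall>x. r < cmod x \<longrightarrow> f x * g x = 0" using r by auto
  moreover have "smooth_fun (\<lambda>z. f z * g z)"
    using assms[THEN test_fun_smooth, THEN smooth_closure.base]
    by (intro smooth_closure_imp_smooth_fun smooth_closure.mult)
  ultimately show ?thesis unfolding test_fun_iff by blast
qed

lemma test_fun_cmult: "test_fun f \<Longrightarrow> test_fun (\<lambda>z. c * f z)"
  using smooth_closure_imp_smooth_fun[OF smooth_closure.cmult[OF smooth_closure.base]]
  unfolding test_fun_iff by fastforce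

lemma test_fun_cnj: "test_fun f \<Longrightarrow> test_fun (\<lambda>z. cnj (f z))"
  using smooth_closure_imp_smooth_fun[OF smooth_closure.cnj[OF smooth_closure.base]]
  unfolding test_fun_iff by fastforce

lemma test_fun_diff: "test_fun f \<Longrightarrow> test_fun g \<Longrightarrow> test_fun (\<lambda>z. f z - g z)"
  using test_fun_add[of f "\<lambda>z. (-1) * g z"] test_fun_cmult[of g "-1"] by simp

lemma test_fun_shift:
  assumes "test_fun f" shows "test_fun (\<lambda>z. f (z - a))"
proof -
  obtain r where r: "\<And>x. r < cmod x \<Longrightarrow> f x = 0" using test_fun_support[OF assms(1)] by blast
  have "f (x - a) = 0" if "r + cmod a < cmod x" for x
    using that norm_triangle_ineq[of "x - a" a] by (intro r) simp
  moreover have "smooth_fun (\<lambda>z. f (z - a))"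
    by (rule smooth_closure_imp_smooth_fun[OF smooth_closure.shift[OF smooth_closure.base[OF test_fun_smooth[OF assms]]]])
  ultimately show ?thesis unfolding test_fun_iff by blast
qed

lemma test_fun_pderiv_dir:
  assumes "test_fun f" shows "test_fun (pderiv_dir v f)"
proof -
  obtain r where r: "\<And>x. r < cmod x \<Longrightarrow> f x = 0" using test_fun_support[OF assms(1)] by blast
  have "pderiv_dir v f x = 0" if x: "r < cmod x" for x
  proof -
    have "open {x. r < cmod x}" by (intro open_Collect_less continuous_intros)
    then have "(f has_derivative (\<lambda>_. 0)) (at x)"
      by (rule has_derivative_transform_within_open[OF has_derivative_const[of 0]]) (use x r in auto)
    then show ?thesis unfolding pderiv_dir_def by (metis frechet_derivative_at)
  qed
  then show ?thesis using assms unfolding test_fun_iff by (blast intro: smooth_fun_pderiv_dir)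
qed

lemma test_fun_dz: "test_fun f \<Longrightarrow> test_fun (dz f)"
proof -
  assume f: "test_fun f"
  have eq: "dz f = (\<lambda>z. (1/2) * (pderiv_dir 1 f z - \<i> * pderiv_dir \<i> f z))"
    by (auto simp: dz_def pderiv_dir_def)
  show ?thesis
    unfolding eq by (intro test_fun_cmult test_fun_diff test_fun_pderiv_dir f)
qed

lemma test_fun_continuous_on: "test_fun f \<Longrightarrow> continuous_on A f"
  by (meson continuous_at_imp_continuous_on differentiable_imp_continuous_within test_fun_differentiable)

lemma test_fun_measurable [measurable_dest]: "test_fun f \<Longrightarrow> f \<in> borel_measurable borel"
  by (intro borel_measurable_continuous_onI test_fun_continuous_on)

lemma test_fun_bounded:
  assumes "test_fun f" obtains B where "B > 0" "\<And>x. cmod (f x) \<le> B"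
proof -
  obtain r where r: "\<And>x. r < cmod x \<Longrightarrow> f x = 0" using test_fun_support[OF assms(1)] by blast
  have "compact (f ` cball 0 r)" by (intro compact_continuous_image test_fun_continuous_on assms) auto
  then obtain B where B: "\<And>x. x \<in> cball 0 r \<Longrightarrow> cmod (f x) \<le> B"
    by (meson bounded_iff compact_imp_bounded imageI)
  show thesis
  proof (rule that[of "max B 1"])
    fix x show "cmod (f x) \<le> max B 1" using r[of x] B[of x] by (cases "r < cmod x") auto
  qed auto
qed

lemma test_fun_lipschitz:
  assumes "test_fun f" obtains L where "L \<ge> 0" "\<And>x y. cmod (f x - f y) \<le> L * cmod (x - y)"
proof -
  obtain A where A: "A > 0" "\<And>x. cmod (pderiv_dir 1 f x) \<le> A"
    using test_fun_bounded[OF test_fun_pderiv_dir[OF assms]] by metis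
  obtain B where B: "B > 0" "\<And>x. cmod (pderiv_dir \<i> f x) \<le> B"
    using test_fun_bounded[OF test_fun_pderiv_dir[OF assms]] by metis
  have *: "cmod (pderiv_dir v f x) \<le> (A + B) * cmod v" for v x
  proof -
    have "cmod (pderiv_dir v f x) \<le> cmod (of_real (Re v) * pderiv_dir 1 f x) + cmod (of_real (Im v) * pderiv_dir \<i> f x)"
      unfolding pderiv_dir_components[OF test_fun_differentiable[OF assms], of v] by (rule norm_triangle_ineq)
    also have "\<dots> \<le> cmod v * A + cmod v * B"
      using A B by (auto intro!: add_mono mult_mono abs_Re_le_cmod abs_Im_le_cmod simp: norm_mult)
    finally show ?thesis by (simp add: algebra_simps)
  qed
  have "cmod (f x - f y) \<le> (A + B) * cmod (x - y)" for x y
    by (rule differentiable_bound[of UNIV f "\<lambda>x v. pderiv_dir v f x"])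
       (auto intro!: onorm_le * has_derivative_pderiv_dir test_fun_differentiable assms)
  then show thesis using A B by (intro that[of "A + B"]) auto
qed

text \<open>The constant does not depend on the base point, because the derivatives are globally
  Lipschitz. This uniformity is what lets \<open>has_derivative_conv\<close> differentiate under the
  integral.\<close>

lemma test_fun_taylor:
  assumes "test_fun f"
  obtains C where "C \<ge> 0" "\<And>x h. cmod (f (x + h) - f x - pderiv_dir h f x) \<le> C * (cmod h)\<^sup>2"
proof -
  obtain A where A: "A \<ge> 0" "\<And>x y. cmod (pderiv_dir 1 f x - pderiv_dir 1 f y) \<le> A * cmod (x - y)"
    using test_fun_lipschitz[OF test_fun_pderiv_dir[OF assms]] by metis
  obtain B where B: "B \<ge> 0" "\<And>x y. cmod (pderiv_dir \<i> f x - pderiv_dir \<i> f y) \<le> B * cmod (x - y)"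
    using test_fun_lipschitz[OF test_fun_pderiv_dir[OF assms]] by metis
  have *: "cmod (pderiv_dir v f x - pderiv_dir v f y) \<le> (A + B) * cmod (x - y) * cmod v" for v x y
  proof -
    have "cmod (pderiv_dir v f x - pderiv_dir v f y) \<le>
      cmod (of_real (Re v) * (pderiv_dir 1 f x - pderiv_dir 1 f y)) + cmod (of_real (Im v) * (pderiv_dir \<i> f x - pderiv_dir \<i> f y))"
      unfolding pderiv_dir_components[OF test_fun_differentiable[OF assms], of v]
      by (rule order_trans[OF _ norm_triangle_ineq]) (simp add: algebra_simps)
    also have "\<dots> \<le> cmod v * (A * cmod (x - y)) + cmod v * (B * cmod (x - y))"
      using A B by (auto intro!: add_mono mult_mono abs_Re_le_cmod abs_Im_le_cmod simp: norm_mult)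
    finally show ?thesis by (simp add: algebra_simps)
  qed
  have "cmod (f (x + h) - f x - pderiv_dir h f x) \<le> (A + B) * (cmod h)\<^sup>2" for x h
  proof -
    have "norm (f (x + h) - f x - pderiv_dir ((x + h) - x) f x) \<le> norm ((x + h) - x) * ((A + B) * cmod h)"
    proof (rule differentiable_bound_linearization[where S="closed_segment x (x + h)" and f' = "\<lambda>x v. pderiv_dir v f x"])
      fix t :: real assume "t \<in> {0..1}"
      then show "x + t *\<^sub>R (x + h - x) \<in> closed_segment x (x + h)"
        by (auto simp: in_segment algebra_simps intro!: exI[of _ t])
    next
      fix y assume "y \<in> closed_segment x (x + h)"
      then have y: "cmod (y - x) \<le> cmod h"
        using segment_bound1 by fastforce
      show "onorm ((\<lambda>v. pderiv_dir v f y) - (\<lambda>v. pderiv_dir v f x)) \<le> (A + B) * cmod h"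
      proof (rule onorm_le)
        fix v
        have "cmod (pderiv_dir v f y - pderiv_dir v f x) \<le> (A + B) * cmod (y - x) * cmod v" by (rule *)
        also have "\<dots> \<le> (A + B) * cmod h * cmod v" using A B y by (intro mult_right_mono mult_left_mono) auto
        finally show "cmod (((\<lambda>v. pderiv_dir v f y) - (\<lambda>v. pderiv_dir v f x)) v) \<le> (A + B) * cmod h * cmod v"
          by simp
      qed
    qed (auto intro!: has_derivative_at_withinI has_derivative_pderiv_dir test_fun_differentiable assms)
    then show ?thesis by (simp add: power2_eq_square mult_ac)
  qed
  then show thesis using A B by (intro that[of "A + B"]) auto
qed

text \<open>A convenient test at points where a function is glued from two pieces, as in
  \<open>has_derivative_square_pos_part\<close> and \<open>DERIV_cocut_profile\<close>, and for
  convolutions.\<close>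

lemma has_derivative_quadratic_remainder:
  fixes f :: "'a::real_normed_vector \<Rightarrow> 'b::real_normed_vector"
  assumes "bounded_linear L" and bound: "\<And>h. norm (f (x + h) - f x - L h) \<le> C * (norm h)\<^sup>2"
  shows "(f has_derivative L) (at x)"
  unfolding has_derivative_at
proof
  show "(\<lambda>h. norm (f (x + h) - f x - L h) / norm h) \<midarrow>0\<rightarrow> 0"
  proof (rule tendsto_0_le[where K=1])
    show "(\<lambda>h::'a. C * norm h) \<midarrow>0\<rightarrow> 0" by (auto intro!: tendsto_eq_intros)
    show "\<forall>\<^sub>F h in at 0. norm (norm (f (x + h) - f x - L h) / norm h) \<le> norm (C * norm h) * 1"
    proof (rule always_eventually, rule allI)
      fix h :: 'a
      have "norm (f (x + h) - f x - L h) / norm h \<le> C * norm h"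
        using bound[of h] by (cases "h = 0") (auto simp: field_simps power2_eq_square)
      then show "norm (norm (f (x + h) - f x - L h) / norm h) \<le> norm (C * norm h) * 1"
        by simp
    qed
  qed
qed fact

subsection \<open>Fourier transform and convolution\<close>

text \<open>Two classes of compactly supported functions: bounded ones, whose linear statistics have
  second moments, and integrable ones, which admit the Cauchy kernel with its singularity at 0 as a
  factor of a convolution.\<close>

definition bounded_cs :: "(complex \<Rightarrow> complex) \<Rightarrow> bool" where
  "bounded_cs h \<longleftrightarrow> h \<in> borel_measurable borel \<and> (\<exists>B. \<forall>x. cmod (h x) \<le> B) \<and> (\<exists>r. \<forall>x. r < cmod x \<longrightarrow> h x = 0)"

definition integrable_cs :: "(complex \<Rightarrow> complex) \<Rightarrow> bool" where
  "integrable_cs g \<longleftrightarrow> g \<in> borel_measurable borel \<and> integrable lborel g \<and> (\<exists>r. \<forall>x. r < cmod x \<longrightarrow> g x = 0)"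

lemma integrable_indicator_cball_complex [simp, intro]:
  "integrable lborel (indicator (cball c r) :: complex \<Rightarrow> real)"
  by (rule integrable_real_indicator[OF _ emeasure_bounded_finite]) auto

lemma integrable_bounded_support:
  fixes h :: "complex \<Rightarrow> complex"
  assumes "h \<in> borel_measurable borel" "\<And>x. cmod (h x) \<le> B" "\<And>x. r < cmod x \<Longrightarrow> h x = 0"
  shows "integrable lborel h"
proof (rule Bochner_Integration.integrable_bound)
  show "integrable lborel (\<lambda>x. B * indicator (cball (0::complex) r) x)" by auto
  show "AE x in lborel. cmod (h x) \<le> norm (B * indicator (cball (0::complex) r) x)"
    using assms(2,3) order_trans[OF norm_ge_zero assms(2)] by (auto simp: indicator_def not_le)
qed (use assms in auto)

lemma bounded_cs_integrable_cs: "bounded_cs h \<Longrightarrow> integrable_cs h"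
  unfolding bounded_cs_def integrable_cs_def using integrable_bounded_support by blast

lemma test_fun_bounded_cs: "test_fun f \<Longrightarrow> bounded_cs f"
  unfolding bounded_cs_def by (metis test_fun_bounded test_fun_support test_fun_measurable)

lemma test_fun_integrable: "test_fun f \<Longrightarrow> integrable lborel f"
  using bounded_cs_integrable_cs[OF test_fun_bounded_cs] by (simp add: integrable_cs_def)

definition echar :: "complex \<Rightarrow> complex \<Rightarrow> complex" where
  "echar \<xi> x = exp (- (2 * of_real pi * \<i>) * of_real (\<xi> \<bullet> x))"

lemma echar_cis: "echar \<xi> x = cis (- (2 * pi * (\<xi> \<bullet> x)))"
  by (simp add: echar_def cis_conv_exp mult_ac)

lemma norm_echar [simp]: "cmod (echar \<xi> x) = 1"
  by (simp add: echar_cis)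

lemma echar_zero [simp]: "echar 0 x = 1" "echar \<xi> 0 = 1"
  by (simp_all add: echar_def)

lemma echar_add: "echar \<xi> (x + y) = echar \<xi> x * echar \<xi> y"
  by (simp add: echar_cis cis_mult inner_add_right algebra_simps)

lemma echar_scale: "echar \<xi> (of_real r * x) = echar (of_real r * \<xi>) x"
  by (simp add: echar_def inner_complex_def algebra_simps)

lemma continuous_on_echar [continuous_intros]:
  "continuous_on A f \<Longrightarrow> continuous_on A g \<Longrightarrow> continuous_on A (\<lambda>x. echar (f x) (g x))"
  unfolding echar_def by (intro continuous_intros)

lemma measurable_echar [measurable (raw)]:
  "f \<in> borel_measurable M \<Longrightarrow> g \<in> borel_measurable M \<Longrightarrow> (\<lambda>x. echar (f x) (g x)) \<in> borel_measurable M"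
  unfolding echar_def by measurable

text \<open>A chord is shorter than its arc. The bound yields both the linear vanishing at the
  origin of the transform of a mean-zero function and the boundedness of
  \<open>delta_weight\<close>.\<close>

lemma echar_diff_one: "cmod (echar \<xi> x - 1) \<le> 2 * pi * cmod \<xi> * cmod x"
proof -
  have "cmod (echar \<xi> x - 1) = 2 * \<bar>sin (- (2 * pi * (\<xi> \<bullet> x)) / 2)\<bar>"
    unfolding echar_cis cis_conv_exp by (rule dist_exp_i_1)
  also have "\<dots> \<le> \<bar>2 * pi * (\<xi> \<bullet> x)\<bar>"
    using abs_sin_x_le_abs_x[of "- (2 * pi * (\<xi> \<bullet> x)) / 2"] by simp
  also have "\<dots> \<le> 2 * pi * (cmod \<xi> * cmod x)"
    using Cauchy_Schwarz_ineq2[of \<xi> x] by (simp add: abs_mult)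
  finally show ?thesis by (simp add: mult_ac)
qed

lemma fourier_echar: "fourier f \<xi> = (\<integral>x. echar \<xi> x * f x \<partial>lborel)"
  by (simp add: fourier_def echar_def)

lemma integrable_echar_mult: "integrable lborel f \<Longrightarrow> integrable lborel (\<lambda>x. echar \<xi> x * f x)"
  by (rule Bochner_Integration.integrable_bound[of _ f]) (auto simp: norm_mult)

lemma measurable_fourier [measurable]:
  assumes [measurable]: "f \<in> borel_measurable borel"
  shows "fourier f \<in> borel_measurable borel"
  unfolding fourier_echar[abs_def] by measurable

lemma fourier_zero: "fourier f 0 = (\<integral>x. f x \<partial>lborel)"
  by (simp add: fourier_echar)

lemma norm_fourier_le: "cmod (fourier f \<xi>) \<le> (\<integral>x. cmod (f x) \<partial>lborel)"
  unfolding fourier_echar by (rule order_trans[OF integral_norm_bound]) (simp add: norm_mult)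

lemma fourier_add: "integrable lborel f \<Longrightarrow> integrable lborel g \<Longrightarrow> fourier (\<lambda>x. f x + g x) \<xi> = fourier f \<xi> + fourier g \<xi>"
  unfolding fourier_echar by (simp add: distrib_left integrable_echar_mult)

lemma fourier_diff: "integrable lborel f \<Longrightarrow> integrable lborel g \<Longrightarrow> fourier (\<lambda>x. f x - g x) \<xi> = fourier f \<xi> - fourier g \<xi>"
  unfolding fourier_echar by (simp add: right_diff_distrib integrable_echar_mult)

lemma fourier_cmult: "fourier (\<lambda>x. c * f x) \<xi> = c * fourier f \<xi>"
  unfolding fourier_echar by (simp add: mult.left_commute)

lemma fourier_shift:
  assumes [measurable]: "f \<in> borel_measurable borel"
  shows "fourier (\<lambda>x. f (x - a)) \<xi> = echar \<xi> a * fourier f \<xi>"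
proof -
  have "fourier (\<lambda>x. f (x - a)) \<xi> = (\<integral>x. echar \<xi> ((x - a) + a) * f (x - a) \<partial>lborel)"
    by (simp add: fourier_echar)
  also have "\<dots> = (\<integral>x. echar \<xi> (x + a) * f x \<partial>lborel)"
    using integral_complex_shift'[of "\<lambda>x. echar \<xi> (x + a) * f x" a] by simp
  also have "\<dots> = (\<integral>x. echar \<xi> a * (echar \<xi> x * f x) \<partial>lborel)"
    by (simp add: echar_add mult_ac)
  finally show ?thesis by (simp add: fourier_echar)
qed

lemma fourier_scale:
  assumes [measurable]: "f \<in> borel_measurable borel" and "R > 0"
  shows "fourier (\<lambda>x. f (x / of_real R)) \<xi> = of_real (R\<^sup>2) * fourier f (of_real R * \<xi>)"
proof -
  have "fourier (\<lambda>x. f (x / of_real R)) \<xi> = (\<integral>x. echar \<xi> (of_real R * (x / of_real R)) * f (x / of_real R) \<partial>lborel)"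
    using assms(2) by (simp add: fourier_echar)
  also have "\<dots> = R\<^sup>2 * (\<integral>x. echar \<xi> (of_real R * x) * f x \<partial>lborel)"
    using integral_complex_scale[of "\<lambda>x. echar \<xi> (of_real R * x) * f x" R] assms(2) by simp
  finally show ?thesis by (simp add: fourier_echar echar_scale)
qed

definition conv :: "(complex \<Rightarrow> complex) \<Rightarrow> (complex \<Rightarrow> complex) \<Rightarrow> complex \<Rightarrow> complex" where
  "conv g f l = (\<integral>u. g u * f (l - u) \<partial>lborel)"

lemma integrable_mult_test_fun:
  assumes "integrable lborel g" "g \<in> borel_measurable borel" "test_fun f"
  shows "integrable lborel (\<lambda>u. g u * f (l - u))"
proof -
  obtain B where B: "\<And>x. cmod (f x) \<le> B" using test_fun_bounded[OF assms(3)] by metis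
  note [measurable] = assms(2) test_fun_measurable[OF assms(3)]
  show ?thesis
  proof (rule Bochner_Integration.integrable_bound)
    show "integrable lborel (\<lambda>u. of_real B * g u)" using assms by simp
    show "AE x in lborel. cmod (g x * f (l - x)) \<le> cmod (complex_of_real B * g x)"
      using B order_trans[OF norm_ge_zero B]
      by (auto simp: norm_mult mult.commute[of "cmod (g _)"] intro!: mult_right_mono)
  qed measurable
qed

text \<open>All derivatives fall on the test function, so the other factor may be singular.\<close>

lemma has_derivative_conv:
  assumes g: "integrable lborel g" "g \<in> borel_measurable borel" and f: "test_fun f"
  shows "(conv g f has_derivative (\<lambda>v. conv g (pderiv_dir v f) l)) (at l)"
proof -
  obtain C where C: "C \<ge> 0" "\<And>x h. cmod (f (x + h) - f x - pderiv_dir h f x) \<le> C * (cmod h)\<^sup>2"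
    using test_fun_taylor[OF f] by metis
  note int = integrable_mult_test_fun[OF g f] integrable_mult_test_fun[OF g test_fun_pderiv_dir[OF f]]
  have comp: "conv g (pderiv_dir v f) l = of_real (Re v) * conv g (pderiv_dir 1 f) l + of_real (Im v) * conv g (pderiv_dir \<i> f) l" for v
  proof -
    have "conv g (pderiv_dir v f) l = (\<integral>u. of_real (Re v) * (g u * pderiv_dir 1 f (l - u)) + of_real (Im v) * (g u * pderiv_dir \<i> f (l - u)) \<partial>lborel)"
      unfolding conv_def
      by (subst pderiv_dir_components[OF test_fun_differentiable[OF f], of v]) (simp add: algebra_simps)
    then show ?thesis by (simp add: int conv_def)
  qed
  show ?thesis
  proof (rule has_derivative_quadratic_remainder)
    show "bounded_linear (\<lambda>v. conv g (pderiv_dir v f) l)"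
      by (subst ext[OF comp])
         (intro bounded_linear_add bounded_linear_mult_const
            bounded_linear_compose[OF bounded_linear_of_real bounded_linear_Re]
            bounded_linear_compose[OF bounded_linear_of_real bounded_linear_Im])
    fix h
    have "cmod (conv g f (l + h) - conv g f l - conv g (pderiv_dir h f) l) =
        cmod (\<integral>u. g u * (f ((l - u) + h) - f (l - u) - pderiv_dir h f (l - u)) \<partial>lborel)"
      unfolding conv_def using int by (simp add: right_diff_distrib add_diff_eq diff_add_eq)
    also have "\<dots> \<le> (\<integral>u. cmod (g u) * (C * (cmod h)\<^sup>2) \<partial>lborel)"
    proof (rule order_trans[OF integral_norm_bound integral_mono])
      have "integrable lborel (\<lambda>u. g u * f ((l + h) - u) - g u * f (l - u) - g u * pderiv_dir h f (l - u))"
        using int by (intro Bochner_Integration.integrable_diff)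
      then show "integrable lborel (\<lambda>u. cmod (g u * (f ((l - u) + h) - f (l - u) - pderiv_dir h f (l - u))))"
        by (intro integrable_norm) (simp add: right_diff_distrib add_diff_eq diff_add_eq)
    qed (use C g in \<open>auto simp: norm_mult intro!: mult_left_mono\<close>)
    also have "\<dots> = ((\<integral>u. cmod (g u) \<partial>lborel) * C) * (cmod h)\<^sup>2" by simp
    finally show "cmod (conv g f (l + h) - conv g f l - conv g (pderiv_dir h f) l) \<le>
      ((\<integral>u. cmod (g u) \<partial>lborel) * C) * (cmod h)\<^sup>2" .
  qed
qed

lemma test_fun_conv:
  assumes g: "integrable_cs g" and f: "test_fun f"
  shows "test_fun (conv g f)"
proof -
  have gi: "integrable lborel g" "g \<in> borel_measurable borel" using g by (auto simp: integrable_cs_def)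
  obtain r where r: "\<And>x. r < cmod x \<Longrightarrow> f x = 0" using test_fun_support[OF f] by blast
  obtain s where s: "\<And>x. s < cmod x \<Longrightarrow> g x = 0" using g by (auto simp: integrable_cs_def)
  have "smooth_fun (conv g f)"
  \<comment> \<open>The stable class consists of all convolutions of this fixed \<open>g\<close>
    with test functions.\<close>
  proof (rule smooth_fun_coinduct[where S="\<lambda>h. \<exists>f. test_fun f \<and> h = conv g f"])
    fix h z assume "\<exists>f. test_fun f \<and> h = conv g f"
    then show "h differentiable (at z)"
      using has_derivative_conv[OF gi] unfolding differentiable_def by blast
  next
    fix h v assume "\<exists>f. test_fun f \<and> h = conv g f"
    then obtain f where f: "test_fun f" "h = conv g f" by blast
    have "pderiv_dir v h = conv g (pderiv_dir v f)"
      unfolding f(2) by (rule pderiv_dir_eq[OF has_derivative_conv[OF gi f(1)]])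
    then show "\<exists>f. test_fun f \<and> pderiv_dir v h = conv g f" using test_fun_pderiv_dir[OF f(1)] by blast
  qed (use f in blast)
  moreover have "conv g f x = 0" if "r + s < cmod x" for x
  proof -
    have "g u * f (x - u) = 0" for u
      using r[of "x - u"] s[of u] norm_triangle_ineq[of "x - u" u] that by fastforce
    then show ?thesis unfolding conv_def by (simp only: Bochner_Integration.integral_zero)
  qed
  ultimately show ?thesis unfolding test_fun_iff by blast
qed

lemma fourier_conv:
  assumes g: "integrable lborel g" "g \<in> borel_measurable borel" and f: "integrable lborel f" "f \<in> borel_measurable borel"
  shows "fourier (conv g f) \<xi> = fourier g \<xi> * fourier f \<xi>"
proof -
  note [measurable] = g(2) f(2)
  have sh: "(\<integral>l. cmod (f (l - u)) \<partial>lborel) = (\<integral>l. cmod (f l) \<partial>lborel)" for u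
    by (rule integral_complex_shift'[of "\<lambda>x. cmod (f x)"]) auto
  have int: "integrable (lborel \<Otimes>\<^sub>M lborel) (\<lambda>(u, l). echar \<xi> l * (g u * f (l - u)))"
  proof (rule lborel_pair.Fubini_integrable)
    show "integrable lborel (\<lambda>u. \<integral>l. norm (case (u, l) of (u, l) \<Rightarrow> echar \<xi> l * (g u * f (l - u))) \<partial>lborel)"
      using g by (simp add: norm_mult sh)
    show "AE u in lborel. integrable lborel (\<lambda>l. case (u, l) of (u, l) \<Rightarrow> echar \<xi> l * (g u * f (l - u)))"
      using f by (auto intro!: integrable_echar_mult simp: integrable_complex_shift')
  qed measurable
  have "fourier (conv g f) \<xi> = (\<integral>l. (\<integral>u. echar \<xi> l * (g u * f (l - u)) \<partial>lborel) \<partial>lborel)"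
    by (simp add: fourier_echar conv_def)
  also have "\<dots> = (\<integral>u. (\<integral>l. echar \<xi> l * (g u * f (l - u)) \<partial>lborel) \<partial>lborel)"
    using lborel_pair.Fubini_integral[OF int] .
  also have "\<dots> = (\<integral>u. g u * fourier (\<lambda>l. f (l - u)) \<xi> \<partial>lborel)"
    by (simp add: fourier_echar mult.left_commute)
  also have "\<dots> = fourier g \<xi> * fourier f \<xi>"
    by (simp add: fourier_shift fourier_echar[of g] mult.commute mult.left_commute flip: integral_mult_left_zero integral_mult_right_zero)
  finally show ?thesis .
qed

subsection \<open>The Riemann--Lebesgue lemma\<close>

text \<open>Translating by \<open>\<xi> / (2 |\<xi>|\<^sup>2)\<close> changes the sign of the character \<open>echar \<xi>\<close>.\<close>

lemma riemann_lebesgue: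
  assumes h: "bounded_cs h" and cont: "AE x in lborel. isCont h x" and "\<xi> \<noteq> 0"
  shows "((\<lambda>R. fourier h (of_real R * \<xi>)) \<longlongrightarrow> 0) at_top"
proof -
  obtain B r where B: "\<And>x. cmod (h x) \<le> B" and r: "\<And>x. r < cmod x \<Longrightarrow> h x = 0" and [measurable]: "h \<in> borel_measurable borel"
    using h by (auto simp: bounded_cs_def)
  have B0: "B \<ge> 0" using order_trans[OF norm_ge_zero B] .
  have hi: "integrable lborel h" using bounded_cs_integrable_cs[OF h] by (simp add: integrable_cs_def)
  define v where "v = \<xi> / of_real (2 * (cmod \<xi>)\<^sup>2)"
  let ?d = "\<lambda>R x. cmod (h x - h (x - v / of_real R))"
  have "((\<lambda>R. \<integral>x. ?d R x \<partial>lborel) \<longlongrightarrow> (\<integral>x. 0 \<partial>(lborel :: complex measure))) at_top"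
  proof (rule integral_dominated_convergence_at_top)
    \<comment> \<open>For R \<ge> 1 the translations have length at most |v|, so all the differences
      live in one fixed disk.\<close>
    show "integrable lborel (\<lambda>x. 2 * B * indicator (cball (0::complex) (r + cmod v)) x)" by auto
    show "\<forall>\<^sub>F R in at_top. AE x in lborel. norm (?d R x) \<le> 2 * B * indicator (cball (0::complex) (r + cmod v)) x"
      using eventually_ge_at_top[of 1]
    proof eventually_elim
      case (elim R)
      have "?d R x \<le> 2 * B * indicator (cball (0::complex) (r + cmod v)) x" for x
      proof (cases "r + cmod v < cmod x")
        case True
        have "cmod (v / of_real R) \<le> cmod v" using elim mult_right_mono[of 1 R "cmod v"] by (simp add: norm_divide field_simps)
        then have "r < cmod (x - v / of_real R)" "r < cmod x"
          using True norm_triangle_ineq[of "x - v / of_real R" "v / of_real R"] norm_ge_zero[of v] by (auto simp del: norm_ge_zero)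
        then show ?thesis using r B0 by simp
      next
        case False
        then show ?thesis using B[of x] B[of "x - v / of_real R"] norm_triangle_ineq4[of "h x" "h (x - v / of_real R)"]
          by (simp add: not_less)
      qed
      then show ?case by simp
    qed
    show "AE x in lborel. ((\<lambda>R. ?d R x) \<longlongrightarrow> 0) at_top"
      using cont
    proof eventually_elim
      case (elim x)
      have "((\<lambda>R::real. v / of_real R) \<longlongrightarrow> 0) at_top"
        by (rule tendsto_divide_0[OF tendsto_const filterlim_of_real_at_infinity])
      from tendsto_diff[OF tendsto_const this, of x]
      have "((\<lambda>R::real. x - v / of_real R) \<longlongrightarrow> x) at_top" by simp
      then have "((\<lambda>R::real. h (x - v / of_real R)) \<longlongrightarrow> h x) at_top"
        by (rule isCont_tendsto_compose[OF elim])
      from tendsto_norm[OF tendsto_diff[OF tendsto_const this, of "h x"]] show ?case by simp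
    qed
  qed auto
  from tendsto_mult[OF tendsto_const this, of "1/2"]
  have lim: "((\<lambda>R. (1/2) * (\<integral>x. ?d R x \<partial>lborel)) \<longlongrightarrow> 0) at_top"
    by simp
  show ?thesis
  proof (rule tendsto_0_le[OF lim, where K=1])
    show "\<forall>\<^sub>F R in at_top. norm (fourier h (of_real R * \<xi>)) \<le> norm ((1/2) * (\<integral>x. ?d R x \<partial>lborel)) * 1"
      using eventually_gt_at_top[of 0]
    proof eventually_elim
      case (elim R)
      have "(of_real R * \<xi>) \<bullet> (v / of_real R) = 1/2"
      proof -
        have "(of_real R * \<xi>) \<bullet> (v / of_real R) = \<xi> \<bullet> v" using elim
          by (simp add: inner_complex_def)
        moreover have "v = (1 / (2 * (cmod \<xi>)\<^sup>2)) *\<^sub>R \<xi>" by (simp add: v_def scaleR_conv_of_real)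
        ultimately show ?thesis
          using \<open>\<xi> \<noteq> 0\<close> by (simp add: dot_square_norm)
      qed
      then have "echar (of_real R * \<xi>) (v / of_real R) = -1"
        unfolding echar_cis by (simp only:) (simp add: complex_eq_iff)
      then have "fourier (\<lambda>x. h (x - v / of_real R)) (of_real R * \<xi>) = - fourier h (of_real R * \<xi>)"
        by (subst fourier_shift) auto
      then have "2 * fourier h (of_real R * \<xi>) = fourier (\<lambda>x. h x - h (x - v / of_real R)) (of_real R * \<xi>)"
        by (subst fourier_diff) (use hi in \<open>auto simp: integrable_complex_shift'\<close>)
      then have "2 * cmod (fourier h (of_real R * \<xi>)) \<le> (\<integral>x. ?d R x \<partial>lborel)"
        using norm_fourier_le[of "\<lambda>x. h x - h (x - v / of_real R)" "of_real R * \<xi>"] by (metis norm_mult norm_numeral)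
      then show ?case by simp
    qed
  qed
qed

lemma measurable_cnj [measurable]: "cnj \<in> borel_measurable borel"
  by (intro borel_measurable_continuous_onI continuous_intros)

subsection \<open>Integration by parts\<close>

text \<open>By translation invariance every difference quotient of \<open>F\<close> in direction
  \<open>v\<close> has integral 0, and the quotients converge to the derivative boundedly and inside
  a fixed disk.\<close>

lemma integral_derivative_eq_0:
  fixes F :: "complex \<Rightarrow> complex"
  assumes F': "\<And>x. (F has_derivative F' x) (at x)"
    and cont: "continuous_on UNIV (\<lambda>x. F' x v)"
    and supp: "\<And>x. r < cmod x \<Longrightarrow> F x = 0"
  shows "(\<integral>x. F' x v \<partial>lborel) = 0"
proof -
  have contF: "continuous_on UNIV F"
    using F' by (meson continuous_at_imp_continuous_on has_derivative_continuous)
  then have [measurable]: "F \<in> borel_measurable borel"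
    by (rule borel_measurable_continuous_onI)
  have [measurable]: "(\<lambda>x. F' x v) \<in> borel_measurable borel"
    using cont by (rule borel_measurable_continuous_onI)
  have supp': "F' x v = 0" if x: "r < cmod x" for x
  proof -
    have "open {x. r < cmod x}" by (intro open_Collect_less continuous_intros)
    then have "(F has_derivative (\<lambda>_. 0)) (at x)"
      by (rule has_derivative_transform_within_open[OF has_derivative_const[of 0]]) (use x supp in auto)
    from has_derivative_unique[OF F' this] show ?thesis by simp
  qed
  have "compact ((\<lambda>x. F' x v) ` cball 0 r)"
    by (intro compact_continuous_image continuous_on_subset[OF cont]) auto
  then obtain B0 where B0: "\<And>x. x \<in> cball 0 r \<Longrightarrow> cmod (F' x v) \<le> B0"
    by (meson bounded_iff compact_imp_bounded imageI)
  define B where "B = max 0 B0"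
  have B: "cmod (F' x v) \<le> B" for x
    using B0[of x] supp'[of x] unfolding B_def by (cases "r < cmod x") auto
  have path: "((\<lambda>s. F (x + s *\<^sub>R v)) has_derivative (\<lambda>h. h *\<^sub>R F' (x + s *\<^sub>R v) v)) (at s)" for x and s :: real
  proof -
    interpret bounded_linear "F' (x + s *\<^sub>R v)" using F' has_derivative_bounded_linear by blast
    have "((\<lambda>s. x + s *\<^sub>R v) has_derivative (\<lambda>h. h *\<^sub>R v)) (at s)"
      by (auto intro!: derivative_eq_intros)
    from diff_chain_at[OF this F'] show ?thesis by (simp add: o_def scaleR)
  qed
  \<comment> \<open>The Lipschitz bound along lines supplies one dominating constant for all
    difference quotients.\<close>
  have lip: "cmod (F (x + t *\<^sub>R v) - F x) \<le> B * \<bar>t\<bar>" for x t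
  proof -
    have "norm (F (x + t *\<^sub>R v) - F (x + 0 *\<^sub>R v)) \<le> B * norm (t - 0)"
      by (rule differentiable_bound[of UNIV "\<lambda>s. F (x + s *\<^sub>R v)" "\<lambda>s h. h *\<^sub>R F' (x + s *\<^sub>R v) v"])
         (auto intro!: path onorm_le simp: mult.commute[of B] mult_left_mono B)
    then show ?thesis by simp
  qed
  define s where "s = (\<lambda>(n::nat) x. real (Suc n) *\<^sub>R (F (x + (1 / real (Suc n)) *\<^sub>R v) - F x))"
  have "(\<lambda>n. \<integral>x. s n x \<partial>lborel) \<longlonglongrightarrow> (\<integral>x. F' x v \<partial>lborel)"
  proof (rule integral_dominated_convergence)
    show "integrable lborel (\<lambda>x. B * indicator (cball (0::complex) (r + cmod v)) x)" by auto
    show "AE x in lborel. (\<lambda>n. s n x) \<longlonglongrightarrow> F' x v"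
    proof (rule AE_I2)
      fix x
      have "(\<lambda>h. norm (F (x + h *\<^sub>R v) - F x - h *\<^sub>R F' x v) / norm h) \<midarrow>0\<rightarrow> 0"
        using path[of x 0] unfolding has_derivative_at by simp
      moreover have "\<forall>\<^sub>F h in at 0. norm (F (x + h *\<^sub>R v) - F x - h *\<^sub>R F' x v) / norm h =
          norm ((F (x + h *\<^sub>R v) - F x) /\<^sub>R h - F' x v)"
        unfolding eventually_at_filter
      proof (intro always_eventually allI impI)
        fix h :: real assume "h \<noteq> 0"
        then have "(F (x + h *\<^sub>R v) - F x) /\<^sub>R h - F' x v = (F (x + h *\<^sub>R v) - F x - h *\<^sub>R F' x v) /\<^sub>R h"
          by (simp add: scaleR_diff_right)
        then show "norm (F (x + h *\<^sub>R v) - F x - h *\<^sub>R F' x v) / norm h =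
          norm ((F (x + h *\<^sub>R v) - F x) /\<^sub>R h - F' x v)"
          by (simp only: norm_scaleR) (simp add: divide_inverse mult.commute)
      qed
      ultimately have "(\<lambda>h. norm ((F (x + h *\<^sub>R v) - F x) /\<^sub>R h - F' x v)) \<midarrow>0\<rightarrow> 0"
        by (rule Lim_transform_eventually)
      then have *: "(\<lambda>h. (F (x + h *\<^sub>R v) - F x) /\<^sub>R h) \<midarrow>0\<rightarrow> F' x v"
        by (simp add: tendsto_norm_zero_iff LIM_zero_iff)
      have "filterlim (\<lambda>n. 1 / real (Suc n)) (at 0) sequentially"
        unfolding filterlim_at using LIMSEQ_Suc[OF lim_1_over_n[where 'a=real]] by auto
      from filterlim_compose[OF * this] show "(\<lambda>n. s n x) \<longlonglongrightarrow> F' x v"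
        by (simp add: s_def)
    qed
    fix n
    show "AE x in lborel. norm (s n x) \<le> B * indicator (cball (0::complex) (r + cmod v)) x"
    proof (rule AE_I2)
      fix x
      show "norm (s n x) \<le> B * indicator (cball (0::complex) (r + cmod v)) x"
      proof (cases "r + cmod v < cmod x")
        case True
        have "cmod ((1 / real (Suc n)) *\<^sub>R v) \<le> cmod v"
          using mult_right_mono[of 1 "real (Suc n)" "cmod v"] by (simp add: field_simps)
        then have "r < cmod (x + (1 / real (Suc n)) *\<^sub>R v)" "r < cmod x"
          using True norm_triangle_ineq4[of "x + (1 / real (Suc n)) *\<^sub>R v" "(1 / real (Suc n)) *\<^sub>R v"]
          using norm_ge_zero[of v] by (auto simp del: norm_ge_zero)
        then show ?thesis using supp True by (simp add: s_def)
      next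
        case False
        have "norm (s n x) = real (Suc n) * cmod (F (x + (1 / real (Suc n)) *\<^sub>R v) - F x)"
          unfolding s_def norm_scaleR by simp
        also have "\<dots> \<le> real (Suc n) * (B * \<bar>1 / real (Suc n)\<bar>)"
          by (intro mult_left_mono lip) auto
        also have "\<dots> = B" by (simp del: of_nat_Suc)
        finally show ?thesis using False by (simp add: not_less)
      qed
    qed
  qed (auto simp: s_def)
  moreover have "(\<integral>x. s n x \<partial>lborel) = 0" for n
  proof -
    have "integrable lborel F"
    proof -
      have "compact (F ` cball 0 r)"
        by (intro compact_continuous_image continuous_on_subset[OF contF]) auto
      then obtain C where "\<And>x. x \<in> cball 0 r \<Longrightarrow> cmod (F x) \<le> C"
        by (meson bounded_iff compact_imp_bounded imageI)
      then have "cmod (F x) \<le> max 0 C" for x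
        using supp[of x] by (cases "r < cmod x") (auto simp: le_max_iff_disj not_less)
      then show ?thesis using supp by (intro integrable_bounded_support) auto
    qed
    then show ?thesis unfolding s_def
      by (simp add: integrable_complex_shift integral_complex_shift del: of_nat_Suc)
  qed
  ultimately show ?thesis by (simp add: LIMSEQ_const_iff)
qed

text \<open>The product \<open>W * G\<close> has the compact support of \<open>G\<close>, so its
  derivative integrates to 0; \<open>W\<close> itself may be a character or a linear
  function.\<close>

lemma integral_mult_derivative:
  fixes W G :: "complex \<Rightarrow> complex"
  assumes W: "\<And>x. (W has_derivative W' x) (at x)" "continuous_on UNIV (\<lambda>x. W' x v)"
    and G: "\<And>x. (G has_derivative G' x) (at x)" "continuous_on UNIV (\<lambda>x. G' x v)"
    and supp: "\<And>x. r < cmod x \<Longrightarrow> G x = 0"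
  shows "(\<integral>x. W x * G' x v \<partial>lborel) = - (\<integral>x. W' x v * G x \<partial>lborel)"
proof -
  have cW: "continuous_on UNIV W" and cG: "continuous_on UNIV G"
    using W(1) G(1) by (meson continuous_at_imp_continuous_on has_derivative_continuous)+
  have supp': "G' x v = 0" if x: "r < cmod x" for x
  proof -
    have "open {x. r < cmod x}" by (intro open_Collect_less continuous_intros)
    then have "(G has_derivative (\<lambda>_. 0)) (at x)"
      by (rule has_derivative_transform_within_open[OF has_derivative_const[of 0]]) (use x supp in auto)
    from has_derivative_unique[OF G(1) this] show ?thesis by simp
  qed
  have int: "integrable lborel f" if c: "continuous_on UNIV f" and s: "\<And>x. r < cmod x \<Longrightarrow> f x = 0" for f :: "complex \<Rightarrow> complex"
  proof -
    have "compact (f ` cball 0 r)"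
      by (intro compact_continuous_image continuous_on_subset[OF c]) auto
    then obtain C where "\<And>x. x \<in> cball 0 r \<Longrightarrow> cmod (f x) \<le> C"
      by (meson bounded_iff compact_imp_bounded imageI)
    then have "cmod (f x) \<le> max 0 C" for x
      using s[of x] by (cases "r < cmod x") (auto simp: le_max_iff_disj not_less)
    then show ?thesis using s by (intro integrable_bounded_support borel_measurable_continuous_onI[OF c]) auto
  qed
  have "(\<integral>x. W x * G' x v + W' x v * G x \<partial>lborel) = 0"
    by (rule integral_derivative_eq_0[where F="\<lambda>x. W x * G x" and F'="\<lambda>x h. W x * G' x h + W' x h * G x" and r=r])
       (auto intro!: has_derivative_mult W G continuous_intros cW cG supp)
  moreover have "integrable lborel (\<lambda>x. W x * G' x v)" "integrable lborel (\<lambda>x. W' x v * G x)"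
    by (rule int; auto intro!: continuous_intros cW cG W G simp: supp supp')+
  ultimately show ?thesis by (simp add: eq_neg_iff_add_eq_0)
qed

lemma has_derivative_echar:
  "(echar \<xi> has_derivative (\<lambda>v. - (2 * of_real pi * \<i>) * of_real (\<xi> \<bullet> v) * echar \<xi> x)) (at x)"
proof -
  have "((\<lambda>x. - (2 * of_real pi * \<i>) * of_real (\<xi> \<bullet> x)) has_derivative (\<lambda>v. - (2 * of_real pi * \<i>) * of_real (\<xi> \<bullet> v))) (at x)"
    by (intro has_derivative_mult_right has_derivative_of_real has_derivative_inner_right has_derivative_ident)
  from diff_chain_at[OF this has_field_derivative_imp_has_derivative[OF DERIV_exp]]
  show ?thesis by (simp add: o_def echar_def[abs_def] mult.commute)
qed

lemma fourier_derivative: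
  assumes G: "\<And>x. (G has_derivative G' x) (at x)" "continuous_on UNIV (\<lambda>x. G' x v)"
    and supp: "\<And>x. r < cmod x \<Longrightarrow> G x = 0"
  shows "fourier (\<lambda>x. G' x v) \<xi> = 2 * of_real pi * \<i> * of_real (\<xi> \<bullet> v) * fourier G \<xi>"
proof -
  have "fourier (\<lambda>x. G' x v) \<xi> = - (\<integral>x. (- (2 * of_real pi * \<i>) * of_real (\<xi> \<bullet> v) * echar \<xi> x) * G x \<partial>lborel)"
    unfolding fourier_echar
    by (rule integral_mult_derivative[OF has_derivative_echar _ G supp]) (auto intro!: continuous_intros)
  also have "\<dots> = (\<integral>x. 2 * of_real pi * \<i> * of_real (\<xi> \<bullet> v) * (echar \<xi> x * G x) \<partial>lborel)"
    by (subst integral_minus[symmetric]) (simp add: mult_ac)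
  finally show ?thesis by (simp add: fourier_echar mult.assoc)
qed

lemma inner_one_ii: "of_real (\<xi> \<bullet> 1) + \<i> * of_real (\<xi> \<bullet> \<i>) = \<xi>" "of_real (\<xi> \<bullet> 1) - \<i> * of_real (\<xi> \<bullet> \<i>) = cnj \<xi>"
  by (simp_all add: inner_complex_def complex_eq_iff)

text \<open>The multipliers of the two real derivatives combine to a multiple of
  \<open>cnj \<xi>\<close>. Division by \<xi> leaves a factor of modulus \<pi>, the source of the
  weight \<pi>^2 for the derivative process.\<close>

lemma fourier_dz:
  assumes "test_fun f"
  shows "fourier (dz f) \<xi> = of_real pi * \<i> * cnj \<xi> * fourier f \<xi>"
proof -
  obtain r where r: "\<And>x. r < cmod x \<Longrightarrow> f x = 0" using test_fun_support[OF assms] by blast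
  have *: "fourier (pderiv_dir v f) \<xi> = 2 * of_real pi * \<i> * of_real (\<xi> \<bullet> v) * fourier f \<xi>" for v
    by (rule fourier_derivative[OF has_derivative_pderiv_dir[OF test_fun_differentiable[OF assms]] test_fun_continuous_on[OF test_fun_pderiv_dir[OF assms]] r])
  have eq: "dz f = (\<lambda>z. (1/2) * (pderiv_dir 1 f z - \<i> * pderiv_dir \<i> f z))"
    by (auto simp: dz_def pderiv_dir_def)
  have "fourier (dz f) \<xi> = (1/2) * (fourier (pderiv_dir 1 f) \<xi> - \<i> * fourier (pderiv_dir \<i> f) \<xi>)"
    unfolding eq fourier_cmult
    by (subst fourier_diff) (auto simp: fourier_cmult intro!: test_fun_integrable test_fun_cmult test_fun_pderiv_dir assms)
  also have "\<dots> = of_real pi * \<i> * (of_real (\<xi> \<bullet> 1) - \<i> * of_real (\<xi> \<bullet> \<i>)) * fourier f \<xi>"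
    unfolding * by (simp add: field_simps)
  finally show ?thesis unfolding inner_one_ii .
qed

text \<open>The derivative \<open>W'\<close> is the same at every point, that is, \<open>W\<close>
  is affine over the reals, so integration by parts leaves a constant times the integral of
  \<open>f\<close>.\<close>

lemma integral_mult_dz:
  assumes f: "test_fun f" and W: "\<And>x. (W has_derivative W') (at x)"
  shows "(\<integral>x. W x * dz f x \<partial>lborel) = - ((W' 1 - \<i> * W' \<i>) / 2) * (\<integral>x. f x \<partial>lborel)"
proof -
  obtain r where r: "\<And>x. r < cmod x \<Longrightarrow> f x = 0" using test_fun_support[OF f] by blast
  have cW: "continuous_on UNIV W"
    using W by (meson continuous_at_imp_continuous_on has_derivative_continuous)
  have *: "(\<integral>x. W x * pderiv_dir v f x \<partial>lborel) = - (W' v * (\<integral>x. f x \<partial>lborel))" for v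
    using integral_mult_derivative[OF W _ has_derivative_pderiv_dir[OF test_fun_differentiable[OF f]] test_fun_continuous_on[OF test_fun_pderiv_dir[OF f]] r, of v]
    by simp
  have int: "integrable lborel (\<lambda>x. W x * pderiv_dir v f x)" for v
  proof -
    have "compact (W ` cball 0 r)"
      by (intro compact_continuous_image continuous_on_subset[OF cW]) auto
    then obtain C where C: "\<And>x. x \<in> cball 0 r \<Longrightarrow> cmod (W x) \<le> C"
      by (meson bounded_iff compact_imp_bounded imageI)
    obtain B where B: "\<And>x. cmod (pderiv_dir v f x) \<le> B" using test_fun_bounded[OF test_fun_pderiv_dir[OF f]] by metis
    have r': "pderiv_dir v f x = 0" if "r < cmod x" for x
    proof -
      have "open {x. r < cmod x}" by (intro open_Collect_less continuous_intros)
      then have "(f has_derivative (\<lambda>_. 0)) (at x)"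
        by (rule has_derivative_transform_within_open[OF has_derivative_const[of 0]]) (use that r in auto)
      from has_derivative_unique[OF has_derivative_pderiv_dir[OF test_fun_differentiable[OF f]] this] show ?thesis by metis
    qed
    have "cmod (W x * pderiv_dir v f x) \<le> max 0 C * B" for x
    proof (cases "r < cmod x")
      case False
      then show ?thesis using C[of x] B[of x] by (auto simp: norm_mult not_less intro!: mult_mono)
    qed (use r' B order_trans[OF norm_ge_zero B] in auto)
    moreover note [measurable] = borel_measurable_continuous_onI[OF cW] test_fun_measurable[OF test_fun_pderiv_dir[OF f]]
    have "(\<lambda>x. W x * pderiv_dir v f x) \<in> borel_measurable borel" by measurable
    ultimately show ?thesis using r' by (intro integrable_bounded_support[of _ "max 0 C * B" r]) auto
  qed
  have "(\<integral>x. W x * dz f x \<partial>lborel) = (\<integral>x. (1/2) * (W x * pderiv_dir 1 f x - \<i> * (W x * pderiv_dir \<i> f x)) \<partial>lborel)"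
    by (simp add: dz_def pderiv_dir_def algebra_simps diff_divide_distrib)
  also have "\<dots> = (1/2) * ((\<integral>x. W x * pderiv_dir 1 f x \<partial>lborel) - \<i> * (\<integral>x. W x * pderiv_dir \<i> f x \<partial>lborel))"
    using int by simp
  finally show ?thesis unfolding * by (simp add: field_simps)
qed

text \<open>Three moments with three roles: mean 0 makes \<open>dz f\<close> an admissible function,
  the moment -1 of a normalized \<open>f\<close> isolates the sums of \<lambda>^-2 in
  \<open>Psi2_inf_spec\<close>, and the vanishing moment against \<open>cnj x\<close> removes the
  atom from the spectral measure of the derivative process.\<close>

lemma integral_dz:
  assumes "test_fun f"
  shows "(\<integral>x. dz f x \<partial>lborel) = 0"
    and "(\<integral>x. x * dz f x \<partial>lborel) = - (\<integral>x. f x \<partial>lborel)"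
    and "(\<integral>x. cnj x * dz f x \<partial>lborel) = 0"
proof -
  show "(\<integral>x. dz f x \<partial>lborel) = 0"
    using integral_mult_dz[OF assms has_derivative_const[of 1]] by simp
  show "(\<integral>x. x * dz f x \<partial>lborel) = - (\<integral>x. f x \<partial>lborel)"
    using integral_mult_dz[OF assms has_derivative_ident] by simp
  show "(\<integral>x. cnj x * dz f x \<partial>lborel) = 0"
    using integral_mult_dz[OF assms bounded_linear_imp_has_derivative[OF bounded_linear_cnj]] by simp
qed

subsection \<open>The truncated Cauchy kernel\<close>

text \<open>Squaring the positive part removes its corner at s = 1; the remainder is at most h^2 on
  either side of that point and across it.\<close>

lemma has_derivative_square_pos_part:
  "((\<lambda>s. (max 0 (1 - s))\<^sup>2) has_real_derivative - 2 * max 0 (1 - s)) (at (s::real))"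
  unfolding has_field_derivative_def
proof (rule has_derivative_quadratic_remainder[where C=1])
  fix h :: real
  define t where "t = 1 - s"
  have "\<bar>(max 0 (t - h))\<^sup>2 - (max 0 t)\<^sup>2 + 2 * max 0 t * h\<bar> \<le> h\<^sup>2"
  proof -
    consider "0 \<le> t" "0 \<le> t - h" | "0 \<le> t" "\<not> 0 \<le> t - h" | "\<not> 0 \<le> t" "0 \<le> t - h" | "\<not> 0 \<le> t" "\<not> 0 \<le> t - h"
      by blast
    then show ?thesis
  proof cases
    assume "0 \<le> t" "0 \<le> t - h"
    then show ?thesis by (simp add: power2_eq_square algebra_simps)
  next
    assume *: "0 \<le> t" "\<not> 0 \<le> t - h"
    then have "2 * t * h - t\<^sup>2 \<ge> 0" by (simp add: power2_eq_square mult_mono algebra_simps)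
    moreover have "2 * t * h - t\<^sup>2 \<le> h\<^sup>2" using zero_le_power2[of "t - h"] by (simp add: power2_diff algebra_simps)
    ultimately show ?thesis using * by (simp add: max_def)
  next
    assume *: "\<not> 0 \<le> t" "0 \<le> t - h"
    then have "(t - h)\<^sup>2 \<le> h\<^sup>2" by (subst abs_le_square_iff[symmetric]) auto
    then show ?thesis using * by (simp add: max_def)
  next
    assume "\<not> 0 \<le> t" "\<not> 0 \<le> t - h"
    then show ?thesis by (simp add: max_def)
  qed
  qed
  then show "norm ((max 0 (1 - (s + h)))\<^sup>2 - (max 0 (1 - s))\<^sup>2 - - 2 * max 0 (1 - s) * h) \<le> 1 * (norm h)\<^sup>2"
    by (simp add: t_def algebra_simps)
qed (rule bounded_linear_mult_right)

text \<open>The square makes the profile continuously differentiable at s = 1, and the value 1 at s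
  = 0 keeps the full singularity of 1/u in the cut kernel.\<close>

definition bump :: "real \<Rightarrow> real" where "bump s = (max 0 (1 - s))\<^sup>2"

definition cauchy_cut :: "complex \<Rightarrow> complex" where
  "cauchy_cut u = of_real (bump ((cmod u)\<^sup>2)) / u"

text \<open>Minus the derivative of \<open>bump\<close>, taken at |u|^2. In the sense of
  distributions, the dbar derivative of \<open>cauchy_cut\<close> is \<pi> times the point mass at 0
  minus this function.\<close>

definition paraboloid :: "complex \<Rightarrow> complex" where
  "paraboloid u = of_real (2 * max 0 (1 - (cmod u)\<^sup>2))"

lemma bump_bounds: "s \<ge> 0 \<Longrightarrow> 0 \<le> bump s" "s \<ge> 0 \<Longrightarrow> bump s \<le> 1" "s \<ge> 1 \<Longrightarrow> bump s = 0"
  by (auto simp: bump_def max_def power_le_one)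

lemma continuous_on_bump [continuous_intros]: "continuous_on A f \<Longrightarrow> continuous_on A (\<lambda>x. bump (f x))"
  unfolding bump_def by (intro continuous_intros)

lemma continuous_on_paraboloid: "continuous_on A paraboloid"
  unfolding paraboloid_def[abs_def] by (intro continuous_intros)

lemma measurable_bump [measurable]: "bump \<in> borel_measurable borel"
  unfolding bump_def[abs_def] by measurable

lemma measurable_cauchy_cut [measurable]: "cauchy_cut \<in> borel_measurable borel"
  unfolding cauchy_cut_def[abs_def] by measurable

lemma measurable_paraboloid [measurable]: "paraboloid \<in> borel_measurable borel"
  unfolding paraboloid_def[abs_def] by measurable

lemma norm_cauchy_cut_le: "cmod (cauchy_cut u) \<le> 1 / cmod u * indicator (cball 0 1) u"
proof (cases "cmod u \<le> 1")
  case True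
  then show ?thesis using bump_bounds[of "(cmod u)\<^sup>2"] by (auto simp: cauchy_cut_def norm_divide intro!: divide_right_mono)
next
  case False
  then have "1 \<le> (cmod u)\<^sup>2" by (simp add: one_le_power)
  then show ?thesis using False by (simp add: cauchy_cut_def bump_bounds)
qed

lemma integrable_cmod_inverse_ball: "integrable lborel (\<lambda>u. 1 / cmod u * indicator (cball 0 r) u)"
proof (cases "r \<ge> 0")
  case True
  have [measurable]: "cball (0::complex) r \<in> sets borel" by simp
  show ?thesis
  proof (rule integrableI_bounded)
    have "(\<integral>\<^sup>+u. ennreal (norm (1 / cmod u * indicator (cball 0 r) u)) \<partial>lborel) =
       (\<integral>\<^sup>+u. ennreal (1 / cmod u) * indicator (cball 0 r) u \<partial>lborel)"
      by (intro nn_integral_cong) (simp add: indicator_def)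
    also have "\<dots> < \<infinity>" using nn_integral_cmod_inverse_ball[OF True] by simp
    finally show "(\<integral>\<^sup>+u. ennreal (norm (1 / cmod u * indicator (cball 0 r) u)) \<partial>lborel) < \<infinity>" .
  qed measurable
qed (simp add: cball_empty)

lemma integrable_cs_cauchy_cut: "integrable_cs cauchy_cut"
  unfolding integrable_cs_def
proof (intro conjI exI allI impI)
  show "integrable lborel cauchy_cut"
    by (rule Bochner_Integration.integrable_bound[OF integrable_cmod_inverse_ball[of 1]])
       (auto intro!: order_trans[OF norm_cauchy_cut_le])
  fix x assume "(1::real) < cmod x"
  then show "cauchy_cut x = 0" using norm_cauchy_cut_le[of x] by auto
qed measurable

lemma bounded_cs_paraboloid: "bounded_cs paraboloid"
  unfolding bounded_cs_def
proof (intro conjI exI allI impI)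
  fix x show "cmod (paraboloid x) \<le> 2" by (auto simp: paraboloid_def norm_mult simp flip: of_real_diff of_real_mult)
next
  fix x assume "(1::real) < cmod x"
  then have "1 \<le> (cmod x)\<^sup>2" by (simp add: one_le_power)
  then show "paraboloid x = 0" by (simp add: paraboloid_def)
qed measurable

lemma integral_paraboloid: "(\<integral>u. paraboloid u \<partial>lborel) = of_real pi"
proof -
  have "(\<integral>u. 2 * max 0 (1 - (cmod u)\<^sup>2) \<partial>lborel) = pi"
    by (rule integral_eq_nn_integral[THEN trans]) (auto simp: nn_integral_paraboloid)
  then show ?thesis unfolding paraboloid_def[abs_def] by (subst integral_complex_of_real) simp
qed

lemma inner_mult_cnj: "2 * of_real (u \<bullet> h) = cnj u * h + u * cnj h"
  by (simp add: inner_complex_def complex_eq_iff)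

lemma cnj_eq_divide: "u \<noteq> 0 \<Longrightarrow> cnj u = of_real ((cmod u)\<^sup>2) / u"
  by (simp only: complex_norm_square) simp

lemma cmod_square_inner: "(cmod u)\<^sup>2 = u \<bullet> u"
  by (simp add: power2_norm_eq_inner)

text \<open>Kernels are written as a radial profile times \<open>cnj u\<close>, using that 1/u is
  \<open>cnj u\<close> divided by |u|^2; in this form they are differentiable at the origin as soon
  as the profile is.\<close>

lemma has_derivative_radial:
  assumes "(A has_real_derivative A') (at ((cmod u)\<^sup>2))"
  shows "((\<lambda>u. of_real (A ((cmod u)\<^sup>2)) * cnj u) has_derivative
    (\<lambda>h. of_real (A ((cmod u)\<^sup>2)) * cnj h + of_real (2 * (u \<bullet> h) * A') * cnj u)) (at u)"
proof -
  have "((\<lambda>u. (cmod u)\<^sup>2) has_derivative (\<lambda>h. 2 * (u \<bullet> h))) (at u)"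
    unfolding cmod_square_inner by (auto intro!: derivative_eq_intros simp: inner_commute)
  from diff_chain_at[OF this has_field_derivative_imp_has_derivative[OF assms]]
  have "((\<lambda>u. A ((cmod u)\<^sup>2)) has_derivative (\<lambda>h. 2 * (u \<bullet> h) * A')) (at u)"
    by (simp add: o_def mult.commute)
  from has_derivative_mult[OF has_derivative_of_real[OF this] bounded_linear_imp_has_derivative[OF bounded_linear_cnj]]
  show ?thesis by simp
qed

text \<open>Adding \<epsilon> to the denominator |u|^2 makes the kernel continuously differentiable.
  The right-hand side is the transform of its dbar derivative, which splits into an approximate
  identity and a regularized \<open>paraboloid\<close>.\<close>

lemma fourier_regularized_cauchy_cut:
  assumes "\<epsilon> > 0"
  shows "of_real pi * \<i> * \<xi> * fourier (\<lambda>u. of_real (bump ((cmod u)\<^sup>2) / ((cmod u)\<^sup>2 + \<epsilon>)) * cnj u) \<xi> =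
    fourier (\<lambda>u. of_real (bump ((cmod u)\<^sup>2) * \<epsilon> / ((cmod u)\<^sup>2 + \<epsilon>)\<^sup>2)) \<xi> -
    fourier (\<lambda>u. of_real (2 * max 0 (1 - (cmod u)\<^sup>2) * (cmod u)\<^sup>2 / ((cmod u)\<^sup>2 + \<epsilon>))) \<xi>"
    (is "_ * fourier ?G \<xi> = fourier ?K \<xi> - fourier ?P \<xi>")
proof -
  define a where "a s = - 2 * max 0 (1 - s) / (s + \<epsilon>) - bump s / (s + \<epsilon>)\<^sup>2" for s
  define G' where "G' u h = of_real (bump ((cmod u)\<^sup>2) / ((cmod u)\<^sup>2 + \<epsilon>)) * cnj h + of_real (2 * (u \<bullet> h) * a ((cmod u)\<^sup>2)) * cnj u" for u h
  have pos: "(cmod u)\<^sup>2 + \<epsilon> \<noteq> 0" for u using assms by (smt (verit) zero_le_power2)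
  have pos': "of_real ((cmod u)\<^sup>2 + \<epsilon>) \<noteq> (0::complex)" for u using pos[of u] by (simp only: of_real_eq_0_iff not_False_eq_True)
  have der: "(?G has_derivative G' u) (at u)" for u
    unfolding G'_def
  proof (rule has_derivative_radial)
    show "((\<lambda>s. bump s / (s + \<epsilon>)) has_real_derivative a ((cmod u)\<^sup>2)) (at ((cmod u)\<^sup>2))"
    proof -
      let ?s = "(cmod u)\<^sup>2"
      have "((\<lambda>s. bump s / (s + \<epsilon>)) has_real_derivative ((- 2 * max 0 (1 - ?s)) * (?s + \<epsilon>) - bump ?s * 1) / ((?s + \<epsilon>) * (?s + \<epsilon>))) (at ?s)"
        unfolding bump_def
        by (rule DERIV_divide[OF has_derivative_square_pos_part[of ?s] DERIV_add[OF DERIV_ident DERIV_const, of \<epsilon>, simplified] pos])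
      also have "((- 2 * max 0 (1 - ?s)) * (?s + \<epsilon>) - bump ?s * 1) / ((?s + \<epsilon>) * (?s + \<epsilon>)) = a ?s"
        unfolding a_def using pos[of u] by (simp add: diff_divide_distrib power2_eq_square)
      finally show ?thesis .
    qed
  qed
  have cont: "continuous_on UNIV (\<lambda>u. G' u v)" for v
    unfolding G'_def a_def by (intro continuous_intros ballI pos) (auto simp: pos)
  have supp: "?G x = 0" if "1 < cmod x" for x
    using that by (simp add: bump_bounds one_le_power)
  have *: "fourier (\<lambda>u. G' u v) \<xi> = 2 * of_real pi * \<i> * of_real (\<xi> \<bullet> v) * fourier ?G \<xi>" for v
    by (rule fourier_derivative[OF der cont supp])
  have supp': "G' u v = 0" if "1 < cmod u" for u v
    using that unfolding G'_def a_def by (simp add: bump_bounds one_le_power)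
  have int: "integrable lborel f" if c: "continuous_on UNIV f" and s: "\<And>x. 1 < cmod x \<Longrightarrow> f x = 0" for f :: "complex \<Rightarrow> complex"
  proof -
    have "compact (f ` cball 0 1)"
      by (intro compact_continuous_image continuous_on_subset[OF c]) auto
    then obtain C where "\<And>x. x \<in> cball 0 1 \<Longrightarrow> cmod (f x) \<le> C"
      by (meson bounded_iff compact_imp_bounded imageI)
    then have "cmod (f x) \<le> max 0 C" for x
      using s[of x] by (cases "1 < cmod x") (auto simp: le_max_iff_disj not_less)
    then show ?thesis using s by (intro integrable_bounded_support borel_measurable_continuous_onI[OF c]) auto
  qed
  \<comment> \<open>Multiplication by \<pi> \<i> \<xi> corresponds to half the sum of the derivative
    in direction 1 and \<i> times the derivative in direction \<i>.\<close>
  have "of_real pi * \<i> * \<xi> * fourier ?G \<xi> =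
      of_real pi * \<i> * (of_real (\<xi> \<bullet> 1) + \<i> * of_real (\<xi> \<bullet> \<i>)) * fourier ?G \<xi>"
    unfolding inner_one_ii ..
  also have "\<dots> = (1/2) * (fourier (\<lambda>u. G' u 1) \<xi> + fourier (\<lambda>u. \<i> * G' u \<i>) \<xi>)"
    unfolding fourier_cmult[of \<i> "\<lambda>u. G' u \<i>"] * by (simp add: field_simps)
  also have "\<dots> = fourier (\<lambda>u. (1/2) * (G' u 1 + \<i> * G' u \<i>)) \<xi>"
  proof -
    have i1: "integrable lborel (\<lambda>u. G' u 1)" by (rule int) (auto intro: cont supp')
    have i2: "integrable lborel (\<lambda>u. \<i> * G' u \<i>)"
      by (rule int) (auto intro!: continuous_on_mult continuous_on_const cont simp: supp')
    show ?thesis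
      using fourier_cmult[of "1/2" "\<lambda>u. G' u 1 + \<i> * G' u \<i>" \<xi>] fourier_add[OF i1 i2, of \<xi>] by (simp only:)
  qed
  also have "(\<lambda>u. (1/2) * (G' u 1 + \<i> * G' u \<i>)) = (\<lambda>u. ?K u - ?P u)"
  proof
    fix u
    let ?s = "(cmod u)\<^sup>2"
    have "(1/2) * (G' u 1 + \<i> * G' u \<i>) = of_real (bump ?s / (?s + \<epsilon>)) +
        (of_real (u \<bullet> 1) + \<i> * of_real (u \<bullet> \<i>)) * of_real (a ?s) * cnj u"
      unfolding G'_def by (simp add: field_simps)
    also have "\<dots> = of_real (bump ?s / (?s + \<epsilon>)) + of_real (a ?s) * (u * cnj u)"
      unfolding inner_one_ii by (simp add: mult_ac)
    also have "u * cnj u = of_real ?s" by (simp only: complex_norm_square)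
    also have "of_real (bump ?s / (?s + \<epsilon>)) + of_real (a ?s) * of_real ?s =
        of_real (bump ?s / (?s + \<epsilon>) + a ?s * ?s)" by (simp only: of_real_add of_real_mult)
    also have "bump ?s / (?s + \<epsilon>) + a ?s * ?s = bump ?s * \<epsilon> / (?s + \<epsilon>)\<^sup>2 - 2 * max 0 (1 - ?s) * ?s / (?s + \<epsilon>)"
    proof -
      have "bump ?s / (?s + \<epsilon>) = bump ?s * (?s + \<epsilon>) / (?s + \<epsilon>)\<^sup>2"
        using pos[of u] by (simp add: power2_eq_square)
      then show ?thesis unfolding a_def by (simp add: algebra_simps add_divide_distrib diff_divide_distrib)
    qed
    finally show "(1/2) * (G' u 1 + \<i> * G' u \<i>) = ?K u - ?P u" by (simp only: of_real_diff)
  qed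
  also have "fourier (\<lambda>u. ?K u - ?P u) \<xi> = fourier ?K \<xi> - fourier ?P \<xi>"
  proof (rule fourier_diff)
    show "integrable lborel ?K"
      by (rule int) (auto intro!: continuous_intros simp: pos bump_bounds one_le_power simp del: of_real_divide of_real_mult)
    show "integrable lborel ?P"
      by (rule int) (auto intro!: continuous_intros simp: pos one_le_power simp del: of_real_divide of_real_mult)
  qed
  finally show ?thesis .
qed

text \<open>With \<epsilon> = d^2, the substitution u = d v turns the kernel into the fixed density
  1 / (1 + |v|^2)^2 of mass \<pi>, while the character and the bump converge to 1.\<close>

lemma fourier_approximate_identity:
  "(\<lambda>n. fourier (\<lambda>u. of_real (bump ((cmod u)\<^sup>2) * (1 / real (Suc n))\<^sup>2 / ((cmod u)\<^sup>2 + (1 / real (Suc n))\<^sup>2)\<^sup>2)) \<xi>) \<longlonglongrightarrow> of_real pi"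
proof -
  define d where "d n = 1 / real (Suc n)" for n
  have d: "d n > 0" "d n \<le> 1" for n by (simp_all add: d_def)
  have d0: "d \<longlonglongrightarrow> 0" unfolding d_def by (rule LIMSEQ_Suc[OF lim_1_over_n[where 'a=real]])
  define f where "f n v = echar \<xi> (of_real (d n) * v) * of_real (bump ((d n)\<^sup>2 * (cmod v)\<^sup>2) * (1 / (1 + (cmod v)\<^sup>2)\<^sup>2))" for n v
  have [measurable]: "f n \<in> borel_measurable borel" for n unfolding f_def[abs_def] by measurable
  have eq: "fourier (\<lambda>u. of_real (bump ((cmod u)\<^sup>2) * (d n)\<^sup>2 / ((cmod u)\<^sup>2 + (d n)\<^sup>2)\<^sup>2)) \<xi> = (\<integral>v. f n v \<partial>lborel)" for n
  proof -
    have "of_real ((d n)\<^sup>2) * (\<integral>v. f n v \<partial>lborel) = (\<integral>u. f n (u / of_real (d n)) \<partial>lborel)"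
      by (subst integral_complex_scale[of "f n"]) (use d in auto)
    moreover have fn: "f n (u / of_real (d n)) = of_real ((d n)\<^sup>2) * (echar \<xi> u * of_real (bump ((cmod u)\<^sup>2) * (d n)\<^sup>2 / ((cmod u)\<^sup>2 + (d n)\<^sup>2)\<^sup>2))" for u
    proof -
      have "1 / (1 + (cmod (u / of_real (d n)))\<^sup>2)\<^sup>2 = (d n)\<^sup>2 * ((d n)\<^sup>2 / ((cmod u)\<^sup>2 + (d n)\<^sup>2)\<^sup>2)"
      proof -
        have "1 + (cmod (u / of_real (d n)))\<^sup>2 = ((cmod u)\<^sup>2 + (d n)\<^sup>2) / (d n)\<^sup>2"
          using d(1)[of n] by (simp add: norm_divide power_divide add_divide_distrib)
        then show ?thesis by (simp add: power_divide power2_eq_square)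
      qed
      moreover have "(d n)\<^sup>2 * (cmod (u / of_real (d n)))\<^sup>2 = (cmod u)\<^sup>2"
        using d(1)[of n] by (simp add: norm_divide power_divide)
      moreover have "of_real (d n) * (u / of_real (d n)) = u" using d(1)[of n] by simp
      ultimately show ?thesis unfolding f_def by (simp add: mult_ac)
    qed
    ultimately have "of_real ((d n)\<^sup>2) * (\<integral>v. f n v \<partial>lborel) = of_real ((d n)\<^sup>2) *
        fourier (\<lambda>u. of_real (bump ((cmod u)\<^sup>2) * (d n)\<^sup>2 / ((cmod u)\<^sup>2 + (d n)\<^sup>2)\<^sup>2)) \<xi>"
      by (simp only: fn fourier_echar integral_mult_right_zero)
    then show ?thesis using d(1)[of n] by simp
  qed
  have int: "integrable lborel (\<lambda>v. 1 / (1 + (cmod v)\<^sup>2)\<^sup>2)"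
    by (rule integrableI_bounded) (simp_all add: nn_integral_inverse_one_plus_square)
  have "(\<lambda>n. \<integral>v. f n v \<partial>lborel) \<longlonglongrightarrow> (\<integral>v. of_real (1 / (1 + (cmod v)\<^sup>2)\<^sup>2) \<partial>lborel)"
  proof (rule integral_dominated_convergence[OF _ _ int])
    show "AE v in lborel. (\<lambda>n. f n v) \<longlonglongrightarrow> of_real (1 / (1 + (cmod v)\<^sup>2)\<^sup>2)"
    proof (rule AE_I2)
      fix v
      have "isCont (\<lambda>t. echar \<xi> (of_real t * v)) 0" "isCont (\<lambda>t. bump (t\<^sup>2 * (cmod v)\<^sup>2)) 0"
        by (rule continuous_on_interior[of UNIV]; auto intro!: continuous_intros)+
      from isCont_tendsto_compose[OF this(1) d0] isCont_tendsto_compose[OF this(2) d0]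
      have "(\<lambda>n. f n v) \<longlonglongrightarrow> 1 * of_real (bump 0 * (1 / (1 + (cmod v)\<^sup>2)\<^sup>2))"
        unfolding f_def by (intro tendsto_intros) auto
      then show "(\<lambda>n. f n v) \<longlonglongrightarrow> of_real (1 / (1 + (cmod v)\<^sup>2)\<^sup>2)" by (simp add: bump_def)
    qed
    fix n
    have "bump ((d n)\<^sup>2 * (cmod v)\<^sup>2) \<le> 1" "0 \<le> bump ((d n)\<^sup>2 * (cmod v)\<^sup>2)" for v by (rule bump_bounds; simp)+
    then show "AE v in lborel. norm (f n v) \<le> 1 / (1 + (cmod v)\<^sup>2)\<^sup>2"
      unfolding f_def norm_mult norm_echar norm_of_real by (auto simp: abs_mult intro!: divide_right_mono)
  qed auto
  also have "(\<integral>v. of_real (1 / (1 + (cmod v)\<^sup>2)\<^sup>2) \<partial>lborel) = complex_of_real (\<integral>v. 1 / (1 + (cmod v)\<^sup>2)\<^sup>2 \<partial>lborel)"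
    by (rule integral_complex_of_real)
  also have "(\<integral>v. 1 / (1 + (cmod v)\<^sup>2)\<^sup>2 \<partial>lborel) = pi"
    by (rule integral_eq_nn_integral[THEN trans]) (auto simp: nn_integral_inverse_one_plus_square)
  finally show ?thesis unfolding eq[unfolded d_def] .
qed

text \<open>Fourier form of the distributional identity for the dbar derivative of
  \<open>cauchy_cut\<close>: in the regularized version \<epsilon> tends to 0 and each term
  converges under a majorant. Multiplying by \<xi> avoids a division at the origin.\<close>

lemma fourier_cauchy_cut: "of_real pi * \<i> * \<xi> * fourier cauchy_cut \<xi> = of_real pi - fourier paraboloid \<xi>"
proof -
  define e where "e n = (1 / real (Suc n))\<^sup>2" for n
  have e: "e n > 0" for n by (simp add: e_def)
  have "(\<lambda>n. 1 / real (Suc n)) \<longlonglongrightarrow> 0" by (rule LIMSEQ_Suc[OF lim_1_over_n[where 'a=real]])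
  from tendsto_power[OF this, of 2] have e0: "e \<longlonglongrightarrow> 0" unfolding e_def by simp
  define G where "G n u = of_real (bump ((cmod u)\<^sup>2) / ((cmod u)\<^sup>2 + e n)) * cnj u" for n u
  define P where "P n u = complex_of_real (2 * max 0 (1 - (cmod u)\<^sup>2) * (cmod u)\<^sup>2 / ((cmod u)\<^sup>2 + e n))" for n u
  define K where "K n u = complex_of_real (bump ((cmod u)\<^sup>2) * e n / ((cmod u)\<^sup>2 + e n)\<^sup>2)" for n u
  have [measurable]: "G n \<in> borel_measurable borel" for n
    unfolding G_def[abs_def] by measurable
  have [measurable]: "P n \<in> borel_measurable borel" for n
    unfolding P_def[abs_def] by measurable
  have reg: "of_real pi * \<i> * \<xi> * fourier (G n) \<xi> = fourier (K n) \<xi> - fourier (P n) \<xi>" for n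
    unfolding G_def K_def P_def by (rule fourier_regularized_cauchy_cut[OF e])
  have lim1: "(\<lambda>n. s / (s + e n)) \<longlonglongrightarrow> 1" if "s > 0" for s
  proof -
    have "(\<lambda>n. s / (s + e n)) \<longlonglongrightarrow> s / (s + 0)" using that by (intro tendsto_intros e0) auto
    then show ?thesis using that by simp
  qed
  have AE0: "AE u in lborel. u \<noteq> (0::complex)" using AE_complex_not_in_sphere[of 0] by simp
  have "(\<lambda>n. fourier (G n) \<xi>) \<longlonglongrightarrow> fourier cauchy_cut \<xi>"
    unfolding fourier_echar
  proof (rule integral_dominated_convergence[OF _ _ integrable_cmod_inverse_ball[of 1]])
    show "AE u in lborel. (\<lambda>n. echar \<xi> u * G n u) \<longlonglongrightarrow> echar \<xi> u * cauchy_cut u"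
      using AE0
    proof eventually_elim
      case (elim u)
      have "G n u = of_real ((cmod u)\<^sup>2 / ((cmod u)\<^sup>2 + e n)) * cauchy_cut u" for n
      proof -
        have "cauchy_cut u = of_real (bump ((cmod u)\<^sup>2)) * cnj u / of_real ((cmod u)\<^sup>2)"
          using elim by (subst cnj_eq_divide) (simp_all add: cauchy_cut_def)
        then show ?thesis using elim by (simp add: G_def)
      qed
      moreover have "(\<lambda>n. of_real ((cmod u)\<^sup>2 / ((cmod u)\<^sup>2 + e n)) * cauchy_cut u) \<longlonglongrightarrow> of_real 1 * cauchy_cut u"
        using elim by (intro tendsto_intros lim1) auto
      ultimately have "(\<lambda>n. G n u) \<longlonglongrightarrow> of_real 1 * cauchy_cut u" by (simp only:)
      from tendsto_mult[OF tendsto_const this, of "echar \<xi> u"] show ?case by simp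
    qed
    fix n
    have "cmod (G n u) \<le> 1 / cmod u * indicator (cball 0 1) u" for u
    proof (cases "cmod u \<le> 1 \<and> u \<noteq> 0")
      case True
      have "cmod (G n u) = bump ((cmod u)\<^sup>2) * (cmod u / ((cmod u)\<^sup>2 + e n))"
        using e[of n] bump_bounds(1)[of "(cmod u)\<^sup>2"] unfolding G_def norm_mult norm_of_real by (simp add: abs_of_nonneg)
      also have "\<dots> \<le> 1 * (cmod u / (cmod u)\<^sup>2)"
        using e[of n] bump_bounds[of "(cmod u)\<^sup>2"] True by (intro mult_mono divide_left_mono) (auto simp: add_pos_pos)
      also have "\<dots> = 1 / cmod u" by (simp add: power2_eq_square)
      finally show ?thesis using True by simp
    next
      case False
      then show ?thesis by (auto simp: G_def bump_bounds one_le_power)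
    qed
    then show "AE u in lborel. norm (echar \<xi> u * G n u) \<le> 1 / cmod u * indicator (cball 0 1) u"
      by (auto simp: norm_mult)
  qed auto
  then have L: "(\<lambda>n. of_real pi * \<i> * \<xi> * fourier (G n) \<xi>) \<longlonglongrightarrow> of_real pi * \<i> * \<xi> * fourier cauchy_cut \<xi>"
    by (intro tendsto_intros)
  have "(\<lambda>n. fourier (P n) \<xi>) \<longlonglongrightarrow> fourier paraboloid \<xi>"
    unfolding fourier_echar
  proof (rule integral_dominated_convergence[where w="\<lambda>u. 2 * indicator (cball 0 1) u"])
    show "AE u in lborel. (\<lambda>n. echar \<xi> u * P n u) \<longlonglongrightarrow> echar \<xi> u * paraboloid u"
      using AE0
    proof eventually_elim
      case (elim u)
      have "P n u = of_real ((cmod u)\<^sup>2 / ((cmod u)\<^sup>2 + e n)) * paraboloid u" for n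
        by (simp add: P_def paraboloid_def)
      moreover have "(\<lambda>n. of_real ((cmod u)\<^sup>2 / ((cmod u)\<^sup>2 + e n)) * paraboloid u) \<longlonglongrightarrow> of_real 1 * paraboloid u"
        using elim by (intro tendsto_intros lim1) auto
      ultimately have "(\<lambda>n. P n u) \<longlonglongrightarrow> of_real 1 * paraboloid u" by (simp only:)
      from tendsto_mult[OF tendsto_const this, of "echar \<xi> u"] show ?case by simp
    qed
    fix n
    have "cmod (P n u) \<le> 2 * indicator (cball 0 1) u" for u
    proof (cases "cmod u \<le> 1")
      case True
      have "cmod (P n u) = (2 * max 0 (1 - (cmod u)\<^sup>2)) * ((cmod u)\<^sup>2 / ((cmod u)\<^sup>2 + e n))"
        using e[of n] unfolding P_def norm_of_real by (simp add: abs_of_nonneg)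
      also have "\<dots> \<le> 2 * 1"
        using e[of n] by (intro mult_mono) (auto simp: divide_le_eq_1 add_nonneg_pos)
      finally show ?thesis using True by simp
    next
      case False
      then show ?thesis by (auto simp: P_def one_le_power)
    qed
    then show "AE u in lborel. norm (echar \<xi> u * P n u) \<le> 2 * indicator (cball 0 1) u"
      by (auto simp: norm_mult)
  qed auto
  moreover have "(\<lambda>n. fourier (K n) \<xi>) \<longlonglongrightarrow> of_real pi"
    unfolding K_def e_def by (rule fourier_approximate_identity)
  ultimately have "(\<lambda>n. fourier (K n) \<xi> - fourier (P n) \<xi>) \<longlonglongrightarrow> of_real pi - fourier paraboloid \<xi>"
    by (intro tendsto_intros)
  then show ?thesis using LIMSEQ_unique[OF L[unfolded reg]] by metis
qed

text \<open>Equals \<open>bump (|u|^2 / R^2) / u\<close>: the prefactor compensates the homogeneity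
  of 1/u.\<close>

definition cauchy_trunc :: "real \<Rightarrow> complex \<Rightarrow> complex" where
  "cauchy_trunc R u = (1 / of_real R) * cauchy_cut (u / of_real R)"

lemma integrable_cs_cauchy_trunc:
  assumes "R > 0" shows "integrable_cs (cauchy_trunc R)"
  unfolding integrable_cs_def
proof (intro conjI exI allI impI)
  show "cauchy_trunc R \<in> borel_measurable borel" unfolding cauchy_trunc_def[abs_def] by measurable
  show "integrable lborel (cauchy_trunc R)"
    using integrable_complex_scale[of cauchy_cut R] assms integrable_cs_cauchy_cut
    unfolding cauchy_trunc_def[abs_def] integrable_cs_def by simp
  fix x assume "R < cmod x"
  then have "1 < cmod (x / of_real R)" using assms by (simp add: norm_divide)
  then show "cauchy_trunc R x = 0" using norm_cauchy_cut_le[of "x / of_real R"] by (simp add: cauchy_trunc_def)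
qed

text \<open>Keeping the factor \<xi> on the left covers the origin. Bound and limit of the kernel
  are read off from the right: \<open>paraboloid\<close> is nonnegative of mass \<pi>, and its
  transform tends to 0 along rays.\<close>

lemma fourier_cauchy_trunc:
  assumes "R > 0"
  shows "\<xi> * fourier (cauchy_trunc R) \<xi> = - \<i> * (1 - fourier paraboloid (of_real R * \<xi>) / of_real pi)"
proof -
  have "fourier (cauchy_trunc R) \<xi> = of_real R * fourier cauchy_cut (of_real R * \<xi>)"
    unfolding cauchy_trunc_def[abs_def] fourier_cmult using assms by (simp add: fourier_scale power2_eq_square)
  then have "of_real pi * \<i> * (\<xi> * fourier (cauchy_trunc R) \<xi>) = of_real pi - fourier paraboloid (of_real R * \<xi>)"
    using fourier_cauchy_cut[of "of_real R * \<xi>"] by (simp add: mult_ac)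
  moreover have "\<xi> * fourier (cauchy_trunc R) \<xi> = (- \<i> / of_real pi) * (of_real pi * \<i> * (\<xi> * fourier (cauchy_trunc R) \<xi>))"
    by simp
  ultimately have "\<xi> * fourier (cauchy_trunc R) \<xi> = (- \<i> / of_real pi) * (of_real pi - fourier paraboloid (of_real R * \<xi>))"
    by (simp only:)
  then show ?thesis by (simp add: field_simps)
qed

lemma norm_fourier_cauchy_trunc:
  assumes "R > 0"
  shows "cmod (\<xi> * fourier (cauchy_trunc R) \<xi>) \<le> 2"
proof -
  have "cmod (fourier paraboloid \<eta>) \<le> pi" for \<eta>
  proof -
    have "cmod (fourier paraboloid \<eta>) \<le> (\<integral>u. cmod (paraboloid u) \<partial>lborel)" by (rule norm_fourier_le)
    also have "(\<lambda>u. cmod (paraboloid u)) = (\<lambda>u. 2 * max 0 (1 - (cmod u)\<^sup>2))"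
      unfolding paraboloid_def norm_of_real by auto
    also have "(\<integral>u. 2 * max 0 (1 - (cmod u)\<^sup>2) \<partial>lborel) = pi"
      by (rule integral_eq_nn_integral[THEN trans]) (auto simp: nn_integral_paraboloid)
    finally show ?thesis .
  qed
  then have "cmod (fourier paraboloid (of_real R * \<xi>) / of_real pi) \<le> 1"
    by (simp add: norm_divide)
  then have "cmod (1 - fourier paraboloid (of_real R * \<xi>) / of_real pi) \<le> 2"
    using norm_triangle_ineq4[of 1 "fourier paraboloid (of_real R * \<xi>) / of_real pi"] by simp
  then show ?thesis unfolding fourier_cauchy_trunc[OF assms] by (simp add: norm_mult)
qed

lemma tendsto_fourier_cauchy_trunc:
  assumes "\<xi> \<noteq> 0"
  shows "((\<lambda>R. fourier (cauchy_trunc R) \<xi>) \<longlongrightarrow> - \<i> / \<xi>) at_top"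
proof -
  have "((\<lambda>R. fourier paraboloid (of_real R * \<xi>)) \<longlongrightarrow> 0) at_top"
    by (rule riemann_lebesgue[OF bounded_cs_paraboloid _ assms])
       (use continuous_on_paraboloid[of UNIV] in \<open>auto simp: continuous_on_eq_continuous_at\<close>)
  then have "((\<lambda>R. - \<i> * (1 - fourier paraboloid (of_real R * \<xi>) / of_real pi) / \<xi>) \<longlongrightarrow> - \<i> * (1 - 0 / of_real pi) / \<xi>) at_top"
    using assms by (intro tendsto_intros) auto
  moreover have "\<forall>\<^sub>F R in at_top. - \<i> * (1 - fourier paraboloid (of_real R * \<xi>) / of_real pi) / \<xi> = fourier (cauchy_trunc R) \<xi>"
    using eventually_gt_at_top[of 0]
  proof eventually_elim
    case (elim R)
    then show ?case using fourier_cauchy_trunc[OF elim, of \<xi>] assms by (metis nonzero_mult_div_cancel_left)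
  qed
  ultimately show ?thesis by (auto elim: Lim_transform_eventually)
qed

text \<open>The complement \<open>1 / u - cauchy_cut u\<close> of the truncated kernel is continuously differentiable.\<close>

definition cocut_profile :: "real \<Rightarrow> real" where
  "cocut_profile s = (if s \<le> 1 then 2 - s else 1 / s)"

definition cauchy_cocut :: "complex \<Rightarrow> complex" where
  "cauchy_cocut u = of_real (cocut_profile ((cmod u)\<^sup>2)) * cnj u"

text \<open>The holomorphic (Wirtinger) derivative of \<open>cauchy_cocut\<close>: the slope
  \<open>- 1 / (max 1 s)^2\<close> of the profile at s = |u|^2, times
  \<open>(cnj u)^2\<close>.\<close>

definition cauchy_cocut_dz :: "complex \<Rightarrow> complex" where
  "cauchy_cocut_dz u = - of_real (1 / (max 1 ((cmod u)\<^sup>2))\<^sup>2) * (cnj u)\<^sup>2"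

text \<open>The identity includes u = 0, where division by zero makes both sides 0. Inside the disk
  it rests on 1 - (2 - s) s = (1 - s)^2.\<close>

lemma cauchy_cut_eq: "cauchy_cut u = 1 / u - cauchy_cocut u"
proof (cases "u = 0")
  case False
  have cnj: "cnj u = of_real ((cmod u)\<^sup>2) / u" using False by (rule cnj_eq_divide)
  show ?thesis
  proof (cases "(cmod u)\<^sup>2 \<le> 1")
    case True
    have "1 / u - cauchy_cocut u = of_real (1 - (2 - (cmod u)\<^sup>2) * (cmod u)\<^sup>2) / u"
      unfolding cauchy_cocut_def cnj using True by (simp add: cocut_profile_def diff_divide_distrib)
    also have "1 - (2 - (cmod u)\<^sup>2) * (cmod u)\<^sup>2 = bump ((cmod u)\<^sup>2)"
      using True by (simp add: bump_def max_def power2_eq_square algebra_simps)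
    finally show ?thesis by (simp add: cauchy_cut_def)
  next
    case F: False
    then show ?thesis using False unfolding cauchy_cut_def cauchy_cocut_def cnj by (simp add: cocut_profile_def bump_bounds)
  qed
qed (simp add: cauchy_cut_def cauchy_cocut_def)

text \<open>Both branches have value 1 and slope -1 at s = 1; the gluing point is settled by a
  quadratic remainder.\<close>

lemma DERIV_cocut_profile: "(cocut_profile has_real_derivative - 1 / (max 1 s)\<^sup>2) (at s)"
proof -
  consider "s < 1" | "s > 1" | "s = 1" by linarith
  then show ?thesis
  proof cases
    case 1
    have "((\<lambda>s. 2 - s) has_real_derivative - 1) (at s)" by (auto intro!: derivative_eq_intros)
    then have "(cocut_profile has_real_derivative - 1) (at s)"
      by (rule has_field_derivative_transform_within_open[of _ _ _ "{..<1}"]) (use 1 in \<open>auto simp: cocut_profile_def\<close>)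
    then show ?thesis using 1 by simp
  next
    case 2
    have "((\<lambda>s. 1 / s) has_real_derivative - 1 / s\<^sup>2) (at s)"
      using 2 by (auto intro!: derivative_eq_intros simp: power2_eq_square)
    then have "(cocut_profile has_real_derivative - 1 / s\<^sup>2) (at s)"
      by (rule has_field_derivative_transform_within_open[of _ _ _ "{1<..}"]) (use 2 in \<open>auto simp: cocut_profile_def\<close>)
    then show ?thesis using 2 by simp
  next
    case 3
    have "(cocut_profile has_derivative (*) (- 1)) (at 1)"
    proof (rule has_derivative_quadratic_remainder[where C=1])
      fix h :: real
      have "\<bar>1 / (1 + h) - 1 + h\<bar> \<le> h\<^sup>2" if "h > 0"
      proof -
        have "1 / (1 + h) - 1 + h = h\<^sup>2 / (1 + h)" using that by (simp add: field_simps power2_eq_square)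
        also have "\<dots> \<le> h\<^sup>2" using that by (simp add: divide_le_eq mult_left_mono)
        finally show ?thesis using \<open>1 / (1 + h) - 1 + h = h\<^sup>2 / (1 + h)\<close> that by simp
      qed
      then show "norm (cocut_profile (1 + h) - cocut_profile 1 - - 1 * h) \<le> 1 * (norm h)\<^sup>2"
        by (auto simp: cocut_profile_def)
    qed (rule bounded_linear_mult_right)
    then show ?thesis using 3 by (simp add: has_field_derivative_def)
  qed
qed

text \<open>The coefficient of \<open>cnj h\<close> has to be \<open>paraboloid\<close>, since 1/u
  and \<open>cauchy_cut\<close> have the same point mass in their dbar derivatives. Through this
  coefficient the conditional intensity enters.\<close>

lemma has_derivative_cauchy_cocut:
  "(cauchy_cocut has_derivative (\<lambda>h. cauchy_cocut_dz u * h + paraboloid u * cnj h)) (at u)"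
proof -
  let ?s = "(cmod u)\<^sup>2"
  have "(\<lambda>h. of_real (cocut_profile ?s) * cnj h + of_real (2 * (u \<bullet> h) * (- 1 / (max 1 ?s)\<^sup>2)) * cnj u) =
      (\<lambda>h. cauchy_cocut_dz u * h + paraboloid u * cnj h)"
  proof
    fix h
    have par: "cocut_profile ?s + ?s * (- 1 / (max 1 ?s)\<^sup>2) = 2 * max 0 (1 - ?s)"
      by (auto simp: cocut_profile_def max_def power2_eq_square)
    define c :: complex where "c = of_real (- 1 / (max 1 ?s)\<^sup>2)"
    have dz: "cauchy_cocut_dz u = c * (cnj u)\<^sup>2" by (simp add: cauchy_cocut_dz_def c_def)
    have "of_real (2 * (u \<bullet> h) * (- 1 / (max 1 ?s)\<^sup>2)) = (cnj u * h + u * cnj h) * c"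
      unfolding inner_mult_cnj[symmetric] c_def by (simp only: of_real_mult of_real_numeral)
    then have "of_real (cocut_profile ?s) * cnj h + of_real (2 * (u \<bullet> h) * (- 1 / (max 1 ?s)\<^sup>2)) * cnj u =
       cauchy_cocut_dz u * h + (of_real (cocut_profile ?s) + (u * cnj u) * c) * cnj h"
      by (simp only: dz) (simp add: power2_eq_square algebra_simps)
    also have "of_real (cocut_profile ?s) + (u * cnj u) * c =
        of_real (cocut_profile ?s + ?s * (- 1 / (max 1 ?s)\<^sup>2))"
      by (simp only: c_def complex_norm_square[symmetric] of_real_add of_real_mult)
    also have "\<dots> = paraboloid u" unfolding par paraboloid_def ..
    finally show "of_real (cocut_profile ?s) * cnj h + of_real (2 * (u \<bullet> h) * (- 1 / (max 1 ?s)\<^sup>2)) * cnj u =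
        cauchy_cocut_dz u * h + paraboloid u * cnj h" .
  qed
  then show ?thesis
    using has_derivative_radial[OF DERIV_cocut_profile, of u] unfolding cauchy_cocut_def[abs_def] by (simp only:)
qed

lemma continuous_on_cauchy_cocut_dz: "continuous_on A cauchy_cocut_dz"
  unfolding cauchy_cocut_dz_def[abs_def] by (intro continuous_intros) auto

text \<open>First-order expansion with error o(|h|), uniform for y in a disk: both derivatives are
  uniformly continuous on the larger disk of radius r + 1, which contains the segment from y to y +
  h.\<close>

lemma cauchy_cocut_taylor:
  assumes "e > 0"
  obtains d where "d > 0" "\<And>y h. cmod y \<le> r \<Longrightarrow> cmod h \<le> d \<Longrightarrow>
    cmod (cauchy_cocut (y + h) - cauchy_cocut y - (cauchy_cocut_dz y * h + paraboloid y * cnj h)) \<le> e * cmod h"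
proof -
  have "uniformly_continuous_on (cball 0 (r + 1)) cauchy_cocut_dz" "uniformly_continuous_on (cball 0 (r + 1)) paraboloid"
    by (intro compact_uniformly_continuous continuous_on_cauchy_cocut_dz continuous_on_paraboloid compact_cball)+
  then obtain d1 d2 where d1: "d1 > 0" "\<And>x x'. x \<in> cball 0 (r+1) \<Longrightarrow> x' \<in> cball 0 (r+1) \<Longrightarrow> dist x' x < d1 \<Longrightarrow> dist (cauchy_cocut_dz x') (cauchy_cocut_dz x) < e/2"
    and d2: "d2 > 0" "\<And>x x'. x \<in> cball 0 (r+1) \<Longrightarrow> x' \<in> cball 0 (r+1) \<Longrightarrow> dist x' x < d2 \<Longrightarrow> dist (paraboloid x') (paraboloid x) < e/2"
    unfolding uniformly_continuous_on_def using assms by (metis half_gt_zero)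
  define d where "d = min 1 (min (d1/2) (d2/2))"
  show thesis
  proof (rule that[of d])
    show "d > 0" using d1 d2 by (simp add: d_def)
    fix y h :: complex assume y: "cmod y \<le> r" and h: "cmod h \<le> d"
    have "norm (cauchy_cocut (y + h) - cauchy_cocut y - (\<lambda>h. cauchy_cocut_dz y * h + paraboloid y * cnj h) ((y + h) - y)) \<le> norm ((y + h) - y) * e"
    proof (rule differentiable_bound_linearization[where S="closed_segment y (y + h)" and f' = "\<lambda>u h. cauchy_cocut_dz u * h + paraboloid u * cnj h"])
      fix t :: real assume "t \<in> {0..1}"
      then show "y + t *\<^sub>R (y + h - y) \<in> closed_segment y (y + h)"
        by (auto simp: in_segment algebra_simps intro!: exI[of _ t])
    next
      fix x assume "x \<in> closed_segment y (y + h)"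
      then have xy: "cmod (x - y) \<le> cmod h"
        using segment_bound1 by fastforce
      have "cmod x \<le> r + 1" using norm_triangle_ineq[of y "x - y"] xy y h by (simp add: d_def)
      moreover have "dist x y < d1" "dist x y < d2" using xy h d1(1) d2(1) by (simp_all add: dist_norm d_def)
      ultimately have *: "cmod (cauchy_cocut_dz x - cauchy_cocut_dz y) < e/2" "cmod (paraboloid x - paraboloid y) < e/2"
        using d1(2)[of y x] d2(2)[of y x] y by (simp_all add: dist_norm)
      show "onorm ((\<lambda>h. cauchy_cocut_dz x * h + paraboloid x * cnj h) - (\<lambda>h. cauchy_cocut_dz y * h + paraboloid y * cnj h)) \<le> e"
      proof (rule onorm_le)
        fix v
        have "((\<lambda>h. cauchy_cocut_dz x * h + paraboloid x * cnj h) - (\<lambda>h. cauchy_cocut_dz y * h + paraboloid y * cnj h)) v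
           = (cauchy_cocut_dz x - cauchy_cocut_dz y) * v + (paraboloid x - paraboloid y) * cnj v"
          by (simp add: algebra_simps)
        also have "cmod \<dots> \<le> cmod (cauchy_cocut_dz x - cauchy_cocut_dz y) * cmod v + cmod (paraboloid x - paraboloid y) * cmod v"
          by (rule order_trans[OF norm_triangle_ineq]) (simp add: norm_mult)
        also have "\<dots> \<le> (e/2) * cmod v + (e/2) * cmod v"
          using * by (intro add_mono mult_right_mono) auto
        finally show "cmod (((\<lambda>h. cauchy_cocut_dz x * h + paraboloid x * cnj h) - (\<lambda>h. cauchy_cocut_dz y * h + paraboloid y * cnj h)) v) \<le> e * cmod v"
          by simp
      qed
    qed (auto intro!: has_derivative_at_withinI has_derivative_cauchy_cocut)
    then show "cmod (cauchy_cocut (y + h) - cauchy_cocut y - (cauchy_cocut_dz y * h + paraboloid y * cnj h)) \<le> e * cmod h"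
      by (simp add: mult.commute)
  qed
qed

text \<open>Outside the unit disk \<open>cauchy_cocut\<close> is 1/u itself. After scaling by R this
  cancels the terms l^-2 beyond radius R.\<close>

lemma cauchy_cocut_dz_outside: "1 \<le> cmod u \<Longrightarrow> cauchy_cocut_dz u = - 1 / u\<^sup>2"
proof -
  assume u: "1 \<le> cmod u"
  then have "u \<noteq> 0" by auto
  have "cnj u = of_real ((cmod u)\<^sup>2) / u" using \<open>u \<noteq> 0\<close> by (rule cnj_eq_divide)
  moreover have "max 1 ((cmod u)\<^sup>2) = (cmod u)\<^sup>2" using u by (simp add: one_le_power)
  ultimately show ?thesis using \<open>u \<noteq> 0\<close> by (simp add: cauchy_cocut_dz_def power_divide)
qed

lemma cauchy_cocut_dz_inside: "cmod u \<le> 1 \<Longrightarrow> cauchy_cocut_dz u = - (cnj u)\<^sup>2"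
  by (simp add: cauchy_cocut_dz_def max_absorb1 power_le_one)

subsection \<open>Configurations as measures\<close>

text \<open>Turning a configuration into a measure replaces sums over its points by integrals, so
  that Fubini and monotone convergence apply; pushing it forward to the Borel sets makes it
  comparable with \<open>lborel\<close>.\<close>

definition conf_measure :: "config \<Rightarrow> complex measure" where
  "conf_measure c = distr (density (count_space UNIV) (\<lambda>z. ennreal (real (c z)))) borel (\<lambda>z. z)"

lemma sets_conf_measure [simp, measurable_cong]: "sets (conf_measure c) = sets borel"
  and space_conf_measure [simp]: "space (conf_measure c) = UNIV"
  by (simp_all add: conf_measure_def)

lemma nn_integral_conf_measure:
  assumes "f \<in> borel_measurable borel"
  shows "(\<integral>\<^sup>+z. f z \<partial>conf_measure c) = (\<integral>\<^sup>+z. ennreal (real (c z)) * f z \<partial>count_space UNIV)"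
  unfolding conf_measure_def using assms
  by (subst nn_integral_distr) (auto simp: nn_integral_density)

lemma integral_conf_measure:
  fixes f :: "complex \<Rightarrow> complex"
  assumes [measurable]: "f \<in> borel_measurable borel"
  shows "(\<integral>z. f z \<partial>conf_measure c) = (\<integral>z. of_nat (c z) * f z \<partial>count_space UNIV)"
proof -
  have [measurable]: "(\<lambda>z. z) \<in> density (count_space UNIV) (\<lambda>z. ennreal (real (c z))) \<rightarrow>\<^sub>M (borel :: complex measure)"
    by simp
  have "(\<integral>z. f z \<partial>conf_measure c) = (\<integral>z. f z \<partial>density (count_space UNIV) (\<lambda>z. ennreal (real (c z))))"
    unfolding conf_measure_def by (subst integral_distr) auto
  also have "\<dots> = (\<integral>z. of_nat (c z) * f z \<partial>count_space UNIV)"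
    by (subst integral_density) (auto simp: scaleR_conv_of_real)
  finally show ?thesis .
qed

lemma finite_supp_conf_bounded:
  assumes "locfin c" "bounded B" shows "finite (supp_conf c \<inter> B)"
proof -
  obtain r where "\<And>x. x \<in> B \<Longrightarrow> cmod x \<le> r" using assms(2) by (auto simp: bounded_iff)
  then have "supp_conf c \<inter> B \<subseteq> {z \<in> supp_conf c. cmod z \<le> r}" by auto
  then show ?thesis using assms(1) finite_subset unfolding locfin_def by blast
qed

lemma emeasure_conf_measure:
  assumes "locfin c" "bounded B" "B \<in> sets borel"
  shows "emeasure (conf_measure c) B = ennreal (real (cnt c B))"
proof -
  have "emeasure (conf_measure c) B = (\<integral>\<^sup>+z. indicator B z \<partial>conf_measure c)"
    using assms by simp
  also have "\<dots> = (\<integral>\<^sup>+z. ennreal (real (c z)) * indicator B z \<partial>count_space UNIV)"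
    using assms by (subst nn_integral_conf_measure) auto
  also have "\<dots> = (\<Sum>z\<in>supp_conf c \<inter> B. ennreal (real (c z)) * indicator B z)"
    by (rule nn_integral_count_space'[OF finite_supp_conf_bounded[OF assms(1,2)]])
       (auto simp: supp_conf_def indicator_def)
  also have "\<dots> = (\<Sum>z\<in>supp_conf c \<inter> B. ennreal (real (c z)))"
    by (intro sum.cong) auto
  finally show ?thesis by (simp add: cnt_def)
qed

lemma sigma_finite_conf_measure:
  assumes "locfin c" shows "sigma_finite_measure (conf_measure c)"
proof
  have "(\<Union>n. cball (0::complex) (real n)) = UNIV" using real_arch_simple by auto
  then show "\<exists>A. countable A \<and> A \<subseteq> sets (conf_measure c) \<and> \<Union> A = space (conf_measure c) \<and> (\<forall>a\<in>A. emeasure (conf_measure c) a \<noteq> \<infinity>)"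
    using assms by (intro exI[of _ "range (\<lambda>n. cball 0 (real n))"]) (auto simp: emeasure_conf_measure)
qed

lemma integrable_conf_measure_bounded_cs:
  assumes "locfin c" "bounded_cs f"
  shows "integrable (conf_measure c) f"
proof -
  obtain B r where B: "\<And>x. cmod (f x) \<le> B" and r: "\<And>x. r < cmod x \<Longrightarrow> f x = 0" and [measurable]: "f \<in> borel_measurable borel"
    using assms(2) by (auto simp: bounded_cs_def)
  show ?thesis
  proof (rule Bochner_Integration.integrable_bound)
    have "emeasure (conf_measure c) (cball 0 r) < \<infinity>" using assms(1) by (simp add: emeasure_conf_measure)
    then show "integrable (conf_measure c) (\<lambda>x. B * indicator (cball 0 r) x)"
      by (intro integrable_mult_right integrable_real_indicator) auto
    show "AE x in conf_measure c. cmod (f x) \<le> norm (B * indicator (cball 0 r) x)"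
      using B r order_trans[OF norm_ge_zero B] by (auto simp: indicator_def not_le)
  qed measurable
qed

lemma integral_conf_measure_eq_linstat:
  assumes "locfin c" "bounded_cs f"
  shows "(\<integral>z. f z \<partial>conf_measure c) = linstat c f"
proof -
  obtain r where r: "\<And>x. r < cmod x \<Longrightarrow> f x = 0" and [measurable]: "f \<in> borel_measurable borel"
    using assms(2) by (auto simp: bounded_cs_def)
  have eq: "{a \<in> UNIV. of_nat (c a) * f a \<noteq> 0} = {z \<in> supp_conf c. f z \<noteq> 0}"
    by (auto simp: supp_conf_def)
  have "finite {z \<in> supp_conf c. f z \<noteq> 0}"
    by (rule finite_subset[OF _ finite_supp_conf_bounded[OF assms(1) bounded_cball[of 0 r]]]) (use r in \<open>auto simp: not_less[symmetric]\<close>)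
  then have "finite {a \<in> UNIV. of_nat (c a) * f a \<noteq> 0}" unfolding eq .
  from lebesgue_integral_count_space_finite_support[OF this]
  have "(\<integral>z. of_nat (c z) * f z \<partial>count_space UNIV) = (\<Sum>z\<in>{z \<in> supp_conf c. f z \<noteq> 0}. of_nat (c z) * f z)"
    using eq by simp
  then show ?thesis by (simp add: integral_conf_measure linstat_def)
qed

text \<open>True without any convergence hypothesis: unconditional and absolute summability agree
  for complex terms, and otherwise both sides are 0 by default.\<close>

lemma infsum_conf:
  fixes f :: "complex \<Rightarrow> complex"
  assumes [measurable]: "f \<in> borel_measurable borel" "S \<in> sets borel"
  shows "infsum (\<lambda>l. of_nat (c l) * f l) {l \<in> supp_conf c. l \<in> S} = (\<integral>l. indicator S l * f l \<partial>conf_measure c)"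
proof -
  let ?A = "{l \<in> supp_conf c. l \<in> S}" and ?f = "\<lambda>l. of_nat (c l) * f l"
  have eq: "(\<lambda>l. indicator ?A l *\<^sub>R ?f l) = (\<lambda>l. of_nat (c l) * (indicator S l * f l))"
    by (auto simp: indicator_def supp_conf_def)
  have "(\<integral>l. indicator S l * f l \<partial>conf_measure c) = (\<integral>l. of_nat (c l) * (indicator S l * f l) \<partial>count_space UNIV)"
    by (rule integral_conf_measure) measurable
  also have "\<dots> = infsetsum ?f ?A"
    unfolding infsetsum_altdef set_lebesgue_integral_def eq ..
  also have "\<dots> = infsum ?f ?A"
  proof (cases "Infinite_Set_Sum.abs_summable_on ?f ?A")
    case True
    then show ?thesis by (rule infsetsum_infsum)
  next
    case False
    then have "infsetsum ?f ?A = 0" by (rule not_summable_infsetsum_eq)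
    moreover have "\<not> ?f summable_on ?A"
      using False unfolding summable_on_iff_abs_summable_on_complex abs_summable_equivalent .
    ultimately show ?thesis by (simp add: infsum_not_exists)
  qed
  finally show ?thesis ..
qed

lemma finite_sum_conf:
  fixes f :: "complex \<Rightarrow> complex"
  assumes [measurable]: "f \<in> borel_measurable borel" "S \<in> sets borel" and "locfin c" "bounded S"
  shows "(\<Sum>l\<in>{l \<in> supp_conf c. l \<in> S}. of_nat (c l) * f l) = (\<integral>l. indicator S l * f l \<partial>conf_measure c)"
proof -
  have "finite {l \<in> supp_conf c. l \<in> S}"
    using finite_supp_conf_bounded[OF assms(3,4)] by (simp add: Int_def conj_commute)
  from infsum_finite[OF this, of "\<lambda>l. of_nat (c l) * f l"] show ?thesis
    by (subst infsum_conf[symmetric]) (use assms in auto)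
qed

subsection \<open>The space of configurations\<close>

lemma space_conf_space: "space conf_space = {c. locfin c}"
  unfolding conf_space_def by (rule space_measure_of) auto

lemma sets_conf_space_gen:
  "sets conf_space = sigma_sets {c. locfin c} {{c. locfin c \<and> cnt c B = k} | B k. B \<in> sets borel \<and> bounded B}"
  unfolding conf_space_def by (rule sets_measure_of) auto

lemma measurable_cnt_conf_space:
  assumes "B \<in> sets borel" "bounded B"
  shows "(\<lambda>c. cnt c B) \<in> conf_space \<rightarrow>\<^sub>M count_space UNIV"
proof (rule measurable_count_space_eq2_countable[THEN iffD2])
  show "(\<lambda>c. cnt c B) \<in> space conf_space \<rightarrow> UNIV \<and> (\<forall>k\<in>UNIV. (\<lambda>c. cnt c B) -` {k} \<inter> space conf_space \<in> sets conf_space)"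
  proof (intro conjI ballI)
    fix k
    have "(\<lambda>c. cnt c B) -` {k} \<inter> space conf_space = {c. locfin c \<and> cnt c B = k}"
      by (auto simp: space_conf_space)
    then show "(\<lambda>c. cnt c B) -` {k} \<inter> space conf_space \<in> sets conf_space"
      using assms unfolding sets_conf_space_gen by (auto intro: sigma_sets.Basic)
  qed auto
qed

text \<open>\<open>cnt\<close> defaults to 0 on infinite sums, so only bounded sets are evaluated
  directly through it; general sets are exhausted by disks.\<close>

lemma measurable_emeasure_conf_measure:
  assumes [measurable]: "B \<in> sets borel"
  shows "(\<lambda>c. emeasure (conf_measure c) B) \<in> borel_measurable conf_space"
proof -
  have "(\<lambda>c. SUP n. emeasure (conf_measure c) (B \<inter> cball 0 (real n))) \<in> borel_measurable conf_space"
  proof (rule borel_measurable_SUP)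
    fix n :: nat
    have b: "B \<inter> cball 0 (real n) \<in> sets borel" "bounded (B \<inter> cball 0 (real n))" by auto
    note [measurable] = measurable_cnt_conf_space[OF b]
    have "(\<lambda>c. ennreal (real (cnt c (B \<inter> cball 0 (real n))))) \<in> borel_measurable conf_space"
      by measurable
    then show "(\<lambda>c. emeasure (conf_measure c) (B \<inter> cball 0 (real n))) \<in> borel_measurable conf_space"
      by (subst measurable_cong) (auto simp: space_conf_space emeasure_conf_measure b)
  qed auto
  moreover have "(SUP n. emeasure (conf_measure c) (B \<inter> cball 0 (real n))) = emeasure (conf_measure c) B" for c
  proof -
    have "(\<Union>n. B \<inter> cball 0 (real n)) = B" using real_arch_simple by auto
    then show ?thesis
      by (subst SUP_emeasure_incseq) (auto simp: incseq_def)
  qed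
  ultimately show ?thesis by simp
qed

lemma measurable_nn_integral_conf_measure:
  assumes "f \<in> borel_measurable borel"
  shows "(\<lambda>c. \<integral>\<^sup>+z. f z \<partial>conf_measure c) \<in> borel_measurable conf_space"
  using assms
proof (induction rule: borel_measurable_induct)
  case (cong f g)
  then show ?case by simp
next
  case (set A)
  then show ?case using measurable_emeasure_conf_measure[of A] by simp
next
  case (mult u c)
  then show ?case by (subst nn_integral_cmult) auto
next
  case (add u v)
  then show ?case by (subst nn_integral_add) auto
next
  case (seq U)
  have [measurable]: "U i \<in> borel_measurable borel" for i using seq by auto
  have "(\<integral>\<^sup>+z. (SUP i. U i) z \<partial>conf_measure c) = (SUP i. \<integral>\<^sup>+z. U i z \<partial>conf_measure c)" for c
    unfolding SUP_apply by (rule nn_integral_monotone_convergence_SUP) (use seq in auto)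
  then show ?case using seq by simp
qed

text \<open>The measure depends on \<open>c\<close>, so measurability is reduced to four nonnegative
  integrals; the case distinction reproduces the value 0 of a divergent integral.\<close>

lemma measurable_integral_conf_measure:
  fixes f :: "complex \<Rightarrow> complex"
  assumes [measurable]: "f \<in> borel_measurable borel"
  shows "(\<lambda>c. \<integral>z. f z \<partial>conf_measure c) \<in> borel_measurable conf_space"
proof -
  note [measurable] = measurable_nn_integral_conf_measure
  have eq: "(\<integral>z. f z \<partial>conf_measure c) =
     (if (\<integral>\<^sup>+z. ennreal (cmod (f z)) \<partial>conf_measure c) < \<infinity> then
        of_real (enn2real (\<integral>\<^sup>+z. ennreal (Re (f z)) \<partial>conf_measure c) - enn2real (\<integral>\<^sup>+z. ennreal (- Re (f z)) \<partial>conf_measure c)) +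
        \<i> * of_real (enn2real (\<integral>\<^sup>+z. ennreal (Im (f z)) \<partial>conf_measure c) - enn2real (\<integral>\<^sup>+z. ennreal (- Im (f z)) \<partial>conf_measure c))
      else 0)" for c
  proof (cases "integrable (conf_measure c) f")
    case True
    then have "(\<integral>z. f z \<partial>conf_measure c) = of_real (\<integral>z. Re (f z) \<partial>conf_measure c) + \<i> * of_real (\<integral>z. Im (f z) \<partial>conf_measure c)"
      by (simp add: complex_eq_iff)
    also have "(\<integral>z. Re (f z) \<partial>conf_measure c) = enn2real (\<integral>\<^sup>+z. ennreal (Re (f z)) \<partial>conf_measure c) - enn2real (\<integral>\<^sup>+z. ennreal (- Re (f z)) \<partial>conf_measure c)"
      using True by (intro real_lebesgue_integral_def integrable_Re)
    also have "(\<integral>z. Im (f z) \<partial>conf_measure c) = enn2real (\<integral>\<^sup>+z. ennreal (Im (f z)) \<partial>conf_measure c) - enn2real (\<integral>\<^sup>+z. ennreal (- Im (f z)) \<partial>conf_measure c)"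
      using True by (intro real_lebesgue_integral_def integrable_Im)
    finally show ?thesis using True by (auto simp: integrable_iff_bounded)
  next
    case False
    then show ?thesis by (simp add: not_integrable_integral_eq integrable_iff_bounded)
  qed
  show ?thesis unfolding eq by measurable
qed

lemma locfin_shift_conf:
  assumes "locfin c" shows "locfin (shift_conf w c)"
  unfolding locfin_def
proof
  fix r
  have "{z \<in> supp_conf (shift_conf w c). cmod z \<le> r} \<subseteq> (\<lambda>z. z + w) ` {z \<in> supp_conf c. cmod z \<le> r + cmod w}"
  proof
    fix z assume "z \<in> {z \<in> supp_conf (shift_conf w c). cmod z \<le> r}"
    then have "z - w \<in> {z \<in> supp_conf c. cmod z \<le> r + cmod w}"
      using norm_triangle_ineq4[of z w] by (auto simp: supp_conf_def shift_conf_def)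
    then show "z \<in> (\<lambda>z. z + w) ` {z \<in> supp_conf c. cmod z \<le> r + cmod w}"
      by (intro image_eqI[of _ _ "z - w"]) auto
  qed
  then show "finite {z \<in> supp_conf (shift_conf w c). cmod z \<le> r}"
    using assms unfolding locfin_def by (meson finite_imageI finite_subset)
qed

lemma shift_conf_shift_conf: "shift_conf v (shift_conf w c) = shift_conf (v + w) c"
  by (simp add: shift_conf_def diff_diff_eq add.commute)

lemma cnt_shift_conf: "cnt (shift_conf w c) ((+) w ` B) = cnt c B"
  unfolding cnt_def
  by (rule sum.reindex_bij_witness[of _ "\<lambda>z. w + z" "\<lambda>z. z - w"]) (auto simp: supp_conf_def shift_conf_def)

lemma cnt_shift_conf': "cnt (shift_conf w c) B = cnt c ((+) (- w) ` B)"
proof -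
  have "(+) w ` (+) (- w) ` B = B" by (auto simp: image_image)
  then show ?thesis using cnt_shift_conf[of w c "(+) (- w) ` B"] by simp
qed

lemma translate_borel:
  fixes B :: "complex set"
  assumes "B \<in> sets borel" shows "(+) w ` B \<in> sets borel"
proof -
  have "(+) w ` B = (\<lambda>z. z - w) -` B \<inter> space borel"
    by (auto simp: image_iff intro!: bexI[of _ "_ - w"])
  also have "\<dots> \<in> sets borel"
    by (rule measurable_sets[of _ borel borel]) (use assms in auto)
  finally show ?thesis .
qed

lemma translate_bounded: "bounded B \<Longrightarrow> bounded ((+) w ` (B :: complex set))"
  using bounded_translation[of B w] by simp

lemma measurable_shift_conf [measurable]: "shift_conf w \<in> conf_space \<rightarrow>\<^sub>M conf_space"
  unfolding conf_space_def
proof (rule measurable_measure_of)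
  show "shift_conf w \<in> space (sigma {c. locfin c} {{c. locfin c \<and> cnt c B = k} |B k. B \<in> sets borel \<and> bounded B}) \<rightarrow> {c. locfin c}"
    using locfin_shift_conf space_conf_space unfolding conf_space_def by auto
next
  fix y assume "y \<in> {{c. locfin c \<and> cnt c B = k} |B k. B \<in> sets borel \<and> bounded B}"
  then obtain B k where B: "B \<in> sets borel" "bounded B" and y: "y = {c. locfin c \<and> cnt c B = k}" by auto
  have "shift_conf w -` y \<inter> space conf_space = {c. locfin c \<and> cnt c ((+) (- w) ` B) = k}"
    unfolding y space_conf_space by (auto simp: locfin_shift_conf cnt_shift_conf')
  also have "\<dots> \<in> sets conf_space"
    unfolding sets_conf_space_gen using translate_borel[OF B(1)] translate_bounded[OF B(2)]
    by (intro sigma_sets.Basic) blast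
  finally show "shift_conf w -` y \<inter> space (sigma {c. locfin c} {{c. locfin c \<and> cnt c B = k} |B k. B \<in> sets borel \<and> bounded B})
      \<in> sets (sigma {c. locfin c} {{c. locfin c \<and> cnt c B = k} |B k. B \<in> sets borel \<and> bounded B})"
    unfolding conf_space_def .
qed auto

lemma emeasure_conf_measure_shift:
  assumes "B \<in> sets borel"
  shows "emeasure (conf_measure (shift_conf w c)) B = emeasure (conf_measure c) ((+) (- w) ` B)"
proof -
  have B': "(+) (- w) ` B \<in> sets borel" by (rule translate_borel[OF assms])
  have "emeasure (conf_measure (shift_conf w c)) B = (\<integral>\<^sup>+z. ennreal (real (c (z - w))) * indicator B z \<partial>count_space UNIV)"
    using nn_integral_conf_measure[of "indicator B" "shift_conf w c"] assms by (simp add: shift_conf_def)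
  also have "\<dots> = (\<integral>\<^sup>+z. ennreal (real (c z)) * indicator B (z + w) \<partial>count_space UNIV)"
    by (subst nn_integral_bij_count_space[of "\<lambda>z. z - w" UNIV UNIV "\<lambda>z. ennreal (real (c z)) * indicator B (z + w)", symmetric])
       (auto intro!: bij_betwI[of _ _ _ "\<lambda>z. z + w"])
  also have "\<dots> = (\<integral>\<^sup>+z. ennreal (real (c z)) * indicator ((+) (- w) ` B) z \<partial>count_space UNIV)"
    by (intro nn_integral_cong arg_cong2[where f="(*)"]) (auto simp: indicator_def image_iff intro!: bexI[of _ "_ + w"])
  also have "\<dots> = emeasure (conf_measure c) ((+) (- w) ` B)"
    using nn_integral_conf_measure[of "indicator ((+) (- w) ` B)" c] B' by simp
  finally show ?thesis .
qed

subsection \<open>Stationary point processes\<close>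

locale stationary_process = prob_space M for M :: "'a measure" +
  fixes N :: "'a \<Rightarrow> config"
  assumes pp: "point_process M N" and stat: "stationary_pp M N" and fsm: "finite_second_moment M N"
begin

lemma locfin_N: "\<omega> \<in> space M \<Longrightarrow> locfin (N \<omega>)"
  using pp by (simp add: point_process_def)

lemma measurable_N [measurable]: "N \<in> M \<rightarrow>\<^sub>M conf_space"
  unfolding conf_space_def
proof (rule measurable_measure_of)
  show "N \<in> space M \<rightarrow> {c. locfin c}" using locfin_N by auto
  fix y assume "y \<in> {{c. locfin c \<and> cnt c B = k} |B k. B \<in> sets borel \<and> bounded B}"
  then obtain B k where B: "B \<in> sets borel" "bounded B" and y: "y = {c. locfin c \<and> cnt c B = k}" by auto
  have [measurable]: "(\<lambda>\<omega>. real (cnt (N \<omega>) B)) \<in> borel_measurable M"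
    using pp B by (simp add: point_process_def)
  have "N -` y \<inter> space M = {\<omega> \<in> space M. real (cnt (N \<omega>) B) = real k}"
    using locfin_N by (auto simp: y)
  also have "\<dots> \<in> sets M" by measurable
  finally show "N -` y \<inter> space M \<in> sets M" .
qed auto

text \<open>Stationarity is given for joint laws of finitely many counts. The corresponding
  cylinders are stable under intersection and generate \<open>conf_space\<close>, so invariance
  extends to the law of the whole configuration.\<close>

lemma distr_shift_conf: "distr (distr M conf_space N) conf_space (shift_conf w) = distr M conf_space N"
proof -
  define cyl :: "complex set list \<Rightarrow> nat list \<Rightarrow> config set" where "cyl Bs ks = {c. locfin c \<and> map (cnt c) Bs = ks}" for Bs ks
  define E where "E = {cyl Bs ks | Bs ks. \<forall>B\<in>set Bs. B \<in> sets borel \<and> bounded B}"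
  have cyl_sets: "cyl Bs ks \<in> sets conf_space" if "\<forall>B\<in>set Bs. B \<in> sets borel \<and> bounded B" for Bs ks
    using that
  proof (induction Bs arbitrary: ks)
    case Nil
    then show ?case using sets.top[of conf_space] by (cases ks) (auto simp: cyl_def space_conf_space)
  next
    case (Cons B Bs)
    show ?case
    proof (cases ks)
      case (Cons k ks')
      have "cyl (B # Bs) ks = {c. locfin c \<and> cnt c B = k} \<inter> cyl Bs ks'"
        by (auto simp: cyl_def Cons)
      moreover have "{c. locfin c \<and> cnt c B = k} \<in> sets conf_space"
        unfolding sets_conf_space_gen using Cons.prems by (intro sigma_sets.Basic) auto
      ultimately show ?thesis using Cons.IH Cons.prems by auto
    qed (auto simp: cyl_def)
  qed
  have pre: "N -` cyl Bs ks \<inter> space M = (\<lambda>\<omega>. map (\<lambda>B. cnt (N \<omega>) B) Bs) -` {ks} \<inter> space M" for Bs ks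
    using locfin_N by (auto simp: cyl_def)
  have map_meas: "(\<lambda>\<omega>. map (\<lambda>B. cnt (N \<omega>) B) Bs) \<in> M \<rightarrow>\<^sub>M count_space UNIV" if Bs: "\<forall>B\<in>set Bs. B \<in> sets borel \<and> bounded B" for Bs
  proof (rule measurable_count_space_eq2_countable[THEN iffD2])
    show "(\<lambda>\<omega>. map (\<lambda>B. cnt (N \<omega>) B) Bs) \<in> space M \<rightarrow> UNIV \<and> (\<forall>ks\<in>UNIV. (\<lambda>\<omega>. map (\<lambda>B. cnt (N \<omega>) B) Bs) -` {ks} \<inter> space M \<in> sets M)"
      unfolding pre[symmetric] using measurable_sets[OF measurable_N cyl_sets[OF Bs]] by auto
  qed
  show ?thesis
  proof (rule measure_eqI_generator_eq[where \<Omega>="{c. locfin c}" and E=E and A="\<lambda>_. {c. locfin c}"])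
    show "Int_stable E"
    proof (rule Int_stableI)
      fix a b assume "a \<in> E" "b \<in> E"
      then obtain Bs ks Bs' ks' where ab: "a = cyl Bs ks" "b = cyl Bs' ks'"
        "\<forall>B\<in>set Bs. B \<in> sets borel \<and> bounded B" "\<forall>B\<in>set Bs'. B \<in> sets borel \<and> bounded B" unfolding E_def by blast
      show "a \<inter> b \<in> E"
      proof (cases "length Bs = length ks")
        case True
        have "a \<inter> b = cyl (Bs @ Bs') (ks @ ks')" using True by (auto simp: ab cyl_def)
        then show ?thesis unfolding E_def using ab(3,4) by force
      next
        case False
        then have "a = {}" using ab(1) by (auto simp: cyl_def)
        \<comment> \<open>Lists of unequal lengths give the empty cylinder, which thereby is a
          member of \<open>E\<close>.\<close>
        moreover have "{} = cyl [] [0]" by (auto simp: cyl_def)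
        ultimately show ?thesis unfolding E_def by force
      qed
    qed
    show "E \<subseteq> Pow {c. locfin c}" by (auto simp: E_def cyl_def)
    have sE: "sets conf_space = sigma_sets {c. locfin c} E"
    proof (rule antisym)
      have "{{c. locfin c \<and> cnt c B = k} |B k. B \<in> sets borel \<and> bounded B} \<subseteq> E"
      proof
        fix y assume "y \<in> {{c. locfin c \<and> cnt c B = k} |B k. B \<in> sets borel \<and> bounded B}"
        then obtain B k where "B \<in> sets borel" "bounded B" and y: "y = {c. locfin c \<and> cnt c B = k}" by auto
        moreover have "y = cyl [B] [k]" by (auto simp: y cyl_def)
        ultimately show "y \<in> E" unfolding E_def by force
      qed
      then show "sets conf_space \<subseteq> sigma_sets {c. locfin c} E"
        unfolding sets_conf_space_gen by (rule sigma_sets_mono')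
      have "E \<subseteq> sets conf_space" unfolding E_def using cyl_sets by blast
      then show "sigma_sets {c. locfin c} E \<subseteq> sets conf_space"
        using sets.sigma_sets_subset[of E conf_space] unfolding space_conf_space by simp
    qed
    then show "sets (distr (distr M conf_space N) conf_space (shift_conf w)) = sigma_sets {c. locfin c} E"
      "sets (distr M conf_space N) = sigma_sets {c. locfin c} E" by simp_all
    have "{c. locfin c} = cyl [] []" by (auto simp: cyl_def)
    then show "range (\<lambda>_::nat. {c. locfin c}) \<subseteq> E" unfolding E_def by force
    show "emeasure (distr (distr M conf_space N) conf_space (shift_conf w)) {c. locfin c} \<noteq> \<infinity>" for i :: nat
    proof -
      interpret D: prob_space "distr M conf_space N" by (rule prob_space_distr) measurable
      interpret D': prob_space "distr (distr M conf_space N) conf_space (shift_conf w)"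
        by (rule D.prob_space_distr) measurable
      show ?thesis by (rule D'.emeasure_finite[unfolded infinity_ennreal_def[symmetric]])
    qed
    fix X assume "X \<in> E"
    then obtain Bs ks where X: "X = cyl Bs ks" and Bs: "\<forall>B\<in>set Bs. B \<in> sets borel \<and> bounded B" unfolding E_def by blast
    let ?Bs = "map (\<lambda>B. (+) (- w) ` B) Bs"
    have Bs': "\<forall>B\<in>set ?Bs. B \<in> sets borel \<and> bounded B"
    proof
      fix B assume "B \<in> set ?Bs"
      then obtain B0 where "B0 \<in> set Bs" "B = (+) (- w) ` B0" by auto
      then show "B \<in> sets borel \<and> bounded B" using Bs translate_borel[of B0 "-w"] translate_bounded[of B0 "-w"] by blast
    qed
    have sh: "shift_conf w -` X \<inter> space conf_space = cyl ?Bs ks"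
      unfolding X by (auto simp: cyl_def space_conf_space locfin_shift_conf cnt_shift_conf' o_def)
    have Xs: "X \<in> sets conf_space" unfolding X by (rule cyl_sets[OF Bs])
    have "emeasure (distr (distr M conf_space N) conf_space (shift_conf w)) X =
        emeasure (distr M conf_space N) (shift_conf w -` X \<inter> space conf_space)"
      by (subst emeasure_distr) (simp_all add: Xs)
    also have "\<dots> = emeasure (distr M conf_space N) (cyl ?Bs ks)"
      by (simp only: sh)
    also have "\<dots> = emeasure M (N -` cyl ?Bs ks \<inter> space M)"
      by (rule emeasure_distr[OF measurable_N cyl_sets[OF Bs']])
    also have "\<dots> = emeasure M ((\<lambda>\<omega>. map (\<lambda>B. cnt (N \<omega>) B) ?Bs) -` {ks} \<inter> space M)"
      by (simp only: pre)
    also have "\<dots> = emeasure (distr M (count_space UNIV) (\<lambda>\<omega>. map (\<lambda>B. cnt (N \<omega>) B) ?Bs)) {ks}"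
      by (subst emeasure_distr[OF map_meas[OF Bs']]) auto
    also have "distr M (count_space UNIV) (\<lambda>\<omega>. map (\<lambda>B. cnt (N \<omega>) B) ?Bs) =
        distr M (count_space UNIV) (\<lambda>\<omega>. map (\<lambda>B. cnt (N \<omega>) B) Bs)"
      using stat[unfolded stationary_pp_def, rule_format, of Bs "- w"] Bs by (simp add: o_def)
    also have "emeasure (distr M (count_space UNIV) (\<lambda>\<omega>. map (\<lambda>B. cnt (N \<omega>) B) Bs)) {ks} =
        emeasure M ((\<lambda>\<omega>. map (\<lambda>B. cnt (N \<omega>) B) Bs) -` {ks} \<inter> space M)"
      by (subst emeasure_distr[OF map_meas[OF Bs]]) auto
    also have "\<dots> = emeasure (distr M conf_space N) X"
      using emeasure_distr[OF measurable_N Xs] by (simp only: pre X)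
    finally show "emeasure (distr (distr M conf_space N) conf_space (shift_conf w)) X = emeasure (distr M conf_space N) X" .
  qed auto
qed

lemma nn_integral_shift_conf:
  assumes [measurable]: "G \<in> borel_measurable conf_space"
  shows "(\<integral>\<^sup>+\<omega>. G (shift_conf w (N \<omega>)) \<partial>M) = (\<integral>\<^sup>+\<omega>. G (N \<omega>) \<partial>M)"
proof -
  have "(\<integral>\<^sup>+\<omega>. G (N \<omega>) \<partial>M) = (\<integral>\<^sup>+c. G c \<partial>distr M conf_space N)"
    by (simp add: nn_integral_distr)
  also have "\<dots> = (\<integral>\<^sup>+c. G c \<partial>distr (distr M conf_space N) conf_space (shift_conf w))"
    by (simp add: distr_shift_conf)
  also have "\<dots> = (\<integral>\<^sup>+\<omega>. G (shift_conf w (N \<omega>)) \<partial>M)"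
    by (simp add: nn_integral_distr)
  finally show ?thesis ..
qed

text \<open>Half-open, so that the integer translates of the square tile the plane; by stationarity
  all of them have this second moment.\<close>

definition second_moment :: ennreal where
  "second_moment = (\<integral>\<^sup>+\<omega>. (emeasure (conf_measure (N \<omega>)) {z. 0 \<le> Re z \<and> Re z < 1 \<and> 0 \<le> Im z \<and> Im z < 1})\<^sup>2 \<partial>M)"

lemma second_moment_finite: "second_moment < \<infinity>"
proof -
  let ?Q = "{z. 0 \<le> Re z \<and> Re z < 1 \<and> 0 \<le> Im z \<and> Im z < 1}"
  have Q: "?Q \<in> sets borel" by measurable
  have b: "bounded ?Q"
  proof (rule boundedI)
    fix z assume "z \<in> ?Q" then show "cmod z \<le> 2" using cmod_le[of z] by auto
  qed
  have "second_moment = (\<integral>\<^sup>+\<omega>. ennreal ((real (cnt (N \<omega>) ?Q))\<^sup>2) \<partial>M)"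
    unfolding second_moment_def
    by (intro nn_integral_cong) (simp add: emeasure_conf_measure[OF locfin_N b Q] ennreal_power)
  also have "\<dots> < \<infinity>"
    using fsm Q b unfolding finite_second_moment_def integrable_iff_bounded by simp
  finally show ?thesis .
qed

text \<open>The plane is split into unit squares, each contributing at most its number of points times the integral of \<open>F\<close> over it;
  Cauchy--Schwarz with these integrals as weights reduces the claim to the second moment of a single square.\<close>

lemma second_moment_bound:
  assumes [measurable]: "f \<in> borel_measurable borel" "F \<in> borel_measurable borel"
    and le: "\<And>x y. cmod (x - y) \<le> 2 \<Longrightarrow> f y \<le> F x"
  shows "(\<integral>\<^sup>+\<omega>. (\<integral>\<^sup>+z. f z \<partial>conf_measure (N \<omega>))\<^sup>2 \<partial>M) \<le> second_moment * (\<integral>\<^sup>+x. F x \<partial>lborel)\<^sup>2"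
proof -
  note [measurable] = measurable_emeasure_conf_measure measurable_nn_integral_conf_measure
  define e :: "nat \<Rightarrow> int \<times> int" where "e = from_nat_into UNIV"
  have "infinite (UNIV :: (int \<times> int) set)" by (simp add: infinite_UNIV_int finite_prod)
  then have e: "bij e" unfolding e_def by (intro bij_betw_from_nat_into) auto
  define p where "p i = Complex (of_int (fst (e i))) (of_int (snd (e i)))" for i
  define Q where "Q i = {z. \<lfloor>Re z\<rfloor> = fst (e i) \<and> \<lfloor>Im z\<rfloor> = snd (e i)}" for i
  define Q0 where "Q0 = {z. 0 \<le> Re z \<and> Re z < 1 \<and> 0 \<le> Im z \<and> Im z < 1}"
  have Q0 [measurable]: "Q0 \<in> sets borel" unfolding Q0_def by measurable
  have QQ: "Q i = (+) (p i) ` Q0" for i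
  proof (rule set_eqI)
    fix z
    have "z \<in> Q i \<longleftrightarrow> z - p i \<in> Q0" by (auto simp: Q_def Q0_def p_def floor_eq_iff)
    also have "\<dots> \<longleftrightarrow> z \<in> (+) (p i) ` Q0" by (auto simp: image_iff intro!: bexI[of _ "z - p i"])
    finally show "z \<in> Q i \<longleftrightarrow> z \<in> (+) (p i) ` Q0" .
  qed
  have Qm [measurable]: "Q i \<in> sets borel" for i unfolding QQ by (rule translate_borel[OF Q0])
  have disj: "disjoint_family Q"
    using e by (auto simp: disjoint_family_on_def Q_def bij_def inj_def prod_eq_iff)
  have un: "(\<Union>i. Q i) = UNIV"
  proof -
    have "z \<in> Q (inv e (\<lfloor>Re z\<rfloor>, \<lfloor>Im z\<rfloor>))" for z
      unfolding Q_def using bij_is_surj[OF e] by (simp add: surj_f_inv_f)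
    then show ?thesis by blast
  qed
  have one: "(\<Sum>i. indicator (Q i) z :: ennreal) = 1" for z
    using suminf_indicator[OF disj, of z] un by simp
  have vol: "emeasure lborel (Q i) = 1" for i
  proof -
    have "emeasure lborel Q0 = 1"
    proof -
      have "emeasure lborel (box 0 (1 + \<i>)) \<le> emeasure lborel Q0" "emeasure lborel Q0 \<le> emeasure lborel (cbox 0 (1 + \<i>))"
        by (intro emeasure_mono; auto simp: Q0_def box_def cbox_def Basis_complex_def)+
      moreover have "emeasure lborel (box 0 (1 + \<i>)) = 1" "emeasure lborel (cbox 0 (1 + \<i>)) = 1"
        by (subst emeasure_lborel_box emeasure_lborel_cbox; auto simp: Basis_complex_def)+
      ultimately show ?thesis by (simp add: antisym)
    qed
    moreover have "(\<integral>\<^sup>+x. indicator (Q i) x \<partial>lborel) = (\<integral>\<^sup>+x. indicator Q0 (x - p i) \<partial>lborel)"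
      unfolding QQ by (intro nn_integral_cong) (auto simp: indicator_def image_iff intro!: bexI[of _ "_ - p i"])
    moreover have "(\<integral>\<^sup>+x. indicator Q0 (x - p i) \<partial>lborel) = (\<integral>\<^sup>+x. indicator Q0 x \<partial>lborel)"
      by (rule nn_integral_complex_shift') measurable
    ultimately show ?thesis by simp
  qed
  define t where "t i = (\<integral>\<^sup>+x. F x * indicator (Q i) x \<partial>lborel)" for i
  have tF: "(\<Sum>i. t i) = (\<integral>\<^sup>+x. F x \<partial>lborel)"
    unfolding t_def by (subst nn_integral_suminf[symmetric]) (auto simp: one)
  have ft: "f y * indicator (Q i) y \<le> t i * indicator (Q i) y" for i y
  proof (cases "y \<in> Q i")
    case True
    have "f y = (\<integral>\<^sup>+x. f y * indicator (Q i) x \<partial>lborel)" by (simp add: nn_integral_cmult vol)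
    also have "\<dots> \<le> t i" unfolding t_def
    proof (intro nn_integral_mono)
      fix x
      show "f y * indicator (Q i) x \<le> F x * indicator (Q i) x"
      proof (cases "x \<in> Q i")
        case x: True
        \<comment> \<open>Points of one square differ by at most 1 in each coordinate; this is why
          the majorant \<open>F\<close> is asked to dominate at distance 2.\<close>
        have "\<bar>Re (x - y)\<bar> \<le> 1" "\<bar>Im (x - y)\<bar> \<le> 1" using True x unfolding Q_def by (auto simp: floor_eq_iff abs_le_iff)
        then have "cmod (x - y) \<le> 2" using cmod_le[of "x - y"] by linarith
        then show ?thesis using le by (simp add: x)
      qed simp
    qed
    finally show ?thesis by (simp add: True)
  qed simp
  define n where "n i \<omega> = emeasure (conf_measure (N \<omega>)) (Q i)" for i \<omega>
  have [measurable]: "n i \<in> borel_measurable M" for i unfolding n_def by measurable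
  have bound: "(\<integral>\<^sup>+z. f z \<partial>conf_measure (N \<omega>)) \<le> (\<Sum>i. t i * n i \<omega>)" for \<omega>
  proof -
    have "(\<integral>\<^sup>+z. f z \<partial>conf_measure (N \<omega>)) = (\<integral>\<^sup>+z. (\<Sum>i. f z * indicator (Q i) z) \<partial>conf_measure (N \<omega>))"
      by (simp add: one)
    also have "\<dots> \<le> (\<integral>\<^sup>+z. (\<Sum>i. t i * indicator (Q i) z) \<partial>conf_measure (N \<omega>))"
      by (intro nn_integral_mono suminf_le ft) auto
    also have "\<dots> = (\<Sum>i. t i * n i \<omega>)"
      by (subst nn_integral_suminf) (auto simp: nn_integral_cmult n_def)
    finally show ?thesis .
  qed
  have En: "(\<integral>\<^sup>+\<omega>. (n i \<omega>)\<^sup>2 \<partial>M) = second_moment" for i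
  proof -
    have "second_moment = (\<integral>\<^sup>+\<omega>. (emeasure (conf_measure (shift_conf (- p i) (N \<omega>))) Q0)\<^sup>2 \<partial>M)"
      unfolding second_moment_def Q0_def[symmetric]
      by (rule nn_integral_shift_conf[symmetric, of "\<lambda>c. (emeasure (conf_measure c) Q0)\<^sup>2"]) measurable
    also have "\<dots> = (\<integral>\<^sup>+\<omega>. (n i \<omega>)\<^sup>2 \<partial>M)"
      unfolding n_def QQ by (simp add: emeasure_conf_measure_shift)
    finally show ?thesis ..
  qed
  have cs: "(\<Sum>i. t i * n i \<omega>)\<^sup>2 \<le> (\<Sum>i. t i) * (\<Sum>i. t i * (n i \<omega>)\<^sup>2)" for \<omega>
  proof -
    let ?T = "density (count_space UNIV) t"
    have "(\<integral>\<^sup>+i. 1 * n i \<omega> \<partial>?T)\<^sup>2 \<le> (\<integral>\<^sup>+i. 1\<^sup>2 \<partial>?T) * (\<integral>\<^sup>+i. (n i \<omega>)\<^sup>2 \<partial>?T)"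
      by (rule Cauchy_Schwarz_nn_integral) auto
    then show ?thesis by (simp add: nn_integral_density nn_integral_count_space_nat emeasure_density)
  qed
  have "(\<integral>\<^sup>+\<omega>. (\<integral>\<^sup>+z. f z \<partial>conf_measure (N \<omega>))\<^sup>2 \<partial>M) \<le> (\<integral>\<^sup>+\<omega>. (\<Sum>i. t i) * (\<Sum>i. t i * (n i \<omega>)\<^sup>2) \<partial>M)"
    by (intro nn_integral_mono order_trans[OF power_mono[OF bound] cs]) auto
  also have "\<dots> = (\<Sum>i. t i) * (\<Sum>i. t i * second_moment)"
    by (simp add: nn_integral_cmult nn_integral_suminf En)
  also have "\<dots> = second_moment * (\<integral>\<^sup>+x. F x \<partial>lborel)\<^sup>2"
    unfolding ennreal_suminf_multc tF by (simp add: power2_eq_square mult_ac)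
  finally show ?thesis .
qed

end

subsection \<open>Mean square convergence\<close>

text \<open>Extended values turn square integrability into the condition
  \<open>< \<infinity>\<close> and allow estimates before it is known.\<close>

definition sqnorm :: "'b measure \<Rightarrow> ('b \<Rightarrow> complex) \<Rightarrow> ennreal" where
  "sqnorm M f = (\<integral>\<^sup>+\<omega>. ennreal ((cmod (f \<omega>))\<^sup>2) \<partial>M)"

definition L2_lim :: "'b measure \<Rightarrow> ('i \<Rightarrow> 'b \<Rightarrow> complex) \<Rightarrow> ('b \<Rightarrow> complex) \<Rightarrow> 'i filter \<Rightarrow> bool" where
  "L2_lim M u Y F \<longleftrightarrow> ((\<lambda>r. sqnorm M (\<lambda>\<omega>. u r \<omega> - Y \<omega>)) \<longlongrightarrow> 0) F"

lemma cmod_add_square_le: "(cmod (a + b))\<^sup>2 \<le> 2 * (cmod a)\<^sup>2 + 2 * (cmod b)\<^sup>2"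
proof -
  have "(cmod (a + b))\<^sup>2 \<le> (cmod a + cmod b)\<^sup>2" by (intro power_mono norm_triangle_ineq) auto
  also have "\<dots> \<le> 2 * (cmod a)\<^sup>2 + 2 * (cmod b)\<^sup>2"
    using zero_le_power2[of "cmod a - cmod b"] by (simp add: power2_eq_square algebra_simps)
  finally show ?thesis .
qed

lemma sqnorm_add:
  assumes [measurable]: "f \<in> borel_measurable M" "g \<in> borel_measurable M"
  shows "sqnorm M (\<lambda>\<omega>. f \<omega> + g \<omega>) \<le> 2 * sqnorm M f + 2 * sqnorm M g"
proof -
  have "sqnorm M (\<lambda>\<omega>. f \<omega> + g \<omega>) \<le> (\<integral>\<^sup>+\<omega>. 2 * ennreal ((cmod (f \<omega>))\<^sup>2) + 2 * ennreal ((cmod (g \<omega>))\<^sup>2) \<partial>M)"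
    unfolding sqnorm_def
  proof (intro nn_integral_mono)
    fix \<omega>
    have "ennreal ((cmod (f \<omega> + g \<omega>))\<^sup>2) \<le> ennreal (2 * (cmod (f \<omega>))\<^sup>2 + 2 * (cmod (g \<omega>))\<^sup>2)"
      by (intro ennreal_leI cmod_add_square_le)
    then show "ennreal ((cmod (f \<omega> + g \<omega>))\<^sup>2) \<le> 2 * ennreal ((cmod (f \<omega>))\<^sup>2) + 2 * ennreal ((cmod (g \<omega>))\<^sup>2)"
      by (simp add: ennreal_plus ennreal_mult)
  qed
  also have "\<dots> = 2 * sqnorm M f + 2 * sqnorm M g"
    by (subst nn_integral_add) (auto simp: nn_integral_cmult sqnorm_def)
  finally show ?thesis .
qed

lemma sqnorm_cmult:
  assumes [measurable]: "f \<in> borel_measurable M"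
  shows "sqnorm M (\<lambda>\<omega>. c * f \<omega>) = ennreal ((cmod c)\<^sup>2) * sqnorm M f"
  unfolding sqnorm_def by (simp add: norm_mult power_mult_distrib ennreal_mult nn_integral_cmult)

lemma sqnorm_minus_commute: "sqnorm M (\<lambda>\<omega>. f \<omega> - g \<omega>) = sqnorm M (\<lambda>\<omega>. g \<omega> - f \<omega>)"
  unfolding sqnorm_def by (simp add: norm_minus_commute)

lemma sqnorm_cong_AE: "AE \<omega> in M. f \<omega> = g \<omega> \<Longrightarrow> sqnorm M f = sqnorm M g"
  unfolding sqnorm_def by (intro nn_integral_cong_AE) auto

lemma sqnorm_triangle:
  assumes [measurable]: "f \<in> borel_measurable M" "g \<in> borel_measurable M" "h \<in> borel_measurable M"
  shows "sqnorm M (\<lambda>\<omega>. f \<omega> - h \<omega>) \<le> 2 * sqnorm M (\<lambda>\<omega>. f \<omega> - g \<omega>) + 2 * sqnorm M (\<lambda>\<omega>. h \<omega> - g \<omega>)"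
proof -
  have "sqnorm M (\<lambda>\<omega>. (f \<omega> - g \<omega>) + (g \<omega> - h \<omega>)) \<le> 2 * sqnorm M (\<lambda>\<omega>. f \<omega> - g \<omega>) + 2 * sqnorm M (\<lambda>\<omega>. g \<omega> - h \<omega>)"
    by (rule sqnorm_add) measurable
  then show ?thesis by (simp add: sqnorm_minus_commute[of M g h])
qed

lemma tendsto_ennreal_zero_sandwich:
  fixes f :: "'i \<Rightarrow> ennreal"
  assumes "(g \<longlongrightarrow> 0) F" "\<forall>\<^sub>F r in F. f r \<le> g r"
  shows "(f \<longlongrightarrow> 0) F"
  by (rule tendsto_sandwich[OF _ assms(2) tendsto_const assms(1)]) auto

lemma L2_lim_add:
  assumes u: "L2_lim M u Y F" "\<And>r. u r \<in> borel_measurable M" "Y \<in> borel_measurable M"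
    and v: "L2_lim M v Z F" "\<And>r. v r \<in> borel_measurable M" "Z \<in> borel_measurable M"
  shows "L2_lim M (\<lambda>r \<omega>. u r \<omega> + v r \<omega>) (\<lambda>\<omega>. Y \<omega> + Z \<omega>) F"
  unfolding L2_lim_def
proof (rule tendsto_ennreal_zero_sandwich)
  note [measurable] = u(2,3) v(2,3)
  have "((\<lambda>r. 2 * sqnorm M (\<lambda>\<omega>. u r \<omega> - Y \<omega>) + 2 * sqnorm M (\<lambda>\<omega>. v r \<omega> - Z \<omega>)) \<longlongrightarrow> 2 * 0 + 2 * 0) F"
    using u(1) v(1) unfolding L2_lim_def by (intro tendsto_add ennreal_tendsto_cmult) auto
  then show "((\<lambda>r. 2 * sqnorm M (\<lambda>\<omega>. u r \<omega> - Y \<omega>) + 2 * sqnorm M (\<lambda>\<omega>. v r \<omega> - Z \<omega>)) \<longlongrightarrow> 0) F" by simp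
  show "\<forall>\<^sub>F r in F. sqnorm M (\<lambda>\<omega>. u r \<omega> + v r \<omega> - (Y \<omega> + Z \<omega>)) \<le> 2 * sqnorm M (\<lambda>\<omega>. u r \<omega> - Y \<omega>) + 2 * sqnorm M (\<lambda>\<omega>. v r \<omega> - Z \<omega>)"
  proof (rule always_eventually, rule allI)
    fix r
    have "sqnorm M (\<lambda>\<omega>. (u r \<omega> - Y \<omega>) + (v r \<omega> - Z \<omega>)) \<le> 2 * sqnorm M (\<lambda>\<omega>. u r \<omega> - Y \<omega>) + 2 * sqnorm M (\<lambda>\<omega>. v r \<omega> - Z \<omega>)"
      by (rule sqnorm_add) measurable
    then show "sqnorm M (\<lambda>\<omega>. u r \<omega> + v r \<omega> - (Y \<omega> + Z \<omega>)) \<le> 2 * sqnorm M (\<lambda>\<omega>. u r \<omega> - Y \<omega>) + 2 * sqnorm M (\<lambda>\<omega>. v r \<omega> - Z \<omega>)"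
      by (simp add: algebra_simps)
  qed
qed

lemma L2_lim_cmult:
  assumes "L2_lim M u Y F" "\<And>r. u r \<in> borel_measurable M" "Y \<in> borel_measurable M"
  shows "L2_lim M (\<lambda>r \<omega>. c * u r \<omega>) (\<lambda>\<omega>. c * Y \<omega>) F"
proof -
  note [measurable] = assms(2,3)
  have "((\<lambda>r. ennreal ((cmod c)\<^sup>2) * sqnorm M (\<lambda>\<omega>. u r \<omega> - Y \<omega>)) \<longlongrightarrow> ennreal ((cmod c)\<^sup>2) * 0) F"
    using assms(1) unfolding L2_lim_def by (intro ennreal_tendsto_cmult) auto
  moreover have "ennreal ((cmod c)\<^sup>2) * sqnorm M (\<lambda>\<omega>. u r \<omega> - Y \<omega>) = sqnorm M (\<lambda>\<omega>. c * u r \<omega> - c * Y \<omega>)" for r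
    by (subst sqnorm_cmult[symmetric]) (auto simp: right_diff_distrib)
  ultimately show ?thesis unfolding L2_lim_def by simp
qed

lemma L2_lim_diff:
  assumes "L2_lim M u Y F" "\<And>r. u r \<in> borel_measurable M" "Y \<in> borel_measurable M"
    and "L2_lim M v Z F" "\<And>r. v r \<in> borel_measurable M" "Z \<in> borel_measurable M"
  shows "L2_lim M (\<lambda>r \<omega>. u r \<omega> - v r \<omega>) (\<lambda>\<omega>. Y \<omega> - Z \<omega>) F"
proof -
  note [measurable] = assms(2,3,5,6)
  have "L2_lim M (\<lambda>r \<omega>. u r \<omega> + (-1) * v r \<omega>) (\<lambda>\<omega>. Y \<omega> + (-1) * Z \<omega>) F"
    by (intro L2_lim_add L2_lim_cmult assms) measurable
  then show ?thesis by simp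
qed

lemma L2_lim_cong:
  assumes "L2_lim M u Y F" "\<forall>\<^sub>F r in F. AE \<omega> in M. u r \<omega> = v r \<omega>" "AE \<omega> in M. Y \<omega> = Z \<omega>"
  shows "L2_lim M v Z F"
  unfolding L2_lim_def
proof (rule Lim_transform_eventually[OF assms(1)[unfolded L2_lim_def]])
  show "\<forall>\<^sub>F r in F. sqnorm M (\<lambda>\<omega>. u r \<omega> - Y \<omega>) = sqnorm M (\<lambda>\<omega>. v r \<omega> - Z \<omega>)"
    using assms(2)
  proof eventually_elim
    case (elim r)
    show ?case by (rule sqnorm_cong_AE) (use elim assms(3) in eventually_elim, simp)
  qed
qed

lemma L2_lim_filterlim: "L2_lim M u Y F \<Longrightarrow> filterlim g F G \<Longrightarrow> L2_lim M (\<lambda>n. u (g n)) Y G"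
  unfolding L2_lim_def by (rule filterlim_compose)

lemma L2_lim_unique:
  assumes "L2_lim M u Y F" "L2_lim M u Z F" "F \<noteq> bot"
    and [measurable]: "\<And>r. u r \<in> borel_measurable M" "Y \<in> borel_measurable M" "Z \<in> borel_measurable M"
  shows "AE \<omega> in M. Y \<omega> = Z \<omega>"
proof -
  have "L2_lim M (\<lambda>r \<omega>. u r \<omega> - u r \<omega>) (\<lambda>\<omega>. Y \<omega> - Z \<omega>) F"
    by (rule L2_lim_diff) (use assms in auto)
  then have "((\<lambda>r. sqnorm M (\<lambda>\<omega>. 0 - (Y \<omega> - Z \<omega>))) \<longlongrightarrow> 0) F" unfolding L2_lim_def by simp
  then have "sqnorm M (\<lambda>\<omega>. 0 - (Y \<omega> - Z \<omega>)) = 0"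
    using tendsto_unique[OF assms(3) _ tendsto_const] by metis
  then have "AE \<omega> in M. ennreal ((cmod (0 - (Y \<omega> - Z \<omega>)))\<^sup>2) = 0"
    unfolding sqnorm_def by (subst (asm) nn_integral_0_iff_AE) auto
  then show ?thesis by eventually_elim (auto simp: ennreal_eq_0_iff)
qed

lemma L2_lim_dominated:
  fixes u :: "real \<Rightarrow> 'b \<Rightarrow> complex"
  assumes [measurable]: "\<And>r. u r \<in> borel_measurable M" "Y \<in> borel_measurable M" "b \<in> borel_measurable M"
    and lim: "\<And>x. x \<in> space M \<Longrightarrow> ((\<lambda>r. u r x) \<longlongrightarrow> Y x) at_top"
    and bound: "\<forall>\<^sub>F r in at_top. \<forall>x\<in>space M. cmod (u r x - Y x) \<le> b x"
    and b: "integrable M (\<lambda>x. (b x)\<^sup>2)"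
  shows "L2_lim M u Y at_top"
proof -
  have bound': "\<forall>\<^sub>F r in at_top. AE x in M. norm ((cmod (u r x - Y x))\<^sup>2) \<le> (b x)\<^sup>2"
    using bound by eventually_elim (auto intro!: power_mono)
  have "((\<lambda>r. \<integral>x. (cmod (u r x - Y x))\<^sup>2 \<partial>M) \<longlongrightarrow> (\<integral>x. 0 \<partial>M)) at_top"
  proof (rule integral_dominated_convergence_at_top[OF _ _ b _ bound'])
    show "AE x in M. ((\<lambda>r. (cmod (u r x - Y x))\<^sup>2) \<longlongrightarrow> 0) at_top"
    proof (rule AE_I2)
      fix x assume "x \<in> space M"
      from tendsto_power[OF tendsto_norm[OF tendsto_diff[OF lim[OF this] tendsto_const, of "Y x"]], of 2]
      show "((\<lambda>r. (cmod (u r x - Y x))\<^sup>2) \<longlongrightarrow> 0) at_top" by simp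
    qed
  qed auto
  then have "((\<lambda>r. ennreal (\<integral>x. (cmod (u r x - Y x))\<^sup>2 \<partial>M)) \<longlongrightarrow> ennreal 0) at_top"
    by (intro tendsto_ennrealI) simp
  moreover have "\<forall>\<^sub>F r in at_top. ennreal (\<integral>x. (cmod (u r x - Y x))\<^sup>2 \<partial>M) = sqnorm M (\<lambda>\<omega>. u r \<omega> - Y \<omega>)"
    using bound'
  proof eventually_elim
    case (elim r)
    have "integrable M (\<lambda>x. (cmod (u r x - Y x))\<^sup>2)"
      by (rule Bochner_Integration.integrable_bound[OF b]) (use elim in auto)
    then show ?case unfolding sqnorm_def by (intro nn_integral_eq_integral[symmetric]) auto
  qed
  ultimately show ?thesis unfolding L2_lim_def by (auto elim: Lim_transform_eventually)
qed

text \<open>If the expected squares are summable, the sum of the squares is almost surely finite, so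
  its terms tend to 0.\<close>

lemma AE_tendsto_0_of_suminf_sqnorm:
  assumes [measurable]: "\<And>k. w k \<in> borel_measurable M" and fin: "(\<Sum>k. sqnorm M (w k)) < \<infinity>"
  shows "AE \<omega> in M. (\<lambda>k. w k \<omega>) \<longlonglongrightarrow> 0"
proof -
  have "(\<integral>\<^sup>+\<omega>. (\<Sum>k. ennreal ((cmod (w k \<omega>))\<^sup>2)) \<partial>M) < \<infinity>"
    using fin unfolding sqnorm_def by (subst nn_integral_suminf) auto
  then have "AE \<omega> in M. (\<Sum>k. ennreal ((cmod (w k \<omega>))\<^sup>2)) \<noteq> \<infinity>"
    by (intro nn_integral_noteq_infinite) auto
  then show ?thesis
  proof eventually_elim
    case (elim \<omega>)
    then have "summable (\<lambda>k. (cmod (w k \<omega>))\<^sup>2)"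
      by (intro summable_suminf_not_top) auto
    from tendsto_real_sqrt[OF summable_LIMSEQ_zero[OF this]]
    have "(\<lambda>k. cmod (w k \<omega>)) \<longlonglongrightarrow> 0" by simp
    then show ?case by (rule tendsto_norm_zero_cancel)
  qed
qed

text \<open>Riesz-Fischer for a family indexed by the reals: a fast subsequence converges almost
  surely, and Fatou's lemma carries the Cauchy bound over to its limit.\<close>

lemma L2_complete:
  fixes u :: "real \<Rightarrow> 'b \<Rightarrow> complex"
  assumes [measurable]: "\<And>r. u r \<in> borel_measurable M"
    and cauchy: "\<And>e. e > 0 \<Longrightarrow> \<exists>T. \<forall>r\<ge>T. \<forall>s\<ge>T. sqnorm M (\<lambda>\<omega>. u r \<omega> - u s \<omega>) \<le> ennreal e"
  obtains Y where "Y \<in> borel_measurable M" "L2_lim M u Y at_top"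
proof -
  \<comment> \<open>The rate 1/8 leaves summable squares after the differences are multiplied by
    2^k, since 4^k / 8^k = 2^-k; hence the differences are almost surely O(2^-k).\<close>
  have "\<forall>k::nat. \<exists>T. \<forall>r\<ge>T. \<forall>s\<ge>T. sqnorm M (\<lambda>\<omega>. u r \<omega> - u s \<omega>) \<le> ennreal ((1/8)^k)"
    using cauchy by simp
  then obtain T where T: "\<And>k r s. r \<ge> T k \<Longrightarrow> s \<ge> T k \<Longrightarrow> sqnorm M (\<lambda>\<omega>. u r \<omega> - u s \<omega>) \<le> ennreal ((1/8)^k)"
    by metis
  \<comment> \<open>Summing the absolute values makes \<open>S n\<close> at least \<open>T k\<close>
    for all k \<le> n without assuming \<open>T\<close> monotone.\<close>
  define S where "S k = real k + (\<Sum>i\<le>k. \<bar>T i\<bar>)" for k :: nat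
  have ST: "S n \<ge> T k" if "k \<le> n" for k n
  proof -
    have "\<bar>T k\<bar> \<le> (\<Sum>i\<le>n. \<bar>T i\<bar>)" using that by (intro member_le_sum) auto
    then show ?thesis by (simp add: S_def)
  qed
  define v where "v k = u (S k)" for k
  have [measurable]: "v k \<in> borel_measurable M" for k by (simp add: v_def)
  have "(\<Sum>k. sqnorm M (\<lambda>\<omega>. of_real (2^k) * (v (Suc k) \<omega> - v k \<omega>))) \<le> (\<Sum>k. ennreal ((1/2)^k))"
  proof (rule suminf_le)
    fix k
    have "sqnorm M (\<lambda>\<omega>. of_real (2^k) * (v (Suc k) \<omega> - v k \<omega>)) = ennreal ((2^k)\<^sup>2) * sqnorm M (\<lambda>\<omega>. v (Suc k) \<omega> - v k \<omega>)"
      by (subst sqnorm_cmult) (auto simp: norm_power)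
    also have "\<dots> \<le> ennreal ((2^k)\<^sup>2) * ennreal ((1/8)^k)"
      unfolding v_def by (intro mult_left_mono T ST) auto
    also have "\<dots> = ennreal ((1/2)^k)"
      by (simp add: ennreal_mult[symmetric] power2_eq_square flip: power_mult_distrib)
    finally show "sqnorm M (\<lambda>\<omega>. of_real (2^k) * (v (Suc k) \<omega> - v k \<omega>)) \<le> ennreal ((1/2)^k)" .
  qed auto
  also have "\<dots> = ennreal (\<Sum>k. (1/2)^k)"
    by (rule suminf_ennreal2) (auto intro: summable_geometric)
  also have "\<dots> < \<infinity>" by simp
  finally have "AE \<omega> in M. (\<lambda>k. of_real (2^k) * (v (Suc k) \<omega> - v k \<omega>)) \<longlonglongrightarrow> 0"
    by (intro AE_tendsto_0_of_suminf_sqnorm) measurable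
  then have conv: "AE \<omega> in M. convergent (\<lambda>k. v k \<omega>)"
  proof eventually_elim
    case (elim \<omega>)
    then have "Bseq (\<lambda>k. of_real (2^k) * (v (Suc k) \<omega> - v k \<omega>))"
      by (intro convergent_imp_Bseq convergentI)
    then obtain C where C: "\<And>k. cmod (of_real (2^k) * (v (Suc k) \<omega> - v k \<omega>)) \<le> C" by (auto simp: Bseq_def)
    have "summable (\<lambda>k. v (Suc k) \<omega> - v k \<omega>)"
    proof (rule summable_comparison_test')
      show "summable (\<lambda>k. C * (1/2)^k)" by (intro summable_mult summable_geometric) simp
      fix k :: nat
      show "norm (v (Suc k) \<omega> - v k \<omega>) \<le> C * (1/2)^k"
      proof -
        have "2 ^ k * cmod (v (Suc k) \<omega> - v k \<omega>) \<le> C" using C[of k] unfolding norm_mult norm_of_real by simp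
        then show ?thesis by (simp add: power_divide pos_le_divide_eq mult.commute)
      qed
    qed
    then have "convergent (\<lambda>n. v n \<omega> - v 0 \<omega>)" by (simp add: summable_iff_convergent sum_lessThan_telescope[of "\<lambda>k. v k \<omega>"])
    from convergent_add[OF this convergent_const[of "v 0 \<omega>"]] show ?case by simp
  qed
  define Y where "Y \<omega> = lim (\<lambda>k. v k \<omega>)" for \<omega>
  have [measurable]: "Y \<in> borel_measurable M" unfolding Y_def[abs_def] by measurable
  have bound: "sqnorm M (\<lambda>\<omega>. u r \<omega> - Y \<omega>) \<le> ennreal ((1/8)^k)" if r: "r \<ge> T k" for r k
  proof -
    have "sqnorm M (\<lambda>\<omega>. u r \<omega> - Y \<omega>) = (\<integral>\<^sup>+\<omega>. liminf (\<lambda>n. ennreal ((cmod (u r \<omega> - v n \<omega>))\<^sup>2)) \<partial>M)"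
      unfolding sqnorm_def
    proof (rule nn_integral_cong_AE)
      show "AE \<omega> in M. ennreal ((cmod (u r \<omega> - Y \<omega>))\<^sup>2) = liminf (\<lambda>n. ennreal ((cmod (u r \<omega> - v n \<omega>))\<^sup>2))"
        using conv
      proof eventually_elim
        case (elim \<omega>)
        then have "(\<lambda>n. v n \<omega>) \<longlonglongrightarrow> Y \<omega>" unfolding Y_def by (simp add: convergent_LIMSEQ_iff)
        then have "(\<lambda>n. ennreal ((cmod (u r \<omega> - v n \<omega>))\<^sup>2)) \<longlonglongrightarrow> ennreal ((cmod (u r \<omega> - Y \<omega>))\<^sup>2)"
          by (intro tendsto_ennrealI tendsto_intros)
        then show ?case by (intro lim_imp_Liminf[symmetric]) auto
      qed
    qed
    also have "\<dots> \<le> liminf (\<lambda>n. sqnorm M (\<lambda>\<omega>. u r \<omega> - v n \<omega>))"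
      unfolding sqnorm_def by (rule nn_integral_liminf) measurable
    also have "\<dots> \<le> ennreal ((1/8)^k)"
    proof (rule Liminf_le)
      show "\<forall>\<^sub>F n in sequentially. sqnorm M (\<lambda>\<omega>. u r \<omega> - v n \<omega>) \<le> ennreal ((1/8)^k)"
        using eventually_ge_at_top[of k] by eventually_elim (simp add: v_def T ST r)
    qed simp
    finally show ?thesis .
  qed
  have "L2_lim M u Y at_top"
    unfolding L2_lim_def
  proof (rule order_tendstoI)
    fix a :: ennreal assume "0 < a"
    have "(\<lambda>k. ennreal ((1/8)^k)) \<longlonglongrightarrow> ennreal 0"
      by (intro tendsto_ennrealI LIMSEQ_realpow_zero) auto
    then have "\<forall>\<^sub>F k in sequentially. ennreal ((1/8)^k) < a" using \<open>0 < a\<close> by (intro order_tendstoD(2)) auto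
    then obtain k where k: "ennreal ((1/8)^k) < a" by (auto simp: eventually_sequentially)
    show "\<forall>\<^sub>F r in at_top. sqnorm M (\<lambda>\<omega>. u r \<omega> - Y \<omega>) < a"
      using eventually_ge_at_top[of "T k"] by eventually_elim (rule le_less_trans[OF bound k])
  qed auto
  then show thesis by (intro that[of Y]) auto
qed

lemma nn_integral_mult_square_le:
  assumes [measurable]: "f \<in> borel_measurable M" "g \<in> borel_measurable M"
  shows "(\<integral>\<^sup>+\<omega>. ennreal (cmod (f \<omega> * g \<omega>)) \<partial>M)\<^sup>2 \<le> sqnorm M f * sqnorm M g"
proof -
  have "(\<integral>\<^sup>+\<omega>. ennreal (cmod (f \<omega>)) * ennreal (cmod (g \<omega>)) \<partial>M)\<^sup>2 \<le>
      (\<integral>\<^sup>+\<omega>. (ennreal (cmod (f \<omega>)))\<^sup>2 \<partial>M) * (\<integral>\<^sup>+\<omega>. (ennreal (cmod (g \<omega>)))\<^sup>2 \<partial>M)"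
    by (rule Cauchy_Schwarz_nn_integral) measurable
  moreover have "ennreal (cmod (x * y)) = ennreal (cmod x) * ennreal (cmod y)" for x y
    by (simp add: norm_mult ennreal_mult)
  moreover have "(ennreal (cmod x))\<^sup>2 = ennreal ((cmod x)\<^sup>2)" for x
    by (rule ennreal_power) simp
  ultimately show ?thesis unfolding sqnorm_def by (simp only:)
qed

lemma integrable_mult_cnj:
  assumes [measurable]: "f \<in> borel_measurable M" "g \<in> borel_measurable M"
    and "sqnorm M f < \<infinity>" "sqnorm M g < \<infinity>"
  shows "integrable M (\<lambda>\<omega>. f \<omega> * cnj (g \<omega>))"
proof (rule integrableI_bounded)
  have "(\<integral>\<^sup>+\<omega>. ennreal (cmod (f \<omega> * g \<omega>)) \<partial>M)\<^sup>2 < \<infinity>"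
    by (rule le_less_trans[OF nn_integral_mult_square_le[OF assms(1,2)]])
       (use assms(3,4) in \<open>simp add: ennreal_mult_less_top\<close>)
  then show "(\<integral>\<^sup>+\<omega>. ennreal (norm (f \<omega> * cnj (g \<omega>))) \<partial>M) < \<infinity>"
    by (simp add: norm_mult power_less_top_ennreal)
qed measurable

lemma norm_integral_mult_cnj:
  assumes [measurable]: "f \<in> borel_measurable M" "g \<in> borel_measurable M"
    and "sqnorm M f < \<infinity>" "sqnorm M g < \<infinity>"
  shows "ennreal ((cmod (\<integral>\<omega>. f \<omega> * cnj (g \<omega>) \<partial>M))\<^sup>2) \<le> sqnorm M f * sqnorm M g"
proof -
  have "ennreal (cmod (\<integral>\<omega>. f \<omega> * cnj (g \<omega>) \<partial>M)) \<le> (\<integral>\<^sup>+\<omega>. ennreal (norm (f \<omega> * cnj (g \<omega>))) \<partial>M)"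
    by (rule integral_norm_bound_ennreal[OF integrable_mult_cnj[OF assms]])
  also have "\<dots> = (\<integral>\<^sup>+\<omega>. ennreal (cmod (f \<omega> * g \<omega>)) \<partial>M)" by (simp add: norm_mult)
  finally have "(ennreal (cmod (\<integral>\<omega>. f \<omega> * cnj (g \<omega>) \<partial>M)))\<^sup>2 \<le> (\<integral>\<^sup>+\<omega>. ennreal (cmod (f \<omega> * g \<omega>)) \<partial>M)\<^sup>2"
    by (intro power_mono) auto
  also have "\<dots> \<le> sqnorm M f * sqnorm M g" by (rule nn_integral_mult_square_le) measurable
  finally show ?thesis by (simp add: ennreal_power)
qed

lemma L2_lim_finite:
  assumes "L2_lim M u Y F" "F \<noteq> bot" and [measurable]: "\<And>r. u r \<in> borel_measurable M" "Y \<in> borel_measurable M"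
    and "\<And>r. sqnorm M (u r) < \<infinity>"
  shows "sqnorm M Y < \<infinity>"
proof -
  have "\<forall>\<^sub>F r in F. sqnorm M (\<lambda>\<omega>. u r \<omega> - Y \<omega>) < 1"
    using assms(1) unfolding L2_lim_def by (rule order_tendstoD) auto
  then obtain r where r: "sqnorm M (\<lambda>\<omega>. u r \<omega> - Y \<omega>) < 1" using assms(2) eventually_happens' by blast
  have "sqnorm M (\<lambda>\<omega>. u r \<omega> + (-1) * (u r \<omega> - Y \<omega>)) \<le> 2 * sqnorm M (u r) + 2 * sqnorm M (\<lambda>\<omega>. (-1) * (u r \<omega> - Y \<omega>))"
    by (rule sqnorm_add) measurable
  also have "sqnorm M (\<lambda>\<omega>. (-1) * (u r \<omega> - Y \<omega>)) = sqnorm M (\<lambda>\<omega>. u r \<omega> - Y \<omega>)"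
    by (subst sqnorm_cmult) auto
  also have "2 * sqnorm M (u r) + 2 * sqnorm M (\<lambda>\<omega>. u r \<omega> - Y \<omega>) < \<infinity>"
    using assms(5)[of r] r by (auto simp: ennreal_mult_less_top less_trans[OF r])
  finally show ?thesis by simp
qed

text \<open>Expanding both factors around their limits leaves three error terms, each small by
  Cauchy-Schwarz.\<close>

lemma L2_lim_integral_mult_cnj:
  assumes u: "L2_lim M u Y F" "\<And>r. u r \<in> borel_measurable M" "Y \<in> borel_measurable M" "\<And>r. sqnorm M (u r) < \<infinity>"
    and v: "L2_lim M v Z F" "\<And>r. v r \<in> borel_measurable M" "Z \<in> borel_measurable M" "\<And>r. sqnorm M (v r) < \<infinity>"
    and F: "F \<noteq> bot"
  shows "((\<lambda>r. \<integral>\<omega>. u r \<omega> * cnj (v r \<omega>) \<partial>M) \<longlongrightarrow> (\<integral>\<omega>. Y \<omega> * cnj (Z \<omega>) \<partial>M)) F"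
proof -
  note [measurable] = u(2,3) v(2,3)
  have Yf: "sqnorm M Y < \<infinity>" and Zf: "sqnorm M Z < \<infinity>"
    using L2_lim_finite[OF u(1) F u(2,3,4)] L2_lim_finite[OF v(1) F v(2,3,4)] by auto
  have df: "sqnorm M (\<lambda>\<omega>. u r \<omega> - Y \<omega>) < \<infinity>" "sqnorm M (\<lambda>\<omega>. v r \<omega> - Z \<omega>) < \<infinity>" for r
  proof -
    have "sqnorm M (\<lambda>\<omega>. f \<omega> - g \<omega>) < \<infinity>" if [measurable]: "f \<in> borel_measurable M" "g \<in> borel_measurable M"
      and fin: "sqnorm M f < \<infinity>" "sqnorm M g < \<infinity>" for f g
    proof -
      have "sqnorm M (\<lambda>\<omega>. f \<omega> - g \<omega>) \<le> 2 * sqnorm M (\<lambda>\<omega>. f \<omega> - 0) + 2 * sqnorm M (\<lambda>\<omega>. g \<omega> - 0)"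
        by (rule sqnorm_triangle) measurable
      also have "\<dots> < \<infinity>" using fin by (auto simp: ennreal_mult_less_top)
      finally show ?thesis .
    qed
    then show "sqnorm M (\<lambda>\<omega>. u r \<omega> - Y \<omega>) < \<infinity>" "sqnorm M (\<lambda>\<omega>. v r \<omega> - Z \<omega>) < \<infinity>" using u(4) v(4) Yf Zf by auto
  qed
  define a where "a r = (\<integral>\<omega>. (u r \<omega> - Y \<omega>) * cnj (v r \<omega> - Z \<omega>) \<partial>M)" for r
  define b where "b r = (\<integral>\<omega>. (u r \<omega> - Y \<omega>) * cnj (Z \<omega>) \<partial>M)" for r
  define c where "c r = (\<integral>\<omega>. Y \<omega> * cnj (v r \<omega> - Z \<omega>) \<partial>M)" for r
  have a_le: "ennreal ((cmod (a r))\<^sup>2) \<le> sqnorm M (\<lambda>\<omega>. u r \<omega> - Y \<omega>) * sqnorm M (\<lambda>\<omega>. v r \<omega> - Z \<omega>)" for r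
    unfolding a_def by (rule norm_integral_mult_cnj[OF _ _ df]) measurable
  have b_le: "ennreal ((cmod (b r))\<^sup>2) \<le> sqnorm M (\<lambda>\<omega>. u r \<omega> - Y \<omega>) * sqnorm M Z" for r
    unfolding b_def by (rule norm_integral_mult_cnj[OF _ _ df(1) Zf]) measurable
  have c_le: "ennreal ((cmod (c r))\<^sup>2) \<le> sqnorm M Y * sqnorm M (\<lambda>\<omega>. v r \<omega> - Z \<omega>)" for r
    unfolding c_def by (rule norm_integral_mult_cnj[OF _ _ Yf df(2)]) measurable
  have lim: "(f \<longlongrightarrow> 0) F" if "((\<lambda>r. g r) \<longlongrightarrow> 0) F" "\<And>r. ennreal ((cmod (f r))\<^sup>2) \<le> g r" for f :: "_ \<Rightarrow> complex" and g
  proof -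
    have "((\<lambda>r. ennreal ((cmod (f r))\<^sup>2)) \<longlongrightarrow> ennreal 0) F"
      using tendsto_ennreal_zero_sandwich[OF that(1)] that(2) by simp
    then have "((\<lambda>r. (cmod (f r))\<^sup>2) \<longlongrightarrow> 0) F" by (subst (asm) tendsto_ennreal_iff) auto
    from tendsto_real_sqrt[OF this] have "((\<lambda>r. cmod (f r)) \<longlongrightarrow> 0) F" by simp
    then show ?thesis by (rule tendsto_norm_zero_cancel)
  qed
  have "((\<lambda>r. sqnorm M (\<lambda>\<omega>. u r \<omega> - Y \<omega>) * sqnorm M Z) \<longlongrightarrow> 0 * sqnorm M Z) F"
    using u(1) Zf unfolding L2_lim_def mult.commute[of _ "sqnorm M Z"] by (intro ennreal_tendsto_cmult) auto
  then have bl: "(b \<longlongrightarrow> 0) F"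
    by (intro lim[of "\<lambda>r. sqnorm M (\<lambda>\<omega>. u r \<omega> - Y \<omega>) * sqnorm M Z"]) (auto intro: b_le)
  have "((\<lambda>r. sqnorm M Y * sqnorm M (\<lambda>\<omega>. v r \<omega> - Z \<omega>)) \<longlongrightarrow> sqnorm M Y * 0) F"
    using v(1) Yf unfolding L2_lim_def by (intro ennreal_tendsto_cmult) auto
  then have cl: "(c \<longlongrightarrow> 0) F"
    by (intro lim[of "\<lambda>r. sqnorm M Y * sqnorm M (\<lambda>\<omega>. v r \<omega> - Z \<omega>)"]) (auto intro: c_le)
  have "((\<lambda>r. sqnorm M (\<lambda>\<omega>. u r \<omega> - Y \<omega>) * sqnorm M (\<lambda>\<omega>. v r \<omega> - Z \<omega>)) \<longlongrightarrow> 0) F"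
  proof (rule tendsto_ennreal_zero_sandwich)
    show "((\<lambda>r. sqnorm M (\<lambda>\<omega>. u r \<omega> - Y \<omega>)) \<longlongrightarrow> 0) F" using u(1) unfolding L2_lim_def .
    have "\<forall>\<^sub>F r in F. sqnorm M (\<lambda>\<omega>. v r \<omega> - Z \<omega>) < 1" using v(1) unfolding L2_lim_def by (rule order_tendstoD) auto
    then show "\<forall>\<^sub>F r in F. sqnorm M (\<lambda>\<omega>. u r \<omega> - Y \<omega>) * sqnorm M (\<lambda>\<omega>. v r \<omega> - Z \<omega>) \<le> sqnorm M (\<lambda>\<omega>. u r \<omega> - Y \<omega>)"
    proof eventually_elim
      case (elim r)
      then show ?case using mult_left_mono[of "sqnorm M (\<lambda>\<omega>. v r \<omega> - Z \<omega>)" 1 "sqnorm M (\<lambda>\<omega>. u r \<omega> - Y \<omega>)"] by simp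
    qed
  qed
  then have al: "(a \<longlongrightarrow> 0) F"
    by (intro lim[of "\<lambda>r. sqnorm M (\<lambda>\<omega>. u r \<omega> - Y \<omega>) * sqnorm M (\<lambda>\<omega>. v r \<omega> - Z \<omega>)"]) (auto intro: a_le)
  have eq: "(\<integral>\<omega>. u r \<omega> * cnj (v r \<omega>) \<partial>M) = a r + b r + c r + (\<integral>\<omega>. Y \<omega> * cnj (Z \<omega>) \<partial>M)" for r
  proof -
    have ints: "integrable M (\<lambda>\<omega>. (u r \<omega> - Y \<omega>) * cnj (v r \<omega> - Z \<omega>))" "integrable M (\<lambda>\<omega>. (u r \<omega> - Y \<omega>) * cnj (Z \<omega>))"
      "integrable M (\<lambda>\<omega>. Y \<omega> * cnj (v r \<omega> - Z \<omega>))" "integrable M (\<lambda>\<omega>. Y \<omega> * cnj (Z \<omega>))"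
      by (intro integrable_mult_cnj df Yf Zf; measurable)+
    have "(\<integral>\<omega>. u r \<omega> * cnj (v r \<omega>) \<partial>M) = (\<integral>\<omega>. (u r \<omega> - Y \<omega>) * cnj (v r \<omega> - Z \<omega>) + (u r \<omega> - Y \<omega>) * cnj (Z \<omega>) + Y \<omega> * cnj (v r \<omega> - Z \<omega>) + Y \<omega> * cnj (Z \<omega>) \<partial>M)"
      by (intro Bochner_Integration.integral_cong) (auto simp: algebra_simps)
    also have "\<dots> = a r + b r + c r + (\<integral>\<omega>. Y \<omega> * cnj (Z \<omega>) \<partial>M)"
      unfolding a_def b_def c_def using ints by (simp only: Bochner_Integration.integral_add Bochner_Integration.integrable_add)
    finally show ?thesis .
  qed
  have "((\<lambda>r. a r + b r + c r + (\<integral>\<omega>. Y \<omega> * cnj (Z \<omega>) \<partial>M)) \<longlongrightarrow> 0 + 0 + 0 + (\<integral>\<omega>. Y \<omega> * cnj (Z \<omega>) \<partial>M)) F"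
    by (intro tendsto_add al bl cl tendsto_const)
  then show ?thesis unfolding eq by simp
qed

lemma (in prob_space) integrable_of_sqnorm:
  assumes "f \<in> borel_measurable M" "sqnorm M f < \<infinity>"
  shows "integrable M f"
proof -
  have "sqnorm M (\<lambda>_. 1) < \<infinity>" by (simp add: sqnorm_def emeasure_space_1)
  from integrable_mult_cnj[OF assms(1) _ assms(2) this] show ?thesis by simp
qed

lemma (in prob_space) covar_eq:
  assumes f: "f \<in> borel_measurable M" "sqnorm M f < \<infinity>" and g: "g \<in> borel_measurable M" "sqnorm M g < \<infinity>"
  shows "covar M f g = (\<integral>\<omega>. f \<omega> * cnj (g \<omega>) \<partial>M) - expect M f * cnj (expect M g)"
proof -
  note int = integrable_of_sqnorm[OF f] integrable_of_sqnorm[OF g] integrable_mult_cnj[OF f(1) g(1) f(2) g(2)]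
  have intc: "integrable M (\<lambda>\<omega>. cnj (g \<omega>))" using int(2) by simp
  have "covar M f g = (\<integral>\<omega>. f \<omega> * cnj (g \<omega>) - f \<omega> * cnj (expect M g) - expect M f * cnj (g \<omega>) + expect M f * cnj (expect M g) \<partial>M)"
    unfolding covar_def by (intro Bochner_Integration.integral_cong) (auto simp: algebra_simps)
  also have "\<dots> = (\<integral>\<omega>. f \<omega> * cnj (g \<omega>) \<partial>M) - expect M f * cnj (expect M g) - expect M f * cnj (expect M g) + expect M f * cnj (expect M g)"
    using int intc by (simp add: expect_def prob_space)
  finally show ?thesis by simp
qed

text \<open>An expectation is a scalar product with the constant 1, so the product of the means
  converges along with the mixed moment.\<close>

lemma (in prob_space) L2_lim_covar:
  assumes u: "L2_lim M u Y F" "\<And>r. u r \<in> borel_measurable M" "Y \<in> borel_measurable M" "\<And>r. sqnorm M (u r) < \<infinity>"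
    and v: "L2_lim M v Z F" "\<And>r. v r \<in> borel_measurable M" "Z \<in> borel_measurable M" "\<And>r. sqnorm M (v r) < \<infinity>"
    and F: "F \<noteq> bot"
  shows "((\<lambda>r. covar M (u r) (v r)) \<longlongrightarrow> covar M Y Z) F"
proof -
  have Yf: "sqnorm M Y < \<infinity>" and Zf: "sqnorm M Z < \<infinity>"
    using L2_lim_finite[OF u(1) F u(2,3,4)] L2_lim_finite[OF v(1) F v(2,3,4)] by auto
  have one: "L2_lim M (\<lambda>_ _. 1) (\<lambda>_. 1) F" "sqnorm M (\<lambda>_. 1) < \<infinity>"
    by (simp_all add: L2_lim_def sqnorm_def emeasure_space_1)
  have "((\<lambda>r. expect M (u r)) \<longlongrightarrow> expect M Y) F" "((\<lambda>r. expect M (v r)) \<longlongrightarrow> expect M Z) F"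
    using L2_lim_integral_mult_cnj[OF u one(1) _ _ one(2) F] L2_lim_integral_mult_cnj[OF v one(1) _ _ one(2) F]
    by (simp_all add: expect_def)
  then have "((\<lambda>r. (\<integral>\<omega>. u r \<omega> * cnj (v r \<omega>) \<partial>M) - expect M (u r) * cnj (expect M (v r))) \<longlongrightarrow>
     (\<integral>\<omega>. Y \<omega> * cnj (Z \<omega>) \<partial>M) - expect M Y * cnj (expect M Z)) F"
    by (intro tendsto_intros L2_lim_integral_mult_cnj u v F)
  then show ?thesis unfolding covar_eq[OF u(2,4) v(2,4)] covar_eq[OF u(3) Yf v(3) Zf] .
qed

subsection \<open>Oscillation\<close>

text \<open>Dominates every increment of \<open>h\<close> between two points near \<open>y\<close>,
  not only the increments from \<open>y\<close>; it can thus serve as the locally uniform majorant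
  demanded by \<open>sqnorm_lint_le\<close>.\<close>

definition oscill :: "(complex \<Rightarrow> complex) \<Rightarrow> real \<Rightarrow> complex \<Rightarrow> ennreal" where
  "oscill h d y = (SUP p\<in>ball y d \<times> ball y d. ennreal (cmod (h (fst p) - h (snd p))))"

text \<open>The supremum runs over uncountably many pairs, but the set where it exceeds
  \<open>a\<close> is a union of intersections of two open disks, hence open.\<close>

lemma measurable_oscill [measurable]: "oscill h d \<in> borel_measurable borel"
proof (rule borel_measurableI_greater)
  fix a
  have "a < oscill h d y \<longleftrightarrow> (\<exists>p. a < ennreal (cmod (h (fst p) - h (snd p))) \<and> dist y (fst p) < d \<and> dist y (snd p) < d)" for y
    unfolding oscill_def less_SUP_iff by (auto simp: mem_Times_iff Bex_def)
  then have "{y \<in> space borel. a < oscill h d y} =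
      (\<Union>p\<in>{p. a < ennreal (cmod (h (fst p) - h (snd p)))}. ball (fst p) d \<inter> ball (snd p) d)"
    by (auto simp: dist_commute; blast)
  also have "\<dots> \<in> sets borel" by (intro borel_open open_UN ballI open_Int open_ball)
  finally show "{y \<in> space borel. a < oscill h d y} \<in> sets borel" .
qed

lemma le_oscill: "dist y z < d \<Longrightarrow> dist y w < d \<Longrightarrow> ennreal (cmod (h z - h w)) \<le> oscill h d y"
  unfolding oscill_def by (rule SUP_upper2[of "(z, w)"]) auto

lemma oscill_le:
  assumes "\<And>z w. dist y z < d \<Longrightarrow> dist y w < d \<Longrightarrow> cmod (h z - h w) \<le> e"
  shows "oscill h d y \<le> ennreal e"
  unfolding oscill_def using assms by (intro SUP_least ennreal_leI) auto

text \<open>At points of continuity the oscillation at scale d/R tends to 0; boundedness and compact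
  support allow dominated convergence. Continuity almost everywhere covers indicators of
  disks.\<close>

lemma tendsto_nn_integral_oscill:
  assumes h: "bounded_cs h" and cont: "AE x in lborel. isCont h x"
  shows "((\<lambda>R. \<integral>\<^sup>+y. oscill h (d / R) y \<partial>lborel) \<longlongrightarrow> 0) at_top"
proof -
  obtain B r where B: "\<And>x. cmod (h x) \<le> B" and r: "\<And>x. r < cmod x \<Longrightarrow> h x = 0" and [measurable]: "h \<in> borel_measurable borel"
    using h by (auto simp: bounded_cs_def)
  have B0: "B \<ge> 0" using order_trans[OF norm_ge_zero B] .
  have osc2: "oscill h e y \<le> ennreal (2 * B)" for e y
  proof (rule oscill_le)
    fix z w show "cmod (h z - h w) \<le> 2 * B"
      using norm_triangle_ineq4[of "h z" "h w"] B[of z] B[of w] by linarith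
  qed
  have fin: "oscill h e y < \<infinity>" for e y by (rule le_less_trans[OF osc2]) simp
  have small: "\<forall>\<^sub>F R in at_top. d / R \<le> 1"
  proof -
    have "((\<lambda>R. d / R) \<longlongrightarrow> 0) at_top" by real_asymp
    then have "\<forall>\<^sub>F R in at_top. d / R < 1" by (rule order_tendstoD) simp
    then show ?thesis by eventually_elim simp
  qed
  have bound: "\<forall>\<^sub>F R in at_top. AE y in lborel. norm (enn2real (oscill h (d / R) y)) \<le> 2 * B * indicator (cball (0::complex) (r + 1)) y"
    using small
  proof eventually_elim
    case (elim R)
    show ?case
    proof (rule AE_I2)
      fix y
      show "norm (enn2real (oscill h (d / R) y)) \<le> 2 * B * indicator (cball (0::complex) (r + 1)) y"
      proof (cases "r + 1 < cmod y")
        case True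
        have "oscill h (d / R) y \<le> ennreal 0"
        proof (rule oscill_le)
          fix z w assume zw: "dist y z < d / R" "dist y w < d / R"
          have "cmod (y - z) < 1" "cmod (y - w) < 1" using zw elim by (simp_all add: dist_norm)
          then have "r < cmod z" "r < cmod w"
            using True norm_triangle_ineq2[of y z] norm_triangle_ineq2[of y w] by linarith+
          then show "cmod (h z - h w) \<le> 0" using r by simp
        qed
        then show ?thesis using B0 by simp
      next
        case False
        have "enn2real (oscill h (d / R) y) \<le> 2 * B" using osc2 B0 by (simp add: enn2real_leI)
        then show ?thesis using False by simp
      qed
    qed
  qed
  have int: "integrable lborel (\<lambda>y. 2 * B * indicator (cball (0::complex) (r + 1)) y)" by auto
  have "((\<lambda>R. \<integral>y. enn2real (oscill h (d / R) y) \<partial>lborel) \<longlongrightarrow> (\<integral>y. 0 \<partial>(lborel :: complex measure))) at_top"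
  proof (rule integral_dominated_convergence_at_top[OF _ _ int _ bound])
    show "AE y in lborel. ((\<lambda>R. enn2real (oscill h (d / R) y)) \<longlongrightarrow> 0) at_top"
      using cont
    proof eventually_elim
      case (elim y)
      show ?case
      proof (rule tendstoI)
        fix e :: real assume "e > 0"
        obtain s where s: "s > 0" "\<And>z. dist z y < s \<Longrightarrow> dist (h z) (h y) < e / 4"
          using elim \<open>e > 0\<close> unfolding continuous_at_eps_delta by (metis zero_less_divide_iff zero_less_numeral)
        have "((\<lambda>R. d / R) \<longlongrightarrow> 0) at_top" by real_asymp
        then have "\<forall>\<^sub>F R in at_top. d / R < s" by (rule order_tendstoD) (rule s)
        then show "\<forall>\<^sub>F R in at_top. dist (enn2real (oscill h (d / R) y)) 0 < e"
        proof eventually_elim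
          case (elim R)
          have "oscill h (d / R) y \<le> ennreal (e / 2)"
          proof (rule oscill_le)
            fix z w assume "dist y z < d / R" "dist y w < d / R"
            then have "dist z y < s" "dist w y < s" using elim by (simp_all add: dist_commute)
            then have "dist (h z) (h y) < e / 4" "dist (h w) (h y) < e / 4" using s(2) by blast+
            then show "cmod (h z - h w) \<le> e / 2" using dist_triangle2[of "h z" "h w" "h y"] by (simp add: dist_norm)
          qed
          then have "enn2real (oscill h (d / R) y) \<le> e / 2" using \<open>e > 0\<close> by (intro enn2real_leI) auto
          then show ?case using \<open>e > 0\<close> by simp
        qed
      qed
    qed
  qed auto
  then have "((\<lambda>R. ennreal (\<integral>y. enn2real (oscill h (d / R) y) \<partial>lborel)) \<longlongrightarrow> ennreal 0) at_top"
    by (intro tendsto_ennrealI) simp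
  moreover have "\<forall>\<^sub>F R in at_top. ennreal (\<integral>y. enn2real (oscill h (d / R) y) \<partial>lborel) = (\<integral>\<^sup>+y. oscill h (d / R) y \<partial>lborel)"
    using bound
  proof eventually_elim
    case (elim R)
    have "integrable lborel (\<lambda>y. enn2real (oscill h (d / R) y))"
    proof (rule Bochner_Integration.integrable_bound[OF int])
      show "AE y in lborel. norm (enn2real (oscill h (d / R) y)) \<le> norm (2 * B * indicator (cball (0::complex) (r + 1)) y)"
        using elim by eventually_elim (rule order_trans, assumption, simp)
    qed measurable
    then have "ennreal (\<integral>y. enn2real (oscill h (d / R) y) \<partial>lborel) = (\<integral>\<^sup>+y. ennreal (enn2real (oscill h (d / R) y)) \<partial>lborel)"
      by (intro nn_integral_eq_integral[symmetric]) auto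
    also have "\<dots> = (\<integral>\<^sup>+y. oscill h (d / R) y \<partial>lborel)" using fin by (simp add: less_top)
    finally show ?case .
  qed
  ultimately show ?thesis by (auto elim: Lim_transform_eventually)
qed

subsection \<open>Translation invariant measures\<close>

text \<open>Integrating \<open>f (x + y) * indicator (ball 0 1) y\<close> in both orders determines the measure up to its value on the disk.\<close>

lemma nn_integral_translation_invariant:
  fixes \<nu> :: "complex measure"
  assumes sets [measurable_cong]: "sets \<nu> = sets borel"
    and fin: "\<And>r. emeasure \<nu> (cball 0 r) < \<infinity>"
    and inv: "\<And>B w. B \<in> sets borel \<Longrightarrow> emeasure \<nu> ((+) w ` B) = emeasure \<nu> B"
    and f [measurable]: "f \<in> borel_measurable borel"
  shows "(\<integral>\<^sup>+x. f x \<partial>\<nu>) * ennreal pi = (\<integral>\<^sup>+x. f x \<partial>lborel) * emeasure \<nu> (ball 0 1)"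
proof -
  have sp: "space \<nu> = UNIV" using sets_eq_imp_space_eq[OF sets] by simp
  interpret sigma_finite_measure \<nu>
  proof
    have "(\<Union>n. cball (0::complex) (real n)) = UNIV" using real_arch_simple by auto
    then show "\<exists>A. countable A \<and> A \<subseteq> sets \<nu> \<and> \<Union> A = space \<nu> \<and> (\<forall>a\<in>A. emeasure \<nu> a \<noteq> \<infinity>)"
      using fin by (intro exI[of _ "range (\<lambda>n. cball 0 (real n))"]) (auto simp: sets sp less_top)
  qed
  interpret P: pair_sigma_finite \<nu> "lborel :: complex measure" ..
  have tr: "(\<integral>\<^sup>+x. g (x + y) \<partial>\<nu>) = (\<integral>\<^sup>+x. g x \<partial>\<nu>)" if [measurable]: "g \<in> borel_measurable borel" for g y
  proof -
    have "distr \<nu> borel (\<lambda>x. x + y) = \<nu>"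
    proof (rule measure_eqI)
      fix B assume "B \<in> sets (distr \<nu> borel (\<lambda>x. x + y))"
      then have B: "B \<in> sets borel" by simp
      have "emeasure (distr \<nu> borel (\<lambda>x. x + y)) B = emeasure \<nu> ((\<lambda>x. x + y) -` B)"
        using B by (subst emeasure_distr) (auto simp: sp)
      also have "(\<lambda>x. x + y) -` B = (+) (- y) ` B" by (auto simp: image_iff intro!: bexI[of _ "_ + y"])
      also have "emeasure \<nu> ((+) (- y) ` B) = emeasure \<nu> B" by (rule inv[OF B])
      finally show "emeasure (distr \<nu> borel (\<lambda>x. x + y)) B = emeasure \<nu> B" .
    qed (simp add: sets)
    then have "(\<integral>\<^sup>+x. g x \<partial>\<nu>) = (\<integral>\<^sup>+x. g x \<partial>distr \<nu> borel (\<lambda>x. x + y))" by simp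
    then show ?thesis by (simp add: nn_integral_distr)
  qed
  let ?g = "indicator (ball 0 1) :: complex \<Rightarrow> ennreal"
  have [measurable]: "ball (0::complex) 1 \<in> sets borel" by simp
  have "(\<integral>\<^sup>+y. (\<integral>\<^sup>+x. f (x + y) * ?g y \<partial>\<nu>) \<partial>lborel) = (\<integral>\<^sup>+y. (\<integral>\<^sup>+x. f x \<partial>\<nu>) * ?g y \<partial>lborel)"
    by (intro nn_integral_cong) (simp add: nn_integral_multc tr)
  also have "\<dots> = (\<integral>\<^sup>+x. f x \<partial>\<nu>) * ennreal pi"
    by (subst nn_integral_cmult_indicator) (auto simp: emeasure_ball_complex)
  finally have 1: "(\<integral>\<^sup>+y. (\<integral>\<^sup>+x. f (x + y) * ?g y \<partial>\<nu>) \<partial>lborel) = (\<integral>\<^sup>+x. f x \<partial>\<nu>) * ennreal pi" .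
  have "(\<integral>\<^sup>+y. (\<integral>\<^sup>+x. f (x + y) * ?g y \<partial>\<nu>) \<partial>lborel) = (\<integral>\<^sup>+x. (\<integral>\<^sup>+y. f (x + y) * ?g y \<partial>lborel) \<partial>\<nu>)"
    by (rule P.Fubini') measurable
  also have "\<dots> = (\<integral>\<^sup>+x. (\<integral>\<^sup>+y. f y * ?g (y - x) \<partial>lborel) \<partial>\<nu>)"
  proof (rule nn_integral_cong)
    fix x
    show "(\<integral>\<^sup>+y. f (x + y) * ?g y \<partial>lborel) = (\<integral>\<^sup>+y. f y * ?g (y - x) \<partial>lborel)"
      using nn_integral_complex_shift[of "\<lambda>y. f y * ?g (y - x)" x] by (simp add: add.commute)
  qed
  also have "\<dots> = (\<integral>\<^sup>+y. (\<integral>\<^sup>+x. f y * ?g (y - x) \<partial>\<nu>) \<partial>lborel)"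
    by (rule P.Fubini'[symmetric]) measurable
  also have "\<dots> = (\<integral>\<^sup>+y. f y * emeasure \<nu> (ball 0 1) \<partial>lborel)"
  proof (intro nn_integral_cong)
    fix y
    have "(\<integral>\<^sup>+x. f y * ?g (y - x) \<partial>\<nu>) = f y * (\<integral>\<^sup>+x. ?g (x + (- y)) \<partial>\<nu>)"
      by (subst nn_integral_cmult[symmetric]) (auto intro!: nn_integral_cong simp: indicator_def norm_minus_commute)
    also have "(\<integral>\<^sup>+x. ?g (x + (- y)) \<partial>\<nu>) = emeasure \<nu> (ball 0 1)"
      by (subst tr) (auto simp: sets)
    finally show "(\<integral>\<^sup>+x. f y * ?g (y - x) \<partial>\<nu>) = f y * emeasure \<nu> (ball 0 1)" .
  qed
  also have "\<dots> = (\<integral>\<^sup>+x. f x \<partial>lborel) * emeasure \<nu> (ball 0 1)" by (simp add: nn_integral_multc)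
  finally show ?thesis using 1 by simp
qed

subsection \<open>Linear statistics\<close>

lemma bounded_cs_cmult: "bounded_cs f \<Longrightarrow> bounded_cs (\<lambda>z. c * f z)"
  unfolding bounded_cs_def by (auto simp: norm_mult) (metis mult_left_mono norm_ge_zero)

lemma bounded_cs_add:
  assumes "bounded_cs f" "bounded_cs g" shows "bounded_cs (\<lambda>z. f z + g z)"
proof -
  obtain B r where B: "\<And>x. cmod (f x) \<le> B" and r: "\<And>x. r < cmod x \<Longrightarrow> f x = 0" and [measurable]: "f \<in> borel_measurable borel"
    using assms(1) by (auto simp: bounded_cs_def)
  obtain C s where C: "\<And>x. cmod (g x) \<le> C" and s: "\<And>x. s < cmod x \<Longrightarrow> g x = 0" and [measurable]: "g \<in> borel_measurable borel"
    using assms(2) by (auto simp: bounded_cs_def)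
  show ?thesis unfolding bounded_cs_def
  proof (intro conjI exI allI impI)
    fix x show "cmod (f x + g x) \<le> B + C" using norm_triangle_ineq[of "f x" "g x"] B[of x] C[of x] by linarith
  next
    fix x assume "max r s < cmod x" then show "f x + g x = 0" using r s by simp
  qed measurable
qed

lemma bounded_cs_diff: "bounded_cs f \<Longrightarrow> bounded_cs g \<Longrightarrow> bounded_cs (\<lambda>z. f z - g z)"
  using bounded_cs_add[of f "\<lambda>z. (-1) * g z"] bounded_cs_cmult[of g "-1"] by simp

lemma bounded_cs_scale:
  assumes "bounded_cs h" "R > 0" shows "bounded_cs (\<lambda>z. h (z / of_real R))"
proof -
  obtain B r where B: "\<And>x. cmod (h x) \<le> B" and r: "\<And>x. r < cmod x \<Longrightarrow> h x = 0" and [measurable]: "h \<in> borel_measurable borel"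
    using assms(1) by (auto simp: bounded_cs_def)
  show ?thesis unfolding bounded_cs_def
  proof (intro conjI exI allI impI)
    fix x show "cmod (h (x / of_real R)) \<le> B" by (rule B)
  next
    fix x :: complex assume "r * R < cmod x"
    then show "h (x / of_real R) = 0" using assms(2) by (intro r) (simp add: norm_divide field_simps)
  qed measurable
qed

lemma bounded_cs_indicator: "bounded B \<Longrightarrow> B \<in> sets borel \<Longrightarrow> bounded_cs (indicator B)"
  unfolding bounded_cs_def bounded_iff
proof (intro conjI exI allI impI)
  assume "\<exists>a. \<forall>x\<in>B. norm x \<le> a" "B \<in> sets borel"
  then obtain a where a: "\<And>x. x \<in> B \<Longrightarrow> norm x \<le> a" by auto
  show "indicator B x = (0::complex)" if "(SOME a. \<forall>x\<in>B. norm x \<le> a) < norm x" for x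
    using that someI[of "\<lambda>a. \<forall>x\<in>B. norm x \<le> a" a] a by (auto simp: indicator_def not_less[symmetric])
  show "cmod (indicator B x) \<le> 1" for x by (simp add: indicator_def)
qed auto

context stationary_process
begin

text \<open>Agrees with \<open>lin_process\<close> on bounded compactly supported functions, but
  also makes sense for \<open>zeta_transform\<close>, which decays without compact support in
  general.\<close>

definition lint :: "(complex \<Rightarrow> complex) \<Rightarrow> 'a \<Rightarrow> complex" where
  "lint f \<omega> = (\<integral>z. f z \<partial>conf_measure (N \<omega>))"

lemma measurable_lint [measurable]: "f \<in> borel_measurable borel \<Longrightarrow> lint f \<in> borel_measurable M"
  unfolding lint_def[abs_def] by (rule measurable_compose[OF measurable_N measurable_integral_conf_measure])

lemma measurable_nn_integral_N [measurable]:
  "f \<in> borel_measurable borel \<Longrightarrow> (\<lambda>\<omega>. \<integral>\<^sup>+z. f z \<partial>conf_measure (N \<omega>)) \<in> borel_measurable M"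
  by (rule measurable_compose[OF measurable_N measurable_nn_integral_conf_measure])

lemma lint_integrable: "\<omega> \<in> space M \<Longrightarrow> bounded_cs f \<Longrightarrow> integrable (conf_measure (N \<omega>)) f"
  by (intro integrable_conf_measure_bounded_cs locfin_N)

lemma lint_add: "\<omega> \<in> space M \<Longrightarrow> bounded_cs f \<Longrightarrow> bounded_cs g \<Longrightarrow> lint (\<lambda>z. f z + g z) \<omega> = lint f \<omega> + lint g \<omega>"
  unfolding lint_def by (intro Bochner_Integration.integral_add lint_integrable)

lemma lint_diff: "\<omega> \<in> space M \<Longrightarrow> bounded_cs f \<Longrightarrow> bounded_cs g \<Longrightarrow> lint (\<lambda>z. f z - g z) \<omega> = lint f \<omega> - lint g \<omega>"
  unfolding lint_def by (intro Bochner_Integration.integral_diff lint_integrable)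

lemma lint_cmult: "lint (\<lambda>z. c * f z) \<omega> = c * lint f \<omega>"
  unfolding lint_def by simp

lemma lin_process_eq_lint: "\<omega> \<in> space M \<Longrightarrow> bounded_cs f \<Longrightarrow> lin_process N f \<omega> = lint f \<omega>"
  unfolding lin_process_def lint_def by (simp add: integral_conf_measure_eq_linstat locfin_N)

text \<open>No summability is assumed: a divergent integral has the value 0, for which the bound is
  trivial.\<close>

lemma sqnorm_lint_le:
  assumes f: "f \<in> borel_measurable borel" and F: "F \<in> borel_measurable borel"
    and le: "\<And>x y. cmod (x - y) \<le> 2 \<Longrightarrow> ennreal (cmod (f y)) \<le> F x"
  shows "sqnorm M (lint f) \<le> second_moment * (\<integral>\<^sup>+x. F x \<partial>lborel)\<^sup>2"
proof -
  have "ennreal (cmod (lint f \<omega>)) \<le> (\<integral>\<^sup>+z. ennreal (cmod (f z)) \<partial>conf_measure (N \<omega>))" for \<omega>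
  proof (cases "integrable (conf_measure (N \<omega>)) f")
    case True
    then show ?thesis unfolding lint_def by (rule integral_norm_bound_ennreal)
  qed (simp add: lint_def not_integrable_integral_eq)
  then have "sqnorm M (lint f) \<le> (\<integral>\<^sup>+\<omega>. (\<integral>\<^sup>+z. ennreal (cmod (f z)) \<partial>conf_measure (N \<omega>))\<^sup>2 \<partial>M)"
    unfolding sqnorm_def ennreal_power[OF norm_ge_zero, symmetric] by (intro nn_integral_mono power_mono) auto
  also have "\<dots> \<le> second_moment * (\<integral>\<^sup>+x. F x \<partial>lborel)\<^sup>2"
    by (rule second_moment_bound) (use f F le in auto)
  finally show ?thesis .
qed

lemma sqnorm_lint_finite:
  assumes "bounded_cs f" shows "sqnorm M (lint f) < \<infinity>"
proof -
  obtain B r where B: "\<And>x. cmod (f x) \<le> B" and r: "\<And>x. r < cmod x \<Longrightarrow> f x = 0" and [measurable]: "f \<in> borel_measurable borel"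
    using assms(1) by (auto simp: bounded_cs_def)
  have "sqnorm M (lint f) \<le> second_moment * (\<integral>\<^sup>+x. ennreal B * indicator (cball (0::complex) (r + 2)) x \<partial>lborel)\<^sup>2"
  proof (rule sqnorm_lint_le)
    have [measurable]: "cball (0::complex) (r + 2) \<in> sets borel" by simp
    show "(\<lambda>x. ennreal B * indicator (cball (0::complex) (r + 2)) x) \<in> borel_measurable borel" by measurable
    fix x y :: complex assume xy: "cmod (x - y) \<le> 2"
    show "ennreal (cmod (f y)) \<le> ennreal B * indicator (cball 0 (r + 2)) x"
    proof (cases "r < cmod y")
      case False
      then have "cmod x \<le> r + 2" using xy norm_triangle_ineq2[of x y] by linarith
      then show ?thesis using B[of y] by (simp add: ennreal_leI)
    qed (simp add: r)
  qed auto
  also have "\<dots> < \<infinity>"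
  proof -
    have "(\<integral>\<^sup>+x. ennreal B * indicator (cball (0::complex) (r + 2)) x \<partial>lborel) < \<infinity>"
      using emeasure_bounded_finite[of "cball (0::complex) (r + 2)"] by (subst nn_integral_cmult_indicator) (simp_all add: ennreal_mult_less_top)
    then show ?thesis using second_moment_finite by (simp add: ennreal_mult_less_top power_less_top_ennreal)
  qed
  finally show ?thesis .
qed

text \<open>Intensity measure of the process restricted to the event that the configuration lies in
  \<open>E\<close>.\<close>

definition mean_measure :: "config set \<Rightarrow> complex measure" where
  "mean_measure E = measure_of UNIV (sets borel) (\<lambda>B. \<integral>\<^sup>+\<omega>. indicator E (N \<omega>) * emeasure (conf_measure (N \<omega>)) B \<partial>M)"

lemma sets_mean_measure [simp, measurable_cong]: "sets (mean_measure E) = sets borel"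
  unfolding mean_measure_def by (metis sets.sigma_sets_eq sets_measure_of space_borel sets.space_closed)

lemma emeasure_mean_measure:
  assumes [measurable]: "E \<in> sets conf_space" and B: "B \<in> sets borel"
  shows "emeasure (mean_measure E) B = (\<integral>\<^sup>+\<omega>. indicator E (N \<omega>) * emeasure (conf_measure (N \<omega>)) B \<partial>M)"
proof (rule emeasure_measure_of[OF mean_measure_def])
  show "positive (sets (mean_measure E)) (\<lambda>B. \<integral>\<^sup>+\<omega>. indicator E (N \<omega>) * emeasure (conf_measure (N \<omega>)) B \<partial>M)"
    by (simp add: positive_def)
  show "countably_additive (sets (mean_measure E)) (\<lambda>B. \<integral>\<^sup>+\<omega>. indicator E (N \<omega>) * emeasure (conf_measure (N \<omega>)) B \<partial>M)"
  proof (rule countably_additiveI)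
    fix A :: "nat \<Rightarrow> complex set" assume A: "range A \<subseteq> sets (mean_measure E)" "disjoint_family A"
    note [measurable] = measurable_emeasure_conf_measure
    have [measurable]: "A i \<in> sets borel" for i using A by auto
    have "(\<Sum>i. \<integral>\<^sup>+\<omega>. indicator E (N \<omega>) * emeasure (conf_measure (N \<omega>)) (A i) \<partial>M) =
        (\<integral>\<^sup>+\<omega>. (\<Sum>i. indicator E (N \<omega>) * emeasure (conf_measure (N \<omega>)) (A i)) \<partial>M)"
      by (rule nn_integral_suminf[symmetric]) measurable
    also have "\<dots> = (\<integral>\<^sup>+\<omega>. indicator E (N \<omega>) * emeasure (conf_measure (N \<omega>)) (\<Union>i. A i) \<partial>M)"
      using A by (intro nn_integral_cong) (simp add: suminf_emeasure)
    finally show "(\<Sum>i. \<integral>\<^sup>+\<omega>. indicator E (N \<omega>) * emeasure (conf_measure (N \<omega>)) (A i) \<partial>M) =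
      (\<integral>\<^sup>+\<omega>. indicator E (N \<omega>) * emeasure (conf_measure (N \<omega>)) (\<Union>i. A i) \<partial>M)" .
  qed
qed (use B in auto)

lemma nn_integral_mean_measure:
  assumes E [measurable]: "E \<in> sets conf_space" and "f \<in> borel_measurable borel"
  shows "(\<integral>\<^sup>+z. f z \<partial>mean_measure E) = (\<integral>\<^sup>+\<omega>. indicator E (N \<omega>) * (\<integral>\<^sup>+z. f z \<partial>conf_measure (N \<omega>)) \<partial>M)"
  using assms(2)
proof (induction rule: borel_measurable_induct)
  case (cong f g)
  then show ?case by simp
next
  case (set A)
  then show ?case by (simp add: emeasure_mean_measure)
next
  case (mult u c)
  then have [measurable]: "u \<in> borel_measurable borel" by simp
  have "(\<integral>\<^sup>+z. c * u z \<partial>mean_measure E) = c * (\<integral>\<^sup>+z. u z \<partial>mean_measure E)"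
    by (rule nn_integral_cmult) simp
  also have "\<dots> = (\<integral>\<^sup>+\<omega>. c * (indicator E (N \<omega>) * (\<integral>\<^sup>+z. u z \<partial>conf_measure (N \<omega>))) \<partial>M)"
    unfolding mult.IH by (rule nn_integral_cmult[symmetric]) measurable
  also have "\<dots> = (\<integral>\<^sup>+\<omega>. indicator E (N \<omega>) * (\<integral>\<^sup>+z. c * u z \<partial>conf_measure (N \<omega>)) \<partial>M)"
    by (intro nn_integral_cong) (simp add: nn_integral_cmult mult.left_commute)
  finally show ?case .
next
  case (add u v)
  then have [measurable]: "u \<in> borel_measurable borel" "v \<in> borel_measurable borel" by simp_all
  have "(\<integral>\<^sup>+z. v z + u z \<partial>mean_measure E) = (\<integral>\<^sup>+z. v z \<partial>mean_measure E) + (\<integral>\<^sup>+z. u z \<partial>mean_measure E)"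
    by (rule nn_integral_add) auto
  also have "\<dots> = (\<integral>\<^sup>+\<omega>. indicator E (N \<omega>) * (\<integral>\<^sup>+z. v z \<partial>conf_measure (N \<omega>)) + indicator E (N \<omega>) * (\<integral>\<^sup>+z. u z \<partial>conf_measure (N \<omega>)) \<partial>M)"
    unfolding add.IH by (rule nn_integral_add[symmetric]) measurable
  also have "\<dots> = (\<integral>\<^sup>+\<omega>. indicator E (N \<omega>) * (\<integral>\<^sup>+z. v z + u z \<partial>conf_measure (N \<omega>)) \<partial>M)"
    by (intro nn_integral_cong) (simp add: nn_integral_add distrib_left)
  finally show ?case .
next
  case (seq U)
  have [measurable]: "U i \<in> borel_measurable borel" for i using seq by auto
  have "(\<integral>\<^sup>+z. (SUP i. U i) z \<partial>mean_measure E) = (SUP i. \<integral>\<^sup>+z. U i z \<partial>mean_measure E)"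
    unfolding SUP_apply by (rule nn_integral_monotone_convergence_SUP) (use seq in auto)
  also have "\<dots> = (SUP i. \<integral>\<^sup>+\<omega>. indicator E (N \<omega>) * (\<integral>\<^sup>+z. U i z \<partial>conf_measure (N \<omega>)) \<partial>M)"
    using seq by simp
  also have "\<dots> = (\<integral>\<^sup>+\<omega>. (SUP i. indicator E (N \<omega>) * (\<integral>\<^sup>+z. U i z \<partial>conf_measure (N \<omega>))) \<partial>M)"
    using \<open>incseq U\<close> by (intro nn_integral_monotone_convergence_SUP[symmetric])
      (auto simp: incseq_def le_fun_def intro!: mult_left_mono nn_integral_mono)
  also have "\<dots> = (\<integral>\<^sup>+\<omega>. indicator E (N \<omega>) * (\<integral>\<^sup>+z. (SUP i. U i) z \<partial>conf_measure (N \<omega>)) \<partial>M)"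
  proof (intro nn_integral_cong)
    fix \<omega>
    have "(\<integral>\<^sup>+z. (SUP i. U i) z \<partial>conf_measure (N \<omega>)) = (SUP i. \<integral>\<^sup>+z. U i z \<partial>conf_measure (N \<omega>))"
      unfolding SUP_apply by (rule nn_integral_monotone_convergence_SUP) (use seq in auto)
    then show "(SUP i. indicator E (N \<omega>) * (\<integral>\<^sup>+z. U i z \<partial>conf_measure (N \<omega>))) = indicator E (N \<omega>) * (\<integral>\<^sup>+z. (SUP i. U i) z \<partial>conf_measure (N \<omega>))"
      by (simp add: SUP_mult_left_ennreal)
  qed
  finally show ?case .
qed

text \<open>Second moments control first moments through n \<le> 1 + n^2.\<close>

lemma emeasure_mean_measure_cball:
  assumes E [measurable]: "E \<in> sets conf_space" shows "emeasure (mean_measure E) (cball 0 r) < \<infinity>"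
proof -
  note [measurable] = measurable_emeasure_conf_measure
  have [measurable]: "(indicator (cball 0 r) :: complex \<Rightarrow> complex) \<in> borel_measurable borel"
    by (rule borel_measurable_indicator) auto
  have "emeasure (mean_measure E) (cball 0 r) \<le> (\<integral>\<^sup>+\<omega>. 1 + ennreal ((cmod (lint (indicator (cball 0 r)) \<omega>))\<^sup>2) \<partial>M)"
    unfolding emeasure_mean_measure[OF E borel_closed[OF closed_cball]]
  proof (intro nn_integral_mono)
    fix \<omega> assume \<omega>: "\<omega> \<in> space M"
    let ?n = "real (cnt (N \<omega>) (cball 0 r))"
    have "lint (indicator (cball 0 r)) \<omega> = of_real ?n"
    proof -
      have "lint (indicator (cball 0 r)) \<omega> = of_real (measure (conf_measure (N \<omega>)) (cball 0 r))"
      proof -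
        have "(indicator (cball 0 r) :: complex \<Rightarrow> complex) = (\<lambda>z. of_real (indicator (cball 0 r) z))"
          by (auto simp: indicator_def)
        then show ?thesis unfolding lint_def by (simp only: integral_complex_of_real) simp
      qed
      then show ?thesis using locfin_N[OF \<omega>] by (simp add: measure_def emeasure_conf_measure)
    qed
    then have "(cmod (lint (indicator (cball 0 r)) \<omega>))\<^sup>2 = ?n\<^sup>2" by simp
    moreover have "?n \<le> 1 + ?n\<^sup>2" using zero_le_power2[of "?n - 1"] by (simp add: power2_eq_square algebra_simps)
    ultimately have "ennreal ?n \<le> 1 + ennreal ((cmod (lint (indicator (cball 0 r)) \<omega>))\<^sup>2)"
      by (simp add: ennreal_leI flip: ennreal_1 ennreal_plus)
    moreover have "indicator E (N \<omega>) * emeasure (conf_measure (N \<omega>)) (cball 0 r) \<le> ennreal ?n"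
      using locfin_N[OF \<omega>] by (simp add: emeasure_conf_measure indicator_def)
    ultimately show "indicator E (N \<omega>) * emeasure (conf_measure (N \<omega>)) (cball 0 r) \<le> 1 + ennreal ((cmod (lint (indicator (cball 0 r)) \<omega>))\<^sup>2)"
      by (rule order_trans[rotated])
  qed
  also have "\<dots> = 1 + sqnorm M (lint (indicator (cball 0 r)))"
    by (subst nn_integral_add) (auto simp: sqnorm_def emeasure_space_1)
  also have "\<dots> < \<infinity>"
    using sqnorm_lint_finite[OF bounded_cs_indicator[OF bounded_cball borel_closed[OF closed_cball]]] by simp
  finally show ?thesis .
qed

text \<open>For an invariant event the restricted intensity measure is translation invariant, hence
  a multiple of Lebesgue measure. Its value on the unit disk, of area \<pi>, fixes the multiple;
  cross-multiplying avoids division in \<open>ennreal\<close>.\<close>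

lemma invariant_mean:
  assumes E [measurable]: "E \<in> sets conf_space" "shift_invariant E" and f: "f \<in> borel_measurable borel"
  shows "(\<integral>\<^sup>+\<omega>. indicator E (N \<omega>) * (\<integral>\<^sup>+z. f z \<partial>conf_measure (N \<omega>)) \<partial>M) * ennreal pi =
    (\<integral>\<^sup>+z. f z \<partial>lborel) * (\<integral>\<^sup>+\<omega>. indicator E (N \<omega>) * emeasure (conf_measure (N \<omega>)) (ball 0 1) \<partial>M)"
proof -
  note [measurable] = measurable_emeasure_conf_measure
  have "(\<integral>\<^sup>+z. f z \<partial>mean_measure E) * ennreal pi = (\<integral>\<^sup>+z. f z \<partial>lborel) * emeasure (mean_measure E) (ball 0 1)"
  proof (rule nn_integral_translation_invariant)
    fix B :: "complex set" and w assume B [measurable]: "B \<in> sets borel"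
    have wB: "(+) w ` B \<in> sets borel" by (rule translate_borel[OF B])
    have "emeasure (mean_measure E) ((+) w ` B) = (\<integral>\<^sup>+\<omega>. indicator E (N \<omega>) * emeasure (conf_measure (N \<omega>)) ((+) w ` B) \<partial>M)"
      by (rule emeasure_mean_measure[OF E(1) wB])
    also have "\<dots> = (\<integral>\<^sup>+\<omega>. indicator E (shift_conf (- w) (N \<omega>)) * emeasure (conf_measure (shift_conf (- w) (N \<omega>))) B \<partial>M)"
    proof (intro nn_integral_cong)
      fix \<omega> assume "\<omega> \<in> space M"
      then have "N \<omega> \<in> E \<longleftrightarrow> shift_conf (- w) (N \<omega>) \<in> E" using E(2) locfin_N unfolding shift_invariant_def by blast
      then show "indicator E (N \<omega>) * emeasure (conf_measure (N \<omega>)) ((+) w ` B) =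
          indicator E (shift_conf (- w) (N \<omega>)) * emeasure (conf_measure (shift_conf (- w) (N \<omega>))) B"
        using emeasure_conf_measure_shift[OF B, of "- w" "N \<omega>"] by (simp add: indicator_def)
    qed
    also have "\<dots> = (\<integral>\<^sup>+\<omega>. indicator E (N \<omega>) * emeasure (conf_measure (N \<omega>)) B \<partial>M)"
      by (rule nn_integral_shift_conf[of "\<lambda>c. indicator E c * emeasure (conf_measure c) B"]) measurable
    also have "\<dots> = emeasure (mean_measure E) B" by (rule emeasure_mean_measure[OF E(1) B, symmetric])
    finally show "emeasure (mean_measure E) ((+) w ` B) = emeasure (mean_measure E) B" .
  next
    fix r show "emeasure (mean_measure E) (cball 0 r) < \<infinity>" by (rule emeasure_mean_measure_cball[OF E(1)])
  qed (use f in simp_all)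
  then show ?thesis by (simp add: nn_integral_mean_measure[OF E(1) f] emeasure_mean_measure[OF E(1)])
qed

definition intensity :: real where
  "intensity = enn2real (\<integral>\<^sup>+\<omega>. emeasure (conf_measure (N \<omega>)) (ball 0 1) \<partial>M) / pi"

text \<open>Campbell's formula, the case in which the invariant event is the whole space.\<close>

lemma nn_integral_intensity:
  assumes f: "f \<in> borel_measurable borel"
  shows "(\<integral>\<^sup>+\<omega>. (\<integral>\<^sup>+z. f z \<partial>conf_measure (N \<omega>)) \<partial>M) = ennreal intensity * (\<integral>\<^sup>+z. f z \<partial>lborel)"
proof -
  let ?E = "space conf_space"
  have inv: "shift_invariant ?E" unfolding shift_invariant_def space_conf_space by (auto intro: locfin_shift_conf)
  have ind: "indicator ?E (N \<omega>) = (1::ennreal)" if "\<omega> \<in> space M" for \<omega>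
    using that locfin_N by (simp add: space_conf_space)
  let ?I = "\<integral>\<^sup>+\<omega>. emeasure (conf_measure (N \<omega>)) (ball 0 1) \<partial>M"
  have fin: "?I < \<infinity>"
  proof -
    have "?I = emeasure (mean_measure ?E) (ball 0 1)"
      by (subst emeasure_mean_measure) (auto intro!: nn_integral_cong simp: ind)
    also have "\<dots> \<le> emeasure (mean_measure ?E) (cball 0 1)" by (intro emeasure_mono) auto
    also have "\<dots> < \<infinity>" by (rule emeasure_mean_measure_cball) simp
    finally show ?thesis .
  qed
  have "(\<integral>\<^sup>+\<omega>. (\<integral>\<^sup>+z. f z \<partial>conf_measure (N \<omega>)) \<partial>M) * ennreal pi = (\<integral>\<^sup>+z. f z \<partial>lborel) * ?I"
    using invariant_mean[OF _ inv f] by (simp add: ind cong: nn_integral_cong)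
  also have "?I = ennreal intensity * ennreal pi"
    using fin unfolding intensity_def by (simp add: ennreal_mult[symmetric] less_top)
  finally have "(\<integral>\<^sup>+\<omega>. (\<integral>\<^sup>+z. f z \<partial>conf_measure (N \<omega>)) \<partial>M) * ennreal pi = (ennreal intensity * (\<integral>\<^sup>+z. f z \<partial>lborel)) * ennreal pi"
    by (simp add: mult_ac)
  then have "((\<integral>\<^sup>+\<omega>. (\<integral>\<^sup>+z. f z \<partial>conf_measure (N \<omega>)) \<partial>M) * ennreal pi) / ennreal pi = ((ennreal intensity * (\<integral>\<^sup>+z. f z \<partial>lborel)) * ennreal pi) / ennreal pi"
    by (simp only:)
  then show ?thesis by (simp add: ennreal_mult_divide_eq)
qed

lemma intensity_nonneg: "intensity \<ge> 0" by (simp add: intensity_def)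

lemma expect_lint_nonneg:
  fixes g :: "complex \<Rightarrow> real"
  assumes g: "bounded_cs (\<lambda>z. of_real (g z))" and nn: "\<And>z. g z \<ge> 0"
  shows "expect M (lint (\<lambda>z. of_real (g z))) = of_real intensity * (\<integral>z. of_real (g z) \<partial>lborel)"
proof -
  have [measurable]: "(\<lambda>z. complex_of_real (g z)) \<in> borel_measurable borel"
    using g unfolding bounded_cs_def by blast
  have "(\<lambda>z. Re (complex_of_real (g z))) \<in> borel_measurable borel" by measurable
  then have [measurable]: "g \<in> borel_measurable borel" by simp
  have gi: "integrable (conf_measure (N \<omega>)) g" if "\<omega> \<in> space M" for \<omega>
    using integrable_Re[OF lint_integrable[OF that g]] by simp
  have lint: "lint (\<lambda>z. of_real (g z)) \<omega> = of_real (\<integral>z. g z \<partial>conf_measure (N \<omega>))" for \<omega>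
    unfolding lint_def by (rule integral_complex_of_real)
  have [measurable]: "(\<lambda>\<omega>. \<integral>z. g z \<partial>conf_measure (N \<omega>)) \<in> borel_measurable M"
  proof -
    have "(\<lambda>\<omega>. Re (lint (\<lambda>z. of_real (g z)) \<omega>)) \<in> borel_measurable M" by measurable
    then show ?thesis by (simp add: lint)
  qed
  have gl: "integrable lborel g"
    using integrable_Re[of lborel "\<lambda>z. complex_of_real (g z)"] bounded_cs_integrable_cs[OF g] by (simp add: integrable_cs_def)
  have "(\<integral>\<omega>. (\<integral>z. g z \<partial>conf_measure (N \<omega>)) \<partial>M) = enn2real (\<integral>\<^sup>+\<omega>. ennreal (\<integral>z. g z \<partial>conf_measure (N \<omega>)) \<partial>M)"
    by (rule integral_eq_nn_integral) (auto intro!: Bochner_Integration.integral_nonneg nn)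
  also have "(\<integral>\<^sup>+\<omega>. ennreal (\<integral>z. g z \<partial>conf_measure (N \<omega>)) \<partial>M) = (\<integral>\<^sup>+\<omega>. (\<integral>\<^sup>+z. ennreal (g z) \<partial>conf_measure (N \<omega>)) \<partial>M)"
    by (intro nn_integral_cong nn_integral_eq_integral[symmetric] gi) (auto simp: nn)
  also have "\<dots> = ennreal intensity * (\<integral>\<^sup>+z. ennreal (g z) \<partial>lborel)"
    by (rule nn_integral_intensity) measurable
  also have "(\<integral>\<^sup>+z. ennreal (g z) \<partial>lborel) = ennreal (\<integral>z. g z \<partial>lborel)"
    by (rule nn_integral_eq_integral[OF gl]) (simp add: nn)
  also have "enn2real (ennreal intensity * ennreal (\<integral>z. g z \<partial>lborel)) = intensity * (\<integral>z. g z \<partial>lborel)"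
    by (simp add: enn2real_mult intensity_nonneg nn)
  finally have "(\<integral>\<omega>. (\<integral>z. g z \<partial>conf_measure (N \<omega>)) \<partial>M) = intensity * (\<integral>z. g z \<partial>lborel)" .
  then show ?thesis unfolding expect_def lint integral_complex_of_real by simp
qed

lemma expect_lint:
  assumes f: "bounded_cs f"
  shows "expect M (lint f) = of_real intensity * (\<integral>z. f z \<partial>lborel)"
proof -
  obtain B r where B: "\<And>x. cmod (f x) \<le> B" and r: "\<And>x. r < cmod x \<Longrightarrow> f x = 0" and fm [measurable]: "f \<in> borel_measurable borel"
    using f by (auto simp: bounded_cs_def)
  \<comment> \<open>The positive part of the real part of \<i>^k f: k = 0 and k = 2 give the two
    parts of Re f, k = 3 and k = 1 those of Im f.\<close>
  define p where "p k z = max 0 (Re (\<i> ^ k * f z))" for k :: nat and z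
  have bp: "bounded_cs (\<lambda>z. of_real (p k z))" for k
    unfolding bounded_cs_def
  proof (intro conjI exI allI impI)
    fix x
    show "cmod (of_real (p k x)) \<le> B"
      using abs_Re_le_cmod[of "\<i> ^ k * f x"] B[of x] norm_ge_zero[of "f x"] unfolding p_def by (simp add: norm_mult norm_power del: norm_ge_zero)
  next
    fix x assume "r < cmod x" then show "complex_of_real (p k x) = 0" using r by (simp add: p_def)
  qed (unfold p_def, measurable)
  have pe: "expect M (lint (\<lambda>z. of_real (p k z))) = of_real intensity * (\<integral>z. of_real (p k z) \<partial>lborel)" for k
    by (rule expect_lint_nonneg[OF bp]) (simp add: p_def)
  have feq: "f z = ((of_real (p 0 z) - of_real (p 2 z)) + (- \<i>) * of_real (p 1 z)) + \<i> * of_real (p 3 z)" for z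
    by (auto simp: p_def max_def complex_eq_iff numeral_eq_Suc)
  have f2: "f = (\<lambda>z. ((of_real (p 0 z) - of_real (p 2 z)) + (- \<i>) * of_real (p 1 z)) + \<i> * of_real (p 3 z))"
    by (rule ext) (rule feq)
  have li: "integrable lborel (\<lambda>z. complex_of_real (p k z))" for k
    using bounded_cs_integrable_cs[OF bp] unfolding integrable_cs_def by blast
  have mi: "integrable M (lint (\<lambda>z. of_real (p k z)))" for k
    using bp[of k] unfolding bounded_cs_def by (intro integrable_of_sqnorm measurable_lint sqnorm_lint_finite bp) auto
  have "expect M (lint f) = (\<integral>\<omega>. ((lint (\<lambda>z. of_real (p 0 z)) \<omega> - lint (\<lambda>z. of_real (p 2 z)) \<omega>) + (- \<i>) * lint (\<lambda>z. of_real (p 1 z)) \<omega>) + \<i> * lint (\<lambda>z. of_real (p 3 z)) \<omega> \<partial>M)"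
    unfolding expect_def
  proof (intro Bochner_Integration.integral_cong refl)
    fix \<omega> assume \<omega>: "\<omega> \<in> space M"
    have "lint f \<omega> = lint (\<lambda>z. ((of_real (p 0 z) - of_real (p 2 z)) + (- \<i>) * of_real (p 1 z)) + \<i> * of_real (p 3 z)) \<omega>"
      using arg_cong[OF f2, of "\<lambda>f. lint f \<omega>"] .
    also have "\<dots> = ((lint (\<lambda>z. of_real (p 0 z)) \<omega> - lint (\<lambda>z. of_real (p 2 z)) \<omega>) + (- \<i>) * lint (\<lambda>z. of_real (p 1 z)) \<omega>) + \<i> * lint (\<lambda>z. of_real (p 3 z)) \<omega>"
      by (simp only: lint_add[OF \<omega>] lint_diff[OF \<omega>] lint_cmult bounded_cs_add bounded_cs_diff bounded_cs_cmult bp)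
    finally show "lint f \<omega> = \<dots>" .
  qed
  also have "\<dots> = ((expect M (lint (\<lambda>z. of_real (p 0 z))) - expect M (lint (\<lambda>z. of_real (p 2 z)))) + (- \<i>) * expect M (lint (\<lambda>z. of_real (p 1 z)))) + \<i> * expect M (lint (\<lambda>z. of_real (p 3 z)))"
    unfolding expect_def using mi by simp
  also have "\<dots> = of_real intensity * (\<integral>z. ((of_real (p 0 z) - of_real (p 2 z)) + (- \<i>) * of_real (p 1 z)) + \<i> * of_real (p 3 z) \<partial>lborel)"
    unfolding pe using li by (simp add: algebra_simps)
  also have "\<dots> = of_real intensity * (\<integral>z. f z \<partial>lborel)" unfolding f2[symmetric] ..
  finally show ?thesis .
qed

lemma tendsto_ennreal_square_0:
  fixes f :: "'i \<Rightarrow> ennreal" assumes "(f \<longlongrightarrow> 0) F" "K < \<infinity>" shows "((\<lambda>r. K * (f r)\<^sup>2) \<longlongrightarrow> 0) F"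
proof -
  have "((\<lambda>r. (f r)\<^sup>2) \<longlongrightarrow> 0) F"
  proof (rule tendsto_ennreal_zero_sandwich[OF assms(1)])
    have "\<forall>\<^sub>F r in F. f r < 1" using assms(1) by (rule order_tendstoD) simp
    then show "\<forall>\<^sub>F r in F. (f r)\<^sup>2 \<le> f r"
    proof eventually_elim
      case (elim r)
      then show ?case using mult_left_mono[of "f r" 1 "f r"] by (simp add: power2_eq_square)
    qed
  qed
  from ennreal_tendsto_cmult[OF assms(2)[unfolded infinity_ennreal_def] this] show ?thesis by simp
qed

text \<open>Mollifying the rescaled \<open>h\<close> changes it by at most a multiple of the
  oscillation of \<open>h\<close> at scale (r + 3)/R: here r bounds the support of \<eta>, 2 is the
  distance allowed by \<open>sqnorm_lint_le\<close>, and 1 makes the inequality strict. The factor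
  R^-2 cancels the area scaling.\<close>

lemma mollification_error:
  assumes h: "bounded_cs h" and cont: "AE x in lborel. isCont h x" and \<eta>: "test_fun \<eta>" and one: "(\<integral>x. \<eta> x \<partial>lborel) = 1"
  shows "L2_lim M (\<lambda>R. lint (\<lambda>l. of_real (1 / R\<^sup>2) * (conv (\<lambda>x. h (x / of_real R)) \<eta> l - h (l / of_real R)))) (\<lambda>_. 0) at_top"
proof -
  have hm [measurable]: "h \<in> borel_measurable borel" using h by (simp add: bounded_cs_def)
  note em [measurable] = test_fun_measurable[OF \<eta>]
  obtain r where r: "r > 0" "\<And>x. r < cmod x \<Longrightarrow> \<eta> x = 0" using test_fun_support[OF \<eta>] by blast
  define A where "A = (\<integral>\<^sup>+u. ennreal (cmod (\<eta> u)) \<partial>lborel)"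
  have A: "A < \<infinity>" using test_fun_integrable[OF \<eta>] unfolding A_def integrable_iff_bounded by simp
  define f where "f R l = of_real (1 / R\<^sup>2) * (conv (\<lambda>x. h (x / of_real R)) \<eta> l - h (l / of_real R))" for R l
  have fm [measurable]: "f R \<in> borel_measurable borel" for R
    unfolding f_def[abs_def] conv_def by measurable
  have le: "ennreal (cmod (f R y)) \<le> ennreal (1 / R\<^sup>2) * (A * oscill h ((r + 3) / R) (x / of_real R))"
    if R: "R > 0" and xy: "cmod (x - y) \<le> 2" for R x y
  proof -
    have hs: "bounded_cs (\<lambda>x. h (x / of_real R))" by (rule bounded_cs_scale[OF h R])
    then obtain B where B: "\<And>x. cmod (h (x / of_real R)) \<le> B" unfolding bounded_cs_def by blast
    have int: "integrable lborel (\<lambda>u. h ((y - u) / of_real R) * \<eta> u)"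
    proof (rule Bochner_Integration.integrable_bound)
      show "integrable lborel (\<lambda>u. of_real B * \<eta> u)" using test_fun_integrable[OF \<eta>] by simp
      show "AE u in lborel. cmod (h ((y - u) / of_real R) * \<eta> u) \<le> cmod (of_real B * \<eta> u)"
        using B order_trans[OF norm_ge_zero B] by (auto simp: norm_mult intro!: mult_right_mono)
    qed measurable
    have "conv (\<lambda>x. h (x / of_real R)) \<eta> y = (\<integral>u. h ((y - u) / of_real R) * \<eta> u \<partial>lborel)"
      unfolding conv_def using integral_complex_reflect[of "\<lambda>u. h (u / of_real R) * \<eta> (y - u)" y] by simp
    moreover have "h (y / of_real R) = (\<integral>u. h (y / of_real R) * \<eta> u \<partial>lborel)" using one by simp
    ultimately have "conv (\<lambda>x. h (x / of_real R)) \<eta> y - h (y / of_real R) =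
        (\<integral>u. h ((y - u) / of_real R) * \<eta> u \<partial>lborel) - (\<integral>u. h (y / of_real R) * \<eta> u \<partial>lborel)" by simp
    also have "\<dots> = (\<integral>u. h ((y - u) / of_real R) * \<eta> u - h (y / of_real R) * \<eta> u \<partial>lborel)"
      using int test_fun_integrable[OF \<eta>] by (subst Bochner_Integration.integral_diff) auto
    finally have eq: "conv (\<lambda>x. h (x / of_real R)) \<eta> y - h (y / of_real R) = (\<integral>u. (h ((y - u) / of_real R) - h (y / of_real R)) * \<eta> u \<partial>lborel)"
      by (simp add: left_diff_distrib)
    have "ennreal (cmod (conv (\<lambda>x. h (x / of_real R)) \<eta> y - h (y / of_real R))) \<le>
        (\<integral>\<^sup>+u. ennreal (cmod ((h ((y - u) / of_real R) - h (y / of_real R)) * \<eta> u)) \<partial>lborel)"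
      unfolding eq using int test_fun_integrable[OF \<eta>] by (intro integral_norm_bound_ennreal) (simp add: left_diff_distrib)
    also have "\<dots> \<le> (\<integral>\<^sup>+u. ennreal (cmod (\<eta> u)) * oscill h ((r + 3) / R) (x / of_real R) \<partial>lborel)"
    proof (intro nn_integral_mono)
      fix u
      show "ennreal (cmod ((h ((y - u) / of_real R) - h (y / of_real R)) * \<eta> u)) \<le> ennreal (cmod (\<eta> u)) * oscill h ((r + 3) / R) (x / of_real R)"
      proof (cases "r < cmod u")
        case False
        have d: "dist (x / of_real R) (z / of_real R) = cmod (x - z) / R" for z
          using R by (simp add: dist_norm norm_divide flip: diff_divide_distrib)
        have "cmod (x - (y - u)) \<le> 2 + r" using norm_triangle_ineq[of "x - y" u] xy False by (simp add: algebra_simps)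
        then have "dist (x / of_real R) ((y - u) / of_real R) < (r + 3) / R" "dist (x / of_real R) (y / of_real R) < (r + 3) / R"
          unfolding d using R xy r(1) by (auto intro!: divide_strict_right_mono)
        from le_oscill[OF this]
        show ?thesis by (simp add: norm_mult ennreal_mult mult.commute mult_left_mono)
      qed (simp add: r)
    qed
    also have "\<dots> = A * oscill h ((r + 3) / R) (x / of_real R)"
      unfolding A_def by (rule nn_integral_multc) measurable
    finally have "ennreal (1 / R\<^sup>2) * ennreal (cmod (conv (\<lambda>x. h (x / of_real R)) \<eta> y - h (y / of_real R))) \<le> ennreal (1 / R\<^sup>2) * (A * oscill h ((r + 3) / R) (x / of_real R))"
      by (rule mult_left_mono) simp
    moreover have "ennreal (cmod (f R y)) = ennreal (1 / R\<^sup>2) * ennreal (cmod (conv (\<lambda>x. h (x / of_real R)) \<eta> y - h (y / of_real R)))"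
      unfolding f_def norm_mult norm_of_real by (subst ennreal_mult[symmetric]) auto
    ultimately show ?thesis by (simp only:)
  qed
  have "((\<lambda>R. second_moment * (A * (\<integral>\<^sup>+y. oscill h ((r + 3) / R) y \<partial>lborel))\<^sup>2) \<longlongrightarrow> 0) at_top"
    using ennreal_tendsto_cmult[OF A[unfolded infinity_ennreal_def] tendsto_nn_integral_oscill[OF h cont, of "r + 3"]]
    by (intro tendsto_ennreal_square_0 second_moment_finite) simp
  then have "((\<lambda>R. sqnorm M (\<lambda>\<omega>. lint (f R) \<omega> - 0)) \<longlongrightarrow> 0) at_top"
  proof (rule tendsto_ennreal_zero_sandwich)
    show "\<forall>\<^sub>F R in at_top. sqnorm M (\<lambda>\<omega>. lint (f R) \<omega> - 0) \<le> second_moment * (A * (\<integral>\<^sup>+y. oscill h ((r + 3) / R) y \<partial>lborel))\<^sup>2"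
      using eventually_gt_at_top[of 0]
    proof eventually_elim
      case (elim R)
      have "sqnorm M (lint (f R)) \<le> second_moment * (\<integral>\<^sup>+x. ennreal (1 / R\<^sup>2) * (A * oscill h ((r + 3) / R) (x / of_real R)) \<partial>lborel)\<^sup>2"
        by (rule sqnorm_lint_le[OF fm _ le[OF elim]]) measurable
      also have "(\<integral>\<^sup>+x. ennreal (1 / R\<^sup>2) * (A * oscill h ((r + 3) / R) (x / of_real R)) \<partial>lborel) =
          ennreal (1 / R\<^sup>2) * (A * (ennreal (R\<^sup>2) * (\<integral>\<^sup>+x. oscill h ((r + 3) / R) x \<partial>lborel)))"
        using elim by (simp add: nn_integral_cmult nn_integral_complex_scale)
      also have "\<dots> = (ennreal (1 / R\<^sup>2) * ennreal (R\<^sup>2)) * (A * (\<integral>\<^sup>+x. oscill h ((r + 3) / R) x \<partial>lborel))"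
        by (simp add: mult_ac)
      also have "ennreal (1 / R\<^sup>2) * ennreal (R\<^sup>2) = 1" using elim by (simp add: ennreal_mult[symmetric])
      finally show ?case by simp
    qed
  qed
  then show ?thesis unfolding L2_lim_def f_def .
qed

end

section \<open>The spectral isometry and the closure of its graph\<close>

lemma sqnorm_eq_integral:
  assumes "f \<in> borel_measurable M" "sqnorm M f < \<infinity>"
  shows "sqnorm M f = ennreal (Re (\<integral>\<omega>. f \<omega> * cnj (f \<omega>) \<partial>M))"
proof -
  have "integrable M (\<lambda>\<omega>. f \<omega> * cnj (f \<omega>))" by (rule integrable_mult_cnj) (use assms in auto)
  then have int: "integrable M (\<lambda>\<omega>. Re (f \<omega> * cnj (f \<omega>)))" and "Re (\<integral>\<omega>. f \<omega> * cnj (f \<omega>) \<partial>M) = (\<integral>\<omega>. Re (f \<omega> * cnj (f \<omega>)) \<partial>M)"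
    by (rule integrable_Re, rule integral_Re[symmetric])
  moreover have "Re (f \<omega> * cnj (f \<omega>)) = (cmod (f \<omega>))\<^sup>2" for \<omega>
    by (simp add: cmod_power2) (simp add: power2_eq_square)
  ultimately show ?thesis
    unfolding sqnorm_def by (simp only:) (rule nn_integral_eq_integral, simp_all)
qed

text \<open>The fixed normalized test function \<eta> smooths ergodic averages at unit scale, and
  \<open>dz \<eta>\<close> shows that the limit behind \<open>Psi2_inf\<close> exists.\<close>

locale spectral_process = stationary_process +
  fixes \<rho> :: "complex measure" and \<eta> :: "complex \<Rightarrow> complex"
  assumes spec: "spectral_measure M (lin_process N) \<rho>"
    and \<eta>: "test_fun \<eta>" and integral_\<eta>: "(\<integral>x. \<eta> x \<partial>lborel) = 1"
begin

lemma sets_\<rho> [simp, measurable_cong]: "sets \<rho> = sets borel"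
  using spec by (simp add: spectral_measure_def)

lemma space_\<rho> [simp]: "space \<rho> = UNIV"
  using sets_eq_imp_space_eq[OF sets_\<rho>] by simp

lemma finite_\<rho>: "compact K \<Longrightarrow> emeasure \<rho> K < \<infinity>"
  using spec by (simp add: spectral_measure_def)

lemma covar_lint:
  assumes "test_fun f" "test_fun g"
  shows "covar M (lint f) (lint g) = (\<integral>\<xi>. fourier f \<xi> * cnj (fourier g \<xi>) \<partial>\<rho>)"
proof -
  have "covar M (lin_process N f) (lin_process N g) = (\<integral>\<xi>. fourier f \<xi> * cnj (fourier g \<xi>) \<partial>\<rho>)"
    using spec assms by (simp add: spectral_measure_def)
  moreover have "expect M (lin_process N h) = expect M (lint h)" if "test_fun h" for h
    unfolding expect_def by (intro Bochner_Integration.integral_cong refl lin_process_eq_lint test_fun_bounded_cs that)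
  moreover have "lin_process N h \<omega> = lint h \<omega>" if "test_fun h" "\<omega> \<in> space M" for h \<omega>
    using that by (simp add: lin_process_eq_lint test_fun_bounded_cs)
  ultimately show ?thesis using assms unfolding covar_def by (simp cong: Bochner_Integration.integral_cong)
qed

lemma sqnorm_fourier_finite:
  assumes "test_fun f" shows "sqnorm \<rho> (fourier f) < \<infinity>"
proof -
  have "integrable \<rho> (\<lambda>\<xi>. fourier f \<xi> * cnj (fourier f \<xi>))"
    using spec assms by (simp add: spectral_measure_def)
  then have "(\<integral>\<^sup>+\<xi>. ennreal (norm (fourier f \<xi> * cnj (fourier f \<xi>))) \<partial>\<rho>) < \<infinity>"
    by (simp add: integrable_iff_bounded)
  then show ?thesis by (simp add: sqnorm_def norm_mult power2_eq_square)
qed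

lemma measurable_fourier_\<rho>: "f \<in> borel_measurable borel \<Longrightarrow> fourier f \<in> borel_measurable \<rho>"
  by (subst measurable_cong_sets[OF sets_\<rho> refl]) (rule measurable_fourier)

lemma measurable_lint_test: "test_fun f \<Longrightarrow> lint f \<in> borel_measurable M"
  by (intro measurable_lint test_fun_measurable)

lemma sqnorm_lint_test: "test_fun f \<Longrightarrow> sqnorm M (lint f) < \<infinity>"
  by (intro sqnorm_lint_finite test_fun_bounded_cs)

text \<open>A transform vanishing at 0 means that \<open>f\<close> has integral 0, so the statistic
  is centered and its variance is its full second moment.\<close>

lemma lint_isometry:
  assumes f: "test_fun f" and 0: "fourier f 0 = 0"
  shows "sqnorm M (lint f) = sqnorm \<rho> (fourier f)"
proof -
  have "expect M (lint f) = 0"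
    using expect_lint[OF test_fun_bounded_cs[OF f]] 0 by (simp add: fourier_zero)
  then have "(\<integral>\<omega>. lint f \<omega> * cnj (lint f \<omega>) \<partial>M) = (\<integral>\<xi>. fourier f \<xi> * cnj (fourier f \<xi>) \<partial>\<rho>)"
    using covar_lint[OF f f] covar_eq[OF measurable_lint_test[OF f] sqnorm_lint_test[OF f] measurable_lint_test[OF f] sqnorm_lint_test[OF f]] by simp
  then show ?thesis
    using sqnorm_eq_integral[OF measurable_lint_test[OF f] sqnorm_lint_test[OF f]]
      sqnorm_eq_integral[OF measurable_fourier_\<rho>[OF test_fun_measurable[OF f]] sqnorm_fourier_finite[OF f]] by simp
qed

text \<open>\<open>spec_rep Y F\<close>: the pair lies in the closure of the graph of the spectral isometry.\<close>

definition spec_rep :: "('a \<Rightarrow> complex) \<Rightarrow> (complex \<Rightarrow> complex) \<Rightarrow> bool" where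
  "spec_rep Y F \<longleftrightarrow> Y \<in> borel_measurable M \<and> F \<in> borel_measurable borel \<and>
    (\<exists>f. (\<forall>n::nat. test_fun (f n)) \<and> L2_lim M (\<lambda>n. lint (f n)) Y sequentially \<and> L2_lim \<rho> (\<lambda>n. fourier (f n)) F sequentially)"

lemma spec_rep_finite:
  assumes "spec_rep Y F" shows "sqnorm M Y < \<infinity>" "sqnorm \<rho> F < \<infinity>"
proof -
  obtain f where f: "\<And>n::nat. test_fun (f n)" "L2_lim M (\<lambda>n. lint (f n)) Y sequentially" "L2_lim \<rho> (\<lambda>n. fourier (f n)) F sequentially"
    and Y: "Y \<in> borel_measurable M" "F \<in> borel_measurable borel" using assms unfolding spec_rep_def by blast
  have F: "F \<in> borel_measurable \<rho>" using Y(2) by (subst measurable_cong_sets[OF sets_\<rho> refl])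
  show "sqnorm M Y < \<infinity>"
    by (rule L2_lim_finite[OF f(2)]) (auto intro: measurable_lint_test f(1) Y sqnorm_lint_test[unfolded infinity_ennreal_def])
  show "sqnorm \<rho> F < \<infinity>"
    by (rule L2_lim_finite[OF f(3)]) (auto intro: measurable_fourier_\<rho> test_fun_measurable f(1) F sqnorm_fourier_finite[unfolded infinity_ennreal_def])
qed

text \<open>The covariance formula carries no centering condition, so it passes to the limit along
  arbitrary approximating test functions.\<close>

lemma spec_rep_covar:
  assumes "spec_rep Y F" "spec_rep Z G"
  shows "covar M Y Z = (\<integral>\<xi>. F \<xi> * cnj (G \<xi>) \<partial>\<rho>)"
proof -
  obtain f where f: "\<And>n::nat. test_fun (f n)" "L2_lim M (\<lambda>n. lint (f n)) Y sequentially" "L2_lim \<rho> (\<lambda>n. fourier (f n)) F sequentially"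
    and Y: "Y \<in> borel_measurable M" "F \<in> borel_measurable borel" using assms(1) unfolding spec_rep_def by blast
  obtain g where g: "\<And>n::nat. test_fun (g n)" "L2_lim M (\<lambda>n. lint (g n)) Z sequentially" "L2_lim \<rho> (\<lambda>n. fourier (g n)) G sequentially"
    and Z: "Z \<in> borel_measurable M" "G \<in> borel_measurable borel" using assms(2) unfolding spec_rep_def by blast
  have FG: "F \<in> borel_measurable \<rho>" "G \<in> borel_measurable \<rho>" using Y(2) Z(2) by (simp_all add: measurable_cong_sets[OF sets_\<rho> refl])
  have 1: "(\<lambda>n. covar M (lint (f n)) (lint (g n))) \<longlonglongrightarrow> covar M Y Z"
    by (rule L2_lim_covar[OF f(2) _ Y(1) _ g(2) _ Z(1)]) (simp_all only: measurable_lint_test sqnorm_lint_test f(1) g(1) sequentially_bot not_False_eq_True)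
  have 2: "(\<lambda>n. \<integral>\<xi>. fourier (f n) \<xi> * cnj (fourier (g n) \<xi>) \<partial>\<rho>) \<longlonglongrightarrow> (\<integral>\<xi>. F \<xi> * cnj (G \<xi>) \<partial>\<rho>)"
    by (rule L2_lim_integral_mult_cnj[OF f(3) _ FG(1) _ g(3) _ FG(2)])
       (simp_all only: measurable_fourier_\<rho> test_fun_measurable sqnorm_fourier_finite f(1) g(1) sequentially_bot not_False_eq_True)
  show ?thesis using LIMSEQ_unique[OF 1 2[unfolded covar_lint[OF f(1) g(1), symmetric]]] .
qed

lemma spec_rep_cmult:
  assumes "spec_rep Y F" shows "spec_rep (\<lambda>\<omega>. c * Y \<omega>) (\<lambda>\<xi>. c * F \<xi>)"
proof -
  obtain f where f: "\<And>n::nat. test_fun (f n)" "L2_lim M (\<lambda>n. lint (f n)) Y sequentially" "L2_lim \<rho> (\<lambda>n. fourier (f n)) F sequentially"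
    and Y [measurable]: "Y \<in> borel_measurable M" "F \<in> borel_measurable borel" using assms unfolding spec_rep_def by blast
  have F: "F \<in> borel_measurable \<rho>" using Y(2) by (simp add: measurable_cong_sets[OF sets_\<rho> refl])
  have "L2_lim M (\<lambda>n. lint (\<lambda>z. c * f n z)) (\<lambda>\<omega>. c * Y \<omega>) sequentially"
    unfolding lint_cmult[abs_def] by (rule L2_lim_cmult[OF f(2) measurable_lint_test[OF f(1)] Y(1)])
  moreover have "L2_lim \<rho> (\<lambda>n. fourier (\<lambda>z. c * f n z)) (\<lambda>\<xi>. c * F \<xi>) sequentially"
    unfolding fourier_cmult[abs_def] by (rule L2_lim_cmult[OF f(3) measurable_fourier_\<rho>[OF test_fun_measurable[OF f(1)]] F])
  moreover have "test_fun (\<lambda>z. c * f n z)" for n by (rule test_fun_cmult[OF f(1)])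
  moreover have "(\<lambda>\<omega>. c * Y \<omega>) \<in> borel_measurable M" "(\<lambda>\<xi>. c * F \<xi>) \<in> borel_measurable borel" by measurable
  ultimately show ?thesis unfolding spec_rep_def by (intro conjI exI[of _ "\<lambda>n z. c * f n z"] allI)
qed

lemma spec_rep_add:
  assumes "spec_rep Y F" "spec_rep Z G" shows "spec_rep (\<lambda>\<omega>. Y \<omega> + Z \<omega>) (\<lambda>\<xi>. F \<xi> + G \<xi>)"
proof -
  obtain f where f: "\<And>n::nat. test_fun (f n)" "L2_lim M (\<lambda>n. lint (f n)) Y sequentially" "L2_lim \<rho> (\<lambda>n. fourier (f n)) F sequentially"
    and Y [measurable]: "Y \<in> borel_measurable M" "F \<in> borel_measurable borel" using assms(1) unfolding spec_rep_def by blast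
  obtain g where g: "\<And>n::nat. test_fun (g n)" "L2_lim M (\<lambda>n. lint (g n)) Z sequentially" "L2_lim \<rho> (\<lambda>n. fourier (g n)) G sequentially"
    and Z [measurable]: "Z \<in> borel_measurable M" "G \<in> borel_measurable borel" using assms(2) unfolding spec_rep_def by blast
  have FG: "F \<in> borel_measurable \<rho>" "G \<in> borel_measurable \<rho>" using Y(2) Z(2) by (simp_all add: measurable_cong_sets[OF sets_\<rho> refl])
  have "L2_lim M (\<lambda>n \<omega>. lint (f n) \<omega> + lint (g n) \<omega>) (\<lambda>\<omega>. Y \<omega> + Z \<omega>) sequentially"
    by (rule L2_lim_add[OF f(2) measurable_lint_test[OF f(1)] Y(1) g(2) measurable_lint_test[OF g(1)] Z(1)])
  then have "L2_lim M (\<lambda>n. lint (\<lambda>z. f n z + g n z)) (\<lambda>\<omega>. Y \<omega> + Z \<omega>) sequentially"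
    by (rule L2_lim_cong) (auto intro!: always_eventually AE_I2 lint_add[symmetric] test_fun_bounded_cs f g)
  moreover have "L2_lim \<rho> (\<lambda>n \<xi>. fourier (f n) \<xi> + fourier (g n) \<xi>) (\<lambda>\<xi>. F \<xi> + G \<xi>) sequentially"
    by (rule L2_lim_add[OF f(3) measurable_fourier_\<rho>[OF test_fun_measurable[OF f(1)]] FG(1) g(3) measurable_fourier_\<rho>[OF test_fun_measurable[OF g(1)]] FG(2)])
  then have "L2_lim \<rho> (\<lambda>n. fourier (\<lambda>z. f n z + g n z)) (\<lambda>\<xi>. F \<xi> + G \<xi>) sequentially"
    by (rule L2_lim_cong) (auto intro!: always_eventually AE_I2 fourier_add[symmetric] test_fun_integrable f g)
  moreover have "test_fun (\<lambda>z. f n z + g n z)" for n by (rule test_fun_add[OF f(1) g(1)])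
  moreover have "(\<lambda>\<omega>. Y \<omega> + Z \<omega>) \<in> borel_measurable M" "(\<lambda>\<xi>. F \<xi> + G \<xi>) \<in> borel_measurable borel" by measurable
  ultimately show ?thesis unfolding spec_rep_def by (intro conjI exI[of _ "\<lambda>n z. f n z + g n z"] allI)
qed

lemma spec_rep_cong_AE:
  assumes "spec_rep Y F" "AE \<omega> in M. Y \<omega> = Z \<omega>" "Z \<in> borel_measurable M"
  shows "spec_rep Z F"
proof -
  obtain f where f: "\<And>n::nat. test_fun (f n)" "L2_lim M (\<lambda>n. lint (f n)) Y sequentially" "L2_lim \<rho> (\<lambda>n. fourier (f n)) F sequentially"
    and Y: "Y \<in> borel_measurable M" "F \<in> borel_measurable borel" using assms(1) unfolding spec_rep_def by blast
  have "L2_lim M (\<lambda>n. lint (f n)) Z sequentially"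
    by (rule L2_lim_cong[OF f(2) _ assms(2)]) simp
  then show ?thesis unfolding spec_rep_def using assms(3) Y f by blast
qed

text \<open>If the transforms agree at 0 for all R, differences of the test functions have mean zero
  and the isometry carries the Cauchy property from \<open>L^2(\<rho>)\<close> to the process.
  Convergence in \<open>L^2(\<rho>)\<close> alone would not control the means when \<rho> has no
  atom at 0.\<close>

lemma spec_rep_limit:
  fixes f :: "real \<Rightarrow> complex \<Rightarrow> complex"
  assumes f: "\<And>R. R \<ge> 1 \<Longrightarrow> test_fun (f R)" and 0: "\<And>R. R \<ge> 1 \<Longrightarrow> fourier (f R) 0 = c"
    and F: "F \<in> borel_measurable borel" and lim: "L2_lim \<rho> (\<lambda>R. fourier (f R)) F at_top"
  obtains Y where "spec_rep Y F" "L2_lim M (\<lambda>R. lint (f R)) Y at_top"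
proof -
  \<comment> \<open>Freezing the family below R = 1 makes its properties hold for all real indices,
    as \<open>L2_complete\<close> asks.\<close>
  define f' where "f' R = f (max 1 R)" for R
  have f': "test_fun (f' R)" "fourier (f' R) 0 = c" for R unfolding f'_def by (auto intro: f 0)
  have ev: "\<forall>\<^sub>F R in at_top. f R = f' R" using eventually_ge_at_top[of 1] by eventually_elim (simp add: f'_def)
  have lim': "L2_lim \<rho> (\<lambda>R. fourier (f' R)) F at_top"
    by (rule L2_lim_cong[OF lim]) (use ev in eventually_elim, auto)
  have F': "F \<in> borel_measurable \<rho>" using F by (simp add: measurable_cong_sets[OF sets_\<rho> refl])
  have m: "lint (f' R) \<in> borel_measurable M" for R by (rule measurable_lint_test[OF f'(1)])
  have m': "fourier (f' R) \<in> borel_measurable \<rho>" for R by (rule measurable_fourier_\<rho>[OF test_fun_measurable[OF f'(1)]])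
  obtain Y where Y: "Y \<in> borel_measurable M" "L2_lim M (\<lambda>R. lint (f' R)) Y at_top"
  proof (rule L2_complete[of "\<lambda>R. lint (f' R)" M])
    show "lint (f' R) \<in> borel_measurable M" for R by (rule m)
    fix e :: real assume e: "e > 0"
    have "\<forall>\<^sub>F R in at_top. sqnorm \<rho> (\<lambda>\<xi>. fourier (f' R) \<xi> - F \<xi>) < ennreal (e / 4)"
      using lim' unfolding L2_lim_def by (rule order_tendstoD) (use e in simp)
    then obtain T where T: "\<And>R. R \<ge> T \<Longrightarrow> sqnorm \<rho> (\<lambda>\<xi>. fourier (f' R) \<xi> - F \<xi>) < ennreal (e / 4)"
      unfolding eventually_at_top_linorder by blast
    have "sqnorm M (\<lambda>\<omega>. lint (f' R) \<omega> - lint (f' S) \<omega>) \<le> ennreal e" if "R \<ge> T" "S \<ge> T" for R S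
    proof -
      have d: "test_fun (\<lambda>z. f' R z - f' S z)" by (rule test_fun_diff[OF f'(1) f'(1)])
      have fd: "fourier (\<lambda>z. f' R z - f' S z) \<xi> = fourier (f' R) \<xi> - fourier (f' S) \<xi>" for \<xi>
        by (rule fourier_diff) (rule test_fun_integrable[OF f'(1)])+
      have "sqnorm M (\<lambda>\<omega>. lint (f' R) \<omega> - lint (f' S) \<omega>) = sqnorm M (lint (\<lambda>z. f' R z - f' S z))"
        by (rule sqnorm_cong_AE) (auto intro!: AE_I2 lint_diff[symmetric] test_fun_bounded_cs f')
      also have "\<dots> = sqnorm \<rho> (\<lambda>\<xi>. fourier (f' R) \<xi> - fourier (f' S) \<xi>)"
        using lint_isometry[OF d] unfolding fd[abs_def] by (simp add: f'(2))
      also have "\<dots> \<le> 2 * sqnorm \<rho> (\<lambda>\<xi>. fourier (f' R) \<xi> - F \<xi>) + 2 * sqnorm \<rho> (\<lambda>\<xi>. fourier (f' S) \<xi> - F \<xi>)"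
        by (rule sqnorm_triangle[OF m' F' m'])
      also have "\<dots> \<le> 2 * ennreal (e / 4) + 2 * ennreal (e / 4)"
        using T[OF that(1)] T[OF that(2)] by (intro add_mono mult_left_mono) auto
      also have "\<dots> = ennreal 2 * ennreal (e / 4) + ennreal 2 * ennreal (e / 4)" by simp
      also have "\<dots> = ennreal e"
        using e unfolding ennreal_mult[symmetric, OF zero_le_numeral less_imp_le[OF divide_pos_pos[OF e zero_less_numeral]]]
        by (subst ennreal_plus[symmetric]) auto
      finally show ?thesis .
    qed
    then show "\<exists>T. \<forall>r\<ge>T. \<forall>s\<ge>T. sqnorm M (\<lambda>\<omega>. lint (f' r) \<omega> - lint (f' s) \<omega>) \<le> ennreal e" by blast
  qed
  have "spec_rep Y F" unfolding spec_rep_def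
    using Y(1) F f'(1) L2_lim_filterlim[OF Y(2) filterlim_real_sequentially] L2_lim_filterlim[OF lim' filterlim_real_sequentially]
    by (intro conjI exI[of _ "\<lambda>n. f' (real n)"]) auto
  moreover have "L2_lim M (\<lambda>R. lint (f R)) Y at_top"
    by (rule L2_lim_cong[OF Y(2)]) (use ev in eventually_elim, auto)
  ultimately show thesis by (rule that)
qed

subsection \<open>The mean ergodic theorem\<close>

text \<open>The average of \<open>h\<close> over the points at scale R, convolved with \<eta> at
  unit scale to become a test function.\<close>

definition average_test :: "(complex \<Rightarrow> complex) \<Rightarrow> real \<Rightarrow> complex \<Rightarrow> complex" where
  "average_test h R l = of_real (1 / R\<^sup>2) * conv (\<lambda>x. h (x / of_real R)) \<eta> l"

lemma test_fun_average_test: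
  assumes "bounded_cs h" "R > 0" shows "test_fun (average_test h R)"
  unfolding average_test_def[abs_def]
  by (intro test_fun_cmult test_fun_conv[OF bounded_cs_integrable_cs[OF bounded_cs_scale[OF assms]] \<eta>])

lemma fourier_average_test:
  assumes h: "bounded_cs h" and R: "R > 0"
  shows "fourier (average_test h R) \<xi> = fourier h (of_real R * \<xi>) * fourier \<eta> \<xi>"
proof -
  have hi: "integrable lborel (\<lambda>x. h (x / of_real R))" "(\<lambda>x. h (x / of_real R)) \<in> borel_measurable borel"
    using bounded_cs_integrable_cs[OF bounded_cs_scale[OF h R]] by (auto simp: integrable_cs_def)
  have hm: "h \<in> borel_measurable borel" using h by (simp add: bounded_cs_def)
  show ?thesis unfolding average_test_def[abs_def] fourier_cmult
    using R by (subst fourier_conv[OF hi test_fun_integrable[OF \<eta>] test_fun_measurable[OF \<eta>]]) (simp add: fourier_scale[OF hm R])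
qed

text \<open>The transform is that of \<open>h\<close> at R \<xi> times that of \<eta>. The second
  factor provides a majorant in \<open>L^2(\<rho>)\<close>; the first is constant in R at the origin
  and tends to 0 elsewhere by Riemann-Lebesgue.\<close>

lemma L2_lim_fourier_average_test:
  assumes h: "bounded_cs h" and cont: "AE x in lborel. isCont h x"
  shows "L2_lim \<rho> (\<lambda>R. fourier (average_test h R)) (\<lambda>\<xi>. if \<xi> = 0 then (\<integral>x. h x \<partial>lborel) else 0) at_top"
proof (rule L2_lim_dominated)
  let ?F = "\<lambda>\<xi>. if \<xi> = 0 then (\<integral>x. h x \<partial>lborel) else 0"
  have [measurable]: "h \<in> borel_measurable borel" "\<eta> \<in> borel_measurable borel" using h test_fun_measurable[OF \<eta>] by (auto simp: bounded_cs_def)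
  have \<eta>0: "fourier \<eta> 0 = 1" by (simp add: fourier_zero integral_\<eta>)
  show "fourier (average_test h R) \<in> borel_measurable \<rho>" for R
    by (rule measurable_fourier_\<rho>) (unfold average_test_def[abs_def] conv_def, measurable)
  show "?F \<in> borel_measurable \<rho>" by measurable
  define A where "A = (\<integral>x. cmod (h x) \<partial>lborel)"
  have A: "A \<ge> 0" by (simp add: A_def)
  show "(\<lambda>\<xi>. A * cmod (fourier \<eta> \<xi>)) \<in> borel_measurable \<rho>" by measurable
  have "integrable \<rho> (\<lambda>\<xi>. (cmod (fourier \<eta> \<xi>))\<^sup>2)"
    using sqnorm_fourier_finite[OF \<eta>] unfolding sqnorm_def by (intro integrableI_bounded) auto
  then show "integrable \<rho> (\<lambda>\<xi>. (A * cmod (fourier \<eta> \<xi>))\<^sup>2)" by (simp add: power_mult_distrib)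
  show "\<forall>\<^sub>F R in at_top. \<forall>\<xi>\<in>space \<rho>. cmod (fourier (average_test h R) \<xi> - ?F \<xi>) \<le> A * cmod (fourier \<eta> \<xi>)"
    using eventually_gt_at_top[of 0]
  proof eventually_elim
    case (elim R)
    show ?case
    proof
      fix \<xi>
      show "cmod (fourier (average_test h R) \<xi> - ?F \<xi>) \<le> A * cmod (fourier \<eta> \<xi>)"
        using A norm_fourier_le[of h "of_real R * \<xi>"] unfolding fourier_average_test[OF h elim] A_def
        by (auto simp: norm_mult \<eta>0 fourier_zero integral_\<eta> intro!: mult_right_mono)
    qed
  qed
  fix \<xi>
  show "((\<lambda>R. fourier (average_test h R) \<xi>) \<longlongrightarrow> ?F \<xi>) at_top"
  proof (rule Lim_transform_eventually)
    show "\<forall>\<^sub>F R in at_top. fourier h (of_real R * \<xi>) * fourier \<eta> \<xi> = fourier (average_test h R) \<xi>"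
      using eventually_gt_at_top[of 0] by eventually_elim (simp add: fourier_average_test[OF h])
    show "((\<lambda>R. fourier h (of_real R * \<xi>) * fourier \<eta> \<xi>) \<longlongrightarrow> ?F \<xi>) at_top"
    proof (cases "\<xi> = 0")
      case True
      then show ?thesis by (simp add: fourier_zero integral_\<eta>)
    next
      case False
      from tendsto_mult[OF riemann_lebesgue[OF h cont False] tendsto_const[of "fourier \<eta> \<xi>"]] False show ?thesis by simp
    qed
  qed
qed

lemma lint_average_test:
  assumes h: "bounded_cs h" and R: "R > 0" and \<omega>: "\<omega> \<in> space M"
  shows "lint (average_test h R) \<omega> - lint (\<lambda>l. of_real (1 / R\<^sup>2) * (conv (\<lambda>x. h (x / of_real R)) \<eta> l - h (l / of_real R))) \<omega> =
    lint (\<lambda>l. of_real (1 / R\<^sup>2) * h (l / of_real R)) \<omega>"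
proof -
  note a = test_fun_bounded_cs[OF test_fun_average_test[OF h R]]
  note b = bounded_cs_cmult[OF bounded_cs_scale[OF h R], of "of_real (1 / R\<^sup>2)"]
  have "(\<lambda>l. of_real (1 / R\<^sup>2) * (conv (\<lambda>x. h (x / of_real R)) \<eta> l - h (l / of_real R))) =
      (\<lambda>l. average_test h R l - of_real (1 / R\<^sup>2) * h (l / of_real R))"
    by (simp add: average_test_def right_diff_distrib)
  then show ?thesis by (simp only: lint_diff[OF \<omega> a b]) simp
qed

lemma ergodic_average_measurable:
  assumes [measurable]: "h \<in> borel_measurable borel"
  shows "lint (\<lambda>l. of_real (1 / R\<^sup>2) * h (l / of_real R)) \<in> borel_measurable M"
    "lint (average_test h R) \<in> borel_measurable M"
    "lint (\<lambda>l. of_real (1 / R\<^sup>2) * (conv (\<lambda>x. h (x / of_real R)) \<eta> l - h (l / of_real R))) \<in> borel_measurable M"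
proof -
  have [measurable]: "\<eta> \<in> borel_measurable borel" using test_fun_measurable[OF \<eta>] .
  show "lint (\<lambda>l. of_real (1 / R\<^sup>2) * h (l / of_real R)) \<in> borel_measurable M"
    by (rule measurable_lint) measurable
  show "lint (average_test h R) \<in> borel_measurable M"
    by (rule measurable_lint) (unfold average_test_def[abs_def] conv_def, measurable)
  show "lint (\<lambda>l. of_real (1 / R\<^sup>2) * (conv (\<lambda>x. h (x / of_real R)) \<eta> l - h (l / of_real R))) \<in> borel_measurable M"
    by (rule measurable_lint) (unfold conv_def, measurable)
qed

lemma L2_lim_average_transfer:
  assumes h: "bounded_cs h" and cont: "AE x in lborel. isCont h x"
    and Y: "Y \<in> borel_measurable M" "L2_lim M (\<lambda>R. lint (average_test h R)) Y at_top"
  shows "L2_lim M (\<lambda>R. lint (\<lambda>l. of_real (1 / R\<^sup>2) * h (l / of_real R))) Y at_top"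
proof -
  have hm: "h \<in> borel_measurable borel" using h by (simp add: bounded_cs_def)
  note m = ergodic_average_measurable[OF hm]
  have "L2_lim M (\<lambda>R \<omega>. lint (average_test h R) \<omega> - lint (\<lambda>l. of_real (1 / R\<^sup>2) * (conv (\<lambda>x. h (x / of_real R)) \<eta> l - h (l / of_real R))) \<omega>) (\<lambda>\<omega>. Y \<omega> - 0) at_top"
    by (rule L2_lim_diff[OF Y(2) m(2) Y(1) mollification_error[OF h cont \<eta> integral_\<eta>] m(3)]) simp
  then show ?thesis
  proof (rule L2_lim_cong)
    show "\<forall>\<^sub>F R in at_top. AE \<omega> in M. lint (average_test h R) \<omega> - lint (\<lambda>l. of_real (1 / R\<^sup>2) * (conv (\<lambda>x. h (x / of_real R)) \<eta> l - h (l / of_real R))) \<omega> =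
       lint (\<lambda>l. of_real (1 / R\<^sup>2) * h (l / of_real R)) \<omega>"
      using eventually_gt_at_top[of 0] by eventually_elim (intro AE_I2 lint_average_test h)
  qed simp
qed

lemma ergodic_limit_exists:
  assumes h: "bounded_cs h" and cont: "AE x in lborel. isCont h x"
  obtains Y where "spec_rep Y (\<lambda>\<xi>. if \<xi> = 0 then (\<integral>x. h x \<partial>lborel) else 0)"
    "L2_lim M (\<lambda>R. lint (\<lambda>l. of_real (1 / R\<^sup>2) * h (l / of_real R))) Y at_top"
proof -
  have "\<exists>Y. spec_rep Y (\<lambda>\<xi>. if \<xi> = 0 then (\<integral>x. h x \<partial>lborel) else 0) \<and> L2_lim M (\<lambda>R. lint (average_test h R)) Y at_top"
  proof (rule spec_rep_limit[of "average_test h" "\<integral>x. h x \<partial>lborel"])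
    fix R :: real assume "R \<ge> 1"
    then have "R > 0" by simp
    then show "test_fun (average_test h R)" "fourier (average_test h R) 0 = (\<integral>x. h x \<partial>lborel)"
      using h by (simp add: test_fun_average_test, subst fourier_average_test) (simp_all add: fourier_zero integral_\<eta>)
  qed (auto intro: L2_lim_fourier_average_test[OF h cont])
  then obtain Y where Y: "spec_rep Y (\<lambda>\<xi>. if \<xi> = 0 then (\<integral>x. h x \<partial>lborel) else 0)" "L2_lim M (\<lambda>R. lint (average_test h R)) Y at_top"
    by blast
  then have "Y \<in> borel_measurable M" by (simp add: spec_rep_def)
  then show thesis using that[OF Y(1) L2_lim_average_transfer[OF h cont _ Y(2)]] by blast
qed

text \<open>Here the means vanish too, so the isometry applies to the averages themselves and
  identifies the limit, which \<open>ergodic_limit_exists\<close> leaves unspecified.\<close>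

lemma ergodic_limit_zero:
  assumes h: "bounded_cs h" and cont: "AE x in lborel. isCont h x" and 0: "(\<integral>x. h x \<partial>lborel) = 0"
  shows "L2_lim M (\<lambda>R. lint (\<lambda>l. of_real (1 / R\<^sup>2) * h (l / of_real R))) (\<lambda>_. 0) at_top"
proof (rule L2_lim_average_transfer[OF h cont])
  have "L2_lim \<rho> (\<lambda>R. fourier (average_test h R)) (\<lambda>\<xi>. 0) at_top"
    using L2_lim_fourier_average_test[OF h cont] unfolding 0 if_cancel .
  then have "((\<lambda>R. sqnorm \<rho> (fourier (average_test h R))) \<longlongrightarrow> 0) at_top" unfolding L2_lim_def by simp
  moreover have "\<forall>\<^sub>F R in at_top. sqnorm \<rho> (fourier (average_test h R)) = sqnorm M (\<lambda>\<omega>. lint (average_test h R) \<omega> - 0)"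
    using eventually_gt_at_top[of 0]
  proof eventually_elim
    case (elim R)
    have "fourier (average_test h R) 0 = 0" using fourier_average_test[OF h elim, of 0] 0 by (simp add: fourier_zero)
    from lint_isometry[OF test_fun_average_test[OF h elim] this] show ?case by simp
  qed
  ultimately show "L2_lim M (\<lambda>R. lint (average_test h R)) (\<lambda>_. 0) at_top"
    unfolding L2_lim_def by (rule Lim_transform_eventually)
qed simp

subsection \<open>Identification of the limit with the conditional intensity\<close>

lemma bounded_cs_disk: "bounded_cs (indicator (ball 0 1))"
  by (rule bounded_cs_indicator) auto

lemma AE_isCont_disk: "AE x in lborel. isCont (indicator (ball 0 1) :: complex \<Rightarrow> complex) x"
  using AE_complex_not_in_sphere[of 1]
proof eventually_elim
  case (elim x)
  consider "x \<in> ball 0 1" | "x \<in> - cball 0 1" using elim by fastforce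
  then show ?case
  proof cases
    case 1
    then have "\<forall>\<^sub>F y in nhds x. indicator (ball 0 1) y = (1::complex)"
      by (intro eventually_nhds[THEN iffD2] exI[of _ "ball 0 1"]) auto
    then show ?thesis by (subst isCont_cong) auto
  next
    case 2
    then have "\<forall>\<^sub>F y in nhds x. indicator (ball 0 1) y = (0::complex)"
      by (intro eventually_nhds[THEN iffD2] exI[of _ "- cball 0 1"]) auto
    then show ?thesis by (subst isCont_cong) auto
  qed
qed

lemma integral_disk: "(\<integral>x. indicator (ball (0::complex) 1) x \<partial>lborel) = complex_of_real pi"
proof -
  have "(indicator (ball 0 1) :: complex \<Rightarrow> complex) = (\<lambda>z. of_real (indicator (ball 0 1) z))"
    by (auto simp: indicator_def)
  then have "(\<integral>x. indicator (ball (0::complex) 1) x \<partial>lborel) = complex_of_real (\<integral>x. indicator (ball (0::complex) 1) x \<partial>lborel)"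
    by (simp only: integral_complex_of_real)
  also have "(\<integral>x. indicator (ball (0::complex) 1) x \<partial>lborel) = pi"
    by (simp add: measure_def emeasure_ball_complex)
  finally show ?thesis .
qed

definition disk_count :: "real \<Rightarrow> 'a \<Rightarrow> real" where
  "disk_count R \<omega> = measure (conf_measure (N \<omega>)) (ball 0 R)"

lemma disk_count_nonneg: "0 \<le> disk_count R \<omega>" by (simp add: disk_count_def)

lemma emeasure_disk_count: "\<omega> \<in> space M \<Longrightarrow> emeasure (conf_measure (N \<omega>)) (ball 0 R) = ennreal (disk_count R \<omega>)"
  unfolding disk_count_def using locfin_N by (simp add: measure_def emeasure_conf_measure)

lemma lint_disk:
  assumes "R > 0" "\<omega> \<in> space M"
  shows "lint (\<lambda>l. of_real (1 / R\<^sup>2) * indicator (ball 0 1) (l / of_real R)) \<omega> = of_real (disk_count R \<omega> / R\<^sup>2)"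
proof -
  have "(\<lambda>l. indicator (ball 0 1) (l / of_real R)) = (\<lambda>l::complex. of_real (indicator (ball 0 R) l) :: complex)"
    using assms(1) by (auto simp: indicator_def norm_divide)
  then have "lint (\<lambda>l. indicator (ball 0 1) (l / of_real R)) \<omega> = of_real (disk_count R \<omega>)"
    unfolding lint_def disk_count_def by (simp only: integral_complex_of_real) simp
  then show ?thesis unfolding lint_cmult by simp
qed

lemma measurable_disk_count [measurable]: "disk_count R \<in> borel_measurable M"
proof -
  have [measurable]: "(\<lambda>c. emeasure (conf_measure c) (ball 0 R)) \<in> borel_measurable conf_space"
    by (rule measurable_emeasure_conf_measure) simp
  show ?thesis unfolding disk_count_def[abs_def] measure_def by measurable
qed

lemma sets_F_inv: "sets (F_inv M N) = sigma_sets (space M) {N -` E \<inter> space M | E. E \<in> sets conf_space \<and> shift_invariant E}"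
  and space_F_inv: "space (F_inv M N) = space M"
  unfolding F_inv_def by (rule sets_measure_of, blast, rule space_measure_of, blast)

lemma shift_invariant_empty: "shift_invariant {}" by (simp add: shift_invariant_def)

text \<open>The generating events already form a \<sigma>-algebra, because invariance survives
  complements and countable unions.\<close>

lemma F_inv_E:
  assumes "A \<in> sets (F_inv M N)"
  obtains E where "E \<in> sets conf_space" "shift_invariant E" "A = N -` E \<inter> space M"
proof -
  have "\<exists>E. E \<in> sets conf_space \<and> shift_invariant E \<and> A = N -` E \<inter> space M"
    using assms unfolding sets_F_inv
  proof (induction rule: sigma_sets.induct)
    case (Basic a)
    then show ?case by blast
  next
    case Empty
    show ?case by (intro exI[of _ "{}"]) (simp add: shift_invariant_empty)
  next
    case (Compl a)
    then obtain E where E: "E \<in> sets conf_space" "shift_invariant E" "a = N -` E \<inter> space M" by blast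
    have "shift_invariant (space conf_space - E)"
      using E(2) unfolding shift_invariant_def space_conf_space by (auto intro: locfin_shift_conf)
    moreover have "space M - a = N -` (space conf_space - E) \<inter> space M"
      using locfin_N unfolding E(3) space_conf_space by auto
    moreover have "space conf_space - E \<in> sets conf_space" using E(1) by auto
    ultimately show ?case by blast
  next
    case (Union a)
    then obtain E where E: "\<And>i::nat. E i \<in> sets conf_space" "\<And>i. shift_invariant (E i)" "\<And>i. a i = N -` E i \<inter> space M" by metis
    have "shift_invariant (\<Union>i. E i)" using E(2) unfolding shift_invariant_def by blast
    moreover have "(\<Union>i. a i) = N -` (\<Union>i. E i) \<inter> space M" unfolding E(3) by auto
    moreover have "(\<Union>i. E i) \<in> sets conf_space" using E(1) by auto
    ultimately show ?case by blast
  qed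
  then show thesis using that by blast
qed

lemma F_inv_I: "E \<in> sets conf_space \<Longrightarrow> shift_invariant E \<Longrightarrow> N -` E \<inter> space M \<in> sets (F_inv M N)"
  unfolding sets_F_inv by (rule sigma_sets.Basic) blast

lemma subalgebra_F_inv: "subalgebra M (F_inv M N)"
  unfolding subalgebra_def space_F_inv
proof (intro conjI refl subsetI)
  fix A assume "A \<in> sets (F_inv M N)"
  then obtain E where "E \<in> sets conf_space" "A = N -` E \<inter> space M" by (rule F_inv_E)
  then show "A \<in> sets M" by (simp add: measurable_sets[OF measurable_N])
qed

text \<open>The supremum over \<open>j\<close> makes the limit of the disk averages invariant under every translation, not just almost surely.\<close>

lemma shift_invariant_limsup:
  fixes r :: "nat \<Rightarrow> real" and a :: "nat \<Rightarrow> ennreal"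
  defines "y \<equiv> \<lambda>c. SUP j::nat. limsup (\<lambda>k. emeasure (conf_measure c) (ball 0 (r k + real j)) * a k)"
  shows "y (shift_conf w c) = y c"
proof (rule antisym)
  have le: "y (shift_conf w c) \<le> y c" for w c
    unfolding y_def
  proof (rule SUP_least)
    fix j :: nat
    obtain m :: nat where m: "cmod w \<le> real m" using real_arch_simple by blast
    have "limsup (\<lambda>k. emeasure (conf_measure (shift_conf w c)) (ball 0 (r k + real j)) * a k) \<le>
        limsup (\<lambda>k. emeasure (conf_measure c) (ball 0 (r k + real (j + m))) * a k)"
    proof (intro Limsup_mono always_eventually allI mult_right_mono)
      fix k
      have "(+) (- w) ` ball 0 (r k + real j) \<subseteq> ball 0 (r k + real (j + m))"
      proof
        fix z assume "z \<in> (+) (- w) ` ball 0 (r k + real j)"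
        then obtain x where x: "z = - w + x" "cmod x < r k + real j" by auto
        then show "z \<in> ball 0 (r k + real (j + m))" using norm_triangle_ineq[of "- w" x] m by simp
      qed
      then show "emeasure (conf_measure (shift_conf w c)) (ball 0 (r k + real j)) \<le> emeasure (conf_measure c) (ball 0 (r k + real (j + m)))"
        by (subst emeasure_conf_measure_shift) (auto intro!: emeasure_mono)
    qed auto
    also have "\<dots> \<le> (SUP j::nat. limsup (\<lambda>k. emeasure (conf_measure c) (ball 0 (r k + real j)) * a k))"
      by (rule SUP_upper) simp
    finally show "limsup (\<lambda>k. emeasure (conf_measure (shift_conf w c)) (ball 0 (r k + real j)) * a k) \<le>
      (SUP j::nat. limsup (\<lambda>k. emeasure (conf_measure c) (ball 0 (r k + real j)) * a k))" .
  qed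
  show "y (shift_conf w c) \<le> y c" by (rule le)
  have "y (shift_conf (- w) (shift_conf w c)) \<le> y (shift_conf w c)" by (rule le)
  then show "y c \<le> y (shift_conf w c)" by (simp add: shift_conf_shift_conf) (simp add: shift_conf_def)
qed

text \<open>On an invariant event the mean number of points in a disk is proportional to its area,
  so the normalized counts have the same integral for every R.\<close>

lemma disk_average_invariant:
  assumes E: "E \<in> sets conf_space" "shift_invariant E" and R: "R > 0"
  shows "(\<integral>\<omega>. indicator E (N \<omega>) * (disk_count R \<omega> / R\<^sup>2) \<partial>M) = (\<integral>\<omega>. indicator E (N \<omega>) * disk_count 1 \<omega> \<partial>M)"
proof -
  note [measurable] = E(1)
  have I: "(\<integral>\<omega>. indicator E (N \<omega>) * disk_count s \<omega> \<partial>M) = enn2real (\<integral>\<^sup>+\<omega>. indicator E (N \<omega>) * emeasure (conf_measure (N \<omega>)) (ball 0 s) \<partial>M)" for s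
  proof -
    have "(\<integral>\<omega>. indicator E (N \<omega>) * disk_count s \<omega> \<partial>M) = enn2real (\<integral>\<^sup>+\<omega>. ennreal (indicator E (N \<omega>) * disk_count s \<omega>) \<partial>M)"
      by (rule integral_eq_nn_integral) (measurable, simp add: disk_count_nonneg)
    also have "(\<integral>\<^sup>+\<omega>. ennreal (indicator E (N \<omega>) * disk_count s \<omega>) \<partial>M) = (\<integral>\<^sup>+\<omega>. indicator E (N \<omega>) * emeasure (conf_measure (N \<omega>)) (ball 0 s) \<partial>M)"
      by (intro nn_integral_cong) (auto simp: emeasure_disk_count indicator_def)
    finally show ?thesis .
  qed
  have "(\<integral>\<^sup>+\<omega>. indicator E (N \<omega>) * emeasure (conf_measure (N \<omega>)) (ball 0 R) \<partial>M) * ennreal pi =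
      ennreal (pi * R\<^sup>2) * (\<integral>\<^sup>+\<omega>. indicator E (N \<omega>) * emeasure (conf_measure (N \<omega>)) (ball 0 1) \<partial>M)"
    using invariant_mean[OF E borel_measurable_indicator[of "ball 0 R"]] R by (simp add: emeasure_ball_complex)
  then have "enn2real ((\<integral>\<^sup>+\<omega>. indicator E (N \<omega>) * emeasure (conf_measure (N \<omega>)) (ball 0 R) \<partial>M) * ennreal pi) =
      enn2real (ennreal (pi * R\<^sup>2) * (\<integral>\<^sup>+\<omega>. indicator E (N \<omega>) * emeasure (conf_measure (N \<omega>)) (ball 0 1) \<partial>M))"
    by (simp only:)
  then have "(\<integral>\<omega>. indicator E (N \<omega>) * disk_count R \<omega> \<partial>M) = R\<^sup>2 * (\<integral>\<omega>. indicator E (N \<omega>) * disk_count 1 \<omega> \<partial>M)"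
    unfolding I by (simp add: enn2real_mult)
  then show ?thesis using R by simp
qed

lemma disk_limit:
  obtains Y where "spec_rep Y (\<lambda>\<xi>. if \<xi> = 0 then of_real pi else 0)"
    "L2_lim M (\<lambda>R. lint (\<lambda>l. of_real (1 / R\<^sup>2) * indicator (ball 0 1) (l / of_real R))) Y at_top"
  using ergodic_limit_exists[OF bounded_cs_disk AE_isCont_disk] unfolding integral_disk by blast

text \<open>The mean square limit is determined only up to null sets; comparison with a conditional
  expectation calls for a version measurable with respect to the invariant events. It is built from
  an everywhere defined, exactly shift-invariant function of the configuration.\<close>

lemma invariant_version:
  assumes Y [measurable]: "Y \<in> borel_measurable M"
    and lim: "L2_lim M (\<lambda>R. lint (\<lambda>l. of_real (1 / R\<^sup>2) * indicator (ball 0 1) (l / of_real R))) Y at_top"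
  obtains g :: "'a \<Rightarrow> real" where "g \<in> borel_measurable (F_inv M N)" "AE \<omega> in M. Y \<omega> = of_real (g \<omega>)"
proof -
  define u where "u R = lint (\<lambda>l. of_real (1 / R\<^sup>2) * indicator (ball 0 1) (l / of_real R))" for R
  have im: "(indicator (ball 0 1) :: complex \<Rightarrow> complex) \<in> borel_measurable borel" using bounded_cs_disk by (simp add: bounded_cs_def)
  have [measurable]: "u R \<in> borel_measurable M" for R unfolding u_def by (rule ergodic_average_measurable(1)[OF im])
  have "\<forall>k::nat. \<exists>T. \<forall>R\<ge>T. sqnorm M (\<lambda>\<omega>. u R \<omega> - Y \<omega>) < ennreal ((1/2)^k)"
  proof
    fix k :: nat
    have "\<forall>\<^sub>F R in at_top. sqnorm M (\<lambda>\<omega>. u R \<omega> - Y \<omega>) < ennreal ((1/2)^k)"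
      using lim unfolding L2_lim_def u_def[symmetric] by (rule order_tendstoD) simp
    then show "\<exists>T. \<forall>R\<ge>T. sqnorm M (\<lambda>\<omega>. u R \<omega> - Y \<omega>) < ennreal ((1/2)^k)" unfolding eventually_at_top_linorder .
  qed
  then obtain T where T: "\<And>k R. R \<ge> T k \<Longrightarrow> sqnorm M (\<lambda>\<omega>. u R \<omega> - Y \<omega>) < ennreal ((1/2)^k)" by metis
  \<comment> \<open>The radii grow fast enough for the squared errors to be summable not only along
    r k but along r k + j for every j.\<close>
  define r where "r k = max (T k) (real k + 1)" for k
  have r1: "r k \<ge> 1" and rk: "r k \<ge> real k" for k by (auto simp: r_def)
  have rlim: "filterlim r at_top sequentially"
    by (rule filterlim_at_top_mono[OF filterlim_real_sequentially]) (simp add: rk)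
  have AEj: "AE \<omega> in M. \<forall>j::nat. (\<lambda>k. u (r k + real j) \<omega> - Y \<omega>) \<longlonglongrightarrow> 0"
    unfolding AE_all_countable
  proof
    fix j :: nat
    have "(\<Sum>k. sqnorm M (\<lambda>\<omega>. u (r k + real j) \<omega> - Y \<omega>)) \<le> (\<Sum>k. ennreal ((1/2)^k))"
      by (intro suminf_le less_imp_le[OF T]) (auto simp: r_def)
    also have "\<dots> = ennreal (\<Sum>k. (1/2)^k)"
      by (rule suminf_ennreal2) (auto intro: summable_geometric)
    also have "\<dots> < \<infinity>" by simp
    finally show "AE \<omega> in M. (\<lambda>k. u (r k + real j) \<omega> - Y \<omega>) \<longlonglongrightarrow> 0"
      by (intro AE_tendsto_0_of_suminf_sqnorm) measurable
  qed
  \<comment> \<open>All j share the normalization by (r k)^2, since the ratio of r k + j to r k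
    tends to 1; almost surely every j yields the same limit.\<close>
  define y where "y c = (SUP j::nat. limsup (\<lambda>k. emeasure (conf_measure c) (ball 0 (r k + real j)) * ennreal (1 / (r k)\<^sup>2)))" for c
  have ym [measurable]: "y \<in> borel_measurable conf_space"
  proof -
    have [measurable]: "(\<lambda>c. emeasure (conf_measure c) (ball 0 s)) \<in> borel_measurable conf_space" for s
      by (rule measurable_emeasure_conf_measure) simp
    show ?thesis unfolding y_def[abs_def] by measurable
  qed
  have yinv: "y (shift_conf w c) = y c" for w c unfolding y_def by (rule shift_invariant_limsup)
  have eq: "AE \<omega> in M. Y \<omega> = of_real (enn2real (y (N \<omega>)))"
    using AEj AE_space
  proof eventually_elim
    case (elim \<omega>)
    have L: "(\<lambda>k. disk_count (r k + real j) \<omega> / (r k)\<^sup>2) \<longlonglongrightarrow> Re (Y \<omega>)" for j :: nat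
    proof -
      have "(\<lambda>k. u (r k + real j) \<omega>) \<longlonglongrightarrow> Y \<omega>" using elim(1) LIM_zero_iff by blast
      then have "(\<lambda>k. Re (u (r k + real j) \<omega>)) \<longlonglongrightarrow> Re (Y \<omega>)" by (rule tendsto_Re)
      moreover have "(\<lambda>k. ((r k + real j) / r k)\<^sup>2) \<longlonglongrightarrow> 1"
      proof -
        have "((\<lambda>x. ((x + real j) / x)\<^sup>2) \<longlongrightarrow> 1) at_top" by real_asymp
        from filterlim_compose[OF this rlim] show ?thesis .
      qed
      ultimately have "(\<lambda>k. Re (u (r k + real j) \<omega>) * ((r k + real j) / r k)\<^sup>2) \<longlonglongrightarrow> Re (Y \<omega>) * 1" by (rule tendsto_mult)
      moreover have "Re (u (r k + real j) \<omega>) * ((r k + real j) / r k)\<^sup>2 = disk_count (r k + real j) \<omega> / (r k)\<^sup>2" for k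
      proof -
        have "r k + real j > 0" using r1[of k] by linarith
        then have "Re (u (r k + real j) \<omega>) = disk_count (r k + real j) \<omega> / (r k + real j)\<^sup>2"
          unfolding u_def by (subst lint_disk[OF _ elim(2)]) auto
        then show ?thesis using \<open>r k + real j > 0\<close> by (simp add: power_divide)
      qed
      ultimately show ?thesis by simp
    qed
    have nn: "Re (Y \<omega>) \<ge> 0" by (rule LIMSEQ_le_const[OF L[of 0]]) (auto simp: disk_count_def)
    have "limsup (\<lambda>k. emeasure (conf_measure (N \<omega>)) (ball 0 (r k + real j)) * ennreal (1 / (r k)\<^sup>2)) = ennreal (Re (Y \<omega>))" for j :: nat
    proof (rule lim_imp_Limsup)
      have "(\<lambda>k. ennreal (disk_count (r k + real j) \<omega> / (r k)\<^sup>2)) \<longlonglongrightarrow> ennreal (Re (Y \<omega>))" by (rule tendsto_ennrealI[OF L])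
      moreover have "ennreal (disk_count (r k + real j) \<omega> / (r k)\<^sup>2) = emeasure (conf_measure (N \<omega>)) (ball 0 (r k + real j)) * ennreal (1 / (r k)\<^sup>2)" for k
        unfolding emeasure_disk_count[OF elim(2)] by (subst ennreal_mult[symmetric]) (auto simp: disk_count_def)
      ultimately show "(\<lambda>k. emeasure (conf_measure (N \<omega>)) (ball 0 (r k + real j)) * ennreal (1 / (r k)\<^sup>2)) \<longlonglongrightarrow> ennreal (Re (Y \<omega>))" by simp
    qed simp
    then have "y (N \<omega>) = ennreal (Re (Y \<omega>))" unfolding y_def by simp
    moreover have "Im (Y \<omega>) = 0"
    proof -
      have "(\<lambda>k. u (r k + real 0) \<omega>) \<longlonglongrightarrow> Y \<omega>" using elim(1) LIM_zero_iff by blast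
      then have "(\<lambda>k. Im (u (r k + real 0) \<omega>)) \<longlonglongrightarrow> Im (Y \<omega>)" by (rule tendsto_Im)
      moreover have "Im (u (r k + real 0) \<omega>) = 0" for k
        unfolding u_def by (subst lint_disk[OF _ elim(2)]) (use r1[of k] in auto)
      ultimately show ?thesis by (simp add: LIMSEQ_const_iff)
    qed
    ultimately show ?case using nn by (simp add: complex_eq_iff)
  qed
  have "(\<lambda>\<omega>. enn2real (y (N \<omega>))) \<in> borel_measurable (F_inv M N)"
  proof (rule measurableI)
    fix B :: "real set" assume [measurable]: "B \<in> sets borel"
    define E where "E = {c \<in> space conf_space. enn2real (y c) \<in> B}"
    have "E \<in> sets conf_space" unfolding E_def by measurable
    moreover have "shift_invariant E"
      unfolding shift_invariant_def E_def space_conf_space by (auto simp: yinv locfin_shift_conf)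
    ultimately have "N -` E \<inter> space M \<in> sets (F_inv M N)" by (rule F_inv_I)
    moreover have "N -` E \<inter> space M = (\<lambda>\<omega>. enn2real (y (N \<omega>))) -` B \<inter> space (F_inv M N)"
      unfolding E_def space_F_inv space_conf_space using locfin_N by auto
    ultimately show "(\<lambda>\<omega>. enn2real (y (N \<omega>))) -` B \<inter> space (F_inv M N) \<in> sets (F_inv M N)" by simp
  qed simp
  then show thesis using eq by (rule that)
qed

lemma measurable_cond_intensity [measurable]: "cond_intensity M N \<in> borel_measurable M"
  unfolding cond_intensity_def[abs_def] using borel_measurable_cond_exp2 by measurable

text \<open>The invariant version characterizes a conditional expectation: by
  \<open>disk_average_invariant\<close> the integrals of the disk averages over an invariant event
  do not depend on R, so they pass to the limit unchanged, and at R = 1 they belong to the count in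
  the unit disk.\<close>

lemma disk_limit_eq_cond_intensity:
  assumes Y [measurable]: "Y \<in> borel_measurable M"
    and lim: "L2_lim M (\<lambda>R. lint (\<lambda>l. of_real (1 / R\<^sup>2) * indicator (ball 0 1) (l / of_real R))) Y at_top"
  shows "AE \<omega> in M. Y \<omega> = of_real (pi * cond_intensity M N \<omega>)"
proof -
  obtain g :: "'a \<Rightarrow> real" where g: "g \<in> borel_measurable (F_inv M N)" "AE \<omega> in M. Y \<omega> = of_real (g \<omega>)"
    by (rule invariant_version[OF Y lim])
  have gM [measurable]: "g \<in> borel_measurable M" by (rule measurable_from_subalg[OF subalgebra_F_inv g(1)])
  interpret FS: finite_measure_subalgebra M "F_inv M N"
    by unfold_locales (rule subalgebra_F_inv)
  define u where "u R = lint (\<lambda>l. of_real (1 / R\<^sup>2) * indicator (ball 0 1) (l / of_real R))" for R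
  have im: "(indicator (ball 0 1) :: complex \<Rightarrow> complex) \<in> borel_measurable borel" using bounded_cs_disk by (simp add: bounded_cs_def)
  have um [measurable]: "u R \<in> borel_measurable M" for R unfolding u_def by (rule ergodic_average_measurable(1)[OF im])
  define u' where "u' R = u (max 1 R)" for R
  have u'm: "u' R \<in> borel_measurable M" for R unfolding u'_def by (rule um)
  have u'f: "sqnorm M (u' R) < \<infinity>" for R unfolding u'_def u_def
    by (rule sqnorm_lint_finite[OF bounded_cs_cmult[OF bounded_cs_scale[OF bounded_cs_disk]]]) simp
  have u'lim: "L2_lim M u' Y at_top"
    by (rule L2_lim_cong[OF lim[folded u_def]]) (use eventually_ge_at_top[of 1] in eventually_elim, auto simp: u'_def)
  have Yf: "sqnorm M Y < \<infinity>" by (rule L2_lim_finite[OF u'lim _ u'm Y u'f]) simp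
  have gf: "sqnorm M (\<lambda>\<omega>. of_real (g \<omega>)) < \<infinity>" using Yf sqnorm_cong_AE[OF g(2)] by simp
  have gi: "integrable M g"
    using integrable_Re[OF integrable_of_sqnorm[OF _ gf]] by simp
  have d1: "integrable M (disk_count 1)"
  proof -
    have "integrable M (u' 1)" by (rule integrable_of_sqnorm[OF u'm u'f])
    then have "integrable M (\<lambda>\<omega>. Re (u' 1 \<omega>))" by (rule integrable_Re)
    moreover have "u' 1 \<omega> = of_real (disk_count 1 \<omega> / 1\<^sup>2)" if "\<omega> \<in> space M" for \<omega>
      unfolding u'_def max.idem u_def by (rule lint_disk[OF zero_less_one that])
    ultimately show ?thesis by (subst Bochner_Integration.integrable_cong[of M M _ "\<lambda>\<omega>. Re (u' 1 \<omega>)"]) auto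
  qed
  have "AE \<omega> in M. real_cond_exp M (F_inv M N) (disk_count 1) \<omega> = g \<omega>"
  proof (rule FS.real_cond_exp_charact[OF _ d1 gi g(1)])
    fix A assume "A \<in> sets (F_inv M N)"
    then obtain E where E: "E \<in> sets conf_space" "shift_invariant E" "A = N -` E \<inter> space M" by (rule F_inv_E)
    note [measurable] = E(1)
    have AM [measurable]: "A \<in> sets M" unfolding E(3) by measurable
    have Eind: "indicator A \<omega> = (indicator E (N \<omega>) :: real)" if "\<omega> \<in> space M" for \<omega> using that E(3) by (simp add: indicator_def)
    have one: "L2_lim M (\<lambda>_. indicator A) (indicator A) at_top" "sqnorm M (indicator A) < \<infinity>"
    proof -
      have "sqnorm M (indicator A) \<le> (\<integral>\<^sup>+\<omega>. 1 \<partial>M)" unfolding sqnorm_def by (intro nn_integral_mono) (simp add: indicator_def)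
      also have "\<dots> < \<infinity>" by (simp add: emeasure_space_1)
      finally show "sqnorm M (indicator A) < \<infinity>" .
    qed (simp add: L2_lim_def sqnorm_def)
    have "((\<lambda>R. \<integral>\<omega>. u' R \<omega> * cnj (indicator A \<omega>) \<partial>M) \<longlongrightarrow> (\<integral>\<omega>. Y \<omega> * cnj (indicator A \<omega>) \<partial>M)) at_top"
      by (rule L2_lim_integral_mult_cnj[OF u'lim u'm Y u'f one(1) _ _ one(2)]) auto
    moreover have "(\<integral>\<omega>. u' R \<omega> * cnj (indicator A \<omega>) \<partial>M) = of_real (\<integral>\<omega>. indicator E (N \<omega>) * disk_count 1 \<omega> \<partial>M)" for R
    proof -
      have R: "max 1 R > 0" by simp
      have u'R: "u' R \<omega> = of_real (disk_count (max 1 R) \<omega> / (max 1 R)\<^sup>2)" if "\<omega> \<in> space M" for \<omega>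
        unfolding u'_def u_def by (rule lint_disk[OF R that])
      have "(\<integral>\<omega>. u' R \<omega> * cnj (indicator A \<omega>) \<partial>M) = (\<integral>\<omega>. of_real (indicator E (N \<omega>) * (disk_count (max 1 R) \<omega> / (max 1 R)\<^sup>2)) \<partial>M)"
        by (intro Bochner_Integration.integral_cong refl) (simp add: u'R E(3) indicator_def)
      also have "\<dots> = of_real (\<integral>\<omega>. indicator E (N \<omega>) * (disk_count (max 1 R) \<omega> / (max 1 R)\<^sup>2) \<partial>M)"
        by (rule integral_complex_of_real)
      finally show ?thesis unfolding disk_average_invariant[OF E(1,2) R] .
    qed
    ultimately have "(\<integral>\<omega>. Y \<omega> * cnj (indicator A \<omega>) \<partial>M) = of_real (\<integral>\<omega>. indicator E (N \<omega>) * disk_count 1 \<omega> \<partial>M)"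
      by (simp add: tendsto_const_iff)
    moreover have "(\<integral>\<omega>. Y \<omega> * cnj (indicator A \<omega>) \<partial>M) = (\<integral>\<omega>. of_real (indicator A \<omega> * g \<omega>) \<partial>M)"
      by (rule integral_cong_AE) (measurable, use g(2) in eventually_elim, auto simp: indicator_def)
    moreover have "(\<integral>\<omega>. complex_of_real (indicator A \<omega> * g \<omega>) \<partial>M) = of_real (\<integral>\<omega>. indicator A \<omega> * g \<omega> \<partial>M)"
      by (rule integral_complex_of_real)
    ultimately have "complex_of_real (\<integral>\<omega>. indicator A \<omega> * g \<omega> \<partial>M) = of_real (\<integral>\<omega>. indicator E (N \<omega>) * disk_count 1 \<omega> \<partial>M)"
      by (simp only:)
    then have "(\<integral>\<omega>. indicator A \<omega> * g \<omega> \<partial>M) = (\<integral>\<omega>. indicator E (N \<omega>) * disk_count 1 \<omega> \<partial>M)"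
      unfolding of_real_eq_iff .
    moreover have "(\<integral>\<omega>. indicator E (N \<omega>) * disk_count 1 \<omega> \<partial>M) = (\<integral>\<omega>. indicator A \<omega> * disk_count 1 \<omega> \<partial>M)"
      by (intro Bochner_Integration.integral_cong refl) (simp add: Eind)
    ultimately show "(\<integral>\<omega>\<in>A. disk_count 1 \<omega> \<partial>M) = (\<integral>\<omega>\<in>A. g \<omega> \<partial>M)"
      by (simp add: set_lebesgue_integral_def)
  qed
  moreover have "AE \<omega> in M. real_cond_exp M (F_inv M N) (\<lambda>\<omega>. real (cnt (N \<omega>) (ball 0 1))) \<omega> = real_cond_exp M (F_inv M N) (disk_count 1) \<omega>"
  proof (rule FS.real_cond_exp_cong)
    have "disk_count 1 \<omega> = real (cnt (N \<omega>) (ball 0 1))" if "\<omega> \<in> space M" for \<omega>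
      using locfin_N[OF that] by (simp add: disk_count_def measure_def emeasure_conf_measure)
    then show "AE \<omega> in M. real (cnt (N \<omega>) (ball 0 1)) = disk_count 1 \<omega>" by (intro AE_I2) simp
    show "(\<lambda>\<omega>. real (cnt (N \<omega>) (ball 0 1))) \<in> borel_measurable M"
      using pp by (simp add: point_process_def)
  qed measurable
  ultimately show ?thesis
    using g(2) by eventually_elim (simp add: cond_intensity_def)
qed

text \<open>In the spectral domain the conditional intensity is the indicator of the origin; this is
  how a drift becomes an atom.\<close>

lemma spec_rep_cond_intensity: "spec_rep (\<lambda>\<omega>. of_real (cond_intensity M N \<omega>)) (\<lambda>\<xi>. if \<xi> = 0 then 1 else 0)"
proof -
  obtain Y where Y: "spec_rep Y (\<lambda>\<xi>. if \<xi> = 0 then of_real pi else 0)"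
    "L2_lim M (\<lambda>R. lint (\<lambda>l. of_real (1 / R\<^sup>2) * indicator (ball 0 1) (l / of_real R))) Y at_top" by (rule disk_limit)
  have "Y \<in> borel_measurable M" using Y(1) by (simp add: spec_rep_def)
  from disk_limit_eq_cond_intensity[OF this Y(2)]
  have "AE \<omega> in M. of_real (1 / pi) * Y \<omega> = of_real (cond_intensity M N \<omega>)" by eventually_elim simp
  from spec_rep_cong_AE[OF spec_rep_cmult[OF Y(1)] this]
  have "spec_rep (\<lambda>\<omega>. of_real (cond_intensity M N \<omega>)) (\<lambda>\<xi>. of_real (1 / pi) * (if \<xi> = 0 then of_real pi else 0))" by simp
  moreover have "(\<lambda>\<xi>. of_real (1 / pi) * (if \<xi> = 0 then of_real pi else 0)) = (\<lambda>\<xi>::complex. if \<xi> = 0 then 1 else (0::complex))" by auto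
  ultimately show ?thesis by simp
qed

text \<open>Subtracting a multiple of the disk indicator leaves a function of integral 0, whose
  averages vanish in the limit; the averages of the indicator are already known.\<close>

theorem mean_ergodic:
  assumes h: "bounded_cs h" and cont: "AE x in lborel. isCont h x"
  shows "L2_lim M (\<lambda>R. lint (\<lambda>l. of_real (1 / R\<^sup>2) * h (l / of_real R))) (\<lambda>\<omega>. of_real (cond_intensity M N \<omega>) * (\<integral>x. h x \<partial>lborel)) at_top"
proof -
  have hm: "h \<in> borel_measurable borel" using h by (simp add: bounded_cs_def)
  let ?i = "indicator (ball 0 1) :: complex \<Rightarrow> complex"
  have im: "?i \<in> borel_measurable borel" using bounded_cs_disk by (simp add: bounded_cs_def)
  define c where "c = (\<integral>x. h x \<partial>lborel) / of_real pi"
  define k where "k x = h x - c * ?i x" for x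
  have k: "bounded_cs k" unfolding k_def[abs_def] by (intro bounded_cs_diff h bounded_cs_cmult bounded_cs_disk)
  have km: "k \<in> borel_measurable borel" using k by (simp add: bounded_cs_def)
  have kc: "AE x in lborel. isCont k x"
    using cont AE_isCont_disk by eventually_elim (auto simp: k_def[abs_def] intro!: continuous_intros)
  have k0: "(\<integral>x. k x \<partial>lborel) = 0"
    using bounded_cs_integrable_cs[OF h] bounded_cs_integrable_cs[OF bounded_cs_disk]
    unfolding k_def integrable_cs_def by (simp add: integral_disk c_def del: integral_indicator)
  obtain Y where Y: "spec_rep Y (\<lambda>\<xi>. if \<xi> = 0 then of_real pi else 0)"
    "L2_lim M (\<lambda>R. lint (\<lambda>l. of_real (1 / R\<^sup>2) * ?i (l / of_real R))) Y at_top" by (rule disk_limit)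
  have Ym: "Y \<in> borel_measurable M" using Y(1) by (simp add: spec_rep_def)
  note m = ergodic_average_measurable(1)
  have "L2_lim M (\<lambda>R \<omega>. lint (\<lambda>l. of_real (1 / R\<^sup>2) * k (l / of_real R)) \<omega> + c * lint (\<lambda>l. of_real (1 / R\<^sup>2) * ?i (l / of_real R)) \<omega>) (\<lambda>\<omega>. 0 + c * Y \<omega>) at_top"
    by (rule L2_lim_add[OF ergodic_limit_zero[OF k kc k0] m[OF km] _ L2_lim_cmult[OF Y(2) m[OF im] Ym]])
       (use m[OF im] Ym in auto)
  then show ?thesis
  proof (rule L2_lim_cong)
    show "\<forall>\<^sub>F R in at_top. AE \<omega> in M. lint (\<lambda>l. of_real (1 / R\<^sup>2) * k (l / of_real R)) \<omega> + c * lint (\<lambda>l. of_real (1 / R\<^sup>2) * ?i (l / of_real R)) \<omega> =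
        lint (\<lambda>l. of_real (1 / R\<^sup>2) * h (l / of_real R)) \<omega>"
      using eventually_gt_at_top[of 0]
    proof eventually_elim
      case (elim R)
      show ?case
      proof (rule AE_I2)
        fix \<omega> assume \<omega>: "\<omega> \<in> space M"
        note b = bounded_cs_cmult[OF bounded_cs_scale[OF k elim], of "of_real (1 / R\<^sup>2)"]
          bounded_cs_cmult[OF bounded_cs_cmult[OF bounded_cs_scale[OF bounded_cs_disk elim], of "of_real (1 / R\<^sup>2)"], of c]
        have "(\<lambda>l. of_real (1 / R\<^sup>2) * h (l / of_real R)) = (\<lambda>l. of_real (1 / R\<^sup>2) * k (l / of_real R) + c * (of_real (1 / R\<^sup>2) * ?i (l / of_real R)))"
          by (simp add: k_def algebra_simps)
        then have "lint (\<lambda>l. of_real (1 / R\<^sup>2) * h (l / of_real R)) \<omega> = lint (\<lambda>l. of_real (1 / R\<^sup>2) * k (l / of_real R)) \<omega> + lint (\<lambda>l. c * (of_real (1 / R\<^sup>2) * ?i (l / of_real R))) \<omega>"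
          by (simp only: lint_add[OF \<omega> b])
        then show "lint (\<lambda>l. of_real (1 / R\<^sup>2) * k (l / of_real R)) \<omega> + c * lint (\<lambda>l. of_real (1 / R\<^sup>2) * ?i (l / of_real R)) \<omega> =
          lint (\<lambda>l. of_real (1 / R\<^sup>2) * h (l / of_real R)) \<omega>" by (simp only: lint_cmult[of c])
      qed
    qed
    show "AE \<omega> in M. 0 + c * Y \<omega> = of_real (cond_intensity M N \<omega>) * (\<integral>x. h x \<partial>lborel)"
      using disk_limit_eq_cond_intensity[OF Ym Y(2)] by eventually_elim (simp add: c_def)
  qed
qed

end

subsection \<open>The zeta function of a configuration\<close>

text \<open>Comparable with |l|^-3 away from the origin and bounded near it, in a form whose
  integral is explicit. Finiteness of its sum over the points decides whether the series of \<zeta>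
  converges.\<close>

definition cubic_decay :: "complex \<Rightarrow> real" where
  "cubic_decay l = 1 / sqrt (1 + (cmod l)\<^sup>2) ^ 3"

lemma cubic_decay_pos: "cubic_decay l > 0"
  by (simp add: cubic_decay_def add_pos_nonneg)

lemma measurable_cubic_decay [measurable]: "cubic_decay \<in> borel_measurable borel"
  unfolding cubic_decay_def[abs_def] by measurable

lemma cubic_decay_inside:
  assumes "cmod l < 1" shows "1 \<le> 3 * cubic_decay l"
proof -
  have "(cmod l)\<^sup>2 \<le> 1" using assms by (simp add: power_le_one)
  then have "sqrt (1 + (cmod l)\<^sup>2) \<le> sqrt 2" by simp
  \<comment> \<open>The cube of 1.42 is about 2.86, below the constant 3 of the claim.\<close>
  also have "sqrt 2 \<le> 1.42" by (rule real_le_lsqrt) (auto simp: power2_eq_square)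
  finally have "sqrt (1 + (cmod l)\<^sup>2) ^ 3 \<le> 1.42 ^ 3" by (intro power_mono) auto
  then have "sqrt (1 + (cmod l)\<^sup>2) ^ 3 \<le> 3" by (simp add: power3_eq_cube)
  then show ?thesis by (simp add: cubic_decay_def divide_le_eq pos_le_divide_eq add_pos_nonneg)
qed

text \<open>The first bound transfers kernel estimates to \<open>cubic_decay\<close>; the second
  bounds tails by |l|^-3 and shows that divergence of the sum forces divergence of the series of
  \<zeta>.\<close>

lemma cubic_decay_outside:
  assumes "1 \<le> cmod l" shows "1 / ((1 + cmod l) * (cmod l)\<^sup>2) \<le> 2 * cubic_decay l" "cubic_decay l \<le> 1 / cmod l ^ 3"
proof -
  let ?s = "sqrt (1 + (cmod l)\<^sup>2)"
  have s2: "?s\<^sup>2 = 1 + (cmod l)\<^sup>2" by (simp add: add_nonneg_nonneg)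
  have l2: "1 \<le> (cmod l)\<^sup>2" using assms by (simp add: one_le_power)
  have s1: "?s \<le> 1 + cmod l" by (rule real_le_lsqrt) (auto simp: power2_eq_square algebra_simps)
  have sp: "?s > 0" by (simp add: add_pos_nonneg)
  have "?s ^ 3 = ?s * ?s\<^sup>2" by (simp add: power3_eq_cube power2_eq_square)
  also have "\<dots> \<le> (1 + cmod l) * (2 * (cmod l)\<^sup>2)" unfolding s2 using s1 l2 by (intro mult_mono) auto
  finally have *: "?s ^ 3 \<le> 2 * ((1 + cmod l) * (cmod l)\<^sup>2)" by simp
  have pos: "(1 + cmod l) * (cmod l)\<^sup>2 > 0" using assms by (intro mult_pos_pos) (auto simp: add_pos_nonneg)
  have "1 / (2 * ((1 + cmod l) * (cmod l)\<^sup>2)) \<le> 1 / ?s ^ 3" using * sp pos by (intro divide_left_mono mult_pos_pos[OF pos] zero_less_power) auto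
  from mult_left_mono[OF this, of 2]
  show "1 / ((1 + cmod l) * (cmod l)\<^sup>2) \<le> 2 * cubic_decay l" unfolding cubic_decay_def by simp
  have "cmod l \<le> ?s" by (rule real_le_rsqrt) simp
  then have "cmod l ^ 3 \<le> ?s ^ 3" using assms by (intro power_mono) auto
  then show "cubic_decay l \<le> 1 / cmod l ^ 3" unfolding cubic_decay_def using assms sp by (intro divide_left_mono mult_pos_pos) auto
qed

text \<open>The singularity 1/|z - l| is locally integrable, uniformly in l; and for |l| > 2r, with
  r \<ge> 1 bounding the support, one has |z - l| \<ge> (1 + |l|)/4 on the support.\<close>

lemma nn_integral_cauchy_kernel_le:
  assumes \<theta>: "bounded_cs \<theta>"
  obtains A where "A \<ge> 0" "\<And>l. (\<integral>\<^sup>+z. ennreal (cmod (\<theta> z / (z - l))) \<partial>lborel) \<le> ennreal (A / (1 + cmod l))"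
proof -
  obtain B r0 where B: "\<And>x. cmod (\<theta> x) \<le> B" and r0: "\<And>x. r0 < cmod x \<Longrightarrow> \<theta> x = 0" and [measurable]: "\<theta> \<in> borel_measurable borel"
    using \<theta> by (auto simp: bounded_cs_def)
  have B0: "B \<ge> 0" using order_trans[OF norm_ge_zero B] .
  define r where "r = max r0 1"
  have r: "r \<ge> 1" "\<And>x. r < cmod x \<Longrightarrow> \<theta> x = 0" using r0 by (auto simp: r_def)
  define A0 where "A0 = B * (2 * pi) + B * (pi * r\<^sup>2)"
  have A0: "A0 \<ge> 0" using B0 by (simp add: A0_def)
  define A where "A = A0 * (1 + 2 * r) + 4 * B * (pi * r\<^sup>2)"
  have [measurable]: "cball (0::complex) s \<in> sets borel" for s by simp
  have uniform: "(\<integral>\<^sup>+z. ennreal (cmod (\<theta> z / (z - l))) \<partial>lborel) \<le> ennreal A0" for l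
  proof -
    have "(\<integral>\<^sup>+z. ennreal (cmod (\<theta> z / (z - l))) \<partial>lborel) \<le>
        (\<integral>\<^sup>+z. ennreal B * (ennreal (1 / cmod (z - l)) * indicator (cball 0 1) (z - l)) + ennreal B * indicator (cball 0 r) z \<partial>lborel)"
    proof (intro nn_integral_mono)
      fix z
      consider "r < cmod z" | "cmod z \<le> r" "cmod (z - l) \<le> 1" | "cmod z \<le> r" "1 < cmod (z - l)" by linarith
      then show "ennreal (cmod (\<theta> z / (z - l))) \<le> ennreal B * (ennreal (1 / cmod (z - l)) * indicator (cball 0 1) (z - l)) + ennreal B * indicator (cball 0 r) z"
      proof cases
        case 2
        have "cmod (\<theta> z / (z - l)) \<le> B * (1 / cmod (z - l))" using B[of z] by (simp add: norm_divide divide_right_mono)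
        then have "ennreal (cmod (\<theta> z / (z - l))) \<le> ennreal B * ennreal (1 / cmod (z - l))" using B0 by (simp add: ennreal_mult[symmetric] ennreal_leI)
        then show ?thesis using 2 by (simp add: add_increasing2)
      next
        case 3
        have "cmod (\<theta> z) / cmod (z - l) \<le> B / 1" using B[of z] 3 B0 by (intro frac_le) auto
        then have "ennreal (cmod (\<theta> z / (z - l))) \<le> ennreal B" by (simp add: norm_divide ennreal_leI)
        then show ?thesis using 3 by (simp add: add_increasing)
      qed (simp add: r)
    qed
    also have "\<dots> = ennreal B * (\<integral>\<^sup>+z. ennreal (1 / cmod (z - l)) * indicator (cball 0 1) (z - l) \<partial>lborel) + ennreal B * emeasure lborel (cball (0::complex) r)"
      by (subst nn_integral_add) (auto simp: nn_integral_cmult nn_integral_cmult_indicator)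
    also have "(\<integral>\<^sup>+z. ennreal (1 / cmod (z - l)) * indicator (cball 0 1) (z - l) \<partial>lborel) = ennreal (2 * pi)"
      using nn_integral_complex_shift'[of "\<lambda>z. ennreal (1 / cmod z) * indicator (cball 0 1) z" l] nn_integral_cmod_inverse_ball[of 1] by simp
    also have "ennreal B * ennreal (2 * pi) + ennreal B * emeasure lborel (cball (0::complex) r) = ennreal A0"
      using B0 r(1) unfolding A0_def by (simp add: emeasure_cball_complex ennreal_mult[symmetric] ennreal_plus[symmetric] del: ennreal_plus)
    finally show ?thesis .
  qed
  have "(\<integral>\<^sup>+z. ennreal (cmod (\<theta> z / (z - l))) \<partial>lborel) \<le> ennreal (A / (1 + cmod l))" for l
  proof (cases "cmod l \<le> 2 * r")
    case True
    have "A0 * (1 + cmod l) \<le> A0 * (1 + 2 * r)" using True A0 by (intro mult_left_mono) auto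
    moreover have "0 \<le> 4 * B * (pi * r\<^sup>2)" using B0 by simp
    ultimately have "A0 * (1 + cmod l) \<le> A" unfolding A_def by linarith
    then have "A0 \<le> A / (1 + cmod l)" by (simp add: pos_le_divide_eq add_pos_nonneg)
    then show ?thesis using uniform[of l] by (meson ennreal_leI order_trans)
  next
    case False
    have "(\<integral>\<^sup>+z. ennreal (cmod (\<theta> z / (z - l))) \<partial>lborel) \<le> (\<integral>\<^sup>+z. ennreal (4 * B / (1 + cmod l)) * indicator (cball (0::complex) r) z \<partial>lborel)"
    proof (intro nn_integral_mono)
      fix z
      show "ennreal (cmod (\<theta> z / (z - l))) \<le> ennreal (4 * B / (1 + cmod l)) * indicator (cball 0 r) z"
      proof (cases "r < cmod z")
        case F: False
        have "cmod (z - l) \<ge> cmod l - cmod z" using norm_triangle_ineq2[of l z] by (simp add: norm_minus_commute)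
        moreover have "cmod l - cmod z \<ge> (1 + cmod l) / 4" using False F r(1) by simp
        ultimately have "cmod (z - l) \<ge> (1 + cmod l) / 4" by simp
        moreover have "0 < (1 + cmod l) / 4" by (simp add: add_pos_nonneg)
        ultimately have "cmod (\<theta> z) / cmod (z - l) \<le> B / ((1 + cmod l) / 4)" using B[of z] B0 by (intro frac_le) auto
        then show ?thesis using F by (simp add: norm_divide ennreal_leI mult.commute)
      qed (simp add: r)
    qed
    also have "\<dots> = ennreal (4 * B / (1 + cmod l)) * emeasure lborel (cball (0::complex) r)" by (simp add: nn_integral_cmult_indicator)
    also have "\<dots> = ennreal (4 * B / (1 + cmod l) * (pi * r\<^sup>2))"
      using r(1) B0 by (simp add: emeasure_cball_complex ennreal_mult[symmetric])
    also have "\<dots> \<le> ennreal (A / (1 + cmod l))"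
    proof (rule ennreal_leI)
      have "4 * B * (pi * r\<^sup>2) \<le> A" unfolding A_def using A0 r(1) by simp
      then show "4 * B / (1 + cmod l) * (pi * r\<^sup>2) \<le> A / (1 + cmod l)" by (simp add: divide_right_mono)
    qed
    finally show ?thesis .
  qed
  moreover have "A \<ge> 0" unfolding A_def using A0 B0 r(1) by simp
  ultimately show thesis by (rule that[rotated])
qed

definition zeta_kernel :: "complex \<Rightarrow> complex \<Rightarrow> complex" where
  "zeta_kernel z l = (if cmod l < 1 then 1 / (z - l) else 1 / (z - l) + 1 / l + z / l\<^sup>2)"

lemma measurable_zeta_kernel [measurable (raw)]:
  assumes [measurable]: "f \<in> borel_measurable M" "g \<in> borel_measurable M"
  shows "(\<lambda>x. zeta_kernel (f x) (g x)) \<in> borel_measurable M"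
  unfolding zeta_kernel_def by measurable

lemma zeta_kernel_outside:
  assumes "1 \<le> cmod l" "z \<noteq> l" shows "zeta_kernel z l = (z\<^sup>2 / (z - l)) / l\<^sup>2"
proof -
  have "l \<noteq> 0" "z - l \<noteq> 0" using assms by auto
  then have "1 / (z - l) + 1 / l + z / l\<^sup>2 = (z\<^sup>2 / (z - l)) / l\<^sup>2"
    by (simp add: divide_simps power2_eq_square) (simp add: algebra_simps)
  then show ?thesis using assms(1) by (simp add: zeta_kernel_def)
qed

text \<open>For |l| \<ge> 1 the added terms leave z^2 / ((z - l) l^2), which reduces the claim to
  \<open>nn_integral_cauchy_kernel_le\<close> for the function \<open>\<theta> z * z^2\<close>, with
  the gain |l|^-2.\<close>

lemma nn_integral_zeta_kernel_le:
  assumes \<theta>: "bounded_cs \<theta>"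
  obtains C where "C \<ge> 0" "\<And>l. (\<integral>\<^sup>+z. ennreal (cmod (\<theta> z * zeta_kernel z l)) \<partial>lborel) \<le> ennreal (C * cubic_decay l)"
proof -
  obtain A where A: "A \<ge> 0" "\<And>l. (\<integral>\<^sup>+z. ennreal (cmod (\<theta> z / (z - l))) \<partial>lborel) \<le> ennreal (A / (1 + cmod l))"
    using nn_integral_cauchy_kernel_le[OF \<theta>] by blast
  have "bounded_cs (\<lambda>z. \<theta> z * z\<^sup>2)"
  proof -
    obtain B r where B: "\<And>x. cmod (\<theta> x) \<le> B" and r: "\<And>x. r < cmod x \<Longrightarrow> \<theta> x = 0" and [measurable]: "\<theta> \<in> borel_measurable borel"
      using \<theta> by (auto simp: bounded_cs_def)
    show ?thesis unfolding bounded_cs_def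
    proof (intro conjI exI allI impI)
      fix x show "cmod (\<theta> x * x\<^sup>2) \<le> B * r\<^sup>2"
      proof (cases "r < cmod x")
        case False
        then show ?thesis using B[of x] order_trans[OF norm_ge_zero B] by (auto simp: norm_mult norm_power intro!: mult_mono power_mono)
      qed (use r order_trans[OF norm_ge_zero B] in auto)
    next
      fix x assume "r < cmod x" then show "\<theta> x * x\<^sup>2 = 0" using r by simp
    qed measurable
  qed
  then obtain A2 where A2: "A2 \<ge> 0" "\<And>l. (\<integral>\<^sup>+z. ennreal (cmod (\<theta> z * z\<^sup>2 / (z - l))) \<partial>lborel) \<le> ennreal (A2 / (1 + cmod l))"
    using nn_integral_cauchy_kernel_le by blast
  have [measurable]: "\<theta> \<in> borel_measurable borel" using \<theta> by (simp add: bounded_cs_def)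
  show thesis
  proof (rule that[of "3 * A + 2 * A2"])
    fix l
    show "(\<integral>\<^sup>+z. ennreal (cmod (\<theta> z * zeta_kernel z l)) \<partial>lborel) \<le> ennreal ((3 * A + 2 * A2) * cubic_decay l)"
    proof (cases "cmod l < 1")
      case True
      have "A / (1 + cmod l) \<le> A / 1" using A(1) by (intro divide_left_mono) (auto simp: add_pos_nonneg)
      also have "\<dots> \<le> A * (3 * cubic_decay l)" using mult_left_mono[OF cubic_decay_inside[OF True] A(1)] by simp
      also have "\<dots> \<le> (3 * A + 2 * A2) * cubic_decay l" using A2(1) cubic_decay_pos[of l] by (simp add: algebra_simps)
      finally have "ennreal (A / (1 + cmod l)) \<le> ennreal ((3 * A + 2 * A2) * cubic_decay l)" by (rule ennreal_leI)
      moreover have "(\<integral>\<^sup>+z. ennreal (cmod (\<theta> z * zeta_kernel z l)) \<partial>lborel) = (\<integral>\<^sup>+z. ennreal (cmod (\<theta> z / (z - l))) \<partial>lborel)"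
        using True by (simp add: zeta_kernel_def)
      ultimately show ?thesis using A(2)[of l] by simp
    next
      case False
      then have l: "1 \<le> cmod l" by simp
      have "(\<integral>\<^sup>+z. ennreal (cmod (\<theta> z * zeta_kernel z l)) \<partial>lborel) = (\<integral>\<^sup>+z. ennreal (1 / (cmod l)\<^sup>2) * ennreal (cmod (\<theta> z * z\<^sup>2 / (z - l))) \<partial>lborel)"
      proof (rule nn_integral_cong_AE)
        have "AE z in lborel. z \<noteq> l" by (rule AE_lborel_singleton)
        then show "AE z in lborel. ennreal (cmod (\<theta> z * zeta_kernel z l)) = ennreal (1 / (cmod l)\<^sup>2) * ennreal (cmod (\<theta> z * z\<^sup>2 / (z - l)))"
        proof eventually_elim
          case (elim z)
          show ?case unfolding zeta_kernel_outside[OF l elim]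
            by (subst ennreal_mult[symmetric]) (auto simp: norm_mult norm_divide norm_power)
        qed
      qed
      also have "\<dots> = ennreal (1 / (cmod l)\<^sup>2) * (\<integral>\<^sup>+z. ennreal (cmod (\<theta> z * z\<^sup>2 / (z - l))) \<partial>lborel)"
        by (rule nn_integral_cmult) measurable
      also have "\<dots> \<le> ennreal (1 / (cmod l)\<^sup>2) * ennreal (A2 / (1 + cmod l))"
        by (intro mult_left_mono A2) auto
      also have "\<dots> = ennreal (A2 * (1 / ((1 + cmod l) * (cmod l)\<^sup>2)))"
        using A2(1) by (subst ennreal_mult[symmetric]) auto
      also have "\<dots> \<le> ennreal ((3 * A + 2 * A2) * cubic_decay l)"
      proof (rule ennreal_leI)
        have "A2 * (1 / ((1 + cmod l) * (cmod l)\<^sup>2)) \<le> A2 * (2 * cubic_decay l)" by (intro mult_left_mono cubic_decay_outside l A2)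
        also have "\<dots> \<le> (3 * A + 2 * A2) * cubic_decay l" using A(1) cubic_decay_pos[of l] by (simp add: algebra_simps)
        finally show "A2 * (1 / ((1 + cmod l) * (cmod l)\<^sup>2)) \<le> (3 * A + 2 * A2) * cubic_decay l" .
      qed
      finally show ?thesis .
    qed
  qed (use A A2 in simp)
qed

text \<open>The two sums stay separate because the second may diverge and then counts as 0, while
  the first is finite.\<close>

lemma zeta_conf_eq_integral:
  assumes "locfin c"
  shows "zeta_conf c psi z = (\<integral>l. indicator (ball 0 1) l * zeta_kernel z l \<partial>conf_measure c) +
    (\<integral>l. indicator (- ball 0 1) l * zeta_kernel z l \<partial>conf_measure c) - psi * z"
proof -
  have [measurable]: "ball (0::complex) 1 \<in> sets borel" "- ball (0::complex) 1 \<in> sets borel" by auto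
  have "(\<Sum>l\<in>{l \<in> supp_conf c. cmod l < 1}. of_nat (c l) / (z - l)) = (\<Sum>l\<in>{l \<in> supp_conf c. l \<in> ball 0 1}. of_nat (c l) * (1 / (z - l)))"
    by simp
  also have "\<dots> = (\<integral>l. indicator (ball 0 1) l * (1 / (z - l)) \<partial>conf_measure c)"
    by (rule finite_sum_conf) (use assms in auto)
  also have "\<dots> = (\<integral>l. indicator (ball 0 1) l * zeta_kernel z l \<partial>conf_measure c)"
    by (intro Bochner_Integration.integral_cong) (auto simp: indicator_def zeta_kernel_def)
  finally have 1: "(\<Sum>l\<in>{l \<in> supp_conf c. cmod l < 1}. of_nat (c l) / (z - l)) = (\<integral>l. indicator (ball 0 1) l * zeta_kernel z l \<partial>conf_measure c)" .
  have "infsum (\<lambda>l. of_nat (c l) * (1 / (z - l) + 1 / l + z / l\<^sup>2)) {l \<in> supp_conf c. 1 \<le> cmod l} =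
      infsum (\<lambda>l. of_nat (c l) * (1 / (z - l) + 1 / l + z / l\<^sup>2)) {l \<in> supp_conf c. l \<in> - ball 0 1}"
    by (simp add: not_less)
  also have "\<dots> = (\<integral>l. indicator (- ball 0 1) l * (1 / (z - l) + 1 / l + z / l\<^sup>2) \<partial>conf_measure c)"
    by (rule infsum_conf) measurable
  also have "\<dots> = (\<integral>l. indicator (- ball 0 1) l * zeta_kernel z l \<partial>conf_measure c)"
    by (intro Bochner_Integration.integral_cong) (auto simp: indicator_def zeta_kernel_def)
  finally show ?thesis unfolding zeta_conf_def 1 by simp
qed

lemma conf_measure_fubini:
  fixes k :: "complex \<Rightarrow> complex \<Rightarrow> complex"
  assumes c: "locfin c" and [measurable]: "(\<lambda>(l, z). k z l) \<in> borel_measurable (borel \<Otimes>\<^sub>M borel)"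
    and fin: "(\<integral>\<^sup>+l. (\<integral>\<^sup>+z. ennreal (cmod (k z l)) \<partial>lborel) \<partial>conf_measure c) < \<infinity>"
  shows "integrable lborel (\<lambda>z. \<integral>l. k z l \<partial>conf_measure c)"
    and "(\<integral>z. (\<integral>l. k z l \<partial>conf_measure c) \<partial>lborel) = (\<integral>l. (\<integral>z. k z l \<partial>lborel) \<partial>conf_measure c)"
    and "AE z in lborel. integrable (conf_measure c) (k z)"
    and "integrable (conf_measure c) (\<lambda>l. \<integral>z. k z l \<partial>lborel)"
proof -
  interpret C: sigma_finite_measure "conf_measure c" by (rule sigma_finite_conf_measure[OF c])
  interpret P: pair_sigma_finite "conf_measure c" "lborel :: complex measure" ..
  have int: "integrable (conf_measure c \<Otimes>\<^sub>M lborel) (\<lambda>(l, z). k z l)"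
  proof (rule integrableI_bounded)
    have "(\<integral>\<^sup>+p. ennreal (norm (case p of (l, z) \<Rightarrow> k z l)) \<partial>(conf_measure c \<Otimes>\<^sub>M lborel)) =
        (\<integral>\<^sup>+l. (\<integral>\<^sup>+z. ennreal (norm (k z l)) \<partial>lborel) \<partial>conf_measure c)"
      by (subst lborel.nn_integral_fst[symmetric]) auto
    then show "(\<integral>\<^sup>+p. ennreal (norm (case p of (l, z) \<Rightarrow> k z l)) \<partial>(conf_measure c \<Otimes>\<^sub>M lborel)) < \<infinity>" using fin by simp
  qed measurable
  show "integrable lborel (\<lambda>z. \<integral>l. k z l \<partial>conf_measure c)" using P.integrable_snd[OF int] .
  show "(\<integral>z. (\<integral>l. k z l \<partial>conf_measure c) \<partial>lborel) = (\<integral>l. (\<integral>z. k z l \<partial>lborel) \<partial>conf_measure c)" using P.Fubini_integral[OF int] .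
  show "AE z in lborel. integrable (conf_measure c) (k z)" using P.AE_integrable_snd[OF int] .
  show "integrable (conf_measure c) (\<lambda>l. \<integral>z. k z l \<partial>lborel)" using P.integrable_fst[OF int] .
qed

lemma measurable_zeta_conf:
  assumes c: "locfin c" shows "zeta_conf c psi \<in> borel_measurable borel"
proof -
  interpret C: sigma_finite_measure "conf_measure c" by (rule sigma_finite_conf_measure[OF c])
  have [measurable]: "ball (0::complex) 1 \<in> sets borel" "- ball (0::complex) 1 \<in> sets borel" by auto
  have "(\<lambda>z. (\<integral>l. indicator (ball 0 1) l * zeta_kernel z l \<partial>conf_measure c) +
    (\<integral>l. indicator (- ball 0 1) l * zeta_kernel z l \<partial>conf_measure c) - psi * z) \<in> borel_measurable borel"
    by measurable
  then show ?thesis unfolding zeta_conf_eq_integral[OF c, abs_def] .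
qed

lemma integrable_mult_bounded_cs:
  assumes "bounded_cs \<theta>" "continuous_on UNIV f"
  shows "integrable lborel (\<lambda>z. f z * \<theta> z)"
proof -
  obtain B r where B: "\<And>x. cmod (\<theta> x) \<le> B" and r: "\<And>x. r < cmod x \<Longrightarrow> \<theta> x = 0" and [measurable]: "\<theta> \<in> borel_measurable borel"
    using assms(1) by (auto simp: bounded_cs_def)
  have [measurable]: "f \<in> borel_measurable borel" by (rule borel_measurable_continuous_onI[OF assms(2)])
  have "compact (f ` cball 0 r)" by (intro compact_continuous_image continuous_on_subset[OF assms(2)]) auto
  then obtain C where C: "\<And>x. x \<in> cball 0 r \<Longrightarrow> cmod (f x) \<le> C"
    by (meson bounded_iff compact_imp_bounded imageI)
  show ?thesis
  proof (rule integrable_bounded_support)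
    fix x show "cmod (f x * \<theta> x) \<le> max 0 C * B"
    proof (cases "r < cmod x")
      case False
      then show ?thesis using B[of x] C[of x] by (auto simp: norm_mult not_less intro!: mult_mono)
    qed (use r order_trans[OF norm_ge_zero B] in auto)
    assume "r < cmod x" then show "f x * \<theta> x = 0" using r by simp
  qed measurable
qed

text \<open>Fubini interchanges sum and pairing; a multiple of the sum of \<open>cubic_decay\<close>
  bounds the double integral.\<close>

lemma integral_zeta_conf_good:
  assumes c: "locfin c" and good: "(\<integral>\<^sup>+l. ennreal (cubic_decay l) \<partial>conf_measure c) < \<infinity>" and \<theta>: "bounded_cs \<theta>"
  shows "integrable lborel (\<lambda>z. zeta_conf c psi z * \<theta> z)"
    and "(\<integral>z. zeta_conf c psi z * \<theta> z \<partial>lborel) = (\<integral>l. (\<integral>z. \<theta> z * zeta_kernel z l \<partial>lborel) \<partial>conf_measure c) - psi * (\<integral>z. z * \<theta> z \<partial>lborel)"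
    and "integrable (conf_measure c) (\<lambda>l. \<integral>z. \<theta> z * zeta_kernel z l \<partial>lborel)"
proof -
  have \<theta>m [measurable]: "\<theta> \<in> borel_measurable borel" using \<theta> by (simp add: bounded_cs_def)
  note zm [measurable] = measurable_zeta_conf[OF c, of psi]
  have [measurable]: "ball (0::complex) 1 \<in> sets borel" "- ball (0::complex) 1 \<in> sets borel" by auto
  let ?k = "\<lambda>z l. \<theta> z * zeta_kernel z l"
  obtain C where C: "C \<ge> 0" "\<And>l. (\<integral>\<^sup>+z. ennreal (cmod (?k z l)) \<partial>lborel) \<le> ennreal (C * cubic_decay l)"
    using nn_integral_zeta_kernel_le[OF \<theta>] by blast
  have fin: "(\<integral>\<^sup>+l. (\<integral>\<^sup>+z. ennreal (cmod (?k z l)) \<partial>lborel) \<partial>conf_measure c) < \<infinity>"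
  proof -
    have "(\<integral>\<^sup>+l. (\<integral>\<^sup>+z. ennreal (cmod (?k z l)) \<partial>lborel) \<partial>conf_measure c) \<le> (\<integral>\<^sup>+l. ennreal C * ennreal (cubic_decay l) \<partial>conf_measure c)"
      using C less_imp_le[OF cubic_decay_pos] by (intro nn_integral_mono) (simp add: ennreal_mult[symmetric])
    also have "\<dots> = ennreal C * (\<integral>\<^sup>+l. ennreal (cubic_decay l) \<partial>conf_measure c)" by (rule nn_integral_cmult) measurable
    also have "\<dots> < \<infinity>" using good by (simp add: ennreal_mult_less_top)
    finally show ?thesis .
  qed
  have km: "(\<lambda>(l, z). ?k z l) \<in> borel_measurable (borel \<Otimes>\<^sub>M borel)" by measurable
  note F = conf_measure_fubini[OF c km fin]
  have zi: "integrable lborel (\<lambda>z. z * \<theta> z)" by (rule integrable_mult_bounded_cs[OF \<theta>]) (intro continuous_intros)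
  have eq: "AE z in lborel. zeta_conf c psi z * \<theta> z = (\<integral>l. ?k z l \<partial>conf_measure c) - psi * (z * \<theta> z)"
    using F(3)
  proof eventually_elim
    case (elim z)
    show ?case
    \<comment> \<open>Fubini only yields integrability of \<theta> z times the kernel: where
      \<theta> z = 0 both sides vanish, and elsewhere the factor is divided out.\<close>
    proof (cases "\<theta> z = 0")
      case False
      have "integrable (conf_measure c) (\<lambda>l. (1 / \<theta> z) * ?k z l)" using elim by (rule integrable_mult_right)
      then have int: "integrable (conf_measure c) (zeta_kernel z)" using False by simp
      have i: "integrable (conf_measure c) (\<lambda>l. indicator S l * zeta_kernel z l)" if [measurable]: "S \<in> sets borel" for S
        by (rule Bochner_Integration.integrable_bound[OF int]) (auto simp: indicator_def)
      have "(\<integral>l. indicator (ball 0 1) l * zeta_kernel z l \<partial>conf_measure c) + (\<integral>l. indicator (- ball 0 1) l * zeta_kernel z l \<partial>conf_measure c) =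
         (\<integral>l. indicator (ball 0 1) l * zeta_kernel z l + indicator (- ball 0 1) l * zeta_kernel z l \<partial>conf_measure c)"
        by (rule Bochner_Integration.integral_add[symmetric]) (intro i; measurable)+
      also have "\<dots> = (\<integral>l. zeta_kernel z l \<partial>conf_measure c)"
        by (intro Bochner_Integration.integral_cong) (auto simp: indicator_def)
      finally show ?thesis unfolding zeta_conf_eq_integral[OF c] by (simp add: algebra_simps)
    qed (simp add: zeta_conf_def)
  qed
  have im: "(\<lambda>z. (\<integral>l. ?k z l \<partial>conf_measure c) - psi * (z * \<theta> z)) \<in> borel_measurable lborel"
    using F(1) zi by (intro borel_measurable_integrable) simp
  have int': "integrable lborel (\<lambda>z. (\<integral>l. ?k z l \<partial>conf_measure c) - psi * (z * \<theta> z))" using F(1) zi by simp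
  show "integrable lborel (\<lambda>z. zeta_conf c psi z * \<theta> z)"
    by (rule integrable_cong_AE_imp[OF int']) (use eq in \<open>simp_all add: AE_symmetric\<close>)
  have "(\<integral>z. zeta_conf c psi z * \<theta> z \<partial>lborel) = (\<integral>z. (\<integral>l. ?k z l \<partial>conf_measure c) - psi * (z * \<theta> z) \<partial>lborel)"
    by (rule integral_cong_AE) (use eq im in simp_all)
  also have "\<dots> = (\<integral>z. (\<integral>l. ?k z l \<partial>conf_measure c) \<partial>lborel) - psi * (\<integral>z. z * \<theta> z \<partial>lborel)" using F(1) zi by simp
  finally show "(\<integral>z. zeta_conf c psi z * \<theta> z \<partial>lborel) = (\<integral>l. (\<integral>z. ?k z l \<partial>lborel) \<partial>conf_measure c) - psi * (\<integral>z. z * \<theta> z \<partial>lborel)"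
    unfolding F(2) .
  show "integrable (conf_measure c) (\<lambda>l. \<integral>z. ?k z l \<partial>lborel)" by (rule F(4))
qed

text \<open>When the sum of \<open>|l|\<^sup>-\<^sup>3\<close> diverges, the infinite sum defining the zeta function has the default value \<open>0\<close> off the origin.
  This null event matters only because measurability is required on the whole space.\<close>

lemma integral_zeta_conf_bad:
  assumes c: "locfin c" and bad: "\<not> (\<integral>\<^sup>+l. ennreal (cubic_decay l) \<partial>conf_measure c) < \<infinity>" and \<theta>: "bounded_cs \<theta>"
  shows "integrable lborel (\<lambda>z. zeta_conf c psi z * \<theta> z)"
    and "(\<integral>z. zeta_conf c psi z * \<theta> z \<partial>lborel) = (\<integral>l. indicator (ball 0 1) l * (\<integral>z. \<theta> z * zeta_kernel z l \<partial>lborel) \<partial>conf_measure c) - psi * (\<integral>z. z * \<theta> z \<partial>lborel)"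
proof -
  have \<theta>m [measurable]: "\<theta> \<in> borel_measurable borel" using \<theta> by (simp add: bounded_cs_def)
  note zm [measurable] = measurable_zeta_conf[OF c, of psi]
  have [measurable]: "ball (0::complex) 1 \<in> sets borel" "- ball (0::complex) 1 \<in> sets borel" by auto
  let ?k = "\<lambda>z l. indicator (ball 0 1) l * (\<theta> z * zeta_kernel z l)"
  obtain C where C: "C \<ge> 0" "\<And>l. (\<integral>\<^sup>+z. ennreal (cmod (\<theta> z * zeta_kernel z l)) \<partial>lborel) \<le> ennreal (C * cubic_decay l)"
    using nn_integral_zeta_kernel_le[OF \<theta>] by blast
  have decay1: "cubic_decay l \<le> 1" for l
    unfolding cubic_decay_def by (simp add: divide_le_eq_1 add_pos_nonneg one_le_power)
  have ballfin: "emeasure (conf_measure c) (ball 0 1) < \<infinity>" using c by (simp add: emeasure_conf_measure)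
  have fin: "(\<integral>\<^sup>+l. (\<integral>\<^sup>+z. ennreal (cmod (?k z l)) \<partial>lborel) \<partial>conf_measure c) < \<infinity>"
  proof -
    have "(\<integral>\<^sup>+l. (\<integral>\<^sup>+z. ennreal (cmod (?k z l)) \<partial>lborel) \<partial>conf_measure c) \<le> (\<integral>\<^sup>+l. ennreal C * indicator (ball 0 1) l \<partial>conf_measure c)"
    proof (intro nn_integral_mono)
      fix l
      have "C * cubic_decay l \<le> C" using mult_left_mono[OF decay1[of l] C(1)] by simp
      then have "(\<integral>\<^sup>+z. ennreal (cmod (\<theta> z * zeta_kernel z l)) \<partial>lborel) \<le> ennreal C" using C(2)[of l] by (meson ennreal_leI order_trans)
      then show "(\<integral>\<^sup>+z. ennreal (cmod (?k z l)) \<partial>lborel) \<le> ennreal C * indicator (ball 0 1) l" by (simp add: indicator_def)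
    qed
    also have "\<dots> = ennreal C * emeasure (conf_measure c) (ball 0 1)" by (rule nn_integral_cmult_indicator) simp
    also have "\<dots> < \<infinity>" using ballfin by (simp add: ennreal_mult_less_top)
    finally show ?thesis .
  qed
  have km: "(\<lambda>(l, z). ?k z l) \<in> borel_measurable (borel \<Otimes>\<^sub>M borel)" by measurable
  note F = conf_measure_fubini[OF c km fin]
  have zero: "(\<integral>l. indicator (- ball 0 1) l * zeta_kernel z l \<partial>conf_measure c) = 0" if "z \<noteq> 0" for z
  proof (rule not_integrable_integral_eq, rule notI)
    assume int: "integrable (conf_measure c) (\<lambda>l. indicator (- ball 0 1) l * zeta_kernel z l)"
    \<comment> \<open>Comes from |z - l| \<le> (1 + |z|) |l|, valid for |l| \<ge> 1: the kernel is
      at least \<delta> times \<open>cubic_decay\<close>, so its integrability would contradict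
      \<open>bad\<close>.\<close>
    define \<delta> where "\<delta> = (cmod z)\<^sup>2 / (1 + cmod z)"
    have \<delta>: "\<delta> > 0" using that by (simp add: \<delta>_def add_pos_nonneg)
    have lower: "\<delta> * cubic_decay l \<le> cmod (zeta_kernel z l)" if l: "1 \<le> cmod l" for l
    proof (cases "z = l")
      \<comment> \<open>At l = z division by zero drops the term 1/(z - l) and leaves 2/l, so this
        point has its own estimate.\<close>
      case True
      have "\<delta> * cubic_decay l \<le> \<delta> * (1 / cmod l ^ 3)" using \<delta> cubic_decay_outside(2)[OF l] by (intro mult_left_mono) auto
      also have "\<dots> = (1 / (1 + cmod l)) * (1 / cmod l)" using True l by (simp add: \<delta>_def power2_eq_square power3_eq_cube)
      also have "\<dots> \<le> 2 * (1 / cmod l)" using l by (intro mult_right_mono) (auto simp: divide_le_eq)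
      also have "\<dots> = cmod (2 / l)" by (simp add: norm_divide)
      also have "2 / l = zeta_kernel z l" using True l by (simp add: zeta_kernel_def power2_eq_square)
      finally show ?thesis .
    next
      case False
      have pos: "cmod (z - l) > 0" "cmod l > 0" using False l by auto
      have "cmod (z - l) \<le> cmod z + cmod l" by (rule norm_triangle_ineq4)
      also have "\<dots> \<le> cmod z * cmod l + cmod l" using mult_left_mono[OF l norm_ge_zero[of z]] by simp
      finally have le: "cmod (z - l) \<le> (1 + cmod z) * cmod l" by (simp add: algebra_simps)
      have "\<delta> * cubic_decay l \<le> \<delta> * (1 / cmod l ^ 3)" using \<delta> cubic_decay_outside(2)[OF l] by (intro mult_left_mono) auto
      also have "\<dots> = (cmod z)\<^sup>2 / ((1 + cmod z) * cmod l) / (cmod l)\<^sup>2" by (simp add: \<delta>_def power2_eq_square power3_eq_cube)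
      also have "\<dots> \<le> (cmod z)\<^sup>2 / cmod (z - l) / (cmod l)\<^sup>2" using le pos by (intro divide_right_mono divide_left_mono mult_pos_pos) (auto simp: add_pos_nonneg)
      also have "\<dots> = cmod (zeta_kernel z l)" unfolding zeta_kernel_outside[OF l False] by (simp add: norm_mult norm_divide norm_power)
      finally show ?thesis .
    qed
    have "(\<integral>\<^sup>+l. ennreal (cubic_decay l) \<partial>conf_measure c) \<le>
        (\<integral>\<^sup>+l. indicator (ball 0 1) l + ennreal (1 / \<delta>) * ennreal (norm (indicator (- ball 0 1) l * zeta_kernel z l)) \<partial>conf_measure c)"
    proof (intro nn_integral_mono)
      fix l
      show "ennreal (cubic_decay l) \<le> indicator (ball 0 1) l + ennreal (1 / \<delta>) * ennreal (norm (indicator (- ball 0 1) l * zeta_kernel z l))"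
      proof (cases "cmod l < 1")
        case True
        then show ?thesis using decay1[of l] by simp
      next
        case False
        then have "cubic_decay l \<le> (1 / \<delta>) * cmod (zeta_kernel z l)" using lower[of l] \<delta> by (simp add: pos_le_divide_eq mult.commute)
        then show ?thesis using False \<delta> by (simp add: ennreal_mult[symmetric] ennreal_leI)
      qed
    qed
    also have "\<dots> = emeasure (conf_measure c) (ball 0 1) + ennreal (1 / \<delta>) * (\<integral>\<^sup>+l. ennreal (norm (indicator (- ball 0 1) l * zeta_kernel z l)) \<partial>conf_measure c)"
      by (subst nn_integral_add) (auto simp: nn_integral_cmult)
    also have "\<dots> < \<infinity>" using ballfin int unfolding integrable_iff_bounded by (simp add: ennreal_mult_less_top)
    finally show False using bad by simp
  qed
  have zi: "integrable lborel (\<lambda>z. z * \<theta> z)" by (rule integrable_mult_bounded_cs[OF \<theta>]) (intro continuous_intros)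
  have "AE z in lborel. z \<noteq> (0::complex)" by (rule AE_lborel_singleton)
  then have eq: "AE z in lborel. zeta_conf c psi z * \<theta> z = (\<integral>l. ?k z l \<partial>conf_measure c) - psi * (z * \<theta> z)"
  proof eventually_elim
    case (elim z)
    have "(\<integral>l. ?k z l \<partial>conf_measure c) = \<theta> z * (\<integral>l. indicator (ball 0 1) l * zeta_kernel z l \<partial>conf_measure c)"
      by (subst integral_mult_right_zero[symmetric]) (simp add: mult.left_commute)
    then show ?case unfolding zeta_conf_eq_integral[OF c] zero[OF elim] by (simp add: algebra_simps)
  qed
  have im: "(\<lambda>z. (\<integral>l. ?k z l \<partial>conf_measure c) - psi * (z * \<theta> z)) \<in> borel_measurable lborel"
    using F(1) zi by (intro borel_measurable_integrable) simp
  have int': "integrable lborel (\<lambda>z. (\<integral>l. ?k z l \<partial>conf_measure c) - psi * (z * \<theta> z))" using F(1) zi by simp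
  show "integrable lborel (\<lambda>z. zeta_conf c psi z * \<theta> z)"
    by (rule integrable_cong_AE_imp[OF int']) (use eq in \<open>simp_all add: AE_symmetric\<close>)
  have "(\<integral>z. zeta_conf c psi z * \<theta> z \<partial>lborel) = (\<integral>z. (\<integral>l. ?k z l \<partial>conf_measure c) - psi * (z * \<theta> z) \<partial>lborel)"
    by (rule integral_cong_AE) (use eq im in simp_all)
  also have "\<dots> = (\<integral>z. (\<integral>l. ?k z l \<partial>conf_measure c) \<partial>lborel) - psi * (\<integral>z. z * \<theta> z \<partial>lborel)" using F(1) zi by simp
  finally show "(\<integral>z. zeta_conf c psi z * \<theta> z \<partial>lborel) = (\<integral>l. indicator (ball 0 1) l * (\<integral>z. \<theta> z * zeta_kernel z l \<partial>lborel) \<partial>conf_measure c) - psi * (\<integral>z. z * \<theta> z \<partial>lborel)"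
    unfolding F(2) by simp
qed

lemma integrable_zeta_conf:
  assumes "locfin c" "bounded_cs \<theta>" shows "integrable lborel (\<lambda>z. zeta_conf c psi z * \<theta> z)"
  using integral_zeta_conf_good(1)[OF assms(1) _ assms(2)] integral_zeta_conf_bad(1)[OF assms(1) _ assms(2)] by blast

subsection \<open>Truncated Cauchy transforms\<close>

text \<open>The part of \<open>cauchy_cocut_dz\<close> on the unit disk. Splitting it off leaves a
  sharp cut-off of the sum of l^-2, as in \<open>Psi_partial\<close>; its own averages vanish in the
  limit by \<open>integral_cut_dz\<close>.\<close>

definition cut_dz :: "complex \<Rightarrow> complex" where
  "cut_dz y = (if cmod y \<le> 1 then cauchy_cocut_dz y else 0)"

lemma measurable_cauchy_cocut_dz [measurable]: "cauchy_cocut_dz \<in> borel_measurable borel"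
  by (intro borel_measurable_continuous_onI continuous_on_cauchy_cocut_dz)

lemma bounded_cs_cut_dz: "bounded_cs cut_dz"
  unfolding bounded_cs_def
proof (intro conjI exI allI impI)
  show "cut_dz \<in> borel_measurable borel" unfolding cut_dz_def[abs_def] by measurable
  fix y show "cmod (cut_dz y) \<le> 1"
    by (auto simp: cut_dz_def cauchy_cocut_dz_inside norm_power power_le_one)
  assume "1 < cmod y" then show "cut_dz y = 0" by (simp add: cut_dz_def)
qed

lemma AE_isCont_cut_dz: "AE x in lborel. isCont cut_dz x"
  using AE_complex_not_in_sphere[of 1]
proof eventually_elim
  case (elim x)
  consider "x \<in> ball 0 1" | "x \<in> - cball 0 1" using elim by fastforce
  then show ?case
  proof cases
    case 1
    then have "\<forall>\<^sub>F y in nhds x. cut_dz y = cauchy_cocut_dz y"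
      by (intro eventually_nhds[THEN iffD2] exI[of _ "ball 0 1"]) (auto simp: cut_dz_def)
    moreover have "isCont cauchy_cocut_dz x"
      using continuous_on_cauchy_cocut_dz[of UNIV] by (simp add: continuous_on_eq_continuous_at)
    ultimately show ?thesis by (subst isCont_cong)
  next
    case 2
    then have "\<forall>\<^sub>F y in nhds x. cut_dz y = 0"
      by (intro eventually_nhds[THEN iffD2] exI[of _ "- cball 0 1"]) (auto simp: cut_dz_def)
    then show ?thesis by (subst isCont_cong) auto
  qed
qed

text \<open>A quarter turn reverses the sign of the integrand.\<close>

lemma integral_cut_dz: "(\<integral>y. cut_dz y \<partial>lborel) = 0"
proof -
  have "cut_dz (\<i> * y) = - cut_dz y" for y
    by (simp add: cut_dz_def cauchy_cocut_dz_def norm_mult power_mult_distrib)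
  then have "(\<integral>y. cut_dz y \<partial>lborel) = - (\<integral>y. cut_dz y \<partial>lborel)"
    using integral_complex_times_ii[of cut_dz] bounded_cs_cut_dz by (simp add: bounded_cs_def)
  then show ?thesis by (simp add: eq_neg_iff_add_eq_0 flip: mult_2)
qed

lemma AE_isCont_paraboloid: "AE x in lborel. isCont paraboloid x"
  using continuous_on_paraboloid[of UNIV] by (auto simp: continuous_on_eq_continuous_at)

lemma cauchy_trunc_eq:
  assumes "R > 0" shows "cauchy_trunc R u = 1 / u - (1 / of_real R) * cauchy_cocut (u / of_real R)"
  unfolding cauchy_trunc_def cauchy_cut_eq using assms by (simp add: right_diff_distrib)

lemma cauchy_trunc_minus: "cauchy_trunc R (- u) = - cauchy_trunc R u"
  by (simp add: cauchy_trunc_def cauchy_cut_def)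

lemma cauchy_trunc_outside: "R > 0 \<Longrightarrow> R \<le> cmod u \<Longrightarrow> cauchy_trunc R u = 0"
  by (simp add: cauchy_trunc_def cauchy_cut_def norm_divide bump_bounds one_le_power)

lemma cauchy_cocut_dz_minus: "cauchy_cocut_dz (- y) = cauchy_cocut_dz y"
  by (simp add: cauchy_cocut_dz_def)

lemma paraboloid_minus: "paraboloid (- y) = paraboloid y"
  by (simp add: paraboloid_def)

lemma continuous_on_cauchy_cocut: "continuous_on A cauchy_cocut"
  by (meson continuous_at_imp_continuous_on has_derivative_continuous has_derivative_cauchy_cocut)

text \<open>The sign compensates that \<open>conv\<close> evaluates the odd kernel at l - z, while
  \<zeta> involves z - l.\<close>

definition trunc_transform :: "(complex \<Rightarrow> complex) \<Rightarrow> real \<Rightarrow> complex \<Rightarrow> complex" where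
  "trunc_transform \<theta> R l = - 1 * conv (cauchy_trunc R) \<theta> l"

lemma test_fun_trunc_transform: "test_fun \<theta> \<Longrightarrow> R > 0 \<Longrightarrow> test_fun (trunc_transform \<theta> R)"
  unfolding trunc_transform_def[abs_def] by (intro test_fun_cmult test_fun_conv integrable_cs_cauchy_trunc)

lemma fourier_trunc_transform:
  assumes "test_fun \<theta>" "R > 0"
  shows "fourier (trunc_transform \<theta> R) \<xi> = - (fourier (cauchy_trunc R) \<xi> * fourier \<theta> \<xi>)"
proof -
  have "integrable lborel (cauchy_trunc R)" "cauchy_trunc R \<in> borel_measurable borel"
    using integrable_cs_cauchy_trunc[OF assms(2)] by (auto simp: integrable_cs_def)
  from fourier_conv[OF this test_fun_integrable[OF assms(1)] test_fun_measurable[OF assms(1)]]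
  show ?thesis unfolding trunc_transform_def[abs_def] fourier_cmult by simp
qed

lemma measurable_cauchy_trunc [measurable]: "cauchy_trunc R \<in> borel_measurable borel"
  unfolding cauchy_trunc_def[abs_def] by measurable

lemma trunc_transform_eq:
  assumes "test_fun \<theta>"
  shows "trunc_transform \<theta> R l = (\<integral>z. cauchy_trunc R (z - l) * \<theta> z \<partial>lborel)"
proof -
  note [measurable] = test_fun_measurable[OF assms]
  have "conv (cauchy_trunc R) \<theta> l = (\<integral>z. cauchy_trunc R (l - z) * \<theta> z \<partial>lborel)"
    unfolding conv_def using integral_complex_reflect[of "\<lambda>u. cauchy_trunc R u * \<theta> (l - u)" l] by simp
  also have "\<dots> = (\<integral>z. - (cauchy_trunc R (z - l) * \<theta> z) \<partial>lborel)"
    using cauchy_trunc_minus[of R "_ - l"] by simp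
  finally show ?thesis by (simp add: trunc_transform_def)
qed

definition zeta_transform :: "(complex \<Rightarrow> complex) \<Rightarrow> complex \<Rightarrow> complex" where
  "zeta_transform \<theta> l = (\<integral>z. \<theta> z * zeta_kernel z l \<partial>lborel)"

lemma measurable_zeta_transform [measurable]:
  assumes [measurable]: "\<theta> \<in> borel_measurable borel" shows "zeta_transform \<theta> \<in> borel_measurable borel"
  unfolding zeta_transform_def[abs_def] by measurable

definition inverse_square_annulus :: "real \<Rightarrow> complex \<Rightarrow> complex" where
  "inverse_square_annulus R l = (if 1 \<le> cmod l \<and> cmod l \<le> R then 1 / l\<^sup>2 else 0)"

lemma bounded_cs_inverse_square_annulus: "bounded_cs (inverse_square_annulus R)"
  unfolding bounded_cs_def
proof (intro conjI exI allI impI)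
  show "inverse_square_annulus R \<in> borel_measurable borel" unfolding inverse_square_annulus_def[abs_def] by measurable
  fix x show "cmod (inverse_square_annulus R x) \<le> 1"
    by (auto simp: inverse_square_annulus_def norm_divide norm_power divide_le_eq one_le_power)
  assume "R < cmod x" then show "inverse_square_annulus R x = 0" by (simp add: inverse_square_annulus_def)
qed

lemma measurable_inverse_square_annulus [measurable]: "inverse_square_annulus R \<in> borel_measurable borel"
  using bounded_cs_inverse_square_annulus by (simp add: bounded_cs_def)

locale centered_test_fun =
  fixes \<theta> :: "complex \<Rightarrow> complex"
  assumes \<theta>: "test_fun \<theta>" and mean0: "(\<integral>z. \<theta> z \<partial>lborel) = 0"
begin

lemma \<theta>_cs: "bounded_cs \<theta>" by (rule test_fun_bounded_cs[OF \<theta>])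

lemma \<theta>_m [measurable]: "\<theta> \<in> borel_measurable borel" by (rule test_fun_measurable[OF \<theta>])

definition moment :: complex where "moment = (\<integral>z. z * \<theta> z \<partial>lborel)"

definition moment_cnj :: complex where "moment_cnj = (\<integral>z. cnj z * \<theta> z \<partial>lborel)"

lemma integrable_mult_\<theta>: "continuous_on UNIV f \<Longrightarrow> integrable lborel (\<lambda>z. f z * \<theta> z)"
  by (rule integrable_mult_bounded_cs[OF \<theta>_cs])

lemma integrable_cauchy: "integrable lborel (\<lambda>z. \<theta> z / (z - l))"
proof (rule integrableI_bounded)
  obtain A where "(\<integral>\<^sup>+z. ennreal (cmod (\<theta> z / (z - l))) \<partial>lborel) \<le> ennreal (A / (1 + cmod l))"
    using nn_integral_cauchy_kernel_le[OF \<theta>_cs] by blast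
  also have "\<dots> < \<infinity>" by simp
  finally show "(\<integral>\<^sup>+z. ennreal (norm (\<theta> z / (z - l))) \<partial>lborel) < \<infinity>" .
qed measurable

text \<open>Mean zero removes the term 1/l of the kernel, and z / l^2 contributes the first
  moment.\<close>

lemma zeta_transform_eq:
  "zeta_transform \<theta> l = (\<integral>z. \<theta> z / (z - l) \<partial>lborel) + (if cmod l < 1 then 0 else moment / l\<^sup>2)"
proof (cases "cmod l < 1")
  case True
  then show ?thesis by (simp add: zeta_transform_def zeta_kernel_def)
next
  case False
  have "zeta_transform \<theta> l = (\<integral>z. \<theta> z / (z - l) + ((1 / l) * \<theta> z + (1 / l\<^sup>2) * (z * \<theta> z)) \<partial>lborel)"
    unfolding zeta_transform_def using False
    by (intro Bochner_Integration.integral_cong) (auto simp: zeta_kernel_def algebra_simps)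
  also have "\<dots> = (\<integral>z. \<theta> z / (z - l) \<partial>lborel) + ((1 / l) * (\<integral>z. \<theta> z \<partial>lborel) + (1 / l\<^sup>2) * (\<integral>z. z * \<theta> z \<partial>lborel))"
    using integrable_cauchy test_fun_integrable[OF \<theta>] integrable_mult_\<theta>[OF continuous_on_id] by simp
  finally show ?thesis using False by (simp add: mean0 moment_def)
qed

text \<open>What remains of the full transform after four pieces: the partial sum of l^-2, an
  ergodic average with limit 0, the average of \<open>paraboloid\<close> that carries the intensity,
  and the test function \<open>trunc_transform\<close>.\<close>

definition link_error :: "real \<Rightarrow> complex \<Rightarrow> complex" where
  "link_error R l = zeta_transform \<theta> l - (moment * inverse_square_annulus R l +
     (moment * (of_real (1 / R\<^sup>2) * cut_dz (l / of_real R)) +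
      (moment_cnj * (of_real (1 / R\<^sup>2) * paraboloid (l / of_real R)) + trunc_transform \<theta> R l)))"

lemma link_error_outside:
  assumes R: "R > 0" and supp: "\<And>z. R < cmod z \<Longrightarrow> \<theta> z = 0" and l: "2 * R \<le> cmod l"
  shows "link_error R l = zeta_transform \<theta> l"
proof -
  have "cauchy_trunc R (z - l) * \<theta> z = 0" for z
  proof (cases "R < cmod z")
    case False
    then have "R \<le> cmod (z - l)" using l norm_triangle_ineq2[of l z] by (simp add: norm_minus_commute)
    then show ?thesis using cauchy_trunc_outside[OF R] by simp
  qed (simp add: supp)
  then have "trunc_transform \<theta> R l = 0" unfolding trunc_transform_eq[OF \<theta>] by (simp only: Bochner_Integration.integral_zero)
  moreover have "1 < cmod (l / of_real R)" using l R by (simp add: norm_divide)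
  moreover have "inverse_square_annulus R l = 0" using l R by (simp add: inverse_square_annulus_def)
  ultimately show ?thesis
    by (simp add: link_error_def cut_dz_def paraboloid_def one_le_power)
qed

text \<open>The transform with kernel 1/(z - l) minus the truncated one is the pairing of \<theta>
  with the scaled \<open>cauchy_cocut\<close>. Expanding at -l/R, the constant term dies because
  \<theta> has mean zero, the linear terms account for the two moments, and the Taylor remainder is
  left.\<close>

lemma link_error_inside:
  assumes R: "R \<ge> 1"
  shows "link_error R l = (1 / of_real R) * (\<integral>z. (cauchy_cocut (- l / of_real R + z / of_real R) - cauchy_cocut (- l / of_real R) -
    (cauchy_cocut_dz (- l / of_real R) * (z / of_real R) + paraboloid (- l / of_real R) * cnj (z / of_real R))) * \<theta> z \<partial>lborel)"
proof -
  let ?y = "- l / of_real R"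
  let ?c = "\<lambda>z. cauchy_cocut (?y + z / of_real R)"
  have ic: "integrable lborel (\<lambda>z. ?c z * \<theta> z)"
    by (rule integrable_mult_\<theta>) (intro continuous_on_compose2[OF continuous_on_cauchy_cocut[of UNIV]] continuous_intros, use R in auto)
  note i0 = test_fun_integrable[OF \<theta>] and i1 = integrable_mult_\<theta>[OF continuous_on_id]
    and i2 = integrable_mult_\<theta>[OF continuous_on_cnj[OF continuous_on_id]]
  have "trunc_transform \<theta> R l = (\<integral>z. \<theta> z / (z - l) - (1 / of_real R) * (?c z * \<theta> z) \<partial>lborel)"
    unfolding trunc_transform_eq[OF \<theta>]
  proof (intro Bochner_Integration.integral_cong refl)
    fix z
    have "?y + z / of_real R = (z - l) / of_real R" by (simp add: diff_divide_distrib)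
    then show "cauchy_trunc R (z - l) * \<theta> z = \<theta> z / (z - l) - (1 / of_real R) * (?c z * \<theta> z)"
      using R by (subst cauchy_trunc_eq) (simp_all add: algebra_simps)
  qed
  then have f: "trunc_transform \<theta> R l = (\<integral>z. \<theta> z / (z - l) \<partial>lborel) - (1 / of_real R) * (\<integral>z. ?c z * \<theta> z \<partial>lborel)"
    using ic integrable_cauchy by simp
  have rem: "(\<integral>z. (?c z - cauchy_cocut ?y - (cauchy_cocut_dz ?y * (z / of_real R) + paraboloid ?y * cnj (z / of_real R))) * \<theta> z \<partial>lborel) =
     (\<integral>z. ?c z * \<theta> z \<partial>lborel) - (cauchy_cocut_dz ?y / of_real R * moment + paraboloid ?y / of_real R * moment_cnj)"
  proof -
    have "(\<integral>z. (?c z - cauchy_cocut ?y - (cauchy_cocut_dz ?y * (z / of_real R) + paraboloid ?y * cnj (z / of_real R))) * \<theta> z \<partial>lborel) =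
      (\<integral>z. ?c z * \<theta> z - (cauchy_cocut ?y * \<theta> z + (cauchy_cocut_dz ?y / of_real R * (z * \<theta> z) + paraboloid ?y / of_real R * (cnj z * \<theta> z))) \<partial>lborel)"
      by (intro Bochner_Integration.integral_cong) (auto simp: algebra_simps)
    also have "\<dots> = (\<integral>z. ?c z * \<theta> z \<partial>lborel) - (cauchy_cocut ?y * (\<integral>z. \<theta> z \<partial>lborel) + (cauchy_cocut_dz ?y / of_real R * moment + paraboloid ?y / of_real R * moment_cnj))"
      unfolding moment_def moment_cnj_def using ic i0 i1 i2
      by (simp only: Bochner_Integration.integral_diff Bochner_Integration.integral_add integral_mult_right_zero integrable_mult_right Bochner_Integration.integrable_add)
    finally show ?thesis by (simp add: mean0)
  qed
  have "cauchy_cocut_dz ?y = cauchy_cocut_dz (l / of_real R)" "paraboloid ?y = paraboloid (l / of_real R)"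
    using cauchy_cocut_dz_minus[of "l / of_real R"] paraboloid_minus[of "l / of_real R"] by simp_all
  then have rem': "(1 / of_real R) * (\<integral>z. (?c z - cauchy_cocut ?y - (cauchy_cocut_dz ?y * (z / of_real R) + paraboloid ?y * cnj (z / of_real R))) * \<theta> z \<partial>lborel) =
     (1 / of_real R) * (\<integral>z. ?c z * \<theta> z \<partial>lborel) - (moment * (of_real (1 / R\<^sup>2) * cauchy_cocut_dz (l / of_real R)) + moment_cnj * (of_real (1 / R\<^sup>2) * paraboloid (l / of_real R)))"
    unfolding rem using R by (simp add: right_diff_distrib distrib_left power2_eq_square mult_ac)
  \<comment> \<open>The terms l^-2 of the kernel meet the holomorphic derivative of the removed
    part: inside radius R the sharp partial sum remains, and outside the two cancel.\<close>
  have key: "(if cmod l < 1 then 0 else moment / l\<^sup>2) = moment * inverse_square_annulus R l + moment * (of_real (1 / R\<^sup>2) * cut_dz (l / of_real R)) -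
      moment * (of_real (1 / R\<^sup>2) * cauchy_cocut_dz (l / of_real R))"
  proof (cases "cmod l \<le> R")
    case True
    then have "cmod (l / of_real R) \<le> 1" using R by (simp add: norm_divide)
    then have "cut_dz (l / of_real R) = cauchy_cocut_dz (l / of_real R)" by (simp add: cut_dz_def)
    then show ?thesis using True by (simp add: inverse_square_annulus_def)
  next
    case False
    then have "1 < cmod (l / of_real R)" using R by (simp add: norm_divide)
    then have "cut_dz (l / of_real R) = 0" "cauchy_cocut_dz (l / of_real R) = - 1 / (l / of_real R)\<^sup>2"
      by (simp_all add: cut_dz_def cauchy_cocut_dz_outside)
    then show ?thesis using False R by (simp add: inverse_square_annulus_def power_divide)
  qed
  show ?thesis unfolding rem' link_error_def zeta_transform_eq f key by (simp add: algebra_simps)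
qed

lemma measurable_trunc_transform [measurable]: "trunc_transform \<theta> R \<in> borel_measurable borel"
  unfolding trunc_transform_def[abs_def] conv_def by measurable

lemma measurable_cut_dz: "cut_dz \<in> borel_measurable borel"
  using bounded_cs_cut_dz by (simp add: bounded_cs_def)

lemma measurable_link_error [measurable]: "link_error R \<in> borel_measurable borel"
proof -
  note [measurable] = measurable_cut_dz
  show ?thesis unfolding link_error_def[abs_def] by measurable
qed

lemma norm_zeta_transform_le:
  obtains C where "C \<ge> 0" "\<And>l. cmod (zeta_transform \<theta> l) \<le> C * cubic_decay l"
proof -
  obtain C where C: "C \<ge> 0" "\<And>l. (\<integral>\<^sup>+z. ennreal (cmod (\<theta> z * zeta_kernel z l)) \<partial>lborel) \<le> ennreal (C * cubic_decay l)"
    using nn_integral_zeta_kernel_le[OF \<theta>_cs] by blast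
  have "cmod (zeta_transform \<theta> l) \<le> C * cubic_decay l" for l
  proof -
    have "(\<integral>\<^sup>+z. ennreal (norm (\<theta> z * zeta_kernel z l)) \<partial>lborel) < \<infinity>"
      by (rule le_less_trans[OF C(2)]) simp
    then have "integrable lborel (\<lambda>z. \<theta> z * zeta_kernel z l)" by (intro integrableI_bounded) auto
    then have "ennreal (cmod (zeta_transform \<theta> l)) \<le> (\<integral>\<^sup>+z. ennreal (norm (\<theta> z * zeta_kernel z l)) \<partial>lborel)"
      unfolding zeta_transform_def by (rule integral_norm_bound_ennreal)
    also note C(2)
    finally show ?thesis using C(1) cubic_decay_pos[of l] by (simp add: less_imp_le)
  qed
  with C(1) show thesis by (rule that)
qed

text \<open>For |l| < 2R the prefactor 1/R and the increments z/R in the Taylor remainder give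
  o(R^-2); beyond 2R the truncated pieces vanish and only the cubic decay of
  \<open>zeta_transform\<close> is left.\<close>

lemma link_error_bound:
  obtains C where "C \<ge> 0" "\<And>e. e > 0 \<Longrightarrow> \<exists>R0\<ge>1. \<forall>R\<ge>R0. \<forall>l.
    cmod (link_error R l) \<le> (if cmod l < 2 * R then e / R\<^sup>2 else C / cmod l ^ 3)"
proof -
  obtain C where C: "C \<ge> 0" "\<And>l. cmod (zeta_transform \<theta> l) \<le> C * cubic_decay l" using norm_zeta_transform_le by blast
  obtain r where r: "r > 0" "\<And>z. r < cmod z \<Longrightarrow> \<theta> z = 0" using test_fun_support[OF \<theta>] by blast
  define A where "A = (\<integral>z. cmod (\<theta> z) \<partial>lborel)"
  have A: "A \<ge> 0" by (simp add: A_def)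
  have "\<exists>R0\<ge>1. \<forall>R\<ge>R0. \<forall>l. cmod (link_error R l) \<le> (if cmod l < 2 * R then e / R\<^sup>2 else C / cmod l ^ 3)" if e: "e > 0" for e
  proof -
    \<comment> \<open>Chosen so that e' r A \<le> e; adding 1 to A keeps the denominator
      positive.\<close>
    define e' where "e' = e / (r * (A + 1))"
    have A1: "A + 1 > 0" using A by simp
    have e': "e' > 0" unfolding e'_def using e r(1) A1 by simp
    have "e' * r * A = e * (A / (A + 1))" unfolding e'_def using r(1) by simp
    also have "\<dots> \<le> e * 1" using e A1 by (intro mult_left_mono) auto
    finally have e'2: "e' * r * A \<le> e" by simp
    obtain d where d: "d > 0" "\<And>y h. cmod y \<le> 2 \<Longrightarrow> cmod h \<le> d \<Longrightarrow>
        cmod (cauchy_cocut (y + h) - cauchy_cocut y - (cauchy_cocut_dz y * h + paraboloid y * cnj h)) \<le> e' * cmod h"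
      using cauchy_cocut_taylor[OF e', of 2] by blast
    show ?thesis
    \<comment> \<open>R \<ge> r puts the support of \<theta> inside the disk of radius R, and R
      \<ge> r/d keeps the increments z/R within the range d of the expansion.\<close>
    proof (intro exI[of _ "max (max 1 r) (r / d)"] conjI allI impI)
      fix R l assume "max (max 1 r) (r / d) \<le> R"
      then have R: "R \<ge> 1" "R \<ge> r" "r / d \<le> R" by auto
      show "cmod (link_error R l) \<le> (if cmod l < 2 * R then e / R\<^sup>2 else C / cmod l ^ 3)"
      proof (cases "cmod l < 2 * R")
        case True
        let ?g = "\<lambda>z. (cauchy_cocut (- l / of_real R + z / of_real R) - cauchy_cocut (- l / of_real R) -
          (cauchy_cocut_dz (- l / of_real R) * (z / of_real R) + paraboloid (- l / of_real R) * cnj (z / of_real R))) * \<theta> z"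
        have g: "cmod (?g z) \<le> (e' * r / R) * cmod (\<theta> z)" for z
        proof (cases "r < cmod z")
          case False
          have "cmod (z / of_real R) \<le> r / R" using False R by (simp add: norm_divide divide_right_mono)
          moreover have "r / R \<le> d" using R(1,3) d(1) by (simp add: divide_le_eq mult.commute)
          moreover have "cmod (- l / of_real R) \<le> 2" using True R(1) by (simp add: norm_divide divide_le_eq)
          ultimately have "cmod (cauchy_cocut (- l / of_real R + z / of_real R) - cauchy_cocut (- l / of_real R) -
            (cauchy_cocut_dz (- l / of_real R) * (z / of_real R) + paraboloid (- l / of_real R) * cnj (z / of_real R))) \<le> e' * cmod (z / of_real R)"
            by (intro d(2)) auto
          also have "\<dots> \<le> e' * (r / R)" using \<open>cmod (z / of_real R) \<le> r / R\<close> e' by (intro mult_left_mono) auto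
          finally show ?thesis unfolding norm_mult by (intro mult_right_mono) auto
        qed (simp add: r)
        have "cmod (\<integral>z. ?g z \<partial>lborel) \<le> (\<integral>z. (e' * r / R) * cmod (\<theta> z) \<partial>lborel)"
        proof (rule order_trans[OF integral_norm_bound integral_mono])
          have gi: "integrable lborel ?g"
          proof (rule integrable_mult_\<theta>)
            show "continuous_on UNIV (\<lambda>z. cauchy_cocut (- l / of_real R + z / of_real R) - cauchy_cocut (- l / of_real R) -
               (cauchy_cocut_dz (- l / of_real R) * (z / of_real R) + paraboloid (- l / of_real R) * cnj (z / of_real R)))"
              by (intro continuous_intros continuous_on_compose2[OF continuous_on_cauchy_cocut[of UNIV]]) (use R(1) in auto)
          qed
          then show "integrable lborel (\<lambda>z. cmod (?g z))" by (rule integrable_norm)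
          show "integrable lborel (\<lambda>z. (e' * r / R) * cmod (\<theta> z))" using test_fun_integrable[OF \<theta>] by simp
          show "cmod (?g z) \<le> (e' * r / R) * cmod (\<theta> z)" for z by (rule g)
        qed
        also have "\<dots> = (e' * r * A) / R" by (simp add: A_def)
        also have "\<dots> \<le> e / R" using e'2 R(1) by (intro divide_right_mono) auto
        finally have "cmod (\<integral>z. ?g z \<partial>lborel) \<le> e / R" .
        then have "(1 / R) * cmod (\<integral>z. ?g z \<partial>lborel) \<le> (1 / R) * (e / R)" using R(1) by (intro mult_left_mono) auto
        moreover have "cmod (link_error R l) = (1 / R) * cmod (\<integral>z. ?g z \<partial>lborel)"
          unfolding link_error_inside[OF R(1)] norm_mult using R(1) by (simp add: norm_divide)
        ultimately show ?thesis using True by (simp add: power2_eq_square)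
      next
        case False
        then have l: "1 \<le> cmod l" "2 * R \<le> cmod l" using R(1) by auto
        have "link_error R l = zeta_transform \<theta> l"
          by (rule link_error_outside) (use R r l in auto)
        also have "cmod (zeta_transform \<theta> l) \<le> C * cubic_decay l" by (rule C)
        also have "\<dots> \<le> C * (1 / cmod l ^ 3)" by (intro mult_left_mono cubic_decay_outside C l)
        finally show ?thesis using False by simp
      qed
    qed auto
  qed
  with C(1) show thesis by (rule that)
qed

end

lemma tendsto_ennreal_0_of_square_bound:
  fixes f :: "'i \<Rightarrow> ennreal"
  assumes K: "K < \<infinity>" and bound: "\<And>e. e > 0 \<Longrightarrow> \<forall>\<^sub>F r in F. f r \<le> K * (ennreal e)\<^sup>2"
  shows "(f \<longlongrightarrow> 0) F"
proof (rule order_tendstoI)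
  fix a :: ennreal assume a: "0 < a"
  have "(\<lambda>n. (1 / real (Suc n))\<^sup>2) \<longlonglongrightarrow> 0\<^sup>2"
    by (intro tendsto_power LIMSEQ_Suc[OF lim_1_over_n[where 'a=real]])
  then have "(\<lambda>n. ennreal ((1 / real (Suc n))\<^sup>2)) \<longlonglongrightarrow> ennreal 0" by (intro tendsto_ennrealI) simp
  then have "(\<lambda>n. (ennreal (1 / real (Suc n)))\<^sup>2) \<longlonglongrightarrow> 0" by (subst ennreal_power) simp_all
  from ennreal_tendsto_cmult[OF K[unfolded infinity_ennreal_def] this]
  have "(\<lambda>n. K * (ennreal (1 / real (Suc n)))\<^sup>2) \<longlonglongrightarrow> 0" by simp
  then have "\<forall>\<^sub>F n in sequentially. K * (ennreal (1 / real (Suc n)))\<^sup>2 < a" by (rule order_tendstoD) (rule a)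
  then obtain n where n: "K * (ennreal (1 / real (Suc n)))\<^sup>2 < a" by (auto simp: eventually_sequentially)
  show "\<forall>\<^sub>F r in F. f r < a"
  proof (rule eventually_mono)
    show "\<forall>\<^sub>F r in F. f r \<le> K * (ennreal (1 / real (Suc n)))\<^sup>2" by (rule bound) simp
  qed (rule le_less_trans[OF _ n])
qed auto

subsection \<open>Mean square asymptotics\<close>

context stationary_process
begin

text \<open>By Campbell's formula the expected sum is the intensity times the integral of
  \<open>cubic_decay\<close>, which is 2 \<pi>.\<close>

lemma AE_cubic_decay_finite: "AE \<omega> in M. (\<integral>\<^sup>+l. ennreal (cubic_decay l) \<partial>conf_measure (N \<omega>)) < \<infinity>"
proof -
  have "(\<integral>\<^sup>+\<omega>. (\<integral>\<^sup>+l. ennreal (cubic_decay l) \<partial>conf_measure (N \<omega>)) \<partial>M) = ennreal intensity * (\<integral>\<^sup>+l. ennreal (cubic_decay l) \<partial>lborel)"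
    by (rule nn_integral_intensity) measurable
  also have "(\<integral>\<^sup>+l. ennreal (cubic_decay l) \<partial>lborel) = ennreal (2 * pi)"
    using nn_integral_cubic_decay[of 1] by (simp add: cubic_decay_def)
  finally have "(\<integral>\<^sup>+\<omega>. (\<integral>\<^sup>+l. ennreal (cubic_decay l) \<partial>conf_measure (N \<omega>)) \<partial>M) \<noteq> \<infinity>"
    by (simp add: ennreal_mult[symmetric] intensity_nonneg)
  then have "AE \<omega> in M. (\<integral>\<^sup>+l. ennreal (cubic_decay l) \<partial>conf_measure (N \<omega>)) \<noteq> \<infinity>"
    by (intro nn_integral_noteq_infinite) measurable
  then show ?thesis by eventually_elim (simp add: less_top)
qed

text \<open>Of order R^2 points carry an error o(R^-2), and the cubic tail contributes order 1/R, so
  the second-moment bound tends to 0.\<close>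

lemma L2_lim_link_error:
  assumes "centered_test_fun \<theta>"
  shows "L2_lim M (\<lambda>R. lint (centered_test_fun.link_error \<theta> R)) (\<lambda>_. 0) at_top"
proof -
  interpret centered_test_fun \<theta> by fact
  obtain C where C: "C \<ge> 0" "\<And>e. e > 0 \<Longrightarrow> \<exists>R0\<ge>1. \<forall>R\<ge>R0. \<forall>l.
    cmod (link_error R l) \<le> (if cmod l < 2 * R then e / R\<^sup>2 else C / cmod l ^ 3)" using link_error_bound by blast
  have [measurable]: "cball (0::complex) s \<in> sets borel" for s by simp
  have "((\<lambda>R. sqnorm M (\<lambda>\<omega>. lint (link_error R) \<omega> - 0)) \<longlongrightarrow> 0) at_top"
  proof (rule tendsto_ennreal_0_of_square_bound[OF second_moment_finite])
    fix e :: real assume e: "e > 0"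
    \<comment> \<open>The disk of radius 2R + 2 has area at most 16 \<pi> R^2, so this share amounts
      to e/2. The threshold for R below makes the tail, 54 \<pi> C / R, at most e/2 too.\<close>
    define e' where "e' = e / (32 * pi)"
    have e': "e' > 0" using e by (simp add: e'_def)
    obtain R0 where R0: "R0 \<ge> 1" "\<And>R l. R \<ge> R0 \<Longrightarrow> cmod (link_error R l) \<le> (if cmod l < 2 * R then e' / R\<^sup>2 else C / cmod l ^ 3)"
      using C(2)[OF e'] by blast
    show "\<forall>\<^sub>F R in at_top. sqnorm M (\<lambda>\<omega>. lint (link_error R) \<omega> - 0) \<le> second_moment * (ennreal e)\<^sup>2"
      using eventually_ge_at_top[of "max R0 (108 * pi * C / e)"]
    proof eventually_elim
      case (elim R)
      then have R: "R \<ge> R0" "R \<ge> 1" "108 * pi * C / e \<le> R" using R0(1) by auto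
      let ?F = "\<lambda>x. ennreal (e' / R\<^sup>2) * indicator (cball 0 (2 * R + 2)) x + ennreal (27 * C) * ennreal (1 / sqrt (R\<^sup>2 + (cmod x)\<^sup>2) ^ 3)"
      have "sqnorm M (lint (link_error R)) \<le> second_moment * (\<integral>\<^sup>+x. ?F x \<partial>lborel)\<^sup>2"
      proof (rule sqnorm_lint_le)
        fix x y :: complex assume xy: "cmod (x - y) \<le> 2"
        have xy': "cmod x \<le> cmod y + 2" using norm_triangle_ineq2[of x y] xy by linarith
        show "ennreal (cmod (link_error R y)) \<le> ?F x"
        proof (cases "cmod y < 2 * R")
          case True
          then have "ennreal (cmod (link_error R y)) \<le> ennreal (e' / R\<^sup>2)" using R0(2)[OF R(1), of y] by (simp add: ennreal_leI)
          moreover have "cmod x \<le> 2 * R + 2" using True xy' by linarith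
          ultimately show ?thesis by (simp add: add_increasing2)
        next
          case False
          have y: "2 * R \<le> cmod y" "2 \<le> cmod y" using False R(2) by auto
          \<comment> \<open>R \<le> |y| and |x| \<le> 2 |y| give R^2 + |x|^2 \<le> 9 |y|^2; the cube
            of 3 is the factor 27 in the majorant.\<close>
          have "sqrt (R\<^sup>2 + (cmod x)\<^sup>2) \<le> 3 * cmod y"
          proof (rule real_le_lsqrt)
            have "R\<^sup>2 \<le> (cmod y)\<^sup>2" using y R(2) by (intro power_mono) auto
            moreover have "(cmod x)\<^sup>2 \<le> 4 * (cmod y)\<^sup>2" using power_mono[of "cmod x" "2 * cmod y" 2] xy' y by (simp add: power_mult_distrib)
            moreover have "(3 * cmod y)\<^sup>2 = 9 * (cmod y)\<^sup>2" by (simp add: power_mult_distrib)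
            ultimately show "R\<^sup>2 + (cmod x)\<^sup>2 \<le> (3 * cmod y)\<^sup>2" using zero_le_power2[of "cmod y"] by linarith
          qed (use y in auto)
          then have "sqrt (R\<^sup>2 + (cmod x)\<^sup>2) ^ 3 \<le> (3 * cmod y) ^ 3" by (intro power_mono) auto
          moreover have s: "sqrt (R\<^sup>2 + (cmod x)\<^sup>2) ^ 3 > 0" using R(2) by (simp add: add_pos_nonneg)
          ultimately have "1 / (3 * cmod y) ^ 3 \<le> 1 / sqrt (R\<^sup>2 + (cmod x)\<^sup>2) ^ 3" using y by (intro divide_left_mono mult_pos_pos) auto
          then have "27 * C * (1 / (3 * cmod y) ^ 3) \<le> 27 * C * (1 / sqrt (R\<^sup>2 + (cmod x)\<^sup>2) ^ 3)" using C(1) by (intro mult_left_mono) auto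
          moreover have "27 * C * (1 / (3 * cmod y) ^ 3) = C / cmod y ^ 3" by (simp add: power_mult_distrib)
          ultimately have "cmod (link_error R y) \<le> 27 * C * (1 / sqrt (R\<^sup>2 + (cmod x)\<^sup>2) ^ 3)" using R0(2)[OF R(1), of y] False by simp
          then have "ennreal (cmod (link_error R y)) \<le> ennreal (27 * C) * ennreal (1 / sqrt (R\<^sup>2 + (cmod x)\<^sup>2) ^ 3)"
            using C(1) s by (subst ennreal_mult[symmetric]) (auto intro: ennreal_leI)
          then show ?thesis by (rule add_increasing[OF zero_le])
        qed
      qed measurable
      also have "(\<integral>\<^sup>+x. ?F x \<partial>lborel) = ennreal (e' / R\<^sup>2) * emeasure lborel (cball (0::complex) (2 * R + 2)) + ennreal (27 * C) * ennreal (2 * pi / R)"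
        using R(2) by (subst nn_integral_add) (auto simp: nn_integral_cmult nn_integral_cmult_indicator nn_integral_cubic_decay)
      also have "\<dots> = ennreal (e' / R\<^sup>2 * (pi * (2 * R + 2)\<^sup>2) + 27 * C * (2 * pi / R))"
        using R(2) e' C(1) by (simp add: emeasure_cball_complex ennreal_mult[symmetric] ennreal_plus[symmetric] del: ennreal_plus)
      also have "\<dots> \<le> ennreal e"
      proof (rule ennreal_leI)
        have "(2 * R + 2)\<^sup>2 \<le> (4 * R)\<^sup>2" using R(2) by (intro power_mono) auto
        then have "e' / R\<^sup>2 * (pi * (2 * R + 2)\<^sup>2) \<le> e' / R\<^sup>2 * (pi * (4 * R)\<^sup>2)" using e' by (intro mult_left_mono) auto
        also have "\<dots> = e / 2" using R(2) by (simp add: e'_def power_mult_distrib field_simps)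
        finally have 1: "e' / R\<^sup>2 * (pi * (2 * R + 2)\<^sup>2) \<le> e / 2" .
        have "108 * pi * C \<le> R * e" using R(3) e by (simp add: pos_divide_le_eq)
        then have "27 * C * (2 * pi / R) \<le> e / 2" using R(2) by (simp add: field_simps)
        with 1 show "e' / R\<^sup>2 * (pi * (2 * R + 2)\<^sup>2) + 27 * C * (2 * pi / R) \<le> e" by linarith
      qed
      finally show ?case by (simp add: mult_left_mono power_mono)
    qed
  qed
  then show ?thesis unfolding L2_lim_def .
qed

lemma Psi_partial_eq_lint:
  assumes "\<omega> \<in> space M" shows "Psi_partial (N \<omega>) R = lint (inverse_square_annulus R) \<omega>"
proof -
  let ?S = "{l. 1 \<le> cmod l \<and> cmod l \<le> R}"
  have S: "?S \<in> sets borel" "bounded ?S" by (measurable, auto simp: bounded_iff)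
  have "Psi_partial (N \<omega>) R = (\<Sum>l\<in>{l \<in> supp_conf (N \<omega>). l \<in> ?S}. of_nat (N \<omega> l) * (1 / l\<^sup>2))"
    unfolding Psi_partial_def by simp
  also have "\<dots> = (\<integral>l. indicator ?S l * (1 / l\<^sup>2) \<partial>conf_measure (N \<omega>))"
    by (rule finite_sum_conf) (use S locfin_N[OF assms] in auto)
  also have "\<dots> = lint (inverse_square_annulus R) \<omega>"
    unfolding lint_def by (intro Bochner_Integration.integral_cong) (auto simp: inverse_square_annulus_def)
  finally show ?thesis .
qed

definition zeta_pairing :: "(complex \<Rightarrow> complex) \<Rightarrow> 'a \<Rightarrow> complex" where
  "zeta_pairing \<theta> \<omega> = (\<integral>z. zeta_pp M N \<omega> z * \<theta> z \<partial>lborel)"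

lemma zeta_pairing_good:
  assumes "\<omega> \<in> space M" "(\<integral>\<^sup>+l. ennreal (cubic_decay l) \<partial>conf_measure (N \<omega>)) < \<infinity>" "bounded_cs \<theta>"
  shows "zeta_pairing \<theta> \<omega> = lint (zeta_transform \<theta>) \<omega> - Psi2_inf M N \<omega> * (\<integral>z. z * \<theta> z \<partial>lborel)"
  using integral_zeta_conf_good(2)[OF locfin_N[OF assms(1)] assms(2,3)]
  unfolding zeta_pairing_def zeta_pp_def lint_def zeta_transform_def .

text \<open>Both on the event of convergence and on its complement the pairing is a linear statistic
  minus a multiple of \<open>Psi2_inf\<close>; on the complement only the points of the unit disk
  count.\<close>

lemma measurable_zeta_pairing:
  assumes \<theta>: "bounded_cs \<theta>" and [measurable]: "Psi2_inf M N \<in> borel_measurable M"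
  shows "zeta_pairing \<theta> \<in> borel_measurable M"
proof -
  have [measurable]: "\<theta> \<in> borel_measurable borel" using \<theta> by (simp add: bounded_cs_def)
  have [measurable]: "ball (0::complex) 1 \<in> sets borel" by simp
  define g where "g \<omega> = (if (\<integral>\<^sup>+l. ennreal (cubic_decay l) \<partial>conf_measure (N \<omega>)) < \<infinity> then lint (zeta_transform \<theta>) \<omega>
      else lint (\<lambda>l. indicator (ball 0 1) l * zeta_transform \<theta> l) \<omega>) - Psi2_inf M N \<omega> * (\<integral>z. z * \<theta> z \<partial>lborel)" for \<omega>
  have [measurable]: "lint (zeta_transform \<theta>) \<in> borel_measurable M" "lint (\<lambda>l. indicator (ball 0 1) l * zeta_transform \<theta> l) \<in> borel_measurable M"
    by (rule measurable_lint; measurable)+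
  have [measurable]: "(\<lambda>\<omega>. \<integral>\<^sup>+l. ennreal (cubic_decay l) \<partial>conf_measure (N \<omega>)) \<in> borel_measurable M"
    by (rule measurable_nn_integral_N) measurable
  have "g \<in> borel_measurable M" unfolding g_def[abs_def] by measurable
  moreover have "zeta_pairing \<theta> \<omega> = g \<omega>" if \<omega>: "\<omega> \<in> space M" for \<omega>
  proof (cases "(\<integral>\<^sup>+l. ennreal (cubic_decay l) \<partial>conf_measure (N \<omega>)) < \<infinity>")
    case True
    then show ?thesis using zeta_pairing_good[OF \<omega> True \<theta>] by (simp add: g_def)
  next
    case False
    then show ?thesis using integral_zeta_conf_bad(2)[OF locfin_N[OF \<omega>] False \<theta>]
      unfolding zeta_pairing_def zeta_pp_def lint_def zeta_transform_def g_def by simp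
  qed
  ultimately show ?thesis by (subst measurable_cong)
qed

end

lemma density_locally_finite:
  fixes \<rho> :: "complex measure"
  assumes [simp, measurable_cong]: "sets \<rho> = sets borel" and fin: "\<And>K. compact K \<Longrightarrow> emeasure \<rho> K < \<infinity>"
    and [measurable]: "w \<in> borel_measurable borel" and wB: "\<And>\<xi>. w \<xi> \<le> B" and K: "compact K"
  shows "emeasure (density \<rho> (\<lambda>\<xi>. ennreal (w \<xi>))) K < \<infinity>"
proof -
  have Ks: "K \<in> sets \<rho>" using borel_compact[OF K] by simp
  have "emeasure (density \<rho> (\<lambda>\<xi>. ennreal (w \<xi>))) K = (\<integral>\<^sup>+\<xi>. ennreal (w \<xi>) * indicator K \<xi> \<partial>\<rho>)"
    by (rule emeasure_density) (use Ks in measurable)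
  also have "\<dots> \<le> (\<integral>\<^sup>+\<xi>. ennreal B * indicator K \<xi> \<partial>\<rho>)"
    by (intro nn_integral_mono mult_right_mono ennreal_leI wB) auto
  also have "\<dots> = ennreal B * emeasure \<rho> K" by (rule nn_integral_cmult_indicator[OF Ks])
  also have "\<dots> < \<infinity>" using fin[OF K] by (simp add: ennreal_mult_less_top)
  finally show ?thesis .
qed

section \<open>Spectral representation of pairings with the zeta function\<close>

context spectral_process
begin

text \<open>The definition of \<open>link_error\<close> is solved for the truncated terms. At this
  stage the truncated transform and the sum of l^-2 are tied together in one limit;
  \<open>Psi2_inf_spec\<close> makes the second limit available by itself.\<close>

lemma L2_lim_trunc_transform:
  assumes "centered_test_fun \<theta>"
  shows "L2_lim M (\<lambda>R \<omega>. lint (trunc_transform \<theta> R) \<omega> + centered_test_fun.moment \<theta> * lint (inverse_square_annulus R) \<omega>)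
    (\<lambda>\<omega>. lint (zeta_transform \<theta>) \<omega> - of_real pi * of_real (cond_intensity M N \<omega>) * centered_test_fun.moment_cnj \<theta>) at_top"
proof -
  interpret centered_test_fun \<theta> by fact
  let ?q = "\<lambda>R. lint (\<lambda>l. of_real (1 / R\<^sup>2) * cut_dz (l / of_real R))"
  let ?p = "\<lambda>R. lint (\<lambda>l. of_real (1 / R\<^sup>2) * paraboloid (l / of_real R))"
  have mq: "?q R \<in> borel_measurable M" for R by (rule ergodic_average_measurable(1)[OF measurable_cut_dz])
  have mp: "?p R \<in> borel_measurable M" for R by (rule ergodic_average_measurable(1)[OF measurable_paraboloid])
  have mD: "lint (zeta_transform \<theta>) \<in> borel_measurable M" by (rule measurable_lint) measurable
  have mE: "lint (link_error R) \<in> borel_measurable M" for R by (rule measurable_lint) measurable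
  have mc: "(\<lambda>\<omega>. of_real (cond_intensity M N \<omega>) * complex_of_real pi) \<in> borel_measurable M" by measurable
  have lq: "L2_lim M ?q (\<lambda>_. 0) at_top"
    by (rule ergodic_limit_zero[OF bounded_cs_cut_dz AE_isCont_cut_dz integral_cut_dz])
  have lp: "L2_lim M ?p (\<lambda>\<omega>. of_real (cond_intensity M N \<omega>) * of_real pi) at_top"
    using mean_ergodic[OF bounded_cs_paraboloid AE_isCont_paraboloid] unfolding integral_paraboloid .
  have lD: "L2_lim M (\<lambda>_. lint (zeta_transform \<theta>)) (lint (zeta_transform \<theta>)) at_top" by (simp add: L2_lim_def sqnorm_def)
  note l1 = L2_lim_cmult[OF lq mq, of moment, OF borel_measurable_const]
  note l2 = L2_lim_cmult[OF lp mp mc, of moment_cnj]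
  note l3 = L2_lim_link_error[OF assms]
  have "L2_lim M (\<lambda>R \<omega>. ((lint (zeta_transform \<theta>) \<omega> - moment * ?q R \<omega>) - moment_cnj * ?p R \<omega>) - lint (link_error R) \<omega>)
     (\<lambda>\<omega>. ((lint (zeta_transform \<theta>) \<omega> - moment * 0) - moment_cnj * (of_real (cond_intensity M N \<omega>) * of_real pi)) - 0) at_top"
    by (rule L2_lim_diff[OF L2_lim_diff[OF L2_lim_diff[OF lD _ _ l1] _ _ l2] _ _ l3])
       (use mq mp mD mE mc in \<open>auto intro!: borel_measurable_diff borel_measurable_times\<close>)
  then show ?thesis
  proof (rule L2_lim_cong)
    show "\<forall>\<^sub>F R in at_top. AE \<omega> in M. ((lint (zeta_transform \<theta>) \<omega> - moment * ?q R \<omega>) - moment_cnj * ?p R \<omega>) - lint (link_error R) \<omega> =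
        lint (trunc_transform \<theta> R) \<omega> + moment * lint (inverse_square_annulus R) \<omega>"
      using eventually_gt_at_top[of 0]
    proof eventually_elim
      case (elim R)
      show ?case
        using AE_cubic_decay_finite AE_space
      proof eventually_elim
        case (elim \<omega>)
        have R: "R > 0" by fact
        note \<omega> = elim(2)
        note b1 = bounded_cs_cmult[OF bounded_cs_inverse_square_annulus, of moment R]
        note b2 = bounded_cs_cmult[OF bounded_cs_cmult[OF bounded_cs_scale[OF bounded_cs_cut_dz R], of "of_real (1 / R\<^sup>2)"], of moment]
        note b3 = bounded_cs_cmult[OF bounded_cs_cmult[OF bounded_cs_scale[OF bounded_cs_paraboloid R], of "of_real (1 / R\<^sup>2)"], of moment_cnj]
        note b4 = test_fun_bounded_cs[OF test_fun_trunc_transform[OF \<theta> R]]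
        have D: "integrable (conf_measure (N \<omega>)) (zeta_transform \<theta>)"
          using integral_zeta_conf_good(3)[OF locfin_N[OF \<omega>] elim(1) \<theta>_cs] unfolding zeta_transform_def[abs_def] .
        have "lint (link_error R) \<omega> = lint (zeta_transform \<theta>) \<omega> - lint (\<lambda>l. moment * inverse_square_annulus R l +
           (moment * (of_real (1 / R\<^sup>2) * cut_dz (l / of_real R)) +
           (moment_cnj * (of_real (1 / R\<^sup>2) * paraboloid (l / of_real R)) + trunc_transform \<theta> R l))) \<omega>"
          unfolding lint_def link_error_def
          by (intro Bochner_Integration.integral_diff D lint_integrable \<omega> bounded_cs_add b1 b2 b3 b4)
        also have "lint (\<lambda>l. moment * inverse_square_annulus R l +
           (moment * (of_real (1 / R\<^sup>2) * cut_dz (l / of_real R)) +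
           (moment_cnj * (of_real (1 / R\<^sup>2) * paraboloid (l / of_real R)) + trunc_transform \<theta> R l))) \<omega> =
           moment * lint (inverse_square_annulus R) \<omega> + (moment * ?q R \<omega> + (moment_cnj * ?p R \<omega> + lint (trunc_transform \<theta> R) \<omega>))"
          by (subst lint_add[OF \<omega> b1 bounded_cs_add[OF b2 bounded_cs_add[OF b3 b4]]], subst lint_add[OF \<omega> b2 bounded_cs_add[OF b3 b4]], subst lint_add[OF \<omega> b3 b4])
             (simp only: lint_cmult[of moment] lint_cmult[of moment_cnj])
        finally show ?case by (simp add: algebra_simps)
      qed
    qed
    show "AE \<omega> in M. ((lint (zeta_transform \<theta>) \<omega> - moment * 0) - moment_cnj * (of_real (cond_intensity M N \<omega>) * of_real pi)) - 0 =
      lint (zeta_transform \<theta>) \<omega> - of_real pi * of_real (cond_intensity M N \<omega>) * moment_cnj"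
      by (intro AE_I2) (simp add: mult_ac)
  qed
qed

text \<open>The candidate limit is square integrable for \<rho>: near the origin because \<theta>
  has mean zero and \<rho> is locally finite, and for |\<xi>| > 1 because dividing by \<xi> makes
  the transform smaller. At the origin all functions involved are 0, division by zero
  included.\<close>

lemma spec_rep_trunc_transform:
  assumes "centered_test_fun \<theta>"
  obtains Y where "spec_rep Y (\<lambda>\<xi>. \<i> * fourier \<theta> \<xi> / \<xi>)" "L2_lim M (\<lambda>R. lint (trunc_transform \<theta> R)) Y at_top"
proof -
  interpret centered_test_fun \<theta> by fact
  have f0: "fourier \<theta> 0 = 0" by (simp add: fourier_zero mean0)
  have fm [measurable]: "fourier \<theta> \<in> borel_measurable borel" by measurable
  \<comment> \<open>Subtracting the integral of \<theta>, which is 0, replaces the character by its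
    increment from 1.\<close>
  have lip: "cmod (fourier \<theta> \<xi>) \<le> cmod \<xi> * (2 * pi * (\<integral>x. cmod (x * \<theta> x) \<partial>lborel))" for \<xi>
  proof -
    note i0 = test_fun_integrable[OF \<theta>]
    have i1: "integrable lborel (\<lambda>x. cmod (x * \<theta> x))" by (intro integrable_norm integrable_mult_\<theta> continuous_on_id)
    have "fourier \<theta> \<xi> = (\<integral>x. echar \<xi> x * \<theta> x \<partial>lborel) - (\<integral>x. \<theta> x \<partial>lborel)" by (simp add: fourier_echar mean0)
    also have "\<dots> = (\<integral>x. (echar \<xi> x - 1) * \<theta> x \<partial>lborel)"
      using i0 integrable_echar_mult[OF i0] by (simp add: left_diff_distrib)
    finally have "cmod (fourier \<theta> \<xi>) \<le> (\<integral>x. cmod ((echar \<xi> x - 1) * \<theta> x) \<partial>lborel)" by (simp add: integral_norm_bound)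
    also have "\<dots> \<le> (\<integral>x. (2 * pi * cmod \<xi>) * cmod (x * \<theta> x) \<partial>lborel)"
    proof (rule integral_mono)
      have "integrable lborel (\<lambda>x. (echar \<xi> x - 1) * \<theta> x)" using i0 integrable_echar_mult[OF i0] by (simp add: left_diff_distrib)
      then show "integrable lborel (\<lambda>x. cmod ((echar \<xi> x - 1) * \<theta> x))" by (rule integrable_norm)
      show "integrable lborel (\<lambda>x. (2 * pi * cmod \<xi>) * cmod (x * \<theta> x))" using i1 by simp
      fix x
      show "cmod ((echar \<xi> x - 1) * \<theta> x) \<le> (2 * pi * cmod \<xi>) * cmod (x * \<theta> x)"
        using mult_right_mono[OF echar_diff_one[of \<xi> x] norm_ge_zero[of "\<theta> x"]] by (simp add: norm_mult mult.assoc)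
    qed
    finally show ?thesis by (simp add: mult_ac)
  qed
  define L where "L = 2 * pi * (\<integral>x. cmod (x * \<theta> x) \<partial>lborel)"
  have L: "L \<ge> 0" by (simp add: L_def)
  \<comment> \<open>The constant 3 is 2, from \<open>norm_fourier_cauchy_trunc\<close>, plus 1 for
    the limit.\<close>
  define b where "b \<xi> = 3 * (cmod (fourier \<theta> \<xi>) / cmod \<xi>)" for \<xi>
  have bm [measurable]: "b \<in> borel_measurable borel" unfolding b_def[abs_def] by measurable
  have b_int: "integrable \<rho> (\<lambda>\<xi>. (b \<xi>)\<^sup>2)"
  proof (rule Bochner_Integration.integrable_bound)
    have "integrable \<rho> (\<lambda>\<xi>. (cmod (fourier \<theta> \<xi>))\<^sup>2)"
      using sqnorm_fourier_finite[OF \<theta>] unfolding sqnorm_def by (intro integrableI_bounded) auto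
    moreover have "integrable \<rho> (indicator (cball 0 1) :: complex \<Rightarrow> real)"
      by (rule integrable_real_indicator) (use finite_\<rho>[OF compact_cball] in auto)
    ultimately show "integrable \<rho> (\<lambda>\<xi>. 9 * (cmod (fourier \<theta> \<xi>))\<^sup>2 + (9 * L\<^sup>2) * indicator (cball 0 1) \<xi>)" by simp
    show "AE \<xi> in \<rho>. norm ((b \<xi>)\<^sup>2) \<le> norm (9 * (cmod (fourier \<theta> \<xi>))\<^sup>2 + (9 * L\<^sup>2) * indicator (cball 0 1) \<xi>)"
    proof (rule AE_I2)
      fix \<xi>
      have eq: "(b \<xi>)\<^sup>2 = 9 * (cmod (fourier \<theta> \<xi>) / cmod \<xi>)\<^sup>2" unfolding b_def power_mult_distrib by simp
      show "norm ((b \<xi>)\<^sup>2) \<le> norm (9 * (cmod (fourier \<theta> \<xi>))\<^sup>2 + (9 * L\<^sup>2) * indicator (cball 0 1) \<xi>)"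
      proof (cases "cmod \<xi> \<le> 1")
        case True
        have "cmod (fourier \<theta> \<xi>) / cmod \<xi> \<le> L" using lip[of \<xi>] L by (cases "\<xi> = 0") (auto simp: L_def divide_le_eq mult.commute)
        then have "(cmod (fourier \<theta> \<xi>) / cmod \<xi>)\<^sup>2 \<le> L\<^sup>2" by (intro power_mono) auto
        then show ?thesis using True by (simp add: eq add_increasing)
      next
        case False
        then have "cmod (fourier \<theta> \<xi>) / cmod \<xi> \<le> cmod (fourier \<theta> \<xi>) / 1" by (intro divide_left_mono) (auto simp: mult_pos_pos)
        then have "(cmod (fourier \<theta> \<xi>) / cmod \<xi>)\<^sup>2 \<le> (cmod (fourier \<theta> \<xi>))\<^sup>2" by (intro power_mono) auto
        then show ?thesis using False by (simp add: eq)
      qed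
    qed
  qed (simp add: measurable_cong_sets[OF sets_\<rho> refl])
  show thesis
  proof (rule spec_rep_limit[of "trunc_transform \<theta>" 0 "\<lambda>\<xi>. \<i> * fourier \<theta> \<xi> / \<xi>"])
    fix R :: real assume "R \<ge> 1"
    then show "test_fun (trunc_transform \<theta> R)" "fourier (trunc_transform \<theta> R) 0 = 0"
      by (simp_all add: test_fun_trunc_transform[OF \<theta>] fourier_trunc_transform[OF \<theta>] f0 del: fourier_zero)
  next
    show "L2_lim \<rho> (\<lambda>R. fourier (trunc_transform \<theta> R)) (\<lambda>\<xi>. \<i> * fourier \<theta> \<xi> / \<xi>) at_top"
    proof (rule L2_lim_dominated[OF _ _ _ _ _ b_int])
      show "fourier (trunc_transform \<theta> R) \<in> borel_measurable \<rho>" for R by (rule measurable_fourier_\<rho>) measurable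
      show "(\<lambda>\<xi>. \<i> * fourier \<theta> \<xi> / \<xi>) \<in> borel_measurable \<rho>" "b \<in> borel_measurable \<rho>" by measurable
      fix \<xi>
      show "((\<lambda>R. fourier (trunc_transform \<theta> R) \<xi>) \<longlongrightarrow> \<i> * fourier \<theta> \<xi> / \<xi>) at_top"
      proof (rule Lim_transform_eventually)
        show "\<forall>\<^sub>F R in at_top. - (fourier (cauchy_trunc R) \<xi> * fourier \<theta> \<xi>) = fourier (trunc_transform \<theta> R) \<xi>"
          using eventually_gt_at_top[of 0] by eventually_elim (simp add: fourier_trunc_transform[OF \<theta>])
        show "((\<lambda>R. - (fourier (cauchy_trunc R) \<xi> * fourier \<theta> \<xi>)) \<longlongrightarrow> \<i> * fourier \<theta> \<xi> / \<xi>) at_top"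
        proof (cases "\<xi> = 0")
          case False
          from tendsto_minus[OF tendsto_mult[OF tendsto_fourier_cauchy_trunc[OF False] tendsto_const[of "fourier \<theta> \<xi>"]]]
          show ?thesis by simp
        qed (simp add: f0 mean0 fourier_zero)
      qed
    next
      show "\<forall>\<^sub>F R in at_top. \<forall>\<xi>\<in>space \<rho>. cmod (fourier (trunc_transform \<theta> R) \<xi> - \<i> * fourier \<theta> \<xi> / \<xi>) \<le> b \<xi>"
        using eventually_gt_at_top[of 0]
      proof eventually_elim
        case (elim R)
        show ?case
        proof
          fix \<xi>
          show "cmod (fourier (trunc_transform \<theta> R) \<xi> - \<i> * fourier \<theta> \<xi> / \<xi>) \<le> b \<xi>"
          proof (cases "\<xi> = 0")
            case False
            have "cmod (fourier (cauchy_trunc R) \<xi>) \<le> 2 / cmod \<xi>"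
              using norm_fourier_cauchy_trunc[OF elim, of \<xi>] False by (simp add: norm_mult pos_le_divide_eq mult.commute)
            then have "cmod (fourier (cauchy_trunc R) \<xi>) * cmod (fourier \<theta> \<xi>) \<le> 2 / cmod \<xi> * cmod (fourier \<theta> \<xi>)" by (rule mult_right_mono) simp
            moreover have "cmod (fourier (trunc_transform \<theta> R) \<xi> - \<i> * fourier \<theta> \<xi> / \<xi>) \<le> cmod (fourier (trunc_transform \<theta> R) \<xi>) + cmod (\<i> * fourier \<theta> \<xi> / \<xi>)"
              by (rule norm_triangle_ineq4)
            ultimately show ?thesis by (simp add: fourier_trunc_transform[OF \<theta> elim] norm_mult norm_divide b_def)
          next
            case True
            have "fourier (trunc_transform \<theta> R) 0 = 0" by (subst fourier_trunc_transform[OF \<theta> elim]) (simp add: f0)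
            then show ?thesis unfolding True by (simp add: b_def)
          qed
        qed
      qed
    qed
  qed (use that in auto)
qed

text \<open>\<open>Psi2_inf\<close> is a choice, so the limit must be shown to exist. For
  \<open>dz \<eta>\<close>, with moment -1, the truncated transform converges by itself, and
  subtracting the combination of \<open>L2_lim_trunc_transform\<close> isolates the sums of
  l^-2.\<close>

lemma Psi2_inf_spec:
  "Psi2_inf M N \<in> borel_measurable M" "L2_lim M (\<lambda>R. lint (inverse_square_annulus R)) (Psi2_inf M N) at_top"
proof -
  interpret c: centered_test_fun "dz \<eta>"
    by unfold_locales (rule test_fun_dz[OF \<eta>], rule integral_dz(1)[OF \<eta>])
  have m: "c.moment = -1" unfolding c.moment_def using integral_dz(2)[OF \<eta>] integral_\<eta> by simp
  obtain Y where Y: "spec_rep Y (\<lambda>\<xi>. \<i> * fourier (dz \<eta>) \<xi> / \<xi>)" "L2_lim M (\<lambda>R. lint (trunc_transform (dz \<eta>) R)) Y at_top"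
    by (rule spec_rep_trunc_transform[OF c.centered_test_fun_axioms])
  have Ym [measurable]: "Y \<in> borel_measurable M" using Y(1) by (simp add: spec_rep_def)
  define Z where "Z \<omega> = lint (zeta_transform (dz \<eta>)) \<omega> - of_real pi * of_real (cond_intensity M N \<omega>) * c.moment_cnj" for \<omega>
  have [measurable]: "lint (zeta_transform (dz \<eta>)) \<in> borel_measurable M" by (rule measurable_lint) (rule measurable_zeta_transform[OF c.\<theta>_m])
  have Zm [measurable]: "Z \<in> borel_measurable M" unfolding Z_def[abs_def] by measurable
  have m1 [measurable]: "lint (trunc_transform (dz \<eta>) R) \<in> borel_measurable M" for R by (rule measurable_lint) (rule c.measurable_trunc_transform)
  have m2 [measurable]: "lint (inverse_square_annulus R) \<in> borel_measurable M" for R by (rule measurable_lint) measurable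
  have "L2_lim M (\<lambda>R \<omega>. lint (trunc_transform (dz \<eta>) R) \<omega> - (lint (trunc_transform (dz \<eta>) R) \<omega> + c.moment * lint (inverse_square_annulus R) \<omega>)) (\<lambda>\<omega>. Y \<omega> - Z \<omega>) at_top"
    by (rule L2_lim_diff[OF Y(2) m1 Ym _ _ Zm]) (use L2_lim_trunc_transform[OF c.centered_test_fun_axioms] in \<open>simp_all add: Z_def[abs_def]\<close>)
  then have lim: "L2_lim M (\<lambda>R. lint (inverse_square_annulus R)) (\<lambda>\<omega>. Y \<omega> - Z \<omega>) at_top" by (simp add: m)
  let ?P = "\<lambda>\<Psi>. \<Psi> \<in> borel_measurable M \<and> ((\<lambda>R. \<integral>\<^sup>+\<omega>. ennreal ((cmod (Psi_partial (N \<omega>) R - \<Psi> \<omega>))\<^sup>2) \<partial>M) \<longlongrightarrow> 0) at_top"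
  have eq: "(\<integral>\<^sup>+\<omega>. ennreal ((cmod (Psi_partial (N \<omega>) R - \<Psi> \<omega>))\<^sup>2) \<partial>M) = sqnorm M (\<lambda>\<omega>. lint (inverse_square_annulus R) \<omega> - \<Psi> \<omega>)" for R \<Psi>
    unfolding sqnorm_def by (intro nn_integral_cong) (simp add: Psi_partial_eq_lint)
  have "?P (\<lambda>\<omega>. Y \<omega> - Z \<omega>)" using lim unfolding eq L2_lim_def by simp
  then have "?P (Psi2_inf M N)" unfolding Psi2_inf_def by (rule someI[of ?P])
  then show "Psi2_inf M N \<in> borel_measurable M" "L2_lim M (\<lambda>R. lint (inverse_square_annulus R)) (Psi2_inf M N) at_top"
    unfolding eq L2_lim_def by blast+
qed

text \<open>With the limit of the sums known, the truncated transform has two descriptions of its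
  limit, one spectral and one through the pairing with \<zeta>; uniqueness of limits identifies them
  almost surely.\<close>

lemma spec_rep_zeta_pairing_centered:
  assumes "centered_test_fun \<theta>"
  shows "spec_rep (\<lambda>\<omega>. zeta_pairing \<theta> \<omega> - of_real pi * of_real (cond_intensity M N \<omega>) * centered_test_fun.moment_cnj \<theta>) (\<lambda>\<xi>. \<i> * fourier \<theta> \<xi> / \<xi>)"
proof -
  interpret centered_test_fun \<theta> by fact
  obtain Y where Y: "spec_rep Y (\<lambda>\<xi>. \<i> * fourier \<theta> \<xi> / \<xi>)" "L2_lim M (\<lambda>R. lint (trunc_transform \<theta> R)) Y at_top"
    by (rule spec_rep_trunc_transform[OF assms])
  have Ym [measurable]: "Y \<in> borel_measurable M" using Y(1) by (simp add: spec_rep_def)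
  note Psi [measurable] = Psi2_inf_spec(1)
  have [measurable]: "zeta_pairing \<theta> \<in> borel_measurable M" by (rule measurable_zeta_pairing[OF \<theta>_cs Psi])
  have [measurable]: "lint (zeta_transform \<theta>) \<in> borel_measurable M" by (rule measurable_lint) measurable
  have m1 [measurable]: "lint (trunc_transform \<theta> R) \<in> borel_measurable M" for R by (rule measurable_lint) measurable
  have m2 [measurable]: "lint (inverse_square_annulus R) \<in> borel_measurable M" for R by (rule measurable_lint) measurable
  define Z where "Z \<omega> = lint (zeta_transform \<theta>) \<omega> - of_real pi * of_real (cond_intensity M N \<omega>) * moment_cnj" for \<omega>
  have Zm [measurable]: "Z \<in> borel_measurable M" unfolding Z_def[abs_def] by measurable
  have lP: "L2_lim M (\<lambda>R \<omega>. moment * lint (inverse_square_annulus R) \<omega>) (\<lambda>\<omega>. moment * Psi2_inf M N \<omega>) at_top"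
    by (rule L2_lim_cmult[OF Psi2_inf_spec(2) m2 Psi])
  have "L2_lim M (\<lambda>R \<omega>. (lint (trunc_transform \<theta> R) \<omega> + moment * lint (inverse_square_annulus R) \<omega>) - moment * lint (inverse_square_annulus R) \<omega>) (\<lambda>\<omega>. Z \<omega> - moment * Psi2_inf M N \<omega>) at_top"
    by (rule L2_lim_diff[OF _ _ Zm lP]) (use L2_lim_trunc_transform[OF assms] in \<open>simp_all add: Z_def[abs_def]\<close>)
  then have "L2_lim M (\<lambda>R. lint (trunc_transform \<theta> R)) (\<lambda>\<omega>. Z \<omega> - moment * Psi2_inf M N \<omega>) at_top" by simp
  then have "AE \<omega> in M. Y \<omega> = Z \<omega> - moment * Psi2_inf M N \<omega>"
    by (rule L2_lim_unique[OF Y(2)]) (auto intro: m1)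
  then have "AE \<omega> in M. Y \<omega> = zeta_pairing \<theta> \<omega> - of_real pi * of_real (cond_intensity M N \<omega>) * moment_cnj"
    using AE_cubic_decay_finite AE_space
  proof eventually_elim
    case (elim \<omega>)
    then show ?case using zeta_pairing_good[OF elim(3,2) \<theta>_cs] by (simp add: Z_def moment_def mult.commute)
  qed
  then show ?thesis by (rule spec_rep_cong_AE[OF Y(1)]) measurable
qed

text \<open>Adding back the conditional intensity fills in the value at the origin, where the
  centered representation is 0.\<close>

lemma spec_rep_zeta_pairing:
  assumes "centered_test_fun \<theta>"
  shows "spec_rep (zeta_pairing \<theta>) (\<lambda>\<xi>. if \<xi> = 0 then of_real pi * centered_test_fun.moment_cnj \<theta> else \<i> * fourier \<theta> \<xi> / \<xi>)"
proof -
  interpret centered_test_fun \<theta> by fact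
  have "spec_rep (\<lambda>\<omega>. (zeta_pairing \<theta> \<omega> - of_real pi * of_real (cond_intensity M N \<omega>) * moment_cnj) + (of_real pi * moment_cnj) * of_real (cond_intensity M N \<omega>))
     (\<lambda>\<xi>. \<i> * fourier \<theta> \<xi> / \<xi> + (of_real pi * moment_cnj) * (if \<xi> = 0 then 1 else 0))"
    by (rule spec_rep_add[OF spec_rep_zeta_pairing_centered[OF assms] spec_rep_cmult[OF spec_rep_cond_intensity]])
  moreover have "(\<lambda>\<xi>. \<i> * fourier \<theta> \<xi> / \<xi> + (of_real pi * moment_cnj) * (if \<xi> = 0 then 1 else 0)) =
    (\<lambda>\<xi>. if \<xi> = 0 then of_real pi * moment_cnj else \<i> * fourier \<theta> \<xi> / \<xi>)" by auto
  ultimately show ?thesis by (simp add: mult_ac)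
qed

text \<open>Products of the representing functions differ from those of the transforms only by the
  weight, so covariances become integrals against the density; boundedness of the weight keeps it
  locally finite.\<close>

lemma spectral_measure_density:
  assumes X: "\<And>\<phi>. test_fun \<phi> \<Longrightarrow> spec_rep (X \<phi>) (F \<phi>)"
    and w [measurable]: "w \<in> borel_measurable borel" and w0: "\<And>\<xi>. 0 \<le> w \<xi>" and wB: "\<And>\<xi>. w \<xi> \<le> B"
    and F: "\<And>\<phi> \<psi> \<xi>. test_fun \<phi> \<Longrightarrow> test_fun \<psi> \<Longrightarrow> F \<phi> \<xi> * cnj (F \<psi> \<xi>) = of_real (w \<xi>) * (fourier \<phi> \<xi> * cnj (fourier \<psi> \<xi>))"
  shows "spectral_measure M X (density \<rho> (\<lambda>\<xi>. ennreal (w \<xi>)))"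
  unfolding spectral_measure_def
proof (intro conjI allI impI)
  show "sets (density \<rho> (\<lambda>\<xi>. ennreal (w \<xi>))) = sets borel" by simp
next
  fix K :: "complex set" assume K: "compact K"
  show "emeasure (density \<rho> (\<lambda>\<xi>. ennreal (w \<xi>))) K < \<infinity>"
    by (rule density_locally_finite[OF sets_\<rho> finite_\<rho> w wB K])
next
  fix \<phi> assume \<phi>: "test_fun \<phi>"
  show m: "X \<phi> \<in> borel_measurable M" using X[OF \<phi>] by (simp add: spec_rep_def)
  show "integrable M (\<lambda>\<omega>. (cmod (X \<phi> \<omega>))\<^sup>2)"
    using spec_rep_finite(1)[OF X[OF \<phi>]] m unfolding sqnorm_def by (intro integrableI_bounded) auto
next
  fix \<phi> \<psi> assume "test_fun \<phi> \<and> test_fun \<psi>"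
  then have \<phi>: "test_fun \<phi>" and \<psi>: "test_fun \<psi>" by auto
  have [measurable]: "fourier \<phi> \<in> borel_measurable borel" "fourier \<psi> \<in> borel_measurable borel"
    by (intro measurable_fourier test_fun_measurable \<phi> \<psi>)+
  have Fm: "F \<phi> \<in> borel_measurable \<rho>" "F \<psi> \<in> borel_measurable \<rho>"
    using X[OF \<phi>] X[OF \<psi>] by (simp_all add: spec_rep_def measurable_cong_sets[OF sets_\<rho> refl])
  have "integrable \<rho> (\<lambda>\<xi>. F \<phi> \<xi> * cnj (F \<psi> \<xi>))"
    by (rule integrable_mult_cnj[OF Fm spec_rep_finite(2)[OF X[OF \<phi>]] spec_rep_finite(2)[OF X[OF \<psi>]]])
  then have int: "integrable \<rho> (\<lambda>\<xi>. w \<xi> *\<^sub>R (fourier \<phi> \<xi> * cnj (fourier \<psi> \<xi>)))"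
    by (simp add: F[OF \<phi> \<psi>] scaleR_conv_of_real)
  have pm: "(\<lambda>\<xi>. fourier \<phi> \<xi> * cnj (fourier \<psi> \<xi>)) \<in> borel_measurable \<rho>" by measurable
  have wm: "w \<in> borel_measurable \<rho>" by measurable
  show "integrable (density \<rho> (\<lambda>\<xi>. ennreal (w \<xi>))) (\<lambda>\<xi>. fourier \<phi> \<xi> * cnj (fourier \<psi> \<xi>))"
    using int by (subst integrable_density[OF pm wm]) (auto simp: w0)
  have "covar M (X \<phi>) (X \<psi>) = (\<integral>\<xi>. w \<xi> *\<^sub>R (fourier \<phi> \<xi> * cnj (fourier \<psi> \<xi>)) \<partial>\<rho>)"
    unfolding spec_rep_covar[OF X[OF \<phi>] X[OF \<psi>]] F[OF \<phi> \<psi>] by (simp add: scaleR_conv_of_real)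
  also have "\<dots> = (\<integral>\<xi>. fourier \<phi> \<xi> * cnj (fourier \<psi> \<xi>) \<partial>density \<rho> (\<lambda>\<xi>. ennreal (w \<xi>)))"
    by (rule integral_density[symmetric, OF pm wm]) (simp add: w0)
  finally show "covar M (X \<phi>) (X \<psi>) = (\<integral>\<xi>. fourier \<phi> \<xi> * cnj (fourier \<psi> \<xi>) \<partial>density \<rho> (\<lambda>\<xi>. ennreal (w \<xi>)))" .
qed

end

section \<open>The weight of the increments and the atom at the origin\<close>

definition delta_weight :: "complex \<Rightarrow> complex \<Rightarrow> real" where
  "delta_weight a \<xi> = (cmod (1 - exp (2 * of_real pi * \<i> * of_real (a \<bullet> \<xi>))))\<^sup>2 / (cmod \<xi>)\<^sup>2"

lemma delta_weight_echar: "delta_weight a \<xi> = (cmod (echar \<xi> a - 1))\<^sup>2 / (cmod \<xi>)\<^sup>2"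
proof -
  have "1 - exp (2 * of_real pi * \<i> * of_real (a \<bullet> \<xi>)) = - cnj (echar \<xi> a - 1)"
    by (simp add: echar_def exp_cnj inner_commute)
  then show ?thesis unfolding delta_weight_def by (simp only: norm_minus_cancel complex_mod_cnj)
qed

lemma measurable_delta_weight [measurable]: "delta_weight a \<in> borel_measurable borel"
  unfolding delta_weight_def[abs_def] by measurable

lemma delta_weight_nonneg [simp]: "0 \<le> delta_weight a \<xi>"
  by (simp add: delta_weight_def)

text \<open>Off the origin this is the chord-arc bound \<open>echar_diff_one\<close>; at the origin
  division by zero makes the weight 0.\<close>

lemma delta_weight_le: "delta_weight a \<xi> \<le> (2 * pi * cmod a)\<^sup>2"
proof (cases "\<xi> = 0")
  case False
  have "cmod (echar \<xi> a - 1) / cmod \<xi> \<le> 2 * pi * cmod a"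
    using echar_diff_one[of \<xi> a] False by (simp add: divide_le_eq mult_ac)
  then have "(cmod (echar \<xi> a - 1) / cmod \<xi>)\<^sup>2 \<le> (2 * pi * cmod a)\<^sup>2" by (intro power_mono) auto
  then show ?thesis by (simp add: delta_weight_echar power_divide)
qed (simp add: delta_weight_def)

lemma delta_weight_eq:
  "\<xi> \<noteq> 0 \<Longrightarrow> (\<i> * ((echar \<xi> a - 1) * x) / \<xi>) * cnj (\<i> * ((echar \<xi> a - 1) * y) / \<xi>) = of_real (delta_weight a \<xi>) * (x * cnj y)"
  unfolding delta_weight_echar of_real_divide complex_norm_square by (simp add: field_simps)

text \<open>A point mass at 0 proportional to \<rho>({0}) amounts to altering the density of \<rho>
  at the single point 0. Exhibiting the sum as a density also shows that \<open>add_measure\<close>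
  yields a genuine measure here.\<close>

lemma density_add_atom:
  fixes \<rho> :: "complex measure"
  assumes [simp, measurable_cong]: "sets \<rho> = sets borel" and fin: "emeasure \<rho> {0} < \<infinity>"
    and [measurable]: "w \<in> borel_measurable borel" and w: "w 0 = 0" and c: "0 \<le> c"
  shows "add_measure (density \<rho> w) (density (return borel 0) (\<lambda>_. ennreal (c * measure \<rho> {0}))) =
    density \<rho> (\<lambda>\<xi>. if \<xi> = 0 then ennreal c else w \<xi>)"
proof -
  let ?\<mu> = "density \<rho> w" and ?\<nu> = "density (return borel (0::complex)) (\<lambda>_. ennreal (c * measure \<rho> {0}))"
  let ?\<kappa> = "density \<rho> (\<lambda>\<xi>. if \<xi> = 0 then ennreal c else w \<xi>)"
  have e0: "emeasure \<rho> {0} = ennreal (measure \<rho> {0})"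
    using fin by (intro emeasure_eq_ennreal_measure) auto
  have eq: "emeasure ?\<mu> A + emeasure ?\<nu> A = emeasure ?\<kappa> A" if "A \<in> sets borel" for A
  proof -
    have A [measurable]: "A \<in> sets borel" by fact
    have "emeasure ?\<kappa> A = (\<integral>\<^sup>+\<xi>. (if \<xi> = 0 then ennreal c else w \<xi>) * indicator A \<xi> \<partial>\<rho>)"
      by (subst emeasure_density) auto
    also have "\<dots> = (\<integral>\<^sup>+\<xi>. w \<xi> * indicator A \<xi> + ennreal c * indicator ({0} \<inter> A) \<xi> \<partial>\<rho>)"
      by (intro nn_integral_cong) (auto simp: w indicator_def)
    also have "\<dots> = (\<integral>\<^sup>+\<xi>. w \<xi> * indicator A \<xi> \<partial>\<rho>) + ennreal c * emeasure \<rho> ({0} \<inter> A)"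
      by (subst nn_integral_add) (auto simp: nn_integral_cmult_indicator)
    also have "(\<integral>\<^sup>+\<xi>. w \<xi> * indicator A \<xi> \<partial>\<rho>) = emeasure ?\<mu> A"
      by (subst emeasure_density) auto
    also have "ennreal c * emeasure \<rho> ({0} \<inter> A) = emeasure ?\<nu> A"
      by (cases "0 \<in> A") (simp_all add: e0 c ennreal_mult emeasure_density nn_integral_cmult_indicator)
    finally show ?thesis by simp
  qed
  have sp: "space \<rho> = UNIV" using sets_eq_imp_space_eq[of \<rho> borel] by simp
  have "add_measure ?\<mu> ?\<nu> = measure_of (space ?\<kappa>) (sets ?\<kappa>) (emeasure ?\<kappa>)"
    unfolding add_measure_def space_density sets_density
  proof (rule measure_of_eq)
    show "sets \<rho> \<subseteq> Pow (space \<rho>)" by (rule sets.space_closed)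
    fix A assume "A \<in> sigma_sets (space \<rho>) (sets \<rho>)"
    then have "A \<in> sets borel" by (simp only: sets.sigma_sets_eq) simp
    then show "emeasure ?\<mu> A + emeasure ?\<nu> A = emeasure ?\<kappa> A" by (rule eq)
  qed
  also have "\<dots> = ?\<kappa>" by (rule measure_of_of_measure)
  finally show ?thesis .
qed

text \<open>Handling the vacuous case separately avoids the construction of a bump function: any nonzero test function can be normalized.\<close>

lemma spectral_measure_no_test_fun:
  assumes no: "\<And>f. test_fun f \<Longrightarrow> f = (\<lambda>_. 0)" and X: "X (\<lambda>_. 0) = (\<lambda>_. 0)"
    and "sets \<kappa> = sets borel" "\<And>K. compact K \<Longrightarrow> emeasure \<kappa> K < \<infinity>"
  shows "spectral_measure M X \<kappa>"
proof -
  have X0: "X f = (\<lambda>_. 0)" "fourier f = (\<lambda>_. 0)" if "test_fun f" for f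
    using no[OF that] X by (auto simp: fourier_def)
  show ?thesis
    unfolding spectral_measure_def covar_def expect_def using assms(3,4) by (simp add: X0)
qed

text \<open>|\<phi>|^2 is again a test function, and its integral is positive because a nonempty
  open set is not null.\<close>

lemma normalized_test_fun:
  assumes \<phi>: "test_fun \<phi>" and x0: "\<phi> x0 \<noteq> 0"
  obtains \<eta> where "test_fun \<eta>" "(\<integral>x. \<eta> x \<partial>lborel) = 1"
proof -
  let ?g = "\<lambda>x. \<phi> x * cnj (\<phi> x)"
  have g: "test_fun ?g" by (intro test_fun_mult test_fun_cnj \<phi>)
  define I where "I = (\<integral>x. (cmod (\<phi> x))\<^sup>2 \<partial>lborel)"
  have geq: "?g = (\<lambda>x. of_real ((cmod (\<phi> x))\<^sup>2))" by (simp only: complex_norm_square)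
  have int: "integrable lborel (\<lambda>x. (cmod (\<phi> x))\<^sup>2)"
    using integrable_norm[OF test_fun_integrable[OF g]] by (simp add: norm_mult power2_eq_square)
  have gI: "(\<integral>x. ?g x \<partial>lborel) = of_real I"
    unfolding geq I_def by (rule integral_complex_of_real)
  have "I \<noteq> 0"
  proof
    assume "I = 0"
    then have "AE x in lborel. (cmod (\<phi> x))\<^sup>2 = 0"
      unfolding I_def by (subst (asm) integral_nonneg_eq_0_iff_AE[OF int]) auto
    then have "AE x in lborel. x \<notin> {x. \<phi> x \<noteq> 0}" by eventually_elim simp
    moreover have o: "open {x. \<phi> x \<noteq> 0}"
      by (rule open_Collect_neq) (intro test_fun_continuous_on \<phi> continuous_on_const)+
    ultimately have "{x. \<phi> x \<noteq> 0} \<in> null_sets lborel" by (subst AE_iff_null_sets) auto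
    then have "negligible {x. \<phi> x \<noteq> 0}" by (simp add: negligible_iff_null_sets null_sets_completionI)
    then show False using open_not_negligible[OF o] x0 by auto
  qed
  then have "(\<integral>x. (1 / of_real I) * ?g x \<partial>lborel) = 1" by (simp only: integral_mult_right_zero gI) simp
  with test_fun_cmult[OF g, of "1 / of_real I"] that show thesis by blast
qed

section \<open>Spectral measures of the increments and of the derivative\<close>

context spectral_process
begin

text \<open>Moving the shift from \<zeta> to the test function splits the integral in two, and both
  parts converge for every \<omega>, including the null event on which the infinite sum takes its
  default value.\<close>

lemma Delta_zeta_eq_zeta_pairing:
  assumes \<phi>: "test_fun \<phi>" and \<omega>: "\<omega> \<in> space M"
  shows "Delta_zeta M N a \<phi> \<omega> = zeta_pairing (\<lambda>z. \<phi> (z - a) - \<phi> z) \<omega>"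
proof -
  note int = integrable_zeta_conf[OF locfin_N[OF \<omega>] test_fun_bounded_cs, folded zeta_pp_def]
  let ?Z = "zeta_pp M N \<omega>"
  note i1 = int[OF \<phi>, of "Psi2_inf M N \<omega>", folded zeta_pp_def]
    and i2 = int[OF test_fun_shift[OF \<phi>], of "Psi2_inf M N \<omega>" a, folded zeta_pp_def]
  have i3: "integrable lborel (\<lambda>z. ?Z (z + a) * \<phi> z)"
    using i2 integrable_complex_shift[of "\<lambda>z. ?Z z * \<phi> (z - a)" a] by simp
  have "Delta_zeta M N a \<phi> \<omega> = (\<integral>z. ?Z (z + a) * \<phi> z - ?Z z * \<phi> z \<partial>lborel)"
    unfolding Delta_zeta_def by (simp add: left_diff_distrib)
  also have "\<dots> = (\<integral>z. ?Z (z + a) * \<phi> z \<partial>lborel) - (\<integral>z. ?Z z * \<phi> z \<partial>lborel)"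
    by (rule Bochner_Integration.integral_diff[OF i3 i1])
  also have "(\<integral>z. ?Z (z + a) * \<phi> z \<partial>lborel) = (\<integral>z. ?Z z * \<phi> (z - a) \<partial>lborel)"
    using integral_complex_shift[of "\<lambda>z. ?Z z * \<phi> (z - a)" a] i2 by simp
  also have "\<dots> - (\<integral>z. ?Z z * \<phi> z \<partial>lborel) = (\<integral>z. ?Z z * \<phi> (z - a) - ?Z z * \<phi> z \<partial>lborel)"
    by (rule Bochner_Integration.integral_diff[symmetric, OF i2 i1])
  finally show ?thesis by (simp add: zeta_pairing_def right_diff_distrib)
qed

text \<open>The moment against \<open>cnj z\<close> is the drift: times \<pi> and the conditional
  intensity it is exactly what the centered process subtracts, and its squared modulus gives the
  weight of the atom.\<close>

lemma centered_increment:
  assumes \<phi>: "test_fun \<phi>"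
  shows "centered_test_fun (\<lambda>z. \<phi> (z - a) - \<phi> z)"
    and "centered_test_fun.moment_cnj (\<lambda>z. \<phi> (z - a) - \<phi> z) = cnj a * (\<integral>z. \<phi> z \<partial>lborel)"
    and "fourier (\<lambda>z. \<phi> (z - a) - \<phi> z) \<xi> = (echar \<xi> a - 1) * fourier \<phi> \<xi>"
proof -
  note t = test_fun_shift[OF \<phi>, of a]
  note i = test_fun_integrable[OF \<phi>] test_fun_integrable[OF t]
  show c: "centered_test_fun (\<lambda>z. \<phi> (z - a) - \<phi> z)"
    by unfold_locales (use i in \<open>simp_all add: test_fun_diff[OF t \<phi>] integral_complex_shift' test_fun_measurable[OF \<phi>]\<close>)
  have cnj: "continuous_on UNIV cnj" by (intro continuous_intros)
  note j = integrable_mult_bounded_cs[OF test_fun_bounded_cs[OF \<phi>] cnj]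
    integrable_mult_bounded_cs[OF test_fun_bounded_cs[OF t] cnj]
  have "(\<integral>z. cnj z * \<phi> (z - a) \<partial>lborel) = (\<integral>z. cnj (z - a) * \<phi> (z - a) + cnj a * \<phi> (z - a) \<partial>lborel)"
    by (simp add: algebra_simps)
  also have "\<dots> = (\<integral>z. cnj (z + a) * \<phi> z \<partial>lborel)"
    using integral_complex_shift'[of "\<lambda>z. cnj (z + a) * \<phi> z" a] test_fun_measurable[OF \<phi>] by (simp add: algebra_simps)
  also have "\<dots> = (\<integral>z. cnj z * \<phi> z + cnj a * \<phi> z \<partial>lborel)" by (simp add: algebra_simps)
  also have "\<dots> = (\<integral>z. cnj z * \<phi> z \<partial>lborel) + cnj a * (\<integral>z. \<phi> z \<partial>lborel)" using i j by simp
  finally show "centered_test_fun.moment_cnj (\<lambda>z. \<phi> (z - a) - \<phi> z) = cnj a * (\<integral>z. \<phi> z \<partial>lborel)"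
    unfolding centered_test_fun.moment_cnj_def[OF c] using j by (simp add: right_diff_distrib)
  show "fourier (\<lambda>z. \<phi> (z - a) - \<phi> z) \<xi> = (echar \<xi> a - 1) * fourier \<phi> \<xi>"
    by (subst fourier_diff[OF i(2,1)]) (simp add: fourier_shift[OF test_fun_measurable[OF \<phi>]] left_diff_distrib)
qed

lemma spectral_measure_Delta_zeta:
  "spectral_measure M (Delta_zeta M N a)
    (density \<rho> (\<lambda>\<xi>. ennreal (if \<xi> = 0 then pi\<^sup>2 * (cmod a)\<^sup>2 else delta_weight a \<xi>)))"
proof (rule spectral_measure_density)
  fix \<phi> assume \<phi>: "test_fun \<phi>"
  let ?\<theta> = "\<lambda>z. \<phi> (z - a) - \<phi> z"
  \<comment> \<open>At the origin the representing function is \<pi> \<open>cnj a\<close> times the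
    integral of \<phi>, which gives the weight \<pi>^2 |a|^2 there.\<close>
  have s: "spec_rep (zeta_pairing ?\<theta>) (\<lambda>\<xi>. if \<xi> = 0 then of_real pi * (cnj a * fourier \<phi> 0) else \<i> * ((echar \<xi> a - 1) * fourier \<phi> \<xi>) / \<xi>)"
    using spec_rep_zeta_pairing[OF centered_increment(1)[OF \<phi>, of a]]
    unfolding centered_increment(2)[OF \<phi>] centered_increment(3)[OF \<phi>] fourier_zero .
  have "zeta_pairing ?\<theta> \<in> borel_measurable M"
    by (intro measurable_zeta_pairing test_fun_bounded_cs test_fun_diff test_fun_shift \<phi> Psi2_inf_spec(1))
  then have "Delta_zeta M N a \<phi> \<in> borel_measurable M"
    by (subst measurable_cong[OF Delta_zeta_eq_zeta_pairing[OF \<phi>]])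
  then show "spec_rep (Delta_zeta M N a \<phi>) (\<lambda>\<xi>. if \<xi> = 0 then of_real pi * (cnj a * fourier \<phi> 0) else \<i> * ((echar \<xi> a - 1) * fourier \<phi> \<xi>) / \<xi>)"
    by (intro spec_rep_cong_AE[OF s] AE_I2) (simp_all add: Delta_zeta_eq_zeta_pairing[OF \<phi>])
next
  show "(\<lambda>\<xi>. if \<xi> = 0 then pi\<^sup>2 * (cmod a)\<^sup>2 else delta_weight a \<xi>) \<in> borel_measurable borel" by measurable
  show "0 \<le> (if \<xi> = 0 then pi\<^sup>2 * (cmod a)\<^sup>2 else delta_weight a \<xi>)" for \<xi> by simp
  have "pi\<^sup>2 * (cmod a)\<^sup>2 \<le> (2 * pi * cmod a)\<^sup>2"
    using power_mono[of "pi * cmod a" "2 * pi * cmod a" 2] by (simp add: power_mult_distrib)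
  then show "(if \<xi> = 0 then pi\<^sup>2 * (cmod a)\<^sup>2 else delta_weight a \<xi>) \<le> (2 * pi * cmod a)\<^sup>2" for \<xi>
    using delta_weight_le by simp
  fix \<phi> \<psi> \<xi>
  show "(if \<xi> = 0 then of_real pi * (cnj a * fourier \<phi> 0) else \<i> * ((echar \<xi> a - 1) * fourier \<phi> \<xi>) / \<xi>) *
      cnj (if \<xi> = 0 then of_real pi * (cnj a * fourier \<psi> 0) else \<i> * ((echar \<xi> a - 1) * fourier \<psi> \<xi>) / \<xi>) =
      of_real (if \<xi> = 0 then pi\<^sup>2 * (cmod a)\<^sup>2 else delta_weight a \<xi>) * (fourier \<phi> \<xi> * cnj (fourier \<psi> \<xi>))"
  proof (cases "\<xi> = 0")
    case True
    have "cnj a * a = complex_of_real (cmod a) * complex_of_real (cmod a)"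
      by (metis complex_norm_square mult.commute of_real_power power2_eq_square)
    then show ?thesis using True by (simp add: power2_eq_square)
  next
    case False
    then show ?thesis using delta_weight_eq[OF False] by simp
  qed
qed

text \<open>Without the drift the representing function is 0 at the origin, by division by zero, so
  the atom disappears.\<close>

lemma spectral_measure_Delta_zeta_centered:
  "spectral_measure M (\<lambda>\<phi> \<omega>. Delta_zeta M N a \<phi> \<omega> - of_real pi * of_real (cond_intensity M N \<omega>) * cnj a * (\<integral>z. \<phi> z \<partial>lborel))
    (density \<rho> (\<lambda>\<xi>. ennreal (if \<xi> = 0 then 0 else delta_weight a \<xi>)))"
proof (rule spectral_measure_density)
  fix \<phi> assume \<phi>: "test_fun \<phi>"
  let ?\<theta> = "\<lambda>z. \<phi> (z - a) - \<phi> z"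
  have s: "spec_rep (\<lambda>\<omega>. zeta_pairing ?\<theta> \<omega> - of_real pi * of_real (cond_intensity M N \<omega>) * cnj a * (\<integral>z. \<phi> z \<partial>lborel))
      (\<lambda>\<xi>. \<i> * ((echar \<xi> a - 1) * fourier \<phi> \<xi>) / \<xi>)"
    using spec_rep_zeta_pairing_centered[OF centered_increment(1)[OF \<phi>, of a]]
    unfolding centered_increment(2)[OF \<phi>] centered_increment(3)[OF \<phi>] mult.assoc .
  have [measurable]: "zeta_pairing ?\<theta> \<in> borel_measurable M"
    by (intro measurable_zeta_pairing test_fun_bounded_cs test_fun_diff test_fun_shift \<phi> Psi2_inf_spec(1))
  then have [measurable]: "Delta_zeta M N a \<phi> \<in> borel_measurable M"
    by (subst measurable_cong[OF Delta_zeta_eq_zeta_pairing[OF \<phi>]])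
  show "spec_rep (\<lambda>\<omega>. Delta_zeta M N a \<phi> \<omega> - of_real pi * of_real (cond_intensity M N \<omega>) * cnj a * (\<integral>z. \<phi> z \<partial>lborel))
      (\<lambda>\<xi>. \<i> * ((echar \<xi> a - 1) * fourier \<phi> \<xi>) / \<xi>)"
    by (rule spec_rep_cong_AE[OF s AE_I2]) (simp_all add: Delta_zeta_eq_zeta_pairing[OF \<phi>])
next
  show "(\<lambda>\<xi>. if \<xi> = 0 then 0 else delta_weight a \<xi>) \<in> borel_measurable borel" by measurable
  show "0 \<le> (if \<xi> = 0 then 0 else delta_weight a \<xi>)" for \<xi> by simp
  show "(if \<xi> = 0 then 0 else delta_weight a \<xi>) \<le> (2 * pi * cmod a)\<^sup>2" for \<xi>
    using delta_weight_le by simp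
  fix \<phi> \<psi> \<xi>
  show "\<i> * ((echar \<xi> a - 1) * fourier \<phi> \<xi>) / \<xi> * cnj (\<i> * ((echar \<xi> a - 1) * fourier \<psi> \<xi>) / \<xi>) =
      of_real (if \<xi> = 0 then 0 else delta_weight a \<xi>) * (fourier \<phi> \<xi> * cnj (fourier \<psi> \<xi>))"
    using delta_weight_eq[of \<xi> a] by (cases "\<xi> = 0") simp_all
qed

text \<open>The moment of \<open>dz \<phi>\<close> against \<open>cnj z\<close> vanishes, so no
  drift and no atom arise; off the origin the multiplier \<pi> \<i> \<open>cnj \<xi>\<close> divided
  by \<xi> has constant modulus \<pi>.\<close>

lemma spectral_measure_wp:
  "spectral_measure M (wp_pp M N) (density \<rho> (\<lambda>\<xi>. ennreal (if \<xi> = 0 then 0 else pi\<^sup>2)))"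
proof (rule spectral_measure_density)
  fix \<phi> assume \<phi>: "test_fun \<phi>"
  interpret c: centered_test_fun "dz \<phi>"
    by unfold_locales (rule test_fun_dz[OF \<phi>], rule integral_dz(1)[OF \<phi>])
  have m: "c.moment_cnj = 0" unfolding c.moment_cnj_def by (rule integral_dz(3)[OF \<phi>])
  have "wp_pp M N \<phi> = zeta_pairing (dz \<phi>)" by (simp add: wp_pp_def zeta_pairing_def fun_eq_iff)
  then show "spec_rep (wp_pp M N \<phi>) (\<lambda>\<xi>. \<i> * (of_real pi * \<i> * cnj \<xi> * fourier \<phi> \<xi>) / \<xi>)"
    using spec_rep_zeta_pairing_centered[OF c.centered_test_fun_axioms] by (simp add: m fourier_dz[OF \<phi>])
next
  show "(\<lambda>\<xi>::complex. if \<xi> = 0 then 0 else pi\<^sup>2) \<in> borel_measurable borel" by measurable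
  show "0 \<le> (if \<xi> = 0 then 0 else pi\<^sup>2)" "(if \<xi> = 0 then 0 else pi\<^sup>2) \<le> pi\<^sup>2" for \<xi> :: complex by simp_all
  fix \<phi> \<psi> and \<xi> :: complex
  show "\<i> * (of_real pi * \<i> * cnj \<xi> * fourier \<phi> \<xi>) / \<xi> * cnj (\<i> * (of_real pi * \<i> * cnj \<xi> * fourier \<psi> \<xi>) / \<xi>) =
      of_real (if \<xi> = 0 then 0 else pi\<^sup>2) * (fourier \<phi> \<xi> * cnj (fourier \<psi> \<xi>))"
    by (cases "\<xi> = 0") (simp_all add: field_simps power2_eq_square)
qed

end

theorem theoremA:
  fixes M :: "'a measure" and N :: "'a \<Rightarrow> config" and \<rho> :: "complex measure" and a :: complex
  assumes "point_process M N"
    and "stationary_pp M N"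
    and "finite_second_moment M N"
    and "spectral_measure M (lin_process N) \<rho>"
  shows "spectral_measure M (Delta_zeta M N a)
           (add_measure
             (density \<rho> (\<lambda>\<xi>. if \<xi> \<noteq> 0
                then ennreal ((cmod (1 - exp (2 * of_real pi * \<i> * of_real (a \<bullet> \<xi>))))\<^sup>2 / (cmod \<xi>)\<^sup>2)
                else 0))
             (density (return borel 0) (\<lambda>_. ennreal (pi\<^sup>2 * (cmod a)\<^sup>2 * measure \<rho> {0}))))
    \<and> spectral_measure M
           (\<lambda>\<phi> \<omega>. Delta_zeta M N a \<phi> \<omega>
                   - of_real pi * of_real (cond_intensity M N \<omega>) * cnj a * (\<integral>z. \<phi> z \<partial>lborel))
           (density \<rho> (\<lambda>\<xi>. if \<xi> \<noteq> 0
                then ennreal ((cmod (1 - exp (2 * of_real pi * \<i> * of_real (a \<bullet> \<xi>))))\<^sup>2 / (cmod \<xi>)\<^sup>2)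
                else 0))
    \<and> spectral_measure M (wp_pp M N)
           (density \<rho> (\<lambda>\<xi>. if \<xi> \<noteq> 0 then ennreal (pi\<^sup>2) else 0))"
proof -
  let ?w0 = "\<lambda>\<xi>. if \<xi> = 0 then 0 else delta_weight a \<xi>"
    and ?w1 = "\<lambda>\<xi>. if \<xi> = 0 then pi\<^sup>2 * (cmod a)\<^sup>2 else delta_weight a \<xi>"
    and ?w2 = "\<lambda>\<xi>::complex. if \<xi> = 0 then 0 else pi\<^sup>2"
  have sets: "sets \<rho> = sets borel" and fin: "\<And>K. compact K \<Longrightarrow> emeasure \<rho> K < \<infinity>"
    using assms(4) by (auto simp: spectral_measure_def)
  have [measurable]: "?w0 \<in> borel_measurable borel" "?w1 \<in> borel_measurable borel" "?w2 \<in> borel_measurable borel" by measurable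
  have w0: "(\<lambda>\<xi>. if \<xi> \<noteq> 0 then ennreal ((cmod (1 - exp (2 * of_real pi * \<i> * of_real (a \<bullet> \<xi>))))\<^sup>2 / (cmod \<xi>)\<^sup>2) else 0)
      = (\<lambda>\<xi>. ennreal (?w0 \<xi>))"
    by (auto simp: delta_weight_def)
  have w2: "(\<lambda>\<xi>::complex. if \<xi> \<noteq> 0 then ennreal (pi\<^sup>2) else 0) = (\<lambda>\<xi>. ennreal (?w2 \<xi>))" by auto
  \<comment> \<open>The atom is absorbed into the density, so that all three measures have the form
    produced by \<open>spectral_measure_density\<close>.\<close>
  have w1: "add_measure (density \<rho> (\<lambda>\<xi>. ennreal (?w0 \<xi>))) (density (return borel 0) (\<lambda>_. ennreal (pi\<^sup>2 * (cmod a)\<^sup>2 * measure \<rho> {0})))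
      = density \<rho> (\<lambda>\<xi>. ennreal (?w1 \<xi>))"
  proof -
    have "(\<lambda>\<xi>. if \<xi> = 0 then ennreal (pi\<^sup>2 * (cmod a)\<^sup>2) else ennreal (?w0 \<xi>)) = (\<lambda>\<xi>. ennreal (?w1 \<xi>))" by auto
    then show ?thesis using density_add_atom[OF sets fin, of "\<lambda>\<xi>. ennreal (?w0 \<xi>)" "pi\<^sup>2 * (cmod a)\<^sup>2"] by simp
  qed
  show ?thesis unfolding w0 w1 w2
  proof (cases "\<exists>\<phi>. test_fun \<phi> \<and> \<phi> \<noteq> (\<lambda>_. 0)")
    case True
    then obtain \<phi> x0 where "test_fun \<phi>" "\<phi> x0 \<noteq> 0" by (auto simp: fun_eq_iff)
    then obtain \<eta> where \<eta>: "test_fun \<eta>" "(\<integral>x. \<eta> x \<partial>lborel) = 1" by (rule normalized_test_fun)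
    interpret prob_space M using assms(1) by (simp add: point_process_def)
    interpret spectral_process M N \<rho> \<eta> by unfold_locales fact+
    show "spectral_measure M (Delta_zeta M N a) (density \<rho> (\<lambda>\<xi>. ennreal (?w1 \<xi>)))
      \<and> spectral_measure M (\<lambda>\<phi> \<omega>. Delta_zeta M N a \<phi> \<omega> - of_real pi * of_real (cond_intensity M N \<omega>) * cnj a * (\<integral>z. \<phi> z \<partial>lborel))
        (density \<rho> (\<lambda>\<xi>. ennreal (?w0 \<xi>)))
      \<and> spectral_measure M (wp_pp M N) (density \<rho> (\<lambda>\<xi>. ennreal (?w2 \<xi>)))"
      by (intro conjI spectral_measure_Delta_zeta spectral_measure_Delta_zeta_centered spectral_measure_wp)
  next
    case False
    then have no: "\<And>f. test_fun f \<Longrightarrow> f = (\<lambda>_. 0)" by blast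
    have "dz (\<lambda>_. 0) = (\<lambda>_. 0)" by (simp add: dz_def[abs_def] frechet_derivative_const)
    then have X: "Delta_zeta M N a (\<lambda>_. 0) = (\<lambda>_. 0)" "wp_pp M N (\<lambda>_. 0) = (\<lambda>_. 0)"
      by (auto simp: Delta_zeta_def wp_pp_def)
    have "delta_weight a \<xi> \<le> (2 * pi * cmod a)\<^sup>2 + pi\<^sup>2 * (cmod a)\<^sup>2" for \<xi>
      using delta_weight_le[of a \<xi>] by (rule add_increasing2[rotated]) simp
    then have lf: "emeasure (density \<rho> (\<lambda>\<xi>. ennreal (?w0 \<xi>))) K < \<infinity>" "emeasure (density \<rho> (\<lambda>\<xi>. ennreal (?w1 \<xi>))) K < \<infinity>"
      "emeasure (density \<rho> (\<lambda>\<xi>. ennreal (?w2 \<xi>))) K < \<infinity>" if "compact K" for K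
      using density_locally_finite[OF sets fin _ _ that, of ?w0 "(2 * pi * cmod a)\<^sup>2 + pi\<^sup>2 * (cmod a)\<^sup>2"]
        density_locally_finite[OF sets fin _ _ that, of ?w1 "(2 * pi * cmod a)\<^sup>2 + pi\<^sup>2 * (cmod a)\<^sup>2"]
        density_locally_finite[OF sets fin _ _ that, of ?w2 "pi\<^sup>2"] by simp_all
    show "spectral_measure M (Delta_zeta M N a) (density \<rho> (\<lambda>\<xi>. ennreal (?w1 \<xi>)))
      \<and> spectral_measure M (\<lambda>\<phi> \<omega>. Delta_zeta M N a \<phi> \<omega> - of_real pi * of_real (cond_intensity M N \<omega>) * cnj a * (\<integral>z. \<phi> z \<partial>lborel))
        (density \<rho> (\<lambda>\<xi>. ennreal (?w0 \<xi>)))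
      \<and> spectral_measure M (wp_pp M N) (density \<rho> (\<lambda>\<xi>. ennreal (?w2 \<xi>)))"
      by (intro conjI spectral_measure_no_test_fun) (use no lf in \<open>simp_all add: X sets\<close>)
  qed
qed

end
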